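(* Let $K$ be a field of characteristic $p>0$ and let $R$ be a (commutative) algebra over $K$. Then $R$ is geometrically normal over $K$ if and only if $R\otimes_{K}K^{1/p}$ is normal.
   Context: A ring $A$ is called normal if, for every prime ideal $\mathfrak{p}$ of $A$, $A_{\mathfrak{p}}$ is an integral domain which is integrally closed in its field of fractions. A $K$-algebra $R$ is geometrically normal over $K$ if $R\otimes_K K'$ is normal for every field extension $K'\supset K$. No finiteness or Noetherian hypothesis is imposed on $R$. *)

theory Defs
  imports "HOL-Algebra.Algebra"
begin

text \<open>
  Algebras over \<open>K\<close> are those of the library locale \<^locale>\<open>algebra\<close>: commutative, with unit,
  possibly zero. A field extension of \<open>K\<close> is a \<open>K\<close>-algebra that is a field; its structure map
  \<open>k \<mapsto> k \<odot> \<one>\<close> is automatically injective.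
\<close>

section \<open>Characteristic\<close>

text \<open>The library's element order is \<open>0\<close> for elements of infinite order.\<close>

definition ring_char :: "('a, 'm) ring_scheme \<Rightarrow> nat" where
  "ring_char A = group.ord (add_monoid A) \<one>\<^bsub>A\<^esub>"

section \<open>Localization and normal rings\<close>

text \<open>\<open>S\<close> is meant to be a multiplicatively closed subset of \<open>carrier A\<close> containing \<open>\<one>\<close>.\<close>

definition loc_rel :: "('a, 'm) ring_scheme \<Rightarrow> 'a set \<Rightarrow> (('a \<times> 'a) \<times> ('a \<times> 'a)) set" where
  "loc_rel A S = {((a, s), (b, t)) | a s b t.
     a \<in> carrier A \<and> b \<in> carrier A \<and> s \<in> S \<and> t \<in> S \<and>
     (\<exists>u\<in>S. u \<otimes>\<^bsub>A\<^esub> (t \<otimes>\<^bsub>A\<^esub> a) = u \<otimes>\<^bsub>A\<^esub> (s \<otimes>\<^bsub>A\<^esub> b))}"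

definition loc_frac :: "('a, 'm) ring_scheme \<Rightarrow> 'a set \<Rightarrow> 'a \<Rightarrow> 'a \<Rightarrow> ('a \<times> 'a) set" where
  "loc_frac A S a s = loc_rel A S `` {(a, s)}"

text \<open>The unions below range over representatives; all of them yield the same class.\<close>

definition localization :: "('a, 'm) ring_scheme \<Rightarrow> 'a set \<Rightarrow> (('a \<times> 'a) set) ring" where
  "localization A S =
     \<lparr>carrier = (carrier A \<times> S) // loc_rel A S,
      monoid.mult = (\<lambda>U V. \<Union>(a, s)\<in>U. \<Union>(b, t)\<in>V. loc_frac A S (a \<otimes>\<^bsub>A\<^esub> b) (s \<otimes>\<^bsub>A\<^esub> t)),
      one = loc_frac A S \<one>\<^bsub>A\<^esub> \<one>\<^bsub>A\<^esub>,
      ring.zero = loc_frac A S \<zero>\<^bsub>A\<^esub> \<one>\<^bsub>A\<^esub>,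
      add = (\<lambda>U V. \<Union>(a, s)\<in>U. \<Union>(b, t)\<in>V.
               loc_frac A S ((t \<otimes>\<^bsub>A\<^esub> a) \<oplus>\<^bsub>A\<^esub> (s \<otimes>\<^bsub>A\<^esub> b)) (s \<otimes>\<^bsub>A\<^esub> t))\<rparr>"

definition fraction_field :: "('a, 'm) ring_scheme \<Rightarrow> (('a \<times> 'a) set) ring" where
  "fraction_field D = localization D (carrier D - {\<zero>\<^bsub>D\<^esub>})"

definition to_fraction_field :: "('a, 'm) ring_scheme \<Rightarrow> 'a \<Rightarrow> ('a \<times> 'a) set" where
  "to_fraction_field D a = loc_frac D (carrier D - {\<zero>\<^bsub>D\<^esub>}) a \<one>\<^bsub>D\<^esub>"

text \<open>\<open>B\<close> is a subring of \<open>F\<close>. Library polynomials are coefficient lists, leading coefficient first.\<close>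

definition integral_over :: "('a, 'm) ring_scheme \<Rightarrow> 'a set \<Rightarrow> 'a \<Rightarrow> bool" where
  "integral_over F B x \<longleftrightarrow>
     (\<exists>f. polynomial\<^bsub>F\<^esub> B f \<and> f \<noteq> [] \<and> lead_coeff f = \<one>\<^bsub>F\<^esub> \<and> ring.eval F f x = \<zero>\<^bsub>F\<^esub>)"

definition integrally_closed :: "('a, 'm) ring_scheme \<Rightarrow> bool" where
  "integrally_closed D \<longleftrightarrow>
     (\<forall>x\<in>carrier (fraction_field D).
        integral_over (fraction_field D) (to_fraction_field D ` carrier D) x \<longrightarrow>
        x \<in> to_fraction_field D ` carrier D)"

definition normal_ring :: "('a, 'm) ring_scheme \<Rightarrow> bool" where
  "normal_ring A \<longleftrightarrow> cring A \<and>
     (\<forall>P. primeideal P A \<longrightarrow>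
        domain (localization A (carrier A - P)) \<and>
        integrally_closed (localization A (carrier A - P)))"

section \<open>Tensor product of algebras\<close>

text \<open>The monoid ring \<open>\<int>[M]\<close> on finitely supported functions, with the convolution product.\<close>

definition monoid_ring :: "('a, 'm) monoid_scheme \<Rightarrow> ('a \<Rightarrow>\<^sub>0 int) ring" where
  "monoid_ring M =
     \<lparr>carrier = {c. Poly_Mapping.keys c \<subseteq> carrier M},
      monoid.mult = (\<lambda>c d. frag_extend (\<lambda>x. frag_extend (\<lambda>y. frag_of (x \<otimes>\<^bsub>M\<^esub> y)) d) c),
      one = frag_of \<one>\<^bsub>M\<^esub>, ring.zero = 0, add = (+)\<rparr>"

definition tensor_relations ::
    "('k, 'l) ring_scheme \<Rightarrow> ('k, 'a, 'm) module_scheme \<Rightarrow> ('k, 'b, 'n) module_scheme \<Rightarrow>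
     ('a \<times> 'b \<Rightarrow>\<^sub>0 int) set" where
  "tensor_relations K A B =
     {frag_of (a \<oplus>\<^bsub>A\<^esub> a', b) - frag_of (a, b) - frag_of (a', b) | a a' b.
        a \<in> carrier A \<and> a' \<in> carrier A \<and> b \<in> carrier B} \<union>
     {frag_of (a, b \<oplus>\<^bsub>B\<^esub> b') - frag_of (a, b) - frag_of (a, b') | a b b'.
        a \<in> carrier A \<and> b \<in> carrier B \<and> b' \<in> carrier B} \<union>
     {frag_of (k \<odot>\<^bsub>A\<^esub> a, b) - frag_of (a, k \<odot>\<^bsub>B\<^esub> b) | k a b.
        k \<in> carrier K \<and> a \<in> carrier A \<and> b \<in> carrier B}"

text \<open>
  The additive group of \<open>\<int>[A \<times> B]\<close> is the free abelian group on the pairs. The subgroup spanned by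
  the bilinearity relations is closed under multiplication by pairs, so it is an ideal; the
  quotient is the usual tensor product, with \<open>(a \<otimes> b)(a' \<otimes> b') = aa' \<otimes> bb'\<close>.
\<close>

definition tensor_algebra ::
    "('k, 'l) ring_scheme \<Rightarrow> ('k, 'a, 'm) module_scheme \<Rightarrow> ('k, 'b, 'n) module_scheme \<Rightarrow>
     (('a \<times> 'b \<Rightarrow>\<^sub>0 int) set) ring" where
  "tensor_algebra K A B =
     monoid_ring (A \<times>\<times> B) Quot (Idl\<^bsub>monoid_ring (A \<times>\<times> B)\<^esub> (tensor_relations K A B))"

section \<open>The extension \<open>K\<^sup>1\<^sup>/\<^sup>p\<close>\<close>

text \<open>
  The elements of the algebraic closure whose \<open>p\<close>-th power lies in \<open>K\<close>; the library embeds \<open>K\<close>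
  into its algebraic closure by \<open>indexed_const\<close>.
\<close>

definition root_extension ::
    "('a, 'm) ring_scheme \<Rightarrow> nat \<Rightarrow> ('a, ('a list \<times> nat) multiset \<Rightarrow> 'a) module" where
  "root_extension K p = (let C = field.alg_closure K; \<iota> = ring.indexed_const K in
     \<lparr>carrier = {x \<in> carrier C. x [^]\<^bsub>C\<^esub> p \<in> \<iota> ` carrier K},
      monoid.mult = monoid.mult C, one = \<one>\<^bsub>C\<^esub>, ring.zero = \<zero>\<^bsub>C\<^esub>, add = ring.add C,
      smult = (\<lambda>k x. \<iota> k \<otimes>\<^bsub>C\<^esub> x)\<rparr>)"

section \<open>Geometrically normal algebras\<close>

text \<open>
  A formula of HOL cannot quantify over types, so the type \<open>'c\<close> carrying the extension fields is
  a parameter: \<open>geometrically_normal TYPE('c) K R\<close> speaks about all field extensions of \<open>K\<close> whose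
  elements are of type \<open>'c\<close>. The theorem is stated for every type \<open>'c\<close> at least as large as \<open>K\<close>;
  every type in which some field extension of \<open>K\<close> can be realized is of this kind.
\<close>

definition geometrically_normal ::
    "'c itself \<Rightarrow> ('a, 'm) ring_scheme \<Rightarrow> ('a, 'b, 'n) module_scheme \<Rightarrow> bool" where
  "geometrically_normal _ K R \<longleftrightarrow>
     (\<forall>L :: ('a, 'c) module. field L \<and> algebra K L \<longrightarrow> normal_ring (tensor_algebra K R L))"

end

theory Submission
  imports Defs
begin

text \<open>
  A ring is normal if and only if its principal ideals are integrally closed. This condition, called \<open>pic\<close> below,
  makes sense for an arbitrary subring of a ring, passes to direct limits and to linear retracts, and is compatible
  with localization.

  Let \<open>W\<close> be an algebraic closure of an extension \<open>L\<close> of \<open>K\<close>, and consider the subfields \<open>M\<close> of \<open>W\<close> that contain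
  \<open>K\<^sup>1\<^sup>/\<^sup>p\<close> and for which \<open>R \<otimes> M\<close>, as a subring of \<open>R \<otimes> W\<close>, is \<open>pic\<close>. By Zorn's lemma there is a maximal one. It is
  perfect: if \<open>a\<close> is integral over \<open>(c)\<close> in \<open>R \<otimes> M\<^sup>1\<^sup>/\<^sup>p\<close>, where \<open>c \<in> R \<otimes> M\<close>, then \<open>a\<^sup>p\<close> is a multiple of \<open>c\<^sup>p\<close> in \<open>R \<otimes> M\<close>,
  and applying \<open>M\<^sup>p\<close>-linear functionals shows that the coefficients of \<open>a\<close> in an \<open>M\<close>-basis of \<open>M\<^sup>1\<^sup>/\<^sup>p\<close> are multiples of \<open>c\<close>.
  It contains every algebraic element, whose conjugates over the perfect field \<open>M\<close> are distinct, and every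
  transcendental element \<open>x\<close>, as \<open>pic\<close> passes from \<open>R \<otimes> M\<close> to the polynomial ring \<open>R \<otimes> M[x]\<close> and to its localization
  \<open>R \<otimes> M(x)\<close>; in both cases an element integral over \<open>(c)\<close> is studied through its values at sufficiently many points.
  So \<open>M = W\<close>, and \<open>R \<otimes> L\<close> is a linear retract of \<open>R \<otimes> W\<close>.
\<close>

section \<open>Integrally closed principal ideals\<close>

text \<open>Tensor products of this generality are in general neither domains nor Noetherian. A
  criterion expressed by equations in the ring itself lets zero divisors be treated by multipliers
  that kill one factor and fix the other. Placing every \<open>R \<otimes> M\<close> inside the one
  ring \<open>R \<otimes> W\<close> turns unions, adjunction of elements and fraction fields into
  operations on subrings. The inclusion \<open>K\<^sup>1\<^sup>/\<^sup>p \<subseteq> M\<close>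
  matters because it places \<open>K\<close> in \<open>M\<^sup>p\<close>: then
  \<open>M\<^sup>p\<close>-linear functionals are \<open>K\<close>-linear, hence defined on the
  tensor product. Conjugates and values of an element may lie outside
  \<open>R \<otimes> M[x]\<close>, so the integral equations of its coefficients are found in
  \<open>R \<otimes> W\<close> and brought back to \<open>R \<otimes> M\<close> by a linear
  retraction. For the forward implication the obstacle is the type:
  \<open>K\<^sup>1\<^sup>/\<^sup>p\<close> is built on the type of the algebraic closure, while the
  hypothesis speaks of fields on \<open>'c\<close>. The remedy is \<open>K\<close> itself, copied to
  \<open>'c\<close>, with \<open>k\<close> acting as multiplication by its \<open>p\<close>-th
  power.\<close>

context cring
begin

lemma diff_add1: "\<lbrakk>x \<in> carrier R; y \<in> carrier R; z \<in> carrier R\<rbrakk> \<Longrightarrow> (x \<ominus> y) \<oplus> z = (x \<oplus> z) \<ominus> y"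
  by (simp add: minus_eq a_ac)

lemma diff_add2: "\<lbrakk>x \<in> carrier R; y \<in> carrier R; z \<in> carrier R\<rbrakk> \<Longrightarrow> z \<oplus> (x \<ominus> y) = (z \<oplus> x) \<ominus> y"
  by (simp add: minus_eq a_ac)

lemma diff_diff1: "\<lbrakk>x \<in> carrier R; y \<in> carrier R; z \<in> carrier R\<rbrakk> \<Longrightarrow> (x \<ominus> y) \<ominus> z = x \<ominus> (y \<oplus> z)"
  by (simp add: minus_eq a_ac minus_add)

lemma diff_diff2: "\<lbrakk>x \<in> carrier R; y \<in> carrier R; z \<in> carrier R\<rbrakk> \<Longrightarrow> z \<ominus> (x \<ominus> y) = (z \<oplus> y) \<ominus> x"
  by (simp add: minus_eq a_ac minus_add)

lemma diff_mult1: "\<lbrakk>x \<in> carrier R; y \<in> carrier R; z \<in> carrier R\<rbrakk> \<Longrightarrow> (x \<ominus> y) \<otimes> z = x \<otimes> z \<ominus> y \<otimes> z"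
  by (simp add: minus_eq l_distr l_minus)

lemma diff_mult2: "\<lbrakk>x \<in> carrier R; y \<in> carrier R; z \<in> carrier R\<rbrakk> \<Longrightarrow> z \<otimes> (x \<ominus> y) = z \<otimes> x \<ominus> z \<otimes> y"
  by (simp add: minus_eq r_distr r_minus)

lemma neg_add1: "\<lbrakk>x \<in> carrier R; y \<in> carrier R\<rbrakk> \<Longrightarrow> \<ominus> x \<oplus> y = y \<ominus> x"
  by (simp add: minus_eq a_ac)

lemma neg_add2: "\<lbrakk>x \<in> carrier R; y \<in> carrier R\<rbrakk> \<Longrightarrow> y \<oplus> \<ominus> x = y \<ominus> x"
  by (simp add: minus_eq a_ac)

lemma neg_diff: "\<lbrakk>x \<in> carrier R; y \<in> carrier R\<rbrakk> \<Longrightarrow> \<ominus> (x \<ominus> y) = y \<ominus> x"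
  by (simp add: minus_eq a_ac minus_add)

lemma diff_neg: "\<lbrakk>x \<in> carrier R; y \<in> carrier R\<rbrakk> \<Longrightarrow> x \<ominus> (\<ominus> y) = x \<oplus> y"
  by (simp add: minus_eq a_ac minus_add)

lemma diff_eq_iff: "\<lbrakk>x \<in> carrier R; y \<in> carrier R; z \<in> carrier R\<rbrakk> \<Longrightarrow> (x \<ominus> y = z) \<longleftrightarrow> x = z \<oplus> y"
  by (metis a_inv_closed minus_eq minus_minus a_comm r_neg1 r_neg2)

lemma eq_diff_iff: "\<lbrakk>x \<in> carrier R; y \<in> carrier R; z \<in> carrier R\<rbrakk> \<Longrightarrow> (z = x \<ominus> y) \<longleftrightarrow> z \<oplus> y = x"
  using diff_eq_iff by metis

lemma neg_eq_iff: "\<lbrakk>y \<in> carrier R; z \<in> carrier R\<rbrakk> \<Longrightarrow> (\<ominus> y = z) \<longleftrightarrow> z \<oplus> y = \<zero>"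
  by (metis a_inv_closed minus_minus l_neg minus_equality)

lemma eq_neg_iff: "\<lbrakk>y \<in> carrier R; z \<in> carrier R\<rbrakk> \<Longrightarrow> (z = \<ominus> y) \<longleftrightarrow> z \<oplus> y = \<zero>"
  using neg_eq_iff by metis

lemmas diff_simps = diff_add1 diff_add2 diff_diff1 diff_diff2 diff_mult1 diff_mult2 neg_add1 neg_add2 neg_diff diff_neg
  diff_eq_iff eq_diff_iff neg_eq_iff eq_neg_iff l_minus r_minus l_distr r_distr

text \<open>Subtractions are pushed outward and then across the equality sign, so that an identity
  of commutative rings becomes an equation between sums of products, decided by associativity and
  commutativity.\<close>

lemmas ring_norm = diff_simps m_ac a_ac

end

text \<open>
  \<open>hev R a s cs\<close> is the homogenization at \<open>(a, s)\<close> of a monic polynomial; \<open>cs\<close> lists its other coefficients,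
  constant coefficient first. So \<open>dep R S a s\<close> says that \<open>a\<close> is integral over the ideal of \<open>S\<close> generated
  by \<open>s\<close>, and \<open>pic R S\<close> that the principal ideals of \<open>S\<close> are integrally closed.
\<close>

primrec hev :: "('a, 'm) ring_scheme \<Rightarrow> 'a \<Rightarrow> 'a \<Rightarrow> 'a list \<Rightarrow> 'a" where
  "hev R a s [] = \<one>\<^bsub>R\<^esub>"
| "hev R a s (c # cs) = a \<otimes>\<^bsub>R\<^esub> hev R a s cs \<oplus>\<^bsub>R\<^esub> c \<otimes>\<^bsub>R\<^esub> s [^]\<^bsub>R\<^esub> Suc (length cs)"

definition dep :: "('a, 'm) ring_scheme \<Rightarrow> 'a set \<Rightarrow> 'a \<Rightarrow> 'a \<Rightarrow> bool" where
  "dep R S a s \<longleftrightarrow> (\<exists>cs. set cs \<subseteq> S \<and> hev R a s cs = \<zero>\<^bsub>R\<^esub>)"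

text \<open>The denominators range over a set \<open>C\<close> of their own: for a simple extension,
  the case of denominators in the base ring comes first and is then used for all others.\<close>

definition pic_on :: "('a, 'm) ring_scheme \<Rightarrow> 'a set \<Rightarrow> 'a set \<Rightarrow> bool" where
  "pic_on R C S \<longleftrightarrow> (\<forall>a\<in>S. \<forall>s\<in>C. dep R S a s \<longrightarrow> (\<exists>b\<in>S. a = s \<otimes>\<^bsub>R\<^esub> b))"

abbreviation pic :: "('a, 'm) ring_scheme \<Rightarrow> 'a set \<Rightarrow> bool" where
  "pic R S \<equiv> pic_on R S S"

text \<open>The list for which an equation with denominator \<open>t s\<close> becomes one with
  denominator \<open>s\<close>: the coefficient of \<open>s^k\<close> absorbs
  \<open>t^k\<close>.\<close>

primrec scl :: "('a, 'm) ring_scheme \<Rightarrow> 'a \<Rightarrow> 'a list \<Rightarrow> 'a list" where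
  "scl R t [] = []"
| "scl R t (c # cs) = (c \<otimes>\<^bsub>R\<^esub> t [^]\<^bsub>R\<^esub> Suc (length cs)) # scl R t cs"

lemma length_scl [simp]: "length (scl R t cs) = length cs"
  by (induction cs) auto

lemma picD: "pic_on R C S \<Longrightarrow> a \<in> S \<Longrightarrow> s \<in> C \<Longrightarrow> dep R S a s \<Longrightarrow> \<exists>b\<in>S. a = s \<otimes>\<^bsub>R\<^esub> b"
  by (auto simp: pic_on_def)

context cring
begin

lemma hev_closed [simp]:
  "\<lbrakk>a \<in> carrier R; s \<in> carrier R; set cs \<subseteq> carrier R\<rbrakk> \<Longrightarrow> hev R a s cs \<in> carrier R"
  by (induction cs) auto

lemma subring_pow: "subring S R \<Longrightarrow> t \<in> S \<Longrightarrow> t [^] (n::nat) \<in> S"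
  by (induction n) (auto simp: subringE)

lemma subring_carrier: "subring S R \<Longrightarrow> t \<in> S \<Longrightarrow> t \<in> carrier R"
  using subringE(1) by blast

lemma subring_minus: "subring S R \<Longrightarrow> a \<in> S \<Longrightarrow> b \<in> S \<Longrightarrow> a \<ominus> b \<in> S"
  by (simp add: minus_eq subringE)

lemmas sub_closed = subringE(2,3,5,6,7) subring_pow subring_minus

lemma hev_in_subring:
  "\<lbrakk>subring S R; a \<in> S; s \<in> S; set cs \<subseteq> S\<rbrakk> \<Longrightarrow> hev R a s cs \<in> S"
  by (induction cs) (auto simp: sub_closed simp del: nat_pow_Suc)

lemma set_scl: "\<lbrakk>subring S R; t \<in> S; set cs \<subseteq> S\<rbrakk> \<Longrightarrow> set (scl R t cs) \<subseteq> S"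
  by (induction cs) (auto simp: sub_closed simp del: nat_pow_Suc)

lemma hev_scale:
  assumes [simp]: "a \<in> carrier R" "s \<in> carrier R" "t \<in> carrier R" and "set cs \<subseteq> carrier R"
  shows "hev R (t \<otimes> a) (t \<otimes> s) cs = t [^] length cs \<otimes> hev R a s cs"
  using assms(4)
proof (induction cs)
  case (Cons c cs)
  then have [simp]: "c \<in> carrier R" "set cs \<subseteq> carrier R" by auto
  have "hev R (t \<otimes> a) (t \<otimes> s) (c # cs)
      = (t \<otimes> a) \<otimes> (t [^] length cs \<otimes> hev R a s cs) \<oplus> c \<otimes> (t [^] Suc (length cs) \<otimes> s [^] Suc (length cs))"
    using Cons by (simp add: nat_pow_distrib m_ac)
  also have "\<dots> = t [^] Suc (length cs) \<otimes> hev R a s (c # cs)"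
    by (simp add: ring_norm)
  finally show ?case by simp
qed auto

lemma hev_scl:
  assumes [simp]: "a \<in> carrier R" "s \<in> carrier R" "t \<in> carrier R" and "set cs \<subseteq> carrier R"
  shows "hev R a (t \<otimes> s) cs = hev R a s (scl R t cs)"
  using assms(4)
proof (induction cs)
  case (Cons c cs)
  then show ?case
    by (simp add: nat_pow_distrib m_ac)
qed auto

lemma hev_zero:
  assumes [simp]: "a \<in> carrier R" and "set cs \<subseteq> carrier R"
  shows "hev R a \<zero> cs = a [^] length cs"
  using assms(2) by (induction cs) (auto simp: m_comm)

lemma hev_replicate:
  assumes [simp]: "a \<in> carrier R" "s \<in> carrier R" "set cs \<subseteq> carrier R"
  shows "hev R a s (replicate n \<zero> @ cs) = a [^] n \<otimes> hev R a s cs"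
  by (induction n) (simp_all add: m_ac)

lemma dep_scale:
  assumes S: "subring S R" and "a \<in> S" "s \<in> S" "t \<in> S" "dep R S a s"
  shows "dep R S (t \<otimes> a) (t \<otimes> s)"
proof -
  obtain cs where cs: "set cs \<subseteq> S" "hev R a s cs = \<zero>" using assms by (auto simp: dep_def)
  then have "hev R (t \<otimes> a) (t \<otimes> s) cs = \<zero>"
    using assms subringE(1)[OF S] by (subst hev_scale) (auto simp: subset_iff)
  then show ?thesis using cs by (auto simp: dep_def)
qed

text \<open>The ideal generated by \<open>t s\<close> is contained in the one generated by
  \<open>s\<close>.\<close>

lemma dep_of_multiple:
  assumes S: "subring S R" and "a \<in> S" "s \<in> S" "t \<in> S" "dep R S a (t \<otimes> s)"
  shows "dep R S a s"
proof -
  obtain cs where cs: "set cs \<subseteq> S" "hev R a (t \<otimes> s) cs = \<zero>" using assms by (auto simp: dep_def)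
  then have "hev R a s (scl R t cs) = \<zero>"
    using assms subringE(1)[OF S] by (subst hev_scl [symmetric]) (auto simp: subset_iff)
  then show ?thesis using set_scl[OF S \<open>t \<in> S\<close> cs(1)] by (auto simp: dep_def)
qed

lemma dep_mono: "dep R S a s \<Longrightarrow> S \<subseteq> S' \<Longrightarrow> dep R S' a s"
  by (auto simp: dep_def)

text \<open>The equation is that of \<open>X^n - b\<close>, homogenized to
  \<open>a^n - b s^n\<close>.\<close>

lemma dep_of_pow_eq:
  assumes S: "subring S R" and "a \<in> S" "s \<in> S" "b \<in> S" "n > 0" "a [^] (n::nat) = s [^] n \<otimes> b"
  shows "dep R S a s"
proof -
  have [simp]: "a \<in> carrier R" "s \<in> carrier R" "b \<in> carrier R"
    using assms subring_carrier by auto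
  obtain m where n: "n = Suc m" using \<open>n > 0\<close> gr0_implies_Suc by blast
  have zs: "set (replicate m \<zero>) \<subseteq> carrier R" by auto
  have "hev R a s (replicate m \<zero>) = a [^] m"
    using hev_replicate[of a s "[]" m] by simp
  then have "hev R a s (\<ominus> b # replicate m \<zero>) = \<zero>"
    using assms(6) by (simp add: n ring_norm)
  moreover have "set (\<ominus> b # replicate m \<zero>) \<subseteq> S"
    using S assms by (auto simp: sub_closed)
  ultimately show ?thesis unfolding dep_def by blast
qed

text \<open>A nilpotent element is integral over the zero ideal, by \<open>X^n\<close>, and
  therefore a multiple of zero.\<close>

lemma pic_reduced:
  assumes S: "subring S R" "pic_on R C S" "\<zero> \<in> C" and "y \<in> S" "y [^] (n::nat) = \<zero>"
  shows "y = \<zero>"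
proof -
  have [simp]: "y \<in> carrier R" using assms subring_carrier by auto
  have "hev R y \<zero> (replicate n \<zero>) = \<zero>"
    using assms(5) hev_replicate[of y \<zero> "[]" n] by simp
  then have "dep R S y \<zero>"
    unfolding dep_def using S by (intro exI[of _ "replicate n \<zero>"]) (auto simp: sub_closed)
  then obtain b where "b \<in> S" "y = \<zero> \<otimes> b"
    using picD[OF S(2) \<open>y \<in> S\<close> S(3)] by blast
  then show ?thesis using S subring_carrier by simp
qed

lemma pic_reduced2:
  assumes S: "subring S R" "pic_on R C S" "\<zero> \<in> C" and "y \<in> S" "z \<in> S" "y [^] (n::nat) \<otimes> z = \<zero>"
  shows "y \<otimes> z = \<zero>"
proof (rule pic_reduced[OF S, of _ "Suc n"])
  have [simp]: "y \<in> carrier R" "z \<in> carrier R" using assms subring_carrier by auto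
  show "y \<otimes> z \<in> S" using assms by (auto simp: sub_closed)
  have "(y \<otimes> z) [^] Suc n = (y \<otimes> z [^] n) \<otimes> (y [^] n \<otimes> z)"
    by (simp add: nat_pow_distrib ring_norm)
  then show "(y \<otimes> z) [^] Suc n = \<zero>" using assms(6) by simp
qed

text \<open>Applied to the pair \<open>a\<close>, \<open>a \<oplus> b\<close>, which satisfies \<open>a\<^sup>2 = (a \<oplus> b) a\<close>.\<close>

lemma pic_zero_divisors:
  assumes S: "subring S R" "pic R S" and "a \<in> S" "b \<in> S" "a \<otimes> b = \<zero>"
  obtains t where "t \<in> S" "(\<one> \<ominus> t) \<otimes> a = \<zero>" "t \<otimes> b = \<zero>"
proof -
  have [simp]: "a \<in> carrier R" "b \<in> carrier R" using assms subring_carrier by auto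
  have "hev R a (a \<oplus> b) [\<zero>, \<ominus> \<one>] = a \<otimes> (a \<otimes> \<one> \<oplus> \<ominus> \<one> \<otimes> (a \<oplus> b)) \<oplus> \<zero>"
    by simp
  also have "\<dots> = \<ominus> (a \<otimes> b)" by (simp add: ring_norm)
  also have "\<dots> = \<zero>" using assms by simp
  finally have "dep R S a (a \<oplus> b)"
    unfolding dep_def using S by (intro exI[of _ "[\<zero>, \<ominus> \<one>]"]) (auto simp: sub_closed)
  then obtain t where t: "t \<in> S" "a = (a \<oplus> b) \<otimes> t"
    using picD[OF S(2) \<open>a \<in> S\<close> subringE(7)[OF S(1) \<open>a \<in> S\<close> \<open>b \<in> S\<close>]] by blast
  then have [simp]: "t \<in> carrier R" using S subring_carrier by auto
  have 1: "(\<one> \<ominus> t) \<otimes> a = t \<otimes> b"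
  proof -
    have "(\<one> \<ominus> t) \<otimes> a = a \<ominus> t \<otimes> a" by (simp add: ring_norm)
    also have "\<dots> = (a \<oplus> b) \<otimes> t \<ominus> t \<otimes> a" using t by simp
    also have "\<dots> = t \<otimes> b" by (simp add: ring_norm)
    finally show ?thesis .
  qed
  \<comment> \<open>The two descriptions of this element are multiplied: its square contains the
    factor \<open>a b\<close>.\<close>
  have 3: "(\<one> \<ominus> t) \<otimes> a = \<zero>"
  proof (rule pic_reduced[OF S subringE(2)[OF S(1)], of _ 2])
    show "(\<one> \<ominus> t) \<otimes> a \<in> S" using S assms t by (auto simp: sub_closed)
    have "((\<one> \<ominus> t) \<otimes> a) [^] (2::nat) = (\<one> \<ominus> t) \<otimes> a \<otimes> ((\<one> \<ominus> t) \<otimes> a)"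
      by (simp add: numeral_2_eq_2)
    also have "\<dots> = (\<one> \<ominus> t) \<otimes> a \<otimes> (t \<otimes> b)" using 1 by simp
    also have "\<dots> = (\<one> \<ominus> t) \<otimes> t \<otimes> (a \<otimes> b)" by (simp add: m_ac)
    finally show "((\<one> \<ominus> t) \<otimes> a) [^] (2::nat) = \<zero>" using assms by simp
  qed
  have "t \<otimes> b = \<zero>" using 1 3 by metis
  with 3 show ?thesis using that[of t] t(1) by blast
qed

text \<open>Finite sets in place of a single zero divisor. The multiplier \<open>v\<close> plays the
  role of an idempotent that separates \<open>c\<close> from the given elements killed by
  \<open>c\<close>; it will be applied to the coefficients of a polynomial.\<close>

lemma pic_annihilator:
  assumes S: "subring S R" "pic R S" and "c \<in> S" and Y: "finite Y" "Y \<subseteq> S" "\<forall>y\<in>Y. c \<otimes> y = \<zero>"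
  obtains v where "v \<in> S" "v \<otimes> c = \<zero>" "\<forall>y\<in>Y. v \<otimes> y = y"
proof -
  have "\<exists>v\<in>S. v \<otimes> c = \<zero> \<and> (\<forall>y\<in>Y. v \<otimes> y = y)"
    using Y
  proof (induction Y)
    case empty
    have "\<zero> \<in> S" "\<zero> \<otimes> c = \<zero>" using assms subring_carrier by (auto simp: sub_closed)
    then show ?case by blast
  next
    case (insert y Y)
    then obtain v where v: "v \<in> S" "v \<otimes> c = \<zero>" "\<forall>y\<in>Y. v \<otimes> y = y" by auto
    have y: "y \<in> S" "c \<otimes> y = \<zero>" using insert by auto
    have [simp]: "y \<in> carrier R" "c \<in> carrier R" "v \<in> carrier R" using y v assms subring_carrier by auto
    obtain t where t: "t \<in> S" "(\<one> \<ominus> t) \<otimes> y = \<zero>" "t \<otimes> c = \<zero>"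
      using pic_zero_divisors[OF S y(1) \<open>c \<in> S\<close>] y by (metis \<open>c \<in> carrier R\<close> \<open>y \<in> carrier R\<close> m_comm)
    have [simp]: "t \<in> carrier R" using t S subring_carrier by auto
    have "y \<ominus> t \<otimes> y = (\<one> \<ominus> t) \<otimes> y" by (simp add: diff_mult1)
    then have ty: "t \<otimes> y = y" using t(2) by simp
    \<comment> \<open>This is \<open>1 - (1 - v) (1 - t)\<close>: it fixes whatever \<open>v\<close>
      or \<open>t\<close> fixes and still kills \<open>c\<close>.\<close>
    let ?w = "(v \<oplus> t) \<ominus> v \<otimes> t"
    have "?w \<otimes> c = v \<otimes> c \<oplus> t \<otimes> c \<ominus> v \<otimes> (t \<otimes> c)" by (simp add: ring_norm)
    then have "?w \<otimes> c = \<zero>" unfolding v(2) t(3) by (simp add: minus_eq)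
    moreover have "?w \<otimes> y = v \<otimes> y \<oplus> t \<otimes> y \<ominus> v \<otimes> (t \<otimes> y)" by (simp add: ring_norm)
    then have "?w \<otimes> y = v \<otimes> y \<oplus> y \<ominus> v \<otimes> y" unfolding ty .
    then have "?w \<otimes> y = y" by (simp add: minus_eq a_ac r_neg)
    moreover have "?w \<otimes> z = z" if "z \<in> Y" for z
    proof -
      have [simp]: "z \<in> carrier R" and vz: "v \<otimes> z = z" using that insert.prems v S subring_carrier by auto
      have "?w \<otimes> z = v \<otimes> z \<oplus> t \<otimes> z \<ominus> t \<otimes> (v \<otimes> z)" by (simp add: ring_norm)
      then have "?w \<otimes> z = z \<oplus> t \<otimes> z \<ominus> t \<otimes> z" unfolding vz .
      then show ?thesis by (simp add: minus_eq a_assoc r_neg)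
    qed
    moreover have "?w \<in> S" using v t S by (auto simp: sub_closed)
    ultimately show ?case by blast
  qed
  then show ?thesis using that by blast
qed

end

section \<open>Determinant trick\<close>

primrec lspan :: "('a, 'm) ring_scheme \<Rightarrow> 'a set \<Rightarrow> 'a list \<Rightarrow> 'a set" where
  "lspan R S [] = {\<zero>\<^bsub>R\<^esub>}"
| "lspan R S (m # ms) = {t \<otimes>\<^bsub>R\<^esub> m \<oplus>\<^bsub>R\<^esub> y | t y. t \<in> S \<and> y \<in> lspan R S ms}"

text \<open>The values at \<open>(a, c)\<close> of the homogeneous polynomials of degree
  \<open>n\<close> with coefficients in \<open>S\<close>, in Horner form. They carry the degree
  bookkeeping for a determinant that is never written down.\<close>

primrec forms :: "('a, 'm) ring_scheme \<Rightarrow> 'a set \<Rightarrow> 'a \<Rightarrow> 'a \<Rightarrow> nat \<Rightarrow> 'a set" where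
  "forms R S a c 0 = S"
| "forms R S a c (Suc n) = {a \<otimes>\<^bsub>R\<^esub> g \<oplus>\<^bsub>R\<^esub> k \<otimes>\<^bsub>R\<^esub> c [^]\<^bsub>R\<^esub> Suc n | g k. g \<in> forms R S a c n \<and> k \<in> S}"

text \<open>Additive subgroups, the common core of subrings, ideals, spans and linear
  subspaces.\<close>

definition add_closed :: "('a, 'm) ring_scheme \<Rightarrow> 'a set \<Rightarrow> bool" where
  "add_closed R W \<longleftrightarrow> W \<subseteq> carrier R \<and> \<zero>\<^bsub>R\<^esub> \<in> W \<and> (\<forall>x\<in>W. \<forall>y\<in>W. x \<oplus>\<^bsub>R\<^esub> y \<in> W) \<and> (\<forall>x\<in>W. \<ominus>\<^bsub>R\<^esub> x \<in> W)"

context cring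
begin

lemma add_closedD:
  assumes "add_closed R W"
  shows "W \<subseteq> carrier R" "\<zero> \<in> W" "\<And>x y. x \<in> W \<Longrightarrow> y \<in> W \<Longrightarrow> x \<oplus> y \<in> W"
    "\<And>x. x \<in> W \<Longrightarrow> \<ominus> x \<in> W" "\<And>x. x \<in> W \<Longrightarrow> x \<in> carrier R"
  using assms by (auto simp: add_closed_def)

lemma add_closed_minus: "add_closed R W \<Longrightarrow> x \<in> W \<Longrightarrow> y \<in> W \<Longrightarrow> x \<ominus> y \<in> W"
  by (simp add: minus_eq add_closedD)

lemma subring_add_closed: "subring S R \<Longrightarrow> add_closed R S"
  by (auto simp: add_closed_def subringE subring_carrier)

lemma lspan_carrier:
  assumes "S \<subseteq> carrier R" "set ms \<subseteq> carrier R"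
  shows "lspan R S ms \<subseteq> carrier R"
  using assms(2) by (induction ms) (use assms(1) in auto)

lemma lspan_add_closed:
  assumes S: "add_closed R S" and "set ms \<subseteq> carrier R"
  shows "add_closed R (lspan R S ms)"
  using assms(2)
proof (induction ms)
  case Nil
  then show ?case by (auto simp: add_closed_def)
next
  case (Cons m ms)
  then have IH: "add_closed R (lspan R S ms)" and [simp]: "m \<in> carrier R" by auto
  have "\<zero> = \<zero> \<otimes> m \<oplus> \<zero>" by simp
  then have 0: "\<zero> \<in> lspan R S (m # ms)"
    using add_closedD(2)[OF S] add_closedD(2)[OF IH] unfolding lspan.simps by blast
  have 1: "x \<oplus> y \<in> lspan R S (m # ms)" if xy: "x \<in> lspan R S (m # ms)" "y \<in> lspan R S (m # ms)" for x y
  proof -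
    obtain t u z w where *: "t \<in> S" "u \<in> S" "z \<in> lspan R S ms" "w \<in> lspan R S ms"
      "x = t \<otimes> m \<oplus> z" "y = u \<otimes> m \<oplus> w" using xy by auto
    then have [simp]: "t \<in> carrier R" "u \<in> carrier R" "z \<in> carrier R" "w \<in> carrier R"
      using add_closedD(5)[OF S] add_closedD(5)[OF IH] by auto
    have "x \<oplus> y = (t \<oplus> u) \<otimes> m \<oplus> (z \<oplus> w)" unfolding * by (simp add: ring_norm)
    moreover have "t \<oplus> u \<in> S" "z \<oplus> w \<in> lspan R S ms" using * add_closedD(3) S IH by auto
    ultimately show ?thesis unfolding lspan.simps by blast
  qed
  have 2: "\<ominus> x \<in> lspan R S (m # ms)" if x: "x \<in> lspan R S (m # ms)" for x
  proof -
    obtain t z where *: "t \<in> S" "z \<in> lspan R S ms" "x = t \<otimes> m \<oplus> z" using x by auto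
    then have [simp]: "t \<in> carrier R" "z \<in> carrier R"
      using add_closedD(5)[OF S] add_closedD(5)[OF IH] by auto
    have "\<ominus> x = (\<ominus> t) \<otimes> m \<oplus> \<ominus> z" unfolding * by (simp add: l_minus minus_add)
    moreover have "\<ominus> t \<in> S" "\<ominus> z \<in> lspan R S ms" using * add_closedD(4) S IH by auto
    ultimately show ?thesis unfolding lspan.simps by blast
  qed
  have "lspan R S (m # ms) \<subseteq> carrier R"
    by (rule lspan_carrier) (use Cons S add_closedD(1) in auto)
  with 0 1 2 show ?case unfolding add_closed_def by blast
qed

lemma lspan_scale:
  assumes [simp]: "u \<in> carrier R" and "set ms \<subseteq> carrier R" "S \<subseteq> carrier R"
    and "\<And>t. t \<in> S \<Longrightarrow> u \<otimes> t \<in> S'" and "y \<in> lspan R S ms"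
  shows "u \<otimes> y \<in> lspan R S' ms"
  using assms(2,5)
proof (induction ms arbitrary: y)
  case (Cons m ms)
  obtain t z where *: "t \<in> S" "z \<in> lspan R S ms" "y = t \<otimes> m \<oplus> z" using Cons.prems by auto
  then have [simp]: "t \<in> carrier R" "z \<in> carrier R" "m \<in> carrier R"
    using assms(3) lspan_carrier[of S ms] Cons.prems by auto
  have "u \<otimes> y = (u \<otimes> t) \<otimes> m \<oplus> u \<otimes> z" unfolding * by (simp add: ring_norm)
  moreover have "u \<otimes> t \<in> S'" "u \<otimes> z \<in> lspan R S' ms"
    using * assms(4) Cons by auto
  ultimately show ?case unfolding lspan.simps by blast
qed auto

lemma lspan_subset:
  assumes "add_closed R W" and "\<And>t m. t \<in> S \<Longrightarrow> m \<in> set ms \<Longrightarrow> t \<otimes> m \<in> W"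
  shows "lspan R S ms \<subseteq> W"
  using assms(2) by (induction ms) (use add_closedD[OF assms(1)] in auto)

lemma lspan_smult_base:
  assumes "add_closed R S" "set ms \<subseteq> carrier R" "m \<in> set ms" "t \<in> S"
  shows "t \<otimes> m \<in> lspan R S ms"
  using assms(2,3)
proof (induction ms)
  case (Cons m' ms)
  then have cl: "add_closed R (lspan R S ms)" using lspan_add_closed assms by auto
  have [simp]: "t \<in> carrier R" "m' \<in> carrier R" "m \<in> carrier R" using assms add_closedD(5) Cons by auto
  show ?case
  proof (cases "m = m'")
    case True
    have "t \<otimes> m = t \<otimes> m' \<oplus> \<zero>" using True by simp
    then show ?thesis using \<open>t \<in> S\<close> add_closedD(2)[OF cl] unfolding lspan.simps by blast
  next
    case False
    then have *: "t \<otimes> m \<in> lspan R S ms" using Cons by auto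
    have "t \<otimes> m = \<zero> \<otimes> m' \<oplus> t \<otimes> m" by simp
    then show ?thesis using * add_closedD(2)[OF assms(1)] unfolding lspan.simps by blast
  qed
qed auto

lemma lspan_base:
  "subring S R \<Longrightarrow> set ms \<subseteq> carrier R \<Longrightarrow> m \<in> set ms \<Longrightarrow> m \<in> lspan R S ms"
  using lspan_smult_base[OF subring_add_closed, of S ms m \<one>] by (auto simp: subringE)

lemma forms_add_closed:
  assumes S: "subring S R" and [simp]: "a \<in> carrier R" "c \<in> carrier R"
  shows "add_closed R (forms R S a c n)"
proof (induction n)
  case 0
  then show ?case using subring_add_closed[OF S] by simp
next
  case (Suc n)
  note SS = subring_add_closed[OF S]
  have "\<zero> = a \<otimes> \<zero> \<oplus> \<zero> \<otimes> c [^] Suc n" by simp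
  then have 0: "\<zero> \<in> forms R S a c (Suc n)"
    using add_closedD(2)[OF Suc] add_closedD(2)[OF SS] unfolding forms.simps by blast
  have 1: "x \<oplus> y \<in> forms R S a c (Suc n)" if xy: "x \<in> forms R S a c (Suc n)" "y \<in> forms R S a c (Suc n)" for x y
  proof -
    obtain g h k l where *: "g \<in> forms R S a c n" "h \<in> forms R S a c n" "k \<in> S" "l \<in> S"
      "x = a \<otimes> g \<oplus> k \<otimes> c [^] Suc n" "y = a \<otimes> h \<oplus> l \<otimes> c [^] Suc n" using xy by auto
    then have [simp]: "g \<in> carrier R" "h \<in> carrier R" "k \<in> carrier R" "l \<in> carrier R"
      using add_closedD(5)[OF Suc] add_closedD(5)[OF SS] by auto
    have "x \<oplus> y = a \<otimes> (g \<oplus> h) \<oplus> (k \<oplus> l) \<otimes> c [^] Suc n" unfolding * by (simp add: ring_norm del: nat_pow_Suc)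
    moreover have "g \<oplus> h \<in> forms R S a c n" "k \<oplus> l \<in> S" using * add_closedD(3) Suc SS by auto
    ultimately show ?thesis unfolding forms.simps by blast
  qed
  have 2: "\<ominus> x \<in> forms R S a c (Suc n)" if x: "x \<in> forms R S a c (Suc n)" for x
  proof -
    obtain g k where *: "g \<in> forms R S a c n" "k \<in> S" "x = a \<otimes> g \<oplus> k \<otimes> c [^] Suc n" using x by auto
    then have [simp]: "g \<in> carrier R" "k \<in> carrier R"
      using add_closedD(5)[OF Suc] add_closedD(5)[OF SS] by auto
    have "\<ominus> x = a \<otimes> (\<ominus> g) \<oplus> (\<ominus> k) \<otimes> c [^] Suc n" unfolding * by (simp add: l_minus r_minus minus_add del: nat_pow_Suc)
    moreover have "\<ominus> g \<in> forms R S a c n" "\<ominus> k \<in> S" using * add_closedD(4) Suc SS by auto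
    ultimately show ?thesis unfolding forms.simps by blast
  qed
  have "forms R S a c (Suc n) \<subseteq> carrier R"
    using add_closedD(5)[OF Suc] add_closedD(5)[OF SS] by auto
  with 0 1 2 show ?case unfolding add_closed_def by blast
qed

lemma forms_carrier: "\<lbrakk>subring S R; a \<in> carrier R; c \<in> carrier R; g \<in> forms R S a c n\<rbrakk> \<Longrightarrow> g \<in> carrier R"
  using forms_add_closed add_closedD(5) by blast

lemma forms_mult_a:
  assumes S: "subring S R" and "a \<in> carrier R" "c \<in> carrier R" "g \<in> forms R S a c n"
  shows "a \<otimes> g \<in> forms R S a c (Suc n)"
proof -
  have "a \<otimes> g = a \<otimes> g \<oplus> \<zero> \<otimes> c [^] Suc n" using forms_carrier[OF assms] assms by simp
  then show ?thesis using assms subringE(2)[OF S] unfolding forms.simps by blast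
qed

lemma forms_mult_c:
  assumes S: "subring S R" and [simp]: "a \<in> carrier R" "c \<in> carrier R" and "g \<in> forms R S a c n"
  shows "c \<otimes> g \<in> forms R S a c (Suc n)"
  using assms(4)
proof (induction n arbitrary: g)
  case 0
  then have [simp]: "g \<in> carrier R" using subring_carrier[OF S] by auto
  have "c \<otimes> g = a \<otimes> \<zero> \<oplus> g \<otimes> c [^] Suc 0" by (simp add: m_comm)
  moreover have "\<zero> \<in> forms R S a c 0" "g \<in> S" using subringE(2)[OF S] 0 by auto
  ultimately show ?case unfolding forms.simps(2) by blast
next
  case (Suc n)
  obtain h k where *: "h \<in> forms R S a c n" "k \<in> S" "g = a \<otimes> h \<oplus> k \<otimes> c [^] Suc n" using Suc by auto
  then have [simp]: "h \<in> carrier R" "k \<in> carrier R"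
    using subring_carrier[OF S] forms_carrier[OF S assms(2,3)] by blast+
  have "c \<otimes> g = a \<otimes> (c \<otimes> h) \<oplus> k \<otimes> c [^] Suc (Suc n)" unfolding * by (simp add: ring_norm)
  then show ?case using Suc.IH[OF *(1)] *(2) unfolding forms.simps(2)[of _ _ _ _ "Suc n"] by blast
qed

lemma forms_mult_apow:
  assumes S: "subring S R" and [simp]: "a \<in> carrier R" "c \<in> carrier R" and "g \<in> forms R S a c n"
  shows "a [^] m \<otimes> g \<in> forms R S a c (m + n)"
proof (induction m)
  case 0
  then show ?case using assms(4) forms_carrier[OF S assms(2,3,4)] by simp
next
  case (Suc m)
  have [simp]: "g \<in> carrier R" using forms_carrier[OF S assms(2,3,4)] .
  have "a [^] Suc m \<otimes> g = a \<otimes> (a [^] m \<otimes> g)" by (simp add: m_ac)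
  then show ?case using forms_mult_a[OF S _ _ Suc] by simp
qed

lemma forms_mult_cpow:
  assumes S: "subring S R" and [simp]: "a \<in> carrier R" "c \<in> carrier R" and "g \<in> forms R S a c n"
  shows "c [^] m \<otimes> g \<in> forms R S a c (m + n)"
proof (induction m)
  case 0
  then show ?case using assms(4) forms_carrier[OF S assms(2,3,4)] by simp
next
  case (Suc m)
  have [simp]: "g \<in> carrier R" using forms_carrier[OF S assms(2,3,4)] .
  have "c [^] Suc m \<otimes> g = c \<otimes> (c [^] m \<otimes> g)" by (simp add: m_ac)
  then show ?case using forms_mult_c[OF S _ _ Suc] by simp
qed

lemma forms_smult:
  assumes S: "subring S R" and [simp]: "a \<in> carrier R" "c \<in> carrier R" and "g \<in> forms R S a c n" and "t \<in> S"
  shows "t \<otimes> g \<in> forms R S a c n"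
  using assms(4)
proof (induction n arbitrary: g)
  case 0
  then show ?case using assms subringE(6)[OF S] by auto
next
  case (Suc n)
  obtain h k where *: "h \<in> forms R S a c n" "k \<in> S" "g = a \<otimes> h \<oplus> k \<otimes> c [^] Suc n" using Suc by auto
  then have [simp]: "h \<in> carrier R" "k \<in> carrier R" "t \<in> carrier R"
    using subring_carrier[OF S] forms_carrier[OF S assms(2,3)] assms(5) by blast+
  have "t \<otimes> g = a \<otimes> (t \<otimes> h) \<oplus> (t \<otimes> k) \<otimes> c [^] Suc n" unfolding * by (simp add: ring_norm)
  then show ?case using Suc.IH[OF *(1)] subringE(6)[OF S \<open>t \<in> S\<close> *(2)] unfolding forms.simps(2) by blast
qed

lemma forms_mult:
  assumes S: "subring S R" and [simp]: "a \<in> carrier R" "c \<in> carrier R"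
    and "g \<in> forms R S a c m" "h \<in> forms R S a c n"
  shows "g \<otimes> h \<in> forms R S a c (m + n)"
  using assms(4)
proof (induction m arbitrary: g)
  case 0
  then show ?case using forms_smult[OF S _ _ assms(5)] by simp
next
  case (Suc m)
  obtain f k where *: "f \<in> forms R S a c m" "k \<in> S" "g = a \<otimes> f \<oplus> k \<otimes> c [^] Suc m" using Suc by auto
  then have [simp]: "f \<in> carrier R" "k \<in> carrier R" "h \<in> carrier R"
    using subring_carrier[OF S] forms_carrier[OF S assms(2,3)] assms(5) by blast+
  have "g \<otimes> h = a \<otimes> (f \<otimes> h) \<oplus> k \<otimes> (c [^] Suc m \<otimes> h)" unfolding * by (simp add: ring_norm)
  moreover have "a \<otimes> (f \<otimes> h) \<in> forms R S a c (Suc m + n)"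
    using forms_mult_a[OF S _ _ Suc.IH[OF *(1)]] by simp
  moreover have "k \<otimes> (c [^] Suc m \<otimes> h) \<in> forms R S a c (Suc m + n)"
    using forms_smult[OF S _ _ forms_mult_cpow[OF S _ _ assms(5), of "Suc m"] *(2)] by simp
  ultimately show ?case using add_closedD(3)[OF forms_add_closed[OF S assms(2,3)]] by metis
qed

text \<open>Every term except the leading one has a factor \<open>c\<close>; what remains is
  homogeneous of degree \<open>n\<close>. Together with the converse \<open>forms_eq_hev\<close>,
  this makes monic equations and expressions \<open>a^(n+1) + c g\<close> interchangeable.\<close>

lemma hev_eq_forms:
  assumes S: "subring S R" and [simp]: "a \<in> carrier R" "c \<in> carrier R"
    and "set cs \<subseteq> S" "length cs = Suc n"
  shows "\<exists>g\<in>forms R S a c n. hev R a c cs = a [^] Suc n \<oplus> c \<otimes> g"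
  using assms(4,5)
proof (induction n arbitrary: cs)
  case 0
  then obtain k where *: "cs = [k]" "k \<in> S" by (cases cs) auto
  then have [simp]: "k \<in> carrier R" using subring_carrier[OF S] by auto
  have "hev R a c cs = a [^] Suc 0 \<oplus> c \<otimes> k" using * by (simp add: m_comm)
  then show ?case using * by auto
next
  case (Suc n)
  then obtain k ks where cs: "cs = k # ks" by (cases cs) auto
  then have k: "k \<in> S" and ks: "set ks \<subseteq> S" "length ks = Suc n" using Suc by auto
  obtain g where g: "g \<in> forms R S a c n" "hev R a c ks = a [^] Suc n \<oplus> c \<otimes> g" using Suc.IH[OF ks] by auto
  have [simp]: "k \<in> carrier R" "g \<in> carrier R"
    using subring_carrier[OF S k] forms_carrier[OF S assms(2,3) g(1)] by auto
  have "hev R a c cs = a \<otimes> (a [^] Suc n \<oplus> c \<otimes> g) \<oplus> k \<otimes> c [^] Suc (Suc n)"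
    using cs g(2) ks by simp
  also have "\<dots> = a [^] Suc (Suc n) \<oplus> c \<otimes> (a \<otimes> g \<oplus> k \<otimes> c [^] Suc n)" by (simp add: ring_norm)
  finally show ?case using g k by auto
qed

lemma forms_eq_hev:
  assumes S: "subring S R" and [simp]: "a \<in> carrier R" "c \<in> carrier R" and "g \<in> forms R S a c n"
  shows "\<exists>cs. set cs \<subseteq> S \<and> length cs = Suc n \<and> hev R a c cs = a [^] Suc n \<oplus> c \<otimes> g"
  using assms(4)
proof (induction n arbitrary: g)
  case 0
  then have [simp]: "g \<in> carrier R" using subring_carrier[OF S] by auto
  have "hev R a c [g] = a [^] Suc 0 \<oplus> c \<otimes> g" by (simp add: m_comm)
  then show ?case using 0 by (intro exI[of _ "[g]"]) auto
next
  case (Suc n)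
  obtain h k where *: "h \<in> forms R S a c n" "k \<in> S" "g = a \<otimes> h \<oplus> k \<otimes> c [^] Suc n" using Suc by auto
  then obtain ks where ks: "set ks \<subseteq> S" "length ks = Suc n" "hev R a c ks = a [^] Suc n \<oplus> c \<otimes> h"
    using Suc.IH by blast
  have [simp]: "k \<in> carrier R" "h \<in> carrier R"
    using subring_carrier[OF S *(2)] forms_carrier[OF S assms(2,3) *(1)] by auto
  have "hev R a c (k # ks) = a \<otimes> (a [^] Suc n \<oplus> c \<otimes> h) \<oplus> k \<otimes> c [^] Suc (Suc n)"
    using ks by simp
  also have "\<dots> = a [^] Suc (Suc n) \<oplus> c \<otimes> g" unfolding * by (simp add: ring_norm)
  finally show ?case using ks * by (intro exI[of _ "k # ks"]) auto
qed

text \<open>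
  The determinant trick by fraction-free elimination: \<open>a [^] Suc d \<ominus> \<lambda>\<close> with \<open>\<lambda> \<in> c \<cdot> forms d\<close>
  plays the role of a monic polynomial, and eliminating one generator doubles the degree.
\<close>

lemma monic_annihilator:
  assumes S: "subring S R" and [simp]: "a \<in> carrier R" "c \<in> carrier R"
    and "set ms \<subseteq> carrier R"
    and "\<And>m. m \<in> set ms \<Longrightarrow> a [^] Suc d \<otimes> m \<in> lspan R ((\<otimes>) c ` forms R S a c d) ms"
  shows "\<exists>e. \<exists>g\<in>forms R S a c e. \<forall>m\<in>set ms. (a [^] Suc e \<ominus> c \<otimes> g) \<otimes> m = \<zero>"
  using assms(4,5)
proof (induction ms arbitrary: d)
  case Nil
  have "\<zero> \<in> forms R S a c 0" using subringE(2)[OF S] by simp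
  then show ?case by (metis empty_iff list.set(1))
next
  case (Cons m ms)
  define L where "L n = (\<otimes>) c ` forms R S a c n" for n
  have fc: "g \<in> carrier R" if "g \<in> forms R S a c n" for g n using forms_carrier[OF S _ _ that] by simp
  have Lc: "L n \<subseteq> carrier R" for n unfolding L_def using fc by auto
  have LL: "x \<otimes> y \<in> L (Suc (n + k))" if xy: "x \<in> L n" "y \<in> L k" for x y n k
  proof -
    obtain g h where *: "g \<in> forms R S a c n" "h \<in> forms R S a c k" "x = c \<otimes> g" "y = c \<otimes> h"
      using xy unfolding L_def by auto
    have "x \<otimes> y = c \<otimes> (c \<otimes> (g \<otimes> h))" unfolding * using fc * by (simp add: m_ac)
    moreover have "c \<otimes> (g \<otimes> h) \<in> forms R S a c (Suc (n + k))"
      using forms_mult_c[OF S _ _ forms_mult[OF S _ _ *(1,2)]] by simp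
    ultimately show ?thesis unfolding L_def by blast
  qed
  have aL: "a [^] k \<otimes> x \<in> L (k + n)" if xy: "x \<in> L n" for x n k
  proof -
    obtain g where *: "g \<in> forms R S a c n" "x = c \<otimes> g" using xy unfolding L_def by auto
    have "a [^] k \<otimes> x = c \<otimes> (a [^] k \<otimes> g)" unfolding * using fc * by (simp add: m_ac)
    moreover have "a [^] k \<otimes> g \<in> forms R S a c (k + n)"
      using forms_mult_apow[OF S _ _ *(1)] by simp
    ultimately show ?thesis unfolding L_def by blast
  qed
  have LA: "add_closed R (L n)" for n
  proof -
    note F = forms_add_closed[OF S assms(2,3), of n]
    have "\<zero> \<in> L n" unfolding L_def using add_closedD(2)[OF F] by (intro image_eqI[of _ _ \<zero>]) auto
    moreover have "x \<oplus> y \<in> L n" if xy: "x \<in> L n" "y \<in> L n" for x y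
    proof -
      obtain g h where *: "g \<in> forms R S a c n" "h \<in> forms R S a c n" "x = c \<otimes> g" "y = c \<otimes> h"
        using xy unfolding L_def by auto
      then have "x \<oplus> y = c \<otimes> (g \<oplus> h)" using fc by (simp add: r_distr)
      then show ?thesis unfolding L_def using add_closedD(3)[OF F *(1,2)] by blast
    qed
    moreover have "\<ominus> x \<in> L n" if xy: "x \<in> L n" for x
    proof -
      obtain g where *: "g \<in> forms R S a c n" "x = c \<otimes> g"
        using xy unfolding L_def by auto
      then have "\<ominus> x = c \<otimes> (\<ominus> g)" using fc by (simp add: r_minus)
      then show ?thesis unfolding L_def using add_closedD(4)[OF F *(1)] by blast
    qed
    ultimately show ?thesis unfolding add_closed_def using Lc by blast
  qed
  have ms: "set ms \<subseteq> carrier R" and m [simp]: "m \<in> carrier R" using Cons.prems by auto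
  note SP = lspan_add_closed[OF LA ms]
  have "a [^] Suc d \<otimes> m \<in> lspan R (L d) (m # ms)" unfolding L_def using Cons.prems by auto
  then obtain l w where l: "l \<in> L d" and w: "w \<in> lspan R (L d) ms" and m_eq: "a [^] Suc d \<otimes> m = l \<otimes> m \<oplus> w"
    by auto
  have [simp]: "l \<in> carrier R" "w \<in> carrier R" using l w Lc add_closedD(5)[OF SP] by auto
  \<comment> \<open>\<open>P\<close> is the pivot: up to a multiple of \<open>c\<close> it is a
    power of \<open>a\<close>, and it sends the generator \<open>m\<close> into the span of the
    others.\<close>
  define P where "P = a [^] Suc d \<ominus> l"
  have [simp]: "P \<in> carrier R" unfolding P_def by simp
  have "P \<otimes> m = a [^] Suc d \<otimes> m \<ominus> l \<otimes> m" unfolding P_def by (simp add: diff_mult1)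
  then have Pm: "P \<otimes> m = w" unfolding m_eq by (simp add: ring_norm)
  \<comment> \<open>There is no division by the pivot: the relation for \<open>m'\<close> is
    multiplied by \<open>P\<close>, and \<open>P m = w\<close> eliminates \<open>m\<close>. The
    exponent of \<open>a\<close> grows from \<open>d + 1\<close> to
    \<open>2 (d + 1)\<close>.\<close>
  have step: "a [^] Suc (Suc (d + d)) \<otimes> m' \<in> lspan R (L (Suc (d + d))) ms" if m': "m' \<in> set ms" for m'
  proof -
    have [simp]: "m' \<in> carrier R" using m' ms by auto
    have "a [^] Suc d \<otimes> m' \<in> lspan R (L d) (m # ms)" unfolding L_def using Cons.prems m' by auto
    then obtain k z where k: "k \<in> L d" and z: "z \<in> lspan R (L d) ms" and eq: "a [^] Suc d \<otimes> m' = k \<otimes> m \<oplus> z"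
      by auto
    have [simp]: "k \<in> carrier R" "z \<in> carrier R" using k z Lc add_closedD(5)[OF SP] by auto
    have "a [^] Suc (Suc (d + d)) = a [^] Suc d \<otimes> a [^] Suc d"
      by (metis add_Suc add_Suc_right assms(2) nat_pow_mult)
    then have "a [^] Suc (Suc (d + d)) \<otimes> m' = P \<otimes> (a [^] Suc d \<otimes> m') \<oplus> (a [^] Suc d \<otimes> l) \<otimes> m'"
      unfolding P_def by (simp add: ring_norm)
    also have "P \<otimes> (a [^] Suc d \<otimes> m') = k \<otimes> (P \<otimes> m) \<oplus> P \<otimes> z"
      unfolding eq by (simp add: ring_norm)
    also have "\<dots> = k \<otimes> w \<oplus> (a [^] Suc d \<otimes> z \<ominus> l \<otimes> z)"
      unfolding Pm unfolding P_def by (simp add: ring_norm)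
    finally have *: "a [^] Suc (Suc (d + d)) \<otimes> m' = k \<otimes> w \<oplus> (a [^] Suc d \<otimes> z \<ominus> l \<otimes> z) \<oplus> (a [^] Suc d \<otimes> l) \<otimes> m'" .
    have "k \<otimes> w \<in> lspan R (L (Suc (d + d))) ms"
      by (rule lspan_scale[OF _ ms Lc LL w]) (use k in auto)
    moreover have "l \<otimes> z \<in> lspan R (L (Suc (d + d))) ms"
      by (rule lspan_scale[OF _ ms Lc LL z]) (use l in auto)
    moreover have "a [^] Suc d \<otimes> z \<in> lspan R (L (Suc (d + d))) ms"
      by (rule lspan_scale[OF _ ms Lc _ z]) (use aL[of _ d "Suc d"] in auto)
    moreover have "(a [^] Suc d \<otimes> l) \<otimes> m' \<in> lspan R (L (Suc (d + d))) ms"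
      by (rule lspan_smult_base[OF LA ms m']) (use aL[OF l, of "Suc d"] in auto)
    ultimately show ?thesis unfolding * using add_closedD(3)[OF SP] add_closed_minus[OF SP] by metis
  qed
  obtain e g where g: "g \<in> forms R S a c e" and kill: "\<forall>m\<in>set ms. (a [^] Suc e \<ominus> c \<otimes> g) \<otimes> m = \<zero>"
    using Cons.IH[OF ms step[unfolded L_def]] by blast
  have [simp]: "g \<in> carrier R" using fc g by auto
  define Q where "Q = a [^] Suc e \<ominus> c \<otimes> g"
  have [simp]: "Q \<in> carrier R" unfolding Q_def by simp
  have "lspan R (L d) ms \<subseteq> {y \<in> carrier R. Q \<otimes> y = \<zero>}"
  proof (rule lspan_subset)
    show "add_closed R {y \<in> carrier R. Q \<otimes> y = \<zero>}"
      unfolding add_closed_def by (auto simp: r_distr r_minus)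
    show "t \<otimes> m \<in> {y \<in> carrier R. Q \<otimes> y = \<zero>}" if "t \<in> L d" "m \<in> set ms" for t m
    proof -
      have [simp]: "t \<in> carrier R" "m \<in> carrier R" using that Lc ms by auto
      have "Q \<otimes> (t \<otimes> m) = t \<otimes> (Q \<otimes> m)" by (simp add: m_ac)
      then show ?thesis using kill that unfolding Q_def by simp
    qed
  qed
  then have Qw: "Q \<otimes> w = \<zero>" using w by auto
  obtain g1 where g1: "g1 \<in> forms R S a c d" "l = c \<otimes> g1" using l unfolding L_def by auto
  have [simp]: "g1 \<in> carrier R" using fc g1 by auto
  \<comment> \<open>The form is read off from the product \<open>Q P = a^(e + d + 2) - c h\<close>.
    As \<open>P\<close> maps \<open>m\<close> to \<open>w\<close> and \<open>Q\<close> kills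
    \<open>w\<close> and the other generators, \<open>Q P\<close> kills all of them.\<close>
  define h where "h = (a [^] Suc e \<otimes> g1 \<oplus> a [^] Suc d \<otimes> g) \<ominus> c \<otimes> (g \<otimes> g1)"
  have h: "h \<in> forms R S a c (Suc (e + d))"
  proof -
    note F = forms_add_closed[OF S assms(2,3), of "Suc (e + d)"]
    have "a [^] Suc e \<otimes> g1 \<in> forms R S a c (Suc (e + d))" using forms_mult_apow[OF S _ _ g1(1), of "Suc e"] by simp
    moreover have "a [^] Suc d \<otimes> g \<in> forms R S a c (Suc (e + d))" using forms_mult_apow[OF S _ _ g, of "Suc d"] by (simp add: add.commute)
    moreover have "c \<otimes> (g \<otimes> g1) \<in> forms R S a c (Suc (e + d))"
      using forms_mult_c[OF S _ _ forms_mult[OF S _ _ g g1(1)]] by simp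
    ultimately show ?thesis unfolding h_def using add_closedD(3)[OF F] add_closed_minus[OF F] by metis
  qed
  have "a [^] Suc (Suc (e + d)) = a [^] Suc e \<otimes> a [^] Suc d"
    by (metis add_Suc add_Suc_right assms(2) nat_pow_mult)
  then have QP: "a [^] Suc (Suc (e + d)) \<ominus> c \<otimes> h = Q \<otimes> P"
    unfolding Q_def P_def h_def g1(2) by (simp add: ring_norm del: nat_pow_Suc)
  have "(Q \<otimes> P) \<otimes> m' = \<zero>" if "m' \<in> set (m # ms)" for m'
  proof (cases "m' = m")
    case True
    have "(Q \<otimes> P) \<otimes> m = Q \<otimes> (P \<otimes> m)" by (simp add: m_assoc)
    then show ?thesis using True Pm Qw by simp
  next
    case False
    then have m': "m' \<in> set ms" using that by auto
    then have [simp]: "m' \<in> carrier R" using ms by auto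
    have "(Q \<otimes> P) \<otimes> m' = P \<otimes> (Q \<otimes> m')" by (simp add: m_ac)
    then show ?thesis using kill m' unfolding Q_def by simp
  qed
  then have "\<forall>m'\<in>set (m # ms). (a [^] Suc (Suc (e + d)) \<ominus> c \<otimes> h) \<otimes> m' = \<zero>" unfolding QP by blast
  then show ?case using h by blast
qed

text \<open>Formally \<open>a / c\<close> is an endomorphism of the module spanned by
  \<open>ms\<close>, and it satisfies a monic equation, here cleared of denominators. The
  elimination starts in degree zero, with the entries of a matrix over \<open>S\<close>.\<close>

lemma hev_annihilator:
  assumes S: "subring S R" and [simp]: "a \<in> carrier R" "c \<in> carrier R"
    and ms: "set ms \<subseteq> carrier R"
    and "\<And>m. m \<in> set ms \<Longrightarrow> \<exists>w\<in>lspan R S ms. a \<otimes> m = c \<otimes> w"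
  obtains cs where "set cs \<subseteq> S" "\<forall>m\<in>set ms. hev R a c cs \<otimes> m = \<zero>"
proof -
  have "a [^] Suc 0 \<otimes> m \<in> lspan R ((\<otimes>) c ` forms R S a c 0) ms" if m: "m \<in> set ms" for m
  proof -
    obtain w where w: "w \<in> lspan R S ms" "a \<otimes> m = c \<otimes> w" using assms(5)[OF m] by blast
    have "c \<otimes> w \<in> lspan R ((\<otimes>) c ` forms R S a c 0) ms"
      by (rule lspan_scale[OF _ ms subringE(1)[OF S] _ w(1)]) auto
    then show ?thesis using w by simp
  qed
  then obtain e g where g: "g \<in> forms R S a c e" "\<forall>m\<in>set ms. (a [^] Suc e \<ominus> c \<otimes> g) \<otimes> m = \<zero>"
    using monic_annihilator[OF S _ _ ms] by (meson assms(2,3))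
  have [simp]: "g \<in> carrier R" using forms_carrier[OF S _ _ g(1)] by simp
  have "\<ominus> g \<in> forms R S a c e" using add_closedD(4)[OF forms_add_closed[OF S assms(2,3)]] g by blast
  then obtain cs where "set cs \<subseteq> S" "hev R a c cs = a [^] Suc e \<oplus> c \<otimes> (\<ominus> g)"
    using forms_eq_hev[OF S assms(2,3)] by blast
  moreover have "a [^] Suc e \<oplus> c \<otimes> (\<ominus> g) = a [^] Suc e \<ominus> c \<otimes> g" by (simp add: r_minus minus_eq)
  ultimately show ?thesis using that g by metis
qed

end

section \<open>Polynomials and interpolation\<close>

text \<open>Here and below, polynomials are coefficient lists with the constant coefficient first.\<close>

primrec pv :: "('a, 'm) ring_scheme \<Rightarrow> 'a list \<Rightarrow> 'a \<Rightarrow> 'a" where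
  "pv R [] x = \<zero>\<^bsub>R\<^esub>"
| "pv R (z # zs) x = z \<oplus>\<^bsub>R\<^esub> x \<otimes>\<^bsub>R\<^esub> pv R zs x"

text \<open>
  Synthetic division by \<open>T \<ominus> y\<close>: the head of the result is the remainder, the tail is the quotient.
\<close>

primrec sdiv :: "('a, 'm) ring_scheme \<Rightarrow> 'a \<Rightarrow> 'a list \<Rightarrow> 'a list" where
  "sdiv R y [] = []"
| "sdiv R y (z # zs) = pv R (z # zs) y # sdiv R y zs"

lemma length_sdiv [simp]: "length (sdiv R y zs) = length zs"
  by (induction zs) auto

section \<open>Integral closures of principal ideals are ideals\<close>

context cring
begin

text \<open>The generators of the power \<open>M\<close> of the ideal
  \<open>(a, b, c)\<close>.\<close>

definition monoms :: "'a \<Rightarrow> 'a \<Rightarrow> 'a \<Rightarrow> nat \<Rightarrow> 'a set" where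
  "monoms a b c M = {a [^] i \<otimes> b [^] j \<otimes> c [^] k | i j k. i + j + k = M}"

lemma monomsI: "i + j + k = M \<Longrightarrow> a [^] (i::nat) \<otimes> b [^] (j::nat) \<otimes> c [^] (k::nat) \<in> monoms a b c M"
  unfolding monoms_def by blast

lemma finite_monoms: "finite (monoms a b c M)"
proof -
  have "monoms a b c M \<subseteq> (\<lambda>(i, j, k). a [^] i \<otimes> b [^] j \<otimes> c [^] k) ` ({..M} \<times> {..M} \<times> {..M})"
  proof
    fix y assume "y \<in> monoms a b c M"
    then obtain i j k where "y = a [^] i \<otimes> b [^] j \<otimes> c [^] k" "i + j + k = M"
      unfolding monoms_def by blast
    then show "y \<in> (\<lambda>(i, j, k). a [^] i \<otimes> b [^] j \<otimes> c [^] k) ` ({..M} \<times> {..M} \<times> {..M})"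
      by (intro image_eqI[of _ _ "(i, j, k)"]) auto
  qed
  then show ?thesis using finite_subset by blast
qed

lemma forms_monoms:
  assumes S: "subring S R" and [simp]: "a \<in> carrier R" "c \<in> carrier R" "x \<in> carrier R"
    and J: "add_closed R J" "\<And>t y. t \<in> carrier R \<Longrightarrow> y \<in> J \<Longrightarrow> t \<otimes> y \<in> J"
    and "g \<in> forms R S a c n" "\<And>i k. i + k = n \<Longrightarrow> x \<otimes> (a [^] i \<otimes> c [^] k) \<in> J"
  shows "x \<otimes> g \<in> J"
  using assms(4,7,8)
proof (induction n arbitrary: g x)
  case 0
  then have [simp]: "g \<in> carrier R" "x \<in> carrier R" using subring_carrier[OF S] by auto
  have "x \<otimes> (a [^] (0::nat) \<otimes> c [^] (0::nat)) \<in> J" using 0(3)[of 0 0] by simp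
  then have "x \<in> J" by simp
  then show ?case using J(2)[of g x] by (simp add: m_comm)
next
  case (Suc n)
  obtain h k where *: "h \<in> forms R S a c n" "k \<in> S" "g = a \<otimes> h \<oplus> k \<otimes> c [^] Suc n" using Suc by auto
  then have [simp]: "h \<in> carrier R" "k \<in> carrier R" "x \<in> carrier R"
    using subring_carrier[OF S *(2)] forms_carrier[OF S assms(2,3) *(1)] Suc by auto
  have "x \<otimes> a \<otimes> h \<in> J"
  proof (rule Suc.IH[OF _ *(1)])
    fix i l assume "i + l = n"
    then have "x \<otimes> (a [^] Suc i \<otimes> c [^] l) \<in> J" using Suc.prems(3)[of "Suc i" l] by simp
    then show "x \<otimes> a \<otimes> (a [^] i \<otimes> c [^] l) \<in> J" by (simp add: m_ac)
  qed simp
  moreover have "k \<otimes> (x \<otimes> c [^] Suc n) \<in> J"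
    using J(2)[of k] Suc.prems(3)[of 0 "Suc n"] by simp
  ultimately have "x \<otimes> a \<otimes> h \<oplus> k \<otimes> (x \<otimes> c [^] Suc n) \<in> J" using add_closedD(3)[OF J(1)] by blast
  moreover have "x \<otimes> a \<otimes> h \<oplus> k \<otimes> (x \<otimes> c [^] Suc n) = x \<otimes> g" unfolding * by (simp add: ring_norm)
  ultimately show ?case by simp
qed

text \<open>Why the degree is \<open>n + m + 1\<close>: a monomial of this degree contains
  \<open>c\<close>, or at least \<open>a^n\<close>, or at least \<open>b^(m+1)\<close>. Multiplied
  by \<open>a\<close>, it has a factor \<open>c\<close> either directly or through one of the two
  integral equations.\<close>

lemma monoms_reduction:
  assumes S: "subring S R" and [simp]: "a \<in> carrier R" "b \<in> carrier R" "c \<in> carrier R"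
    and J: "add_closed R J" "\<And>t y. t \<in> carrier R \<Longrightarrow> y \<in> J \<Longrightarrow> t \<otimes> y \<in> J" "monoms a b c (Suc (n + m)) \<subseteq> J"
    and g: "g \<in> forms R S a c n" "a [^] Suc n = c \<otimes> g"
    and h: "h \<in> forms R S b c m" "b [^] Suc m = c \<otimes> h"
    and y: "y \<in> monoms a b c (Suc (n + m))"
  shows "\<exists>w\<in>J. a \<otimes> y = c \<otimes> w"
proof -
  have [simp]: "g \<in> carrier R" "h \<in> carrier R"
    using forms_carrier[OF S assms(2,4) g(1)] forms_carrier[OF S assms(3,4) h(1)] by auto
  obtain i j k where ijk: "y = a [^] i \<otimes> b [^] j \<otimes> c [^] k" "i + j + k = Suc (n + m)"
    using y unfolding monoms_def by blast
  consider l where "k = Suc l" | "k = 0" "i \<ge> n" | "k = 0" "i < n"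
    by (meson not0_implies_Suc not_le)
  then show ?thesis
  proof cases
    case 1
    have "a \<otimes> y = c \<otimes> (a [^] Suc i \<otimes> b [^] j \<otimes> c [^] l)" unfolding ijk 1 by (simp add: ring_norm)
    moreover have "a [^] Suc i \<otimes> b [^] j \<otimes> c [^] l \<in> J" using J(3) monomsI[of "Suc i" j l "Suc (n + m)"] ijk 1 by auto
    ultimately show ?thesis by blast
  next
    case 2
    have "Suc i = (i - n) + Suc n" using 2 by simp
    then have "a [^] Suc i = a [^] (i - n) \<otimes> a [^] Suc n" by (metis assms(2) nat_pow_mult)
    then have "a \<otimes> a [^] i = a [^] (i - n) \<otimes> (c \<otimes> g)" using g(2) by (simp add: m_comm)
    then have "a \<otimes> y = a [^] (i - n) \<otimes> (c \<otimes> g) \<otimes> b [^] j" unfolding ijk using 2 by (simp add: m_assoc[symmetric])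
    also have "\<dots> = c \<otimes> ((a [^] (i - n) \<otimes> b [^] j) \<otimes> g)" by (simp add: m_ac)
    finally have "a \<otimes> y = c \<otimes> ((a [^] (i - n) \<otimes> b [^] j) \<otimes> g)" .
    moreover have "(a [^] (i - n) \<otimes> b [^] j) \<otimes> g \<in> J"
    proof (rule forms_monoms[OF S _ _ _ J(1,2) g(1)])
      fix p q assume "p + q = n"
      then have "a [^] ((i - n) + p) \<otimes> b [^] j \<otimes> c [^] q \<in> J"
        using J(3) monomsI[of "(i - n) + p" j q "Suc (n + m)"] ijk 2 by auto
      then show "a [^] (i - n) \<otimes> b [^] j \<otimes> (a [^] p \<otimes> c [^] q) \<in> J"
        by (simp add: nat_pow_mult[symmetric] m_ac)
    qed auto
    ultimately show ?thesis by blast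
  next
    case 3
    have "j = (j - Suc m) + Suc m" using 3 ijk by simp
    then have "b [^] j = b [^] (j - Suc m) \<otimes> b [^] Suc m" by (metis assms(3) nat_pow_mult)
    then have bj: "b [^] j = b [^] (j - Suc m) \<otimes> (c \<otimes> h)" using h(2) by simp
    have "a \<otimes> y = a [^] Suc i \<otimes> b [^] j" unfolding ijk using 3 by (simp add: m_ac)
    also have "\<dots> = c \<otimes> ((a [^] Suc i \<otimes> b [^] (j - Suc m)) \<otimes> h)" unfolding bj by (simp add: m_ac)
    finally have "a \<otimes> y = c \<otimes> ((a [^] Suc i \<otimes> b [^] (j - Suc m)) \<otimes> h)" .
    moreover have "(a [^] Suc i \<otimes> b [^] (j - Suc m)) \<otimes> h \<in> J"
    proof (rule forms_monoms[OF S _ _ _ J(1,2) h(1)])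
      fix p q assume "p + q = m"
      then have "a [^] Suc i \<otimes> b [^] ((j - Suc m) + p) \<otimes> c [^] q \<in> J"
        using J(3) monomsI[of "Suc i" "(j - Suc m) + p" q "Suc (n + m)"] ijk 3 by auto
      then show "a [^] Suc i \<otimes> b [^] (j - Suc m) \<otimes> (b [^] p \<otimes> c [^] q) \<in> J"
        by (simp add: nat_pow_mult[symmetric] m_ac)
    qed auto
    ultimately show ?thesis by blast
  qed
qed

lemma monoms_swap: "a \<in> carrier R \<Longrightarrow> b \<in> carrier R \<Longrightarrow> monoms a b c M = monoms b a c M"
proof -
  have "monoms a b c M \<subseteq> monoms b a c M" if [simp]: "a \<in> carrier R" "b \<in> carrier R" for a b
  proof
    fix y assume "y \<in> monoms a b c M"
    then obtain i j k where "y = a [^] i \<otimes> b [^] j \<otimes> c [^] k" "i + j + k = M" unfolding monoms_def by blast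
    then have "y = b [^] j \<otimes> a [^] i \<otimes> c [^] k" "j + i + k = M" by (simp_all add: m_comm)
    then show "y \<in> monoms b a c M" unfolding monoms_def by blast
  qed
  then show "a \<in> carrier R \<Longrightarrow> b \<in> carrier R \<Longrightarrow> monoms a b c M = monoms b a c M" by blast
qed

text \<open>
  If \<open>a\<close> and \<open>b\<close> are integral over the ideal \<open>(c)\<close>, then a high power \<open>J\<close> of \<open>(a, b, c)\<close> satisfies
  \<open>aJ \<subseteq> cJ\<close> and \<open>bJ \<subseteq> cJ\<close>.
\<close>

lemma dep_combination:
  assumes [simp]: "a \<in> carrier R" "b \<in> carrier R" "c \<in> carrier R" "t \<in> carrier R" "u \<in> carrier R"
    and a: "dep R (carrier R) a c" and b: "dep R (carrier R) b c"
  shows "dep R (carrier R) (t \<otimes> a \<oplus> u \<otimes> b) c"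
\<comment> \<open>In the zero ring the empty list is an equation; elsewhere an equation has positive
  degree.\<close>
proof (cases "\<one> = \<zero>")
  case True
  then have "hev R (t \<otimes> a \<oplus> u \<otimes> b) c [] = \<zero>" by simp
  then show ?thesis unfolding dep_def by (intro exI[of _ "[]"]) auto
next
  case False
  note S = carrier_is_subring
  have *: "\<exists>n. \<exists>g\<in>forms R (carrier R) a c n. a [^] Suc n = c \<otimes> g"
    if [simp]: "a \<in> carrier R" and a: "dep R (carrier R) a c" for a
  proof -
    obtain cs where cs: "set cs \<subseteq> carrier R" "hev R a c cs = \<zero>" using a unfolding dep_def by blast
    with False obtain n where "length cs = Suc n" by (cases cs) auto
    then obtain g where g: "g \<in> forms R (carrier R) a c n" "\<zero> = a [^] Suc n \<oplus> c \<otimes> g"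
      using hev_eq_forms[OF S, of a c cs n] cs by auto
    have [simp]: "g \<in> carrier R" using forms_carrier[OF S _ _ g(1)] by simp
    have "a [^] Suc n = \<ominus> (c \<otimes> g)" using g(2) by (metis \<open>g \<in> carrier R\<close> assms(3) m_closed minus_equality minus_minus nat_pow_closed that(1))
    then have "a [^] Suc n = c \<otimes> (\<ominus> g)" by (simp add: r_minus)
    then show ?thesis using add_closedD(4)[OF forms_add_closed[OF S that(1) assms(3)] g(1)] by blast
  qed
  obtain n g where g: "g \<in> forms R (carrier R) a c n" "a [^] Suc n = c \<otimes> g" using *[OF assms(1) a] by blast
  obtain m h where h: "h \<in> forms R (carrier R) b c m" "b [^] Suc m = c \<otimes> h" using *[OF assms(2) b] by blast
  define M where "M = Suc (n + m)"
  obtain ms where ms: "set ms = monoms a b c M" using finite_list[OF finite_monoms[of a b c M]] by blast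
  have msc: "set ms \<subseteq> carrier R" unfolding ms monoms_def by auto
  define J where "J = lspan R (carrier R) ms"
  have J: "add_closed R J" unfolding J_def using lspan_add_closed[OF subring_add_closed[OF S] msc] .
  have J2: "t \<otimes> y \<in> J" if "t \<in> carrier R" "y \<in> J" for t y
    using lspan_scale[of t ms "carrier R" "carrier R" y] that msc unfolding J_def by auto
  have J3: "monoms a b c M \<subseteq> J" unfolding J_def using lspan_base[OF S msc] ms by blast
  define \<alpha> where "\<alpha> = t \<otimes> a \<oplus> u \<otimes> b"
  have [simp]: "\<alpha> \<in> carrier R" unfolding \<alpha>_def by simp
  have "\<exists>w\<in>lspan R (carrier R) ms. \<alpha> \<otimes> y = c \<otimes> w" if y: "y \<in> set ms" for y
  proof -
    have [simp]: "y \<in> carrier R" using y msc by auto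
    have "\<exists>w\<in>J. a \<otimes> y = c \<otimes> w"
      by (rule monoms_reduction[OF S _ _ _ J J2 _ g h]) (use J3 y ms in \<open>auto simp: M_def\<close>)
    then obtain w where w: "w \<in> J" "a \<otimes> y = c \<otimes> w" by blast
    have "y \<in> monoms b a c (Suc (m + n))" "monoms b a c (Suc (m + n)) \<subseteq> J"
      using y ms J3 monoms_swap[of a b c M] unfolding M_def by (auto simp: add.commute)
    then have "\<exists>w\<in>J. b \<otimes> y = c \<otimes> w"
      by (intro monoms_reduction[OF S _ _ _ J J2 _ h g]) auto
    then obtain z where z: "z \<in> J" "b \<otimes> y = c \<otimes> z" by blast
    have [simp]: "w \<in> carrier R" "z \<in> carrier R" using add_closedD(5)[OF J] w z by auto
    have "\<alpha> \<otimes> y = t \<otimes> (a \<otimes> y) \<oplus> u \<otimes> (b \<otimes> y)" unfolding \<alpha>_def by (simp add: ring_norm)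
    also have "\<dots> = c \<otimes> (t \<otimes> w \<oplus> u \<otimes> z)" unfolding w z by (simp add: ring_norm)
    finally have "\<alpha> \<otimes> y = c \<otimes> (t \<otimes> w \<oplus> u \<otimes> z)" .
    moreover have "t \<otimes> w \<oplus> u \<otimes> z \<in> J" using add_closedD(3)[OF J] J2 w z by auto
    ultimately show ?thesis unfolding J_def by blast
  qed
  then obtain cs where cs: "set cs \<subseteq> carrier R" "\<forall>m\<in>set ms. hev R \<alpha> c cs \<otimes> m = \<zero>"
    using hev_annihilator[OF S _ _ msc, of \<alpha> c] by auto
  have "J \<subseteq> {y \<in> carrier R. hev R \<alpha> c cs \<otimes> y = \<zero>}"
    unfolding J_def
  proof (rule lspan_subset)
    show "add_closed R {y \<in> carrier R. hev R \<alpha> c cs \<otimes> y = \<zero>}"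
      unfolding add_closed_def using cs(1) by (auto simp: r_distr r_minus)
    show "t \<otimes> m \<in> {y \<in> carrier R. hev R \<alpha> c cs \<otimes> y = \<zero>}" if "t \<in> carrier R" "m \<in> set ms" for t m
    proof -
      have [simp]: "t \<in> carrier R" "m \<in> carrier R" "hev R \<alpha> c cs \<in> carrier R" using that msc cs by auto
      have "hev R \<alpha> c cs \<otimes> (t \<otimes> m) = t \<otimes> (hev R \<alpha> c cs \<otimes> m)" by (simp add: m_ac)
      then show ?thesis using cs that by simp
    qed
  qed
  \<comment> \<open>The module \<open>J\<close> need not be faithful, so
    \<open>hev R \<alpha> c cs\<close>, which annihilates it, may be nonzero. But
    \<open>\<alpha>^M\<close> expands into monomials and lies in \<open>J\<close>, and shifting the
    equation by \<open>M\<close> zero coefficients repairs this.\<close>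
  moreover have "\<alpha> [^] M \<in> J"
  proof -
    have "x \<otimes> \<alpha> [^] k \<in> J" if "x \<in> carrier R" "\<And>i j. i + j = k \<Longrightarrow> x \<otimes> (a [^] i \<otimes> b [^] j) \<in> J" for x and k :: nat
      using that
    proof (induction k arbitrary: x)
      case 0
      show ?case using 0(2)[of 0 0] 0(1) by simp
    next
      case (Suc k)
      have [simp]: "x \<in> carrier R" using Suc by simp
      have "(x \<otimes> (t \<otimes> a)) \<otimes> \<alpha> [^] k \<in> J"
      proof (rule Suc.IH)
        fix i j assume "i + j = k"
        then have "x \<otimes> (a [^] Suc i \<otimes> b [^] j) \<in> J" using Suc.prems(2)[of "Suc i" j] by simp
        then have "t \<otimes> (x \<otimes> (a [^] Suc i \<otimes> b [^] j)) \<in> J" by (rule J2[rotated]) simp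
        then show "x \<otimes> (t \<otimes> a) \<otimes> (a [^] i \<otimes> b [^] j) \<in> J" by (simp add: m_ac)
      qed simp
      moreover have "(x \<otimes> (u \<otimes> b)) \<otimes> \<alpha> [^] k \<in> J"
      proof (rule Suc.IH)
        fix i j assume "i + j = k"
        then have "x \<otimes> (a [^] i \<otimes> b [^] Suc j) \<in> J" using Suc.prems(2)[of i "Suc j"] by simp
        then have "u \<otimes> (x \<otimes> (a [^] i \<otimes> b [^] Suc j)) \<in> J" by (rule J2[rotated]) simp
        then show "x \<otimes> (u \<otimes> b) \<otimes> (a [^] i \<otimes> b [^] j) \<in> J" by (simp add: m_ac)
      qed simp
      ultimately have "(x \<otimes> (t \<otimes> a)) \<otimes> \<alpha> [^] k \<oplus> (x \<otimes> (u \<otimes> b)) \<otimes> \<alpha> [^] k \<in> J"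
        using add_closedD(3)[OF J] by blast
      moreover have "x \<otimes> \<alpha> [^] Suc k = (x \<otimes> (t \<otimes> a)) \<otimes> \<alpha> [^] k \<oplus> (x \<otimes> (u \<otimes> b)) \<otimes> \<alpha> [^] k"
      proof -
        have "x \<otimes> \<alpha> [^] Suc k = x \<otimes> (\<alpha> [^] k \<otimes> (t \<otimes> a \<oplus> u \<otimes> b))" by (simp add: \<alpha>_def)
        then show ?thesis by (simp add: ring_norm)
      qed
      ultimately show ?case by metis
    qed
    from this[of \<one> M] show ?thesis using J3 monomsI[of _ _ 0 M a b c] by (auto simp: subset_iff)
  qed
  ultimately have "hev R \<alpha> c cs \<otimes> \<alpha> [^] M = \<zero>" by blast
  then have "hev R \<alpha> c (replicate M \<zero> @ cs) = \<zero>"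
    using cs(1) by (simp add: hev_replicate m_comm)
  moreover have "set (replicate M \<zero> @ cs) \<subseteq> carrier R" using cs(1) by auto
  ultimately show ?thesis unfolding dep_def \<alpha>_def by blast
qed

section \<open>Synthetic division and interpolation\<close>

lemma pv_closed [simp]: "set zs \<subseteq> carrier R \<Longrightarrow> x \<in> carrier R \<Longrightarrow> pv R zs x \<in> carrier R"
  by (induction zs) auto

lemma pv_sdiv:
  assumes [simp]: "x \<in> carrier R" "y \<in> carrier R" "z \<in> carrier R" and "set zs \<subseteq> carrier R"
  shows "pv R (z # zs) x = pv R (z # zs) y \<oplus> (x \<ominus> y) \<otimes> pv R (sdiv R y zs) x"
  using assms(3,4)
proof (induction zs arbitrary: z)
  case (Cons w ws)
  then have [simp]: "w \<in> carrier R" "z \<in> carrier R" "set ws \<subseteq> carrier R" by auto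
  have [simp]: "set (sdiv R y ws) \<subseteq> carrier R"
    using \<open>set ws \<subseteq> carrier R\<close> by (induction ws) auto
  have "pv R (z # w # ws) x = z \<oplus> x \<otimes> pv R (w # ws) x" by simp
  also have "pv R (w # ws) x = pv R (w # ws) y \<oplus> (x \<ominus> y) \<otimes> pv R (sdiv R y ws) x"
    by (rule Cons.IH) auto
  also have "z \<oplus> x \<otimes> (pv R (w # ws) y \<oplus> (x \<ominus> y) \<otimes> pv R (sdiv R y ws) x)
     = z \<oplus> y \<otimes> pv R (w # ws) y \<oplus> (x \<ominus> y) \<otimes> (pv R (w # ws) y \<oplus> x \<otimes> pv R (sdiv R y ws) x)"
    by (simp add: ring_norm del: pv.simps)
  finally show ?case by simp
qed simp

lemma sdiv_carrier: "y \<in> carrier R \<Longrightarrow> set zs \<subseteq> carrier R \<Longrightarrow> set (sdiv R y zs) \<subseteq> carrier R"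
  by (induction zs) auto

text \<open>Synthetic division is a unitriangular transformation of coefficient lists, so it
  reflects membership in an ideal.\<close>

lemma set_subset_of_sdiv:
  assumes I: "add_closed R I" "\<And>t y. t \<in> carrier R \<Longrightarrow> y \<in> I \<Longrightarrow> t \<otimes> y \<in> I"
    and [simp]: "y \<in> carrier R" and "set zs \<subseteq> carrier R" "set (sdiv R y zs) \<subseteq> I"
  shows "set zs \<subseteq> I"
  using assms(4,5)
proof (induction zs)
  case (Cons w ws)
  then have ws: "set ws \<subseteq> I" and [simp]: "w \<in> carrier R" "set ws \<subseteq> carrier R" by auto
  have "pv R ws y \<in> I"
    using ws by (induction ws) (use add_closedD[OF I(1)] I(2) in auto)
  then have "y \<otimes> pv R ws y \<in> I" using I(2) by simp
  moreover have "w \<oplus> y \<otimes> pv R ws y \<in> I" using Cons by simp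
  ultimately have "(w \<oplus> y \<otimes> pv R ws y) \<ominus> y \<otimes> pv R ws y \<in> I" using add_closed_minus[OF I(1)] by blast
  moreover have "(w \<oplus> y \<otimes> pv R ws y) \<ominus> y \<otimes> pv R ws y = w" by (simp add: minus_eq a_assoc r_neg)
  ultimately show ?case using ws by simp
qed simp

text \<open>The Vandermonde matrix of \<open>Y\<close> is invertible because the differences are
  units. Instead of inverting it, one point is removed at a time: the quotient by
  \<open>T - y\<close> has one coefficient fewer and takes values in \<open>I\<close> at the
  remaining points.\<close>

lemma interpolation:
  assumes I: "add_closed R I" "\<And>t y. t \<in> carrier R \<Longrightarrow> y \<in> I \<Longrightarrow> t \<otimes> y \<in> I"
    and "finite Y" "Y \<subseteq> carrier R" "card Y = length zs" "set zs \<subseteq> carrier R"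
    and "\<And>y y'. y \<in> Y \<Longrightarrow> y' \<in> Y \<Longrightarrow> y \<noteq> y' \<Longrightarrow> y \<ominus> y' \<in> Units R"
    and "\<And>y. y \<in> Y \<Longrightarrow> pv R zs y \<in> I"
  shows "set zs \<subseteq> I"
  using assms(3-)
proof (induction "length zs" arbitrary: zs Y)
  case (Suc n)
  then obtain z ws where zs: "zs = z # ws" by (cases zs) auto
  then have [simp]: "z \<in> carrier R" "set ws \<subseteq> carrier R" using Suc by auto
  obtain y where y: "y \<in> Y" using Suc by fastforce
  then have [simp]: "y \<in> carrier R" using Suc by auto
  have py: "pv R zs y \<in> I" using Suc y by auto
  have "set (sdiv R y ws) \<subseteq> I"
  proof (rule Suc.hyps(1)[of _ "Y - {y}"])
    show "n = length (sdiv R y ws)" using Suc.hyps(2) zs by simp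
    show "card (Y - {y}) = length (sdiv R y ws)" using Suc zs y by simp
    show "pv R (sdiv R y ws) y' \<in> I" if y': "y' \<in> Y - {y}" for y'
    proof -
      have [simp]: "y' \<in> carrier R" "pv R (sdiv R y ws) y' \<in> carrier R"
        using y' Suc sdiv_carrier[of y ws] by auto
      have U: "y' \<ominus> y \<in> Units R" using Suc.prems(5) y y' by auto
      have [simp]: "pv R zs y \<in> carrier R" "y' \<ominus> y \<in> carrier R" "inv (y' \<ominus> y) \<in> carrier R"
        using Suc.prems zs U by (simp_all del: pv.simps)
      have "pv R zs y' = pv R zs y \<oplus> (y' \<ominus> y) \<otimes> pv R (sdiv R y ws) y'"
        unfolding zs by (rule pv_sdiv) auto
      then have "pv R zs y' \<ominus> pv R zs y = (y' \<ominus> y) \<otimes> pv R (sdiv R y ws) y'"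
        using \<open>pv R zs y \<in> carrier R\<close> \<open>y' \<ominus> y \<in> carrier R\<close> \<open>pv R (sdiv R y ws) y' \<in> carrier R\<close>
        by (metis a_comm m_closed minus_eq r_neg2 a_assoc a_inv_closed)
      then have "(y' \<ominus> y) \<otimes> pv R (sdiv R y ws) y' \<in> I"
        using add_closed_minus[OF I(1) Suc.prems(6)[of y'] py] y' by simp
      then have "inv (y' \<ominus> y) \<otimes> ((y' \<ominus> y) \<otimes> pv R (sdiv R y ws) y') \<in> I" using I(2) by simp
      moreover have "inv (y' \<ominus> y) \<otimes> ((y' \<ominus> y) \<otimes> pv R (sdiv R y ws) y') = pv R (sdiv R y ws) y'"
        using U by (simp add: m_assoc[symmetric])
      ultimately show ?thesis by simp
    qed
  qed (use Suc sdiv_carrier in auto)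
  then have ws: "set ws \<subseteq> I" using set_subset_of_sdiv[OF I, of y ws] by auto
  have "pv R ws y \<in> I"
    using ws \<open>set ws \<subseteq> carrier R\<close> by (induction ws) (use add_closedD[OF I(1)] I(2) in auto)
  then have "y \<otimes> pv R ws y \<in> I" using I(2) by simp
  with py have "(z \<oplus> y \<otimes> pv R ws y) \<ominus> y \<otimes> pv R ws y \<in> I" using add_closed_minus[OF I(1)] zs by simp
  moreover have "(z \<oplus> y \<otimes> pv R ws y) \<ominus> y \<otimes> pv R ws y = z" by (simp add: minus_eq a_assoc r_neg)
  ultimately show ?case using ws zs by simp
qed simp

end

section \<open>Specializations\<close>

text \<open>Coefficient lists are quantified away, so that sums, products and \<open>hev\<close> of
  polynomials need no formula for their coefficients.\<close>

definition polyfun :: "('a, 'm) ring_scheme \<Rightarrow> 'a set \<Rightarrow> ('a \<Rightarrow> 'a) \<Rightarrow> bool" where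
  "polyfun R C f \<longleftrightarrow> (\<exists>vs. set vs \<subseteq> C \<and> (\<forall>T\<in>carrier R. pv R vs T = f T))"

definition pimage :: "('a, 'm) ring_scheme \<Rightarrow> 'a set \<Rightarrow> 'a \<Rightarrow> 'a set" where
  "pimage R C x = {pv R zs x | zs. set zs \<subseteq> C}"

text \<open>\<open>x \<mapsto> y\<close> extends to a homomorphism of \<open>C\<close>-algebras defined on \<open>C[x]\<close>.\<close>

definition specialization :: "('a, 'm) ring_scheme \<Rightarrow> 'a set \<Rightarrow> 'a \<Rightarrow> 'a \<Rightarrow> bool" where
  "specialization R C x y \<longleftrightarrow> y \<in> carrier R \<and>
     (\<forall>zs. set zs \<subseteq> C \<longrightarrow> pv R zs x = \<zero>\<^bsub>R\<^esub> \<longrightarrow> pv R zs y = \<zero>\<^bsub>R\<^esub>)"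

text \<open>The condition under which values at the points of \<open>Y\<close> determine
  coefficients; distinctness alone is not enough in a ring with zero divisors.\<close>

definition separated :: "('a, 'm) ring_scheme \<Rightarrow> 'a set \<Rightarrow> bool" where
  "separated R Y \<longleftrightarrow> finite Y \<and> (\<forall>y\<in>Y. \<forall>y'\<in>Y. y \<noteq> y' \<longrightarrow> y \<ominus>\<^bsub>R\<^esub> y' \<in> Units R)"

context cring
begin

lemma polyfunD: "polyfun R C f \<Longrightarrow> \<exists>vs. set vs \<subseteq> C \<and> (\<forall>T\<in>carrier R. pv R vs T = f T)"
  by (simp add: polyfun_def)

lemma polyfun_pv: "set zs \<subseteq> C \<Longrightarrow> polyfun R C (pv R zs)"
  by (auto simp: polyfun_def)

lemma polyfun_cong: "polyfun R C f \<Longrightarrow> (\<And>T. T \<in> carrier R \<Longrightarrow> f T = g T) \<Longrightarrow> polyfun R C g"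
  by (auto simp: polyfun_def)

lemma polyfun_const:
  assumes "C \<subseteq> carrier R" "c \<in> C" shows "polyfun R C (\<lambda>T. c)"
  unfolding polyfun_def using assms by (intro exI[of _ "[c]"]) auto

lemma polyfun_shift:
  assumes "subring C R" "polyfun R C f"
  shows "polyfun R C (\<lambda>T. T \<otimes> f T)"
proof -
  obtain vs where vs: "set vs \<subseteq> C" "\<forall>T\<in>carrier R. pv R vs T = f T" using assms polyfunD by blast
  moreover have "\<forall>T\<in>carrier R. pv R (\<zero> # vs) T = T \<otimes> f T"
    using vs subringE(1)[OF assms(1)] by (metis m_closed pv.simps(2) pv_closed subset_trans l_zero)
  ultimately show ?thesis unfolding polyfun_def using subringE(2)[OF assms(1)]
    by (intro exI[of _ "\<zero> # vs"]) auto
qed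

lemma polyfun_smult:
  assumes C: "subring C R" and "polyfun R C f" "c \<in> C"
  shows "polyfun R C (\<lambda>T. c \<otimes> f T)"
proof -
  obtain vs where vs: "set vs \<subseteq> C" "\<forall>T\<in>carrier R. pv R vs T = f T" using assms polyfunD by blast
  have [simp]: "c \<in> carrier R" using assms subring_carrier by blast
  have "pv R (map ((\<otimes>) c) zs) T = c \<otimes> pv R zs T" if "set zs \<subseteq> C" and [simp]: "T \<in> carrier R" for zs T
    using that(1)
  proof (induction zs)
    case (Cons z zs)
    then have [simp]: "z \<in> carrier R" "set zs \<subseteq> carrier R" using subringE(1)[OF C] by auto
    show ?case using Cons by (simp add: r_distr m_lcomm)
  qed simp
  moreover have "set (map ((\<otimes>) c) vs) \<subseteq> C" using vs(1) subringE(6)[OF C \<open>c \<in> C\<close>] by auto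
  ultimately show ?thesis unfolding polyfun_def using vs
    by (intro exI[of _ "map ((\<otimes>) c) vs"]) auto
qed

lemma pv_add_ex:
  assumes C: "subring C R"
  shows "set ws \<subseteq> C \<Longrightarrow> set us \<subseteq> C \<Longrightarrow>
    \<exists>vs. set vs \<subseteq> C \<and> length vs = max (length ws) (length us) \<and> (\<forall>T\<in>carrier R. pv R vs T = pv R ws T \<oplus> pv R us T)"
proof (induction ws arbitrary: us)
  case Nil
  then have "set us \<subseteq> carrier R" using subringE(1)[OF C] by blast
  then show ?case using Nil by (intro exI[of _ us]) auto
next
  case (Cons w ws)
  show ?case
  proof (cases us)
    case Nil
    have "set (w # ws) \<subseteq> carrier R" using subringE(1)[OF C] Cons by blast
    then show ?thesis using Nil Cons.prems by (intro exI[of _ "w # ws"]) auto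
  next
    case u: (Cons u us')
    have c: "set ws \<subseteq> C" "set us' \<subseteq> C" "w \<in> C" "u \<in> C" using u Cons.prems by auto
    then obtain vs where vs: "set vs \<subseteq> C" "length vs = max (length ws) (length us')"
      "\<forall>T\<in>carrier R. pv R vs T = pv R ws T \<oplus> pv R us' T" using Cons.IH by blast
    have cc [simp]: "set ws \<subseteq> carrier R" "set us' \<subseteq> carrier R" "w \<in> carrier R" "u \<in> carrier R"
      using c subringE(1)[OF C] by auto
    have "pv R ((w \<oplus> u) # vs) T = pv R (w # ws) T \<oplus> pv R us T" if [simp]: "T \<in> carrier R" for T
      using vs u by (simp add: r_distr a_ac)
    moreover have "w \<oplus> u \<in> C" using c subringE(7)[OF C] by blast
    ultimately show ?thesis using vs u by (intro exI[of _ "(w \<oplus> u) # vs"]) auto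
  qed
qed

lemma polyfun_add:
  assumes C: "subring C R" and "polyfun R C f" "polyfun R C g"
  shows "polyfun R C (\<lambda>T. f T \<oplus> g T)"
proof -
  obtain ws where ws: "set ws \<subseteq> C" "\<forall>T\<in>carrier R. pv R ws T = f T" using assms polyfunD by blast
  obtain us where us: "set us \<subseteq> C" "\<forall>T\<in>carrier R. pv R us T = g T" using assms polyfunD by blast
  obtain vs where "set vs \<subseteq> C" "\<forall>T\<in>carrier R. pv R vs T = pv R ws T \<oplus> pv R us T"
    using pv_add_ex[OF C ws(1) us(1)] by blast
  then show ?thesis unfolding polyfun_def using ws us by (intro exI[of _ vs]) auto
qed

lemma polyfun_mult:
  assumes C: "subring C R" and "polyfun R C f" "polyfun R C g"
  shows "polyfun R C (\<lambda>T. f T \<otimes> g T)"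
proof -
  obtain ws where ws: "set ws \<subseteq> C" "\<forall>T\<in>carrier R. pv R ws T = f T" using assms polyfunD by blast
  have "polyfun R C (\<lambda>T. pv R ws T \<otimes> g T)"
    using ws(1)
  proof (induction ws)
    case Nil
    have *: "polyfun R C (\<lambda>T. \<zero> \<otimes> g T)" using polyfun_smult[OF C assms(3) subringE(2)[OF C]] .
    show ?case by (rule polyfun_cong[OF *]) simp
  next
    case (Cons w ws)
    have g: "g T \<in> carrier R" if "T \<in> carrier R" for T
      using assms(3) subringE(1)[OF C] that unfolding polyfun_def by (metis pv_closed subset_trans)
    have *: "polyfun R C (\<lambda>T. w \<otimes> g T \<oplus> T \<otimes> (pv R ws T \<otimes> g T))"
      using Cons by (intro polyfun_add[OF C] polyfun_smult[OF C assms(3)] polyfun_shift[OF C]) auto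
    have "set ws \<subseteq> carrier R" "w \<in> carrier R" using Cons subringE(1)[OF C] by auto
    then show ?case by (intro polyfun_cong[OF *]) (simp add: g l_distr m_assoc)
  qed
  then show ?thesis by (rule polyfun_cong) (use ws in auto)
qed

lemma polyfun_hev:
  assumes C: "subring C R" and "polyfun R C f" "c \<in> C" "\<forall>g\<in>set gs. polyfun R C g"
  shows "polyfun R C (\<lambda>T. hev R (f T) c (map (\<lambda>g. g T) gs))"
  using assms(4)
proof (induction gs)
  case Nil
  then show ?case using polyfun_const[OF subringE(1)[OF C] subringE(3)[OF C]] by simp
next
  case (Cons g gs)
  then show ?case
    using assms(2,3) subringE(6)[OF C subring_pow[OF C \<open>c \<in> C\<close>, of "length gs"] \<open>c \<in> C\<close>]
    by (auto intro!: polyfun_add[OF C] polyfun_mult[OF C] polyfun_const[OF subringE(1)[OF C]])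
qed

lemma pimageI: "polyfun R C f \<Longrightarrow> x \<in> carrier R \<Longrightarrow> f x \<in> pimage R C x"
  unfolding polyfun_def pimage_def by force

lemma pimage_obtain:
  assumes "z \<in> pimage R C x" obtains zs where "set zs \<subseteq> C" "z = pv R zs x"
  using assms unfolding pimage_def by blast

lemma pimage_subring:
  assumes C: "subring C R" and x: "x \<in> carrier R"
  shows "subring (pimage R C x) R"
proof (rule subringI)
  show "pimage R C x \<subseteq> carrier R" unfolding pimage_def using x subringE(1)[OF C] by auto
  show "\<one> \<in> pimage R C x" using pimageI[OF polyfun_const[OF subringE(1)[OF C] subringE(3)[OF C]] x] .
  fix z assume "z \<in> pimage R C x"
  then obtain zs where zs: "set zs \<subseteq> C" "z = pv R zs x" using pimage_obtain by blast
  have zc: "z \<in> carrier R" using zs x subringE(1)[OF C] by auto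
  have "\<ominus> \<one> \<in> C" using subringE(3,5)[OF C] by blast
  from pimageI[OF polyfun_smult[OF C polyfun_pv[OF zs(1)] this] x]
  show "\<ominus> z \<in> pimage R C x" using zs zc by (simp add: l_minus)
  fix w assume "w \<in> pimage R C x"
  then obtain ws where ws: "set ws \<subseteq> C" "w = pv R ws x" using pimage_obtain by blast
  show "z \<otimes> w \<in> pimage R C x"
    using pimageI[OF polyfun_mult[OF C polyfun_pv[OF zs(1)] polyfun_pv[OF ws(1)]] x] zs ws by simp
  show "z \<oplus> w \<in> pimage R C x"
    using pimageI[OF polyfun_add[OF C polyfun_pv[OF zs(1)] polyfun_pv[OF ws(1)]] x] zs ws by simp
qed

lemma pimage_base: "subring C R \<Longrightarrow> x \<in> carrier R \<Longrightarrow> C \<subseteq> pimage R C x"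
  using pimageI[OF polyfun_const[OF subringE(1)]] by blast

lemma pimage_self:
  assumes "subring C R" "x \<in> carrier R" shows "x \<in> pimage R C x"
  using pimageI[OF polyfun_shift[OF assms(1) polyfun_const[OF subringE(1)[OF assms(1)] subringE(3)[OF assms(1)]]] assms(2)] assms by simp

text \<open>
  The conjugates of an integral element, or the values of a polynomial that is integral, are integral
  over \<open>(c)\<close>; the coefficients are linear combinations of them, and the retraction \<open>\<rho>\<close> brings the
  equation back to \<open>C\<close>.
\<close>

lemma dep_coefficients:
  assumes C: "subring C R" and x: "x \<in> carrier R"
    and \<rho>: "\<And>a. a \<in> carrier R \<Longrightarrow> \<rho> a \<in> C" "\<rho> \<one> = \<one>"
      "\<And>a b. a \<in> carrier R \<Longrightarrow> b \<in> carrier R \<Longrightarrow> \<rho> (a \<oplus> b) = \<rho> a \<oplus> \<rho> b"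
      "\<And>c a. c \<in> C \<Longrightarrow> a \<in> carrier R \<Longrightarrow> \<rho> (c \<otimes> a) = c \<otimes> \<rho> a"
    and Y: "separated R Y" "card Y = length zs" "\<And>y. y \<in> Y \<Longrightarrow> specialization R C x y"
    and zs: "set zs \<subseteq> C" and c: "c \<in> C" and dep: "dep R (pimage R C x) (pv R zs x) c" and w: "w \<in> set zs"
  shows "dep R C w c"
proof -
  have [simp]: "c \<in> carrier R" using c subring_carrier[OF C] by blast
  have zsc: "set zs \<subseteq> carrier R" using zs subringE(1)[OF C] by blast
  obtain cs where cs: "set cs \<subseteq> pimage R C x" "hev R (pv R zs x) c cs = \<zero>" using dep unfolding dep_def by blast
  have "\<forall>d\<in>set cs. \<exists>ds. set ds \<subseteq> C \<and> d = pv R ds x" using cs(1) unfolding pimage_def by blast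
  then obtain D where D: "\<And>d. d \<in> set cs \<Longrightarrow> set (D d) \<subseteq> C \<and> d = pv R (D d) x" by metis
  define gs where "gs = map (\<lambda>d. pv R (D d)) cs"
  have gs: "\<forall>g\<in>set gs. polyfun R C g" unfolding gs_def using D polyfun_pv by auto
  have "map (\<lambda>g. g x) gs = cs" unfolding gs_def using D by (simp add: map_idI)
  then have hx: "hev R (pv R zs x) c (map (\<lambda>g. g x) gs) = \<zero>" using cs by simp
  \<comment> \<open>The coefficients of the equation are themselves polynomials in \<open>x\<close>.
    Written as a single polynomial over \<open>C\<close> that vanishes at \<open>x\<close>, the
    equation passes to every specialization \<open>y\<close>.\<close>
  obtain us where us: "set us \<subseteq> C" "\<forall>T\<in>carrier R. pv R us T = hev R (pv R zs T) c (map (\<lambda>g. g T) gs)"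
    using polyfunD[OF polyfun_hev[OF C polyfun_pv[OF zs] c gs]] by blast
  \<comment> \<open>The integral closure of the ideal \<open>(c)\<close> in the whole ring
    \<open>R\<close>; it is an ideal, so interpolation applies.\<close>
  define I where "I = {z \<in> carrier R. dep R (carrier R) z c}"
  have comb: "t \<otimes> a \<oplus> u \<otimes> b \<in> I" if "a \<in> I" "b \<in> I" "t \<in> carrier R" "u \<in> carrier R" for a b t u
    using that dep_combination[of a b c t u] unfolding I_def by auto
  have "hev R \<zero> c [\<zero>] = \<zero>" by simp
  then have 0: "\<zero> \<in> I" unfolding I_def dep_def by (auto intro!: exI[of _ "[\<zero>]"])
  have Ic: "I \<subseteq> carrier R" unfolding I_def by blast
  have I2: "t \<otimes> y \<in> I" if "t \<in> carrier R" "y \<in> I" for t y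
    using comb[OF that(2) 0 that(1) zero_closed] that Ic by (auto simp: subset_iff)
  have I1: "add_closed R I"
    unfolding add_closed_def
  proof (intro conjI ballI)
    fix a b assume ab: "a \<in> I" "b \<in> I"
    then have [simp]: "a \<in> carrier R" "b \<in> carrier R" using Ic by auto
    show "a \<oplus> b \<in> I" using comb[OF ab, of \<one> \<one>] by simp
    show "\<ominus> a \<in> I" using I2[OF _ ab(1), of "\<ominus> \<one>"] by (simp add: l_minus)
  qed (use 0 Ic in auto)
  have "set zs \<subseteq> I"
  proof (rule interpolation[OF I1 I2])
    show "finite Y" "\<And>y y'. y \<in> Y \<Longrightarrow> y' \<in> Y \<Longrightarrow> y \<noteq> y' \<Longrightarrow> y \<ominus> y' \<in> Units R"
      using Y(1) unfolding separated_def by auto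
    show "Y \<subseteq> carrier R" using Y(3) unfolding specialization_def by blast
    show "pv R zs y \<in> I" if y: "y \<in> Y" for y
    proof -
      have yc [simp]: "y \<in> carrier R" using Y(3)[OF y] unfolding specialization_def by blast
      have "pv R us x = \<zero>" using us(2) hx x by simp
      then have "pv R us y = \<zero>" using Y(3)[OF y] us(1) unfolding specialization_def by blast
      then have "hev R (pv R zs y) c (map (\<lambda>g. g y) gs) = \<zero>" using us(2) by simp
      moreover have "set (map (\<lambda>g. g y) gs) \<subseteq> carrier R"
        unfolding gs_def using D subringE(1)[OF C] by (auto intro!: pv_closed)
      ultimately have "dep R (carrier R) (pv R zs y) c" unfolding dep_def by blast
      then show ?thesis unfolding I_def using zsc by simp
    qed
  qed (use zsc Y in auto)
  then have "dep R (carrier R) w c" using w unfolding I_def by blast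
  then obtain ds where ds: "set ds \<subseteq> carrier R" "hev R w c ds = \<zero>" unfolding dep_def by blast
  have wC: "w \<in> C" using w zs by blast
  have [simp]: "w \<in> carrier R" using subring_carrier[OF C wC] .
  \<comment> \<open>Both \<open>w\<close> and \<open>c\<close> lie in \<open>C\<close>, so the
    \<open>C\<close>-linear map \<open>\<rho>\<close> acts on the coefficients alone.\<close>
  have "hev R w c (map \<rho> ds) = \<rho> (hev R w c ds)"
    using ds(1)
  proof (induction ds)
    case (Cons d ds)
    then have [simp]: "d \<in> carrier R" "set ds \<subseteq> carrier R" by auto
    have "\<rho> (d \<otimes> c [^] Suc (length ds)) = c [^] Suc (length ds) \<otimes> \<rho> d"
      using \<rho>(4)[OF subring_pow[OF C c], of d "Suc (length ds)"] by (simp add: m_comm del: nat_pow_Suc)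
    moreover have "\<rho> d \<in> carrier R" using subring_carrier[OF C \<rho>(1)] by simp
    ultimately show ?case using Cons \<rho>(3)[of "w \<otimes> hev R w c ds"] \<rho>(4)[OF wC] by (simp add: m_comm)
  qed (simp add: \<rho>)
  also have "\<dots> = \<rho> \<zero>" using ds by simp
  also have "\<rho> \<zero> = \<zero>"
    using \<rho>(4)[OF subringE(2)[OF C], of \<zero>] subring_carrier[OF C \<rho>(1)] by simp
  finally have "hev R w c (map \<rho> ds) = \<zero>" .
  moreover have "set (map \<rho> ds) \<subseteq> C" using \<rho>(1) ds by auto
  ultimately show ?thesis unfolding dep_def by blast
qed

text \<open>Interpolation again, now with the annihilator of \<open>c\<close> as the ideal.\<close>

lemma zero_coefficients:
  assumes C: "subring C R" and x: "x \<in> carrier R" and c: "c \<in> C"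
    and Y: "separated R Y" "card Y = length zs" "\<And>y. y \<in> Y \<Longrightarrow> specialization R C x y"
    and zs: "set zs \<subseteq> C" and z: "c \<otimes> pv R zs x = \<zero>" and w: "w \<in> set zs"
  shows "c \<otimes> w = \<zero>"
proof -
  have [simp]: "c \<in> carrier R" using c subring_carrier[OF C] by blast
  have zsc: "set zs \<subseteq> carrier R" using zs subringE(1)[OF C] by blast
  obtain us where us: "set us \<subseteq> C" "\<forall>T\<in>carrier R. pv R us T = c \<otimes> pv R zs T"
    using polyfunD[OF polyfun_smult[OF C polyfun_pv[OF zs] c]] by blast
  define I where "I = {z \<in> carrier R. c \<otimes> z = \<zero>}"
  have "set zs \<subseteq> I"
  proof (rule interpolation)
    show "add_closed R I" unfolding I_def add_closed_def by (auto simp: r_distr r_minus)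
    show "t \<otimes> y \<in> I" if "t \<in> carrier R" "y \<in> I" for t y
      using that m_lcomm[of c t y] unfolding I_def by auto
    show "finite Y" "\<And>y y'. y \<in> Y \<Longrightarrow> y' \<in> Y \<Longrightarrow> y \<noteq> y' \<Longrightarrow> y \<ominus> y' \<in> Units R"
      using Y(1) unfolding separated_def by auto
    show "Y \<subseteq> carrier R" using Y(3) unfolding specialization_def by blast
    show "pv R zs y \<in> I" if y: "y \<in> Y" for y
    proof -
      have yc [simp]: "y \<in> carrier R" using Y(3)[OF y] unfolding specialization_def by blast
      have "pv R us x = \<zero>" using us(2) z x by simp
      then have "pv R us y = \<zero>" using Y(3)[OF y] us(1) unfolding specialization_def by blast
      then show ?thesis unfolding I_def using us(2) zsc by auto
    qed
  qed (use zsc Y in auto)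
  then show ?thesis using w unfolding I_def by blast
qed

end

text \<open>The extension \<open>C[x]\<close> of \<open>C\<close> lies in a larger ring
  \<open>R\<close> that has room for the points to which \<open>x\<close> specializes. The
  assumption \<open>points\<close> demands as many of them as the representation of the element has
  coefficients: the conjugates of an algebraic \<open>x\<close>, or arbitrary scalars for a
  transcendental one.\<close>

locale spec_ext = cring R for R (structure) +
  fixes C :: "'a set" and x :: 'a and \<rho> :: "'a \<Rightarrow> 'a"
  assumes C: "subring C R" and x: "x \<in> carrier R" and picC: "pic R C"
    and \<rho>: "\<And>a. a \<in> carrier R \<Longrightarrow> \<rho> a \<in> C" "\<rho> \<one> = \<one>"
      "\<And>a b. a \<in> carrier R \<Longrightarrow> b \<in> carrier R \<Longrightarrow> \<rho> (a \<oplus> b) = \<rho> a \<oplus> \<rho> b"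
      "\<And>c a. c \<in> C \<Longrightarrow> a \<in> carrier R \<Longrightarrow> \<rho> (c \<otimes> a) = c \<otimes> \<rho> a"
    and points: "\<And>z. z \<in> pimage R C x \<Longrightarrow> \<exists>zs Y. set zs \<subseteq> C \<and> z = pv R zs x \<and> separated R Y \<and>
      card Y = length zs \<and> (\<forall>y\<in>Y. specialization R C x y)"
begin

lemma P: "subring (pimage R C x) R"
  by (rule pimage_subring[OF C x])

lemma CP: "C \<subseteq> pimage R C x"
  by (rule pimage_base[OF C x])

text \<open>Each coefficient of \<open>z\<close> is integral over \<open>(c)\<close> in
  \<open>C\<close> and hence a multiple of \<open>c\<close>; dividing coefficientwise gives the
  quotient of \<open>z\<close>.\<close>

lemma pic_base: "pic_on R C (pimage R C x)"
  unfolding pic_on_def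
proof (intro ballI impI)
  fix z c assume z: "z \<in> pimage R C x" and c: "c \<in> C" and dep: "dep R (pimage R C x) z c"
  obtain zs Y where zs: "set zs \<subseteq> C" "z = pv R zs x" and Y: "separated R Y" "card Y = length zs"
    "\<forall>y\<in>Y. specialization R C x y" using points[OF z] by blast
  have "\<exists>w'\<in>C. w = c \<otimes> w'" if w: "w \<in> set zs" for w
    using dep_coefficients[OF C x \<rho> Y(1,2) _ zs(1) c _ w] Y(3) dep zs picD[OF picC _ c] w by blast
  then obtain f where f: "\<And>w. w \<in> set zs \<Longrightarrow> f w \<in> C \<and> w = c \<otimes> f w" by metis
  have [simp]: "c \<in> carrier R" using subring_carrier[OF C c] .
  have "pv R ws x = c \<otimes> pv R (map f ws) x" if "set ws \<subseteq> set zs" for ws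
    using that
  proof (induction ws)
    case (Cons w ws)
    then have w: "f w \<in> C" "w = c \<otimes> f w" "set (map f ws) \<subseteq> C" using f by auto
    then have [simp]: "f w \<in> carrier R" "pv R (map f ws) x \<in> carrier R"
      using subringE(1)[OF C] x by (auto intro!: pv_closed)
    have "pv R (w # ws) x = w \<oplus> x \<otimes> pv R ws x" by simp
    also have "\<dots> = c \<otimes> f w \<oplus> x \<otimes> (c \<otimes> pv R (map f ws) x)" using w(2) Cons by simp
    also have "\<dots> = c \<otimes> pv R (map f (w # ws)) x" using x by (simp add: r_distr m_lcomm)
    finally show ?case .
  qed simp
  moreover have "pv R (map f zs) x \<in> pimage R C x"
    unfolding pimage_def by (intro CollectI exI[of _ "map f zs"]) (use f in auto)
  ultimately show "\<exists>b\<in>pimage R C x. z = c \<otimes> b" using zs by blast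
qed

text \<open>The coefficients of \<open>z\<close> are finitely many and all are killed by
  \<open>c\<close>, so one multiplier from \<open>C\<close> fixes them all.\<close>

lemma annihilator:
  assumes z: "z \<in> pimage R C x" and c: "c \<in> C" and "c \<otimes> z = \<zero>"
  obtains v where "v \<in> C" "v \<otimes> c = \<zero>" "v \<otimes> z = z"
proof -
  obtain zs Y where zs: "set zs \<subseteq> C" "z = pv R zs x" and Y: "separated R Y" "card Y = length zs"
    "\<forall>y\<in>Y. specialization R C x y" using points[OF z] by blast
  have "c \<otimes> w = \<zero>" if w: "w \<in> set zs" for w
    using zero_coefficients[OF C x c Y(1,2) _ zs(1) _ w] Y(3) assms(3) zs by blast
  then obtain v where v: "v \<in> C" "v \<otimes> c = \<zero>" "\<forall>w\<in>set zs. v \<otimes> w = w"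
    using pic_annihilator[OF C picC c, of "set zs"] zs by auto
  have [simp]: "v \<in> carrier R" using subring_carrier[OF C v(1)] .
  have "v \<otimes> pv R ws x = pv R ws x" if "set ws \<subseteq> set zs" for ws
    using that
  proof (induction ws)
    case (Cons w ws)
    then have w: "v \<otimes> w = w" "v \<otimes> pv R ws x = pv R ws x" using v by auto
    have [simp]: "w \<in> carrier R" "pv R ws x \<in> carrier R"
      using Cons zs subringE(1)[OF C] x by (auto intro!: pv_closed)
    have "v \<otimes> pv R (w # ws) x = v \<otimes> w \<oplus> x \<otimes> (v \<otimes> pv R ws x)" using x by (simp add: r_distr m_lcomm)
    then show ?case unfolding w by simp
  qed simp
  then show ?thesis using that[OF v(1,2)] zs by simp
qed

lemma zero_in_C: "\<zero> \<in> C"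
  using subringE(2)[OF C] .

lemmas reduced = pic_reduced[OF P pic_base zero_in_C] pic_reduced2[OF P pic_base zero_in_C]

end

section \<open>Algebraic simple extensions\<close>

context spec_ext
begin

text \<open>
  Induction on the number of coefficients. If \<open>s\<close> satisfies \<open>s (s h \<oplus> c) = \<zero>\<close>, then \<open>s h = c e\<close> where
  \<open>\<ominus> e\<close> is an idempotent up to elements killed by \<open>c\<close>; these are removed by a multiplier \<open>u\<close>
  with \<open>u c = c\<close>, and \<open>\<one> \<ominus> u\<close> kills the constant coefficient \<open>c\<close>.
\<close>

lemma pic_of_monic_aux:
  assumes "length cs = n" "set cs \<subseteq> C" "s \<in> pimage R C x" "a \<in> pimage R C x"
    and "s \<otimes> hev R s \<one> cs = \<zero>" "dep R (pimage R C x) a s"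
  shows "\<exists>b\<in>pimage R C x. a = s \<otimes> b"
  using assms
proof (induction n arbitrary: cs s a)
  case 0
  have [simp]: "s \<in> carrier R" "a \<in> carrier R" using subring_carrier[OF P] 0 by auto
  have "s = \<zero>" using 0 by simp
  then show ?case using picD[OF pic_base 0(4) zero_in_C] 0 by simp
next
  case (Suc n ccs)
  then obtain c cs where ccs: "ccs = c # cs" by (cases ccs) auto
  note Cons = Suc[unfolded ccs]
  let ?P = "pimage R C x"
  note Pc = subring_carrier[OF P]
  have s: "s \<in> ?P" and a: "a \<in> ?P" and c: "c \<in> C" and cs: "set cs \<subseteq> C"
    and dep: "dep R ?P a s" using Cons(2-) by auto
  define h where "h = hev R s \<one> cs"
  have one: "\<one> \<in> ?P" using subringE(3)[OF P] .
  have cP: "c \<in> ?P" using c CP by blast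
  have h: "h \<in> ?P" unfolding h_def using hev_in_subring[OF P s one] cs CP by blast
  have [simp]: "s \<in> carrier R" "a \<in> carrier R" "c \<in> carrier R" "h \<in> carrier R" "set cs \<subseteq> carrier R"
    using Pc[OF s] Pc[OF a] Pc[OF cP] Pc[OF h] cs subringE(1)[OF C] by auto
  have eq: "s \<otimes> (s \<otimes> h \<oplus> c) = \<zero>" using Cons(6) unfolding h_def by simp
  \<comment> \<open>\<open>X^2 + X\<close>, homogenized to \<open>(s h)^2 + c s h\<close>, shows
    that \<open>s h\<close> is integral over \<open>(c)\<close>.\<close>
  have "hev R (s \<otimes> h) c [\<zero>, \<one>] = h \<otimes> (s \<otimes> (s \<otimes> h \<oplus> c))" by (simp add: ring_norm)
  then have "hev R (s \<otimes> h) c [\<zero>, \<one>] = \<zero>" using eq by simp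
  then have "dep R ?P (s \<otimes> h) c"
    unfolding dep_def using subringE(2)[OF P] one by (intro exI[of _ "[\<zero>, \<one>]"]) auto
  then obtain e where e: "e \<in> ?P" "s \<otimes> h = c \<otimes> e"
    using picD[OF pic_base subringE(6)[OF P s h] c] by blast
  have [simp]: "e \<in> carrier R" using Pc[OF e(1)] .
  have "c \<otimes> (s \<oplus> s \<otimes> e) = s \<otimes> (c \<otimes> e \<oplus> c)" by (simp add: ring_norm)
  then have cy: "c \<otimes> (s \<oplus> s \<otimes> e) = \<zero>" using eq e by simp
  have "s \<oplus> s \<otimes> e \<in> ?P" using s e P by (simp add: subringE)
  then obtain v1 where v1: "v1 \<in> C" "v1 \<otimes> c = \<zero>" "v1 \<otimes> (s \<oplus> s \<otimes> e) = s \<oplus> s \<otimes> e"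
    using annihilator[OF _ c cy] by blast
  have [simp]: "v1 \<in> carrier R" using subring_carrier[OF C v1(1)] .
  have v1P: "v1 \<in> ?P" using v1 CP by blast
  \<comment> \<open>After multiplication by \<open>1 - v1\<close>, which fixes \<open>c\<close>, the
    factor \<open>1 + e\<close> kills \<open>s\<close>. So \<open>w a\<close> is integral over the
    zero ideal and vanishes: up to \<open>1 - v1\<close>, \<open>a\<close> equals
    \<open>- e a\<close>.\<close>
  define w where "w = (\<one> \<ominus> v1) \<otimes> (\<one> \<oplus> e)"
  have w: "w \<in> ?P" unfolding w_def using one v1P e P by (simp add: sub_closed)
  have [simp]: "w \<in> carrier R" using Pc[OF w] .
  have "w \<otimes> s = (s \<oplus> s \<otimes> e) \<ominus> v1 \<otimes> (s \<oplus> s \<otimes> e)" unfolding w_def by (simp add: ring_norm)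
  then have ws: "w \<otimes> s = \<zero>" unfolding v1(3) by simp
  have "dep R ?P (w \<otimes> a) (w \<otimes> s)" by (rule dep_scale[OF P a s w dep])
  then have "dep R ?P (w \<otimes> a) \<zero>" unfolding ws .
  then obtain b0 where "b0 \<in> ?P" "w \<otimes> a = \<zero> \<otimes> b0"
    using picD[OF pic_base subringE(6)[OF P w a] zero_in_C] by blast
  then have wa: "w \<otimes> a = \<zero>" using Pc by simp
  \<comment> \<open>Since \<open>h s\<close> is a multiple of \<open>c\<close>, the element
    \<open>h a\<close> has a quotient \<open>b\<close> by \<open>c\<close>. Then \<open>c\<close>
    kills \<open>e a - s b\<close>, so \<open>- b\<close> is a quotient of \<open>a\<close> by
    \<open>s\<close> up to multipliers that fix \<open>c\<close>.\<close>
  have "dep R ?P (h \<otimes> a) (h \<otimes> s)" by (rule dep_scale[OF P a s h dep])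
  moreover have "h \<otimes> s = e \<otimes> c" using e(2) by (simp add: m_comm)
  ultimately have "dep R ?P (h \<otimes> a) c"
    using dep_of_multiple[OF P subringE(6)[OF P h a] cP e(1)] by simp
  then obtain b where b: "b \<in> ?P" "h \<otimes> a = c \<otimes> b"
    using picD[OF pic_base subringE(6)[OF P h a] c] by blast
  have [simp]: "b \<in> carrier R" using Pc[OF b(1)] .
  have "c \<otimes> (e \<otimes> a \<ominus> s \<otimes> b) = (c \<otimes> e) \<otimes> a \<ominus> s \<otimes> (c \<otimes> b)" by (simp add: ring_norm)
  also have "\<dots> = (s \<otimes> h) \<otimes> a \<ominus> s \<otimes> (h \<otimes> a)" using e b by simp
  also have "\<dots> = \<zero>" by (simp add: m_assoc)
  finally have cy2: "c \<otimes> (e \<otimes> a \<ominus> s \<otimes> b) = \<zero>" .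
  have "e \<otimes> a \<ominus> s \<otimes> b \<in> ?P" using s e a b P by (simp add: sub_closed)
  then obtain v2 where v2: "v2 \<in> C" "v2 \<otimes> c = \<zero>" "v2 \<otimes> (e \<otimes> a \<ominus> s \<otimes> b) = e \<otimes> a \<ominus> s \<otimes> b"
    using annihilator[OF _ c cy2] by blast
  have [simp]: "v2 \<in> carrier R" using subring_carrier[OF C v2(1)] .
  have v2P: "v2 \<in> ?P" using v2 CP by blast
  define u where "u = (\<one> \<ominus> v2) \<otimes> (\<one> \<ominus> v1)"
  have uC: "u \<in> C" unfolding u_def using C v1 v2 by (simp add: sub_closed)
  have u: "u \<in> ?P" using uC CP by blast
  have [simp]: "u \<in> carrier R" using Pc[OF u] .
  have "u \<otimes> a = (\<one> \<ominus> v2) \<otimes> (w \<otimes> a) \<ominus> u \<otimes> (e \<otimes> a)" unfolding u_def w_def by (simp add: ring_norm)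
  also have "\<dots> = \<ominus> (u \<otimes> (e \<otimes> a))" unfolding wa by (simp add: minus_eq)
  also have "\<dots> = \<ominus> ((\<one> \<ominus> v1) \<otimes> ((e \<otimes> a \<ominus> s \<otimes> b) \<ominus> v2 \<otimes> (e \<otimes> a \<ominus> s \<otimes> b))) \<ominus> u \<otimes> (s \<otimes> b)"
    unfolding u_def by (simp add: ring_norm)
  also have "\<dots> = s \<otimes> (\<ominus> (u \<otimes> b))" unfolding v2(3) by (simp add: ring_norm)
  finally have ua: "u \<otimes> a = s \<otimes> (\<ominus> (u \<otimes> b))" .
  \<comment> \<open>On the complementary part the constant coefficient \<open>c\<close> disappears:
    \<open>V s\<close> satisfies an equation with the coefficients \<open>scl R V cs\<close>, one
    fewer than before.\<close>
  define V where "V = \<one> \<ominus> u"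
  have VC: "V \<in> C" unfolding V_def using uC C by (simp add: sub_closed)
  have V: "V \<in> ?P" using VC CP by blast
  have [simp]: "V \<in> carrier R" using Pc[OF V] .
  have "V \<otimes> c = v1 \<otimes> c \<oplus> v2 \<otimes> c \<ominus> v1 \<otimes> (v2 \<otimes> c)" unfolding V_def u_def by (simp add: ring_norm)
  then have Vc: "V \<otimes> c = \<zero>" unfolding v1(2) v2(2) by simp
  have "(V \<otimes> (s \<otimes> h)) [^] (2::nat) = (V \<otimes> h) \<otimes> (V \<otimes> (s \<otimes> (s \<otimes> h)))"
    by (simp add: numeral_2_eq_2 m_ac)
  also have "V \<otimes> (s \<otimes> (s \<otimes> h)) = V \<otimes> (s \<otimes> (s \<otimes> h \<oplus> c)) \<ominus> s \<otimes> (V \<otimes> c)" by (simp add: ring_norm)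
  also have "\<dots> = \<zero>" unfolding eq Vc by simp
  finally have "(V \<otimes> (s \<otimes> h)) [^] (2::nat) = \<zero>" by simp
  then have Vsh: "V \<otimes> (s \<otimes> h) = \<zero>"
    using reduced(1)[OF subringE(6)[OF P V subringE(6)[OF P s h]]] by blast
  have "\<exists>b\<in>?P. V \<otimes> a = (V \<otimes> s) \<otimes> b"
  proof (rule Cons(1))
    show "length (scl R V cs) = n" using Cons(2) by simp
    show "set (scl R V cs) \<subseteq> C" by (rule set_scl[OF C VC cs])
    have "hev R (V \<otimes> s) \<one> (scl R V cs) = hev R (V \<otimes> s) (V \<otimes> \<one>) cs"
      by (rule hev_scl[symmetric]) auto
    also have "\<dots> = V [^] length cs \<otimes> h" unfolding h_def by (rule hev_scale) auto
    finally have "hev R (V \<otimes> s) \<one> (scl R V cs) = V [^] length cs \<otimes> h" .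
    then have "(V \<otimes> s) \<otimes> hev R (V \<otimes> s) \<one> (scl R V cs) = V [^] length cs \<otimes> (V \<otimes> (s \<otimes> h))"
      by (simp add: m_ac)
    then show "V \<otimes> s \<otimes> hev R (V \<otimes> s) \<one> (scl R V cs) = \<zero>" unfolding Vsh by simp
    show "dep R ?P (V \<otimes> a) (V \<otimes> s)" by (rule dep_scale[OF P a s V dep])
  qed (use V s a P in \<open>simp_all add: subringE\<close>)
  then obtain b' where b': "b' \<in> ?P" "V \<otimes> a = (V \<otimes> s) \<otimes> b'" by blast
  have [simp]: "b' \<in> carrier R" using Pc[OF b'(1)] .
  have "a = u \<otimes> a \<oplus> V \<otimes> a" unfolding V_def by (simp add: ring_norm)
  also have "\<dots> = s \<otimes> (\<ominus> (u \<otimes> b) \<oplus> V \<otimes> b')" unfolding ua b'(2) by (simp add: ring_norm)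
  finally have "a = s \<otimes> (\<ominus> (u \<otimes> b) \<oplus> V \<otimes> b')" .
  moreover have "\<ominus> (u \<otimes> b) \<oplus> V \<otimes> b' \<in> ?P" using u b V b' P by (simp add: sub_closed)
  ultimately show ?case by blast
qed

text \<open>The given equation is multiplied by \<open>s\<close>. The spare factor is what the
  induction preserves: removing the constant coefficient from \<open>s (s h + c) = 0\<close> leaves
  \<open>s h = 0\<close>, which is again of this form.\<close>

lemma pic_of_monic:
  assumes "\<And>s. s \<in> pimage R C x \<Longrightarrow> \<exists>cs. set cs \<subseteq> C \<and> hev R s \<one> cs = \<zero>"
  shows "pic R (pimage R C x)"
  unfolding pic_on_def
proof (intro ballI impI)
  fix a s assume *: "a \<in> pimage R C x" "s \<in> pimage R C x" "dep R (pimage R C x) a s"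
  obtain cs where cs: "set cs \<subseteq> C" "hev R s \<one> cs = \<zero>" using assms * by blast
  moreover have "s \<otimes> hev R s \<one> cs = \<zero>" using cs subring_carrier[OF P *(2)] by simp
  ultimately show "\<exists>b\<in>pimage R C x. a = s \<otimes> b" using pic_of_monic_aux * by blast
qed

text \<open>Every element of a simple extension by a root of a monic polynomial is integral.\<close>

lemma pic_of_root:
  assumes fs: "set fs \<subseteq> C" and root: "x [^] length fs \<oplus> pv R fs x = \<zero>"
  shows "pic R (pimage R C x)"
proof (rule pic_of_monic)
  fix s assume s: "s \<in> pimage R C x"
  define d where "d = length fs"
  define ms where "ms = map (\<lambda>i. x [^] i) [0..<d]"
  have msc: "set ms \<subseteq> carrier R" unfolding ms_def using x by auto
  note CA = subring_add_closed[OF C]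
  note LA = lspan_add_closed[OF CA msc]
  have fsc: "set fs \<subseteq> carrier R" using fs subringE(1)[OF C] by blast
  have L2: "t \<otimes> y \<in> lspan R C ms" if t: "t \<in> C" and y: "y \<in> lspan R C ms" for t y
    by (rule lspan_scale[OF subring_carrier[OF C t] msc subringE(1)[OF C] _ y]) (rule subringE(6)[OF C t])
  \<comment> \<open>Polynomials with at most \<open>d\<close> coefficients are spanned by the powers
    of \<open>x\<close> below \<open>x^d\<close>; the shift by \<open>i\<close> makes the induction
    on the list possible.\<close>
  have pvL: "pv R zs x \<otimes> x [^] i \<in> lspan R C ms" if "set zs \<subseteq> C" "length zs + i \<le> d" for zs i
    using that
  proof (induction zs arbitrary: i)
    case Nil
    then show ?case using add_closedD(2)[OF LA] x by simp
  next
    case (Cons z zs)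
    then have zc: "z \<in> C" "set zs \<subseteq> C" by auto
    have [simp]: "z \<in> carrier R" "pv R zs x \<in> carrier R"
      using zc subringE(1)[OF C] x by (auto intro!: pv_closed)
    have "z \<otimes> x [^] i \<in> lspan R C ms"
      using Cons.prems lspan_smult_base[OF CA msc _ zc(1), of "x [^] i"] unfolding ms_def by auto
    moreover have "pv R zs x \<otimes> x [^] Suc i \<in> lspan R C ms" using Cons by (intro Cons.IH) auto
    ultimately have "z \<otimes> x [^] i \<oplus> pv R zs x \<otimes> x [^] Suc i \<in> lspan R C ms" using add_closedD(3)[OF LA] by blast
    moreover have "pv R (z # zs) x \<otimes> x [^] i = z \<otimes> x [^] i \<oplus> pv R zs x \<otimes> x [^] Suc i"
      using x by (simp add: ring_norm)
    ultimately show ?case by metis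
  qed
  have "x [^] d = \<ominus> pv R fs x" using root x fsc unfolding d_def by (simp add: eq_neg_iff)
  moreover have "pv R fs x \<in> lspan R C ms" using pvL[OF fs, of 0] x fsc unfolding d_def by simp
  ultimately have xd: "x [^] d \<in> lspan R C ms" using add_closedD(4)[OF LA] by simp
  have "lspan R C ms \<subseteq> {y \<in> carrier R. x \<otimes> y \<in> lspan R C ms}"
  proof (rule lspan_subset)
    show "add_closed R {y \<in> carrier R. x \<otimes> y \<in> lspan R C ms}"
      unfolding add_closed_def using add_closedD[OF LA] x by (auto simp: r_distr r_minus)
    fix t m assume t: "t \<in> C" and m: "m \<in> set ms"
    then obtain i where i: "i < d" "m = x [^] i" unfolding ms_def by auto
    have [simp]: "t \<in> carrier R" using subring_carrier[OF C t] .
    have "x [^] Suc i \<in> lspan R C ms"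
    proof (cases "Suc i = d")
      case False
      then have "Suc i \<in> set [0..<d]" using i by auto
      then have "x [^] Suc i \<in> set ms" unfolding ms_def set_map by (rule imageI)
      then show ?thesis using lspan_base[OF C msc] by blast
    qed (use xd in simp)
    then have "t \<otimes> x [^] Suc i \<in> lspan R C ms" using L2[OF t] by blast
    then show "t \<otimes> m \<in> {y \<in> carrier R. x \<otimes> y \<in> lspan R C ms}" using i x by (simp add: m_ac)
  qed
  then have xL: "x \<otimes> y \<in> lspan R C ms" if "y \<in> lspan R C ms" for y using that by blast
  have sL: "s \<otimes> y \<in> lspan R C ms" if y: "y \<in> lspan R C ms" for y
  proof -
    obtain zs where zs: "set zs \<subseteq> C" "s = pv R zs x" using pimage_obtain[OF s] .
    have [simp]: "y \<in> carrier R" using add_closedD(5)[OF LA y] .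
    have "pv R zs x \<otimes> y \<in> lspan R C ms"
      using zs(1)
    proof (induction zs)
      case Nil
      then show ?case using add_closedD(2)[OF LA] by simp
    next
      case (Cons z zs)
      then have [simp]: "z \<in> carrier R" "pv R zs x \<in> carrier R"
        using subringE(1)[OF C] x by (auto intro!: pv_closed)
      have "z \<otimes> y \<oplus> x \<otimes> (pv R zs x \<otimes> y) \<in> lspan R C ms"
        using Cons L2[OF _ y] xL add_closedD(3)[OF LA] by auto
      then show ?case using x by (simp add: l_distr m_assoc)
    qed
    then show ?thesis using zs by simp
  qed
  have sc [simp]: "s \<in> carrier R" using subring_carrier[OF P s] .
  have "\<exists>w\<in>lspan R C ms. s \<otimes> m = \<one> \<otimes> w" if m: "m \<in> set ms" for m
    using sL[OF lspan_base[OF C msc m]] add_closedD(5)[OF LA] by auto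
  \<comment> \<open>The determinant trick with denominator \<open>1\<close>. The annihilating
    polynomial vanishes at \<open>s\<close> because \<open>x^0\<close> is one of the generators,
    unless \<open>d = 0\<close>, when the ring is zero.\<close>
  then obtain cs where cs: "set cs \<subseteq> C" "\<forall>m\<in>set ms. hev R s \<one> cs \<otimes> m = \<zero>"
    using hev_annihilator[OF C sc one_closed msc] by blast
  have hc: "hev R s \<one> cs \<in> carrier R" using cs(1) subringE(1)[OF C] by auto
  show "\<exists>cs. set cs \<subseteq> C \<and> hev R s \<one> cs = \<zero>"
  proof (cases "d = 0")
    case True
    then have "\<one> = \<zero>" using root unfolding d_def by simp
    then show ?thesis by (intro exI[of _ "[]"]) auto
  next
    case False
    then have "0 \<in> set [0..<d]" by simp
    then have "x [^] (0::nat) \<in> set ms" unfolding ms_def set_map by (rule imageI)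
    then have "hev R s \<one> cs \<otimes> x [^] (0::nat) = \<zero>" using cs by blast
    then show ?thesis using hc cs by auto
  qed
qed

end

section \<open>Polynomial rings\<close>

text \<open>The index counts coefficients: index \<open>d\<close> means degree less than
  \<open>d\<close>, and index \<open>0\<close> leaves only the zero polynomial.\<close>

definition pdeg :: "('a, 'm) ring_scheme \<Rightarrow> 'a set \<Rightarrow> 'a \<Rightarrow> nat \<Rightarrow> 'a set" where
  "pdeg R C x d = {pv R zs x | zs. set zs \<subseteq> C \<and> length zs = d}"

text \<open>With arbitrarily many points available, \<open>x\<close> behaves like an indeterminate
  over \<open>C\<close>, although it is an element of \<open>R\<close>.\<close>

locale poly_ext = spec_ext +
  assumes many_points: "\<And>n. \<exists>Y. separated R Y \<and> card Y = n \<and> (\<forall>y\<in>Y. specialization R C x y)"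
begin

abbreviation P\<^sub>d :: "nat \<Rightarrow> 'a set" where "P\<^sub>d \<equiv> pdeg R C x"

lemma CR: "c \<in> C \<Longrightarrow> c \<in> carrier R" using subring_carrier[OF C] .

lemma pdeg_0: "P\<^sub>d 0 = {\<zero>}" unfolding pdeg_def by auto

lemma pdeg_pimage: "P\<^sub>d n \<subseteq> pimage R C x" unfolding pdeg_def pimage_def by blast

lemma pdeg_carrier: "t \<in> P\<^sub>d n \<Longrightarrow> t \<in> carrier R" using pdeg_pimage subring_carrier[OF P] by blast

lemma pimage_pdeg: "z \<in> pimage R C x \<Longrightarrow> \<exists>n. z \<in> P\<^sub>d n" unfolding pdeg_def pimage_def by blast

lemma pv_append_zero:
  assumes "set zs \<subseteq> carrier R" shows "pv R (zs @ replicate k \<zero>) x = pv R zs x"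
proof -
  have 0: "pv R (replicate k \<zero>) x = \<zero>" using x by (induction k) auto
  show ?thesis using assms by (induction zs) (use 0 in auto)
qed

lemma pdeg_mono: assumes "m \<le> n" shows "P\<^sub>d m \<subseteq> P\<^sub>d n"
proof
  fix t assume "t \<in> P\<^sub>d m"
  then obtain zs where zs: "set zs \<subseteq> C" "length zs = m" "t = pv R zs x" unfolding pdeg_def by blast
  then have "pv R (zs @ replicate (n - m) \<zero>) x = t" using pv_append_zero CR by (simp add: subset_iff)
  moreover have "set (zs @ replicate (n - m) \<zero>) \<subseteq> C" "length (zs @ replicate (n - m) \<zero>) = n"
    using zs zero_in_C assms by auto
  ultimately show "t \<in> P\<^sub>d n" unfolding pdeg_def by blast
qed

lemma pdeg_add: assumes "s \<in> P\<^sub>d n" "t \<in> P\<^sub>d n" shows "s \<oplus> t \<in> P\<^sub>d n"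
proof -
  obtain ws us where *: "set ws \<subseteq> C" "length ws = n" "s = pv R ws x" "set us \<subseteq> C" "length us = n" "t = pv R us x"
    using assms unfolding pdeg_def by blast
  obtain vs where "set vs \<subseteq> C" "length vs = n" "\<forall>T\<in>carrier R. pv R vs T = pv R ws T \<oplus> pv R us T"
    using pv_add_ex[OF C *(1,4)] * by auto
  then show ?thesis unfolding pdeg_def using x * by (auto intro!: exI[of _ vs])
qed

lemma pdeg_smult: assumes "c \<in> C" "t \<in> P\<^sub>d n" shows "c \<otimes> t \<in> P\<^sub>d n"
proof -
  obtain zs where zs: "set zs \<subseteq> C" "length zs = n" "t = pv R zs x" using assms unfolding pdeg_def by blast
  have "pv R (map ((\<otimes>) c) zs) x = c \<otimes> pv R zs x"
    using zs(1)
  proof (induction zs)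
    case (Cons z zs)
    then have [simp]: "z \<in> carrier R" "set zs \<subseteq> carrier R" using CR by auto
    show ?case using Cons assms CR x by (simp add: r_distr m_lcomm)
  qed (use assms CR in simp)
  moreover have "set (map ((\<otimes>) c) zs) \<subseteq> C" using zs(1) subringE(6)[OF C \<open>c \<in> C\<close>] by auto
  ultimately show ?thesis unfolding pdeg_def using zs by (intro CollectI exI[of _ "map ((\<otimes>) c) zs"]) auto
qed

lemma pdeg_minus: "s \<in> P\<^sub>d n \<Longrightarrow> t \<in> P\<^sub>d n \<Longrightarrow> s \<ominus> t \<in> P\<^sub>d n"
proof -
  assume *: "s \<in> P\<^sub>d n" "t \<in> P\<^sub>d n"
  have "\<ominus> \<one> \<otimes> t \<in> P\<^sub>d n" using pdeg_smult[OF _ *(2)] subringE(3,5)[OF C] by blast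
  then show ?thesis using pdeg_add[OF *(1)] pdeg_carrier[OF *(2)] by (simp add: minus_eq l_minus)
qed

lemma pdeg_shift: "t \<in> P\<^sub>d n \<Longrightarrow> x \<otimes> t \<in> P\<^sub>d (Suc n)"
proof -
  assume "t \<in> P\<^sub>d n"
  then obtain zs where zs: "set zs \<subseteq> C" "length zs = n" "t = pv R zs x" unfolding pdeg_def by blast
  have "pv R (\<zero> # zs) x = x \<otimes> t" using zs x CR by (auto simp: subset_iff)
  then show ?thesis unfolding pdeg_def using zs zero_in_C by (intro CollectI exI[of _ "\<zero> # zs"]) auto
qed

lemma pdeg_shift_pow: "t \<in> P\<^sub>d n \<Longrightarrow> x [^] k \<otimes> t \<in> P\<^sub>d (k + n)"
proof (induction k)
  case 0
  then show ?case using pdeg_carrier by simp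
next
  case (Suc k)
  have "x [^] Suc k \<otimes> t = x \<otimes> (x [^] k \<otimes> t)" using Suc pdeg_carrier x by (simp add: m_ac)
  then show ?case using pdeg_shift[of "x [^] k \<otimes> t" "k + n"] Suc by simp
qed

lemma pdeg_Suc:
  "t \<in> P\<^sub>d (Suc n) \<longleftrightarrow> (\<exists>s\<in>P\<^sub>d n. \<exists>l\<in>C. t = s \<oplus> l \<otimes> x [^] n)" (is "?l \<longleftrightarrow> ?r")
proof
  have *: "pv R (zs @ [l]) x = pv R zs x \<oplus> l \<otimes> x [^] length zs" if "set zs \<subseteq> C" "l \<in> C" for zs l
    using that
  proof (induction zs)
    case Nil
    then show ?case using x CR by simp
  next
    case (Cons z zs)
    then have [simp]: "z \<in> carrier R" "set zs \<subseteq> carrier R" "l \<in> carrier R" "pv R zs x \<in> carrier R"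
      using CR x by (auto intro!: pv_closed)
    show ?case using Cons x by (simp add: ring_norm)
  qed
  {
    assume ?l
    then obtain vs where vs: "set vs \<subseteq> C" "length vs = Suc n" "t = pv R vs x" unfolding pdeg_def by blast
    then obtain zs l where "vs = zs @ [l]" by (metis length_Suc_conv_rev)
    then have "set zs \<subseteq> C" "l \<in> C" "length zs = n" "t = pv R zs x \<oplus> l \<otimes> x [^] n" using vs * by auto
    then show ?r unfolding pdeg_def by blast
  }
  assume ?r
  then obtain zs l where zs: "set zs \<subseteq> C" "length zs = n" "l \<in> C" "t = pv R zs x \<oplus> l \<otimes> x [^] n"
    unfolding pdeg_def by blast
  then have "t = pv R (zs @ [l]) x" using * by simp
  then show ?l unfolding pdeg_def using zs by (intro CollectI exI[of _ "zs @ [l]"]) auto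
qed

lemma pdeg_mult: "s \<in> P\<^sub>d (Suc m) \<Longrightarrow> t \<in> P\<^sub>d n \<Longrightarrow> s \<otimes> t \<in> P\<^sub>d (m + n)"
proof (induction m arbitrary: s)
  case 0
  then obtain l where "l \<in> C" "s = \<zero> \<oplus> l \<otimes> x [^] (0::nat)" unfolding pdeg_Suc pdeg_0 by blast
  then show ?case using pdeg_smult[of l t n] 0 CR by simp
next
  case (Suc m)
  obtain s' l where s: "s' \<in> P\<^sub>d (Suc m)" "l \<in> C" "s = s' \<oplus> l \<otimes> x [^] Suc m"
    using Suc.prems(1) unfolding pdeg_Suc[of _ "Suc m"] by blast
  have [simp]: "s' \<in> carrier R" "l \<in> carrier R" "t \<in> carrier R" "x \<in> carrier R"
    using s CR pdeg_carrier Suc x by auto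
  have "s \<otimes> t = s' \<otimes> t \<oplus> l \<otimes> (x [^] Suc m \<otimes> t)" unfolding s by (simp add: ring_norm)
  moreover have "s' \<otimes> t \<in> P\<^sub>d (Suc m + n)" using Suc.IH[OF s(1) Suc.prems(2)] pdeg_mono[of "m + n" "Suc m + n"] by auto
  moreover have "l \<otimes> (x [^] Suc m \<otimes> t) \<in> P\<^sub>d (Suc m + n)"
    using pdeg_smult[OF s(2) pdeg_shift_pow[OF Suc.prems(2), of "Suc m"]] .
  ultimately show ?case using pdeg_add by metis
qed

lemma pdeg_pow: "s \<in> P\<^sub>d (Suc m) \<Longrightarrow> s [^] k \<in> P\<^sub>d (Suc (k * m))"
proof (induction k)
  case 0
  have "\<one> = \<zero> \<oplus> \<one> \<otimes> x [^] (0::nat)" by simp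
  then have "\<one> \<in> P\<^sub>d (Suc 0)" unfolding pdeg_Suc pdeg_0 using subringE(3)[OF C] by blast
  then show ?case by simp
next
  case (Suc k)
  have "s \<otimes> s [^] k \<in> P\<^sub>d (m + Suc (k * m))" using pdeg_mult Suc by blast
  moreover have "s [^] Suc k = s \<otimes> s [^] k" using pdeg_carrier[OF Suc.prems] by (simp add: m_comm)
  ultimately show ?case by simp
qed

text \<open>Uniqueness of coefficients: the difference of the two representations vanishes at
  \<open>x\<close>, hence at as many separated points as it has coefficients.\<close>

lemma leading_zero:
  assumes "s \<in> P\<^sub>d n" "l \<in> C" "s \<oplus> l \<otimes> x [^] n \<in> P\<^sub>d n"
  shows "l = \<zero>"
proof -
  have [simp]: "s \<in> carrier R" "l \<in> carrier R" "x \<in> carrier R" using assms pdeg_carrier CR x by auto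
  have "(s \<oplus> l \<otimes> x [^] n) \<ominus> s \<in> P\<^sub>d n" using pdeg_minus assms by blast
  then have "l \<otimes> x [^] n \<in> P\<^sub>d n" by (simp add: minus_eq a_ac r_neg2 r_neg)
  then obtain ws where ws: "set ws \<subseteq> C" "length ws = n" "pv R ws x = l \<otimes> x [^] n" unfolding pdeg_def by auto
  have wsc: "set ws \<subseteq> carrier R" using ws CR by blast
  have nl: "\<ominus> l \<in> C" using subringE(5)[OF C] assms by blast
  have "pv R (zs @ [k]) x = pv R zs x \<oplus> k \<otimes> x [^] length zs" if "set zs \<subseteq> C" "k \<in> C" for zs k
    using that
  proof (induction zs)
    case Nil
    then show ?case using x CR by simp
  next
    case (Cons z zs)
    then have [simp]: "z \<in> carrier R" "set zs \<subseteq> carrier R" "k \<in> carrier R" "pv R zs x \<in> carrier R"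
      using CR x by (auto intro!: pv_closed)
    show ?case using Cons x by (simp add: ring_norm)
  qed
  from this[OF ws(1) nl] have "pv R (ws @ [\<ominus> l]) x = \<zero>" using ws by (simp add: l_minus r_neg)
  then have z: "\<one> \<otimes> pv R (ws @ [\<ominus> l]) x = \<zero>" by simp
  obtain Y where Y: "separated R Y" "card Y = length (ws @ [\<ominus> l])" "\<forall>y\<in>Y. specialization R C x y"
    using many_points by blast
  have "\<one> \<otimes> (\<ominus> l) = \<zero>"
    by (rule zero_coefficients[OF C x subringE(3)[OF C] Y(1,2) _ _ z]) (use Y ws nl in auto)
  then show ?thesis by (metis \<open>l \<in> carrier R\<close> a_inv_closed l_one minus_minus minus_zero)
qed

text \<open>
  Below, the multipliers \<open>u \<in> C\<close> with \<open>u l = l\<close> make the leading coefficient \<open>l\<close> behave like a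
  nonzerodivisor.
\<close>

lemma fix_annihilator:
  assumes "y \<in> pimage R C x" "l \<in> C" "l \<otimes> y = \<zero>"
  obtains u where "u \<in> C" "u \<otimes> l = l" "u \<otimes> y = \<zero>"
proof -
  obtain v where v: "v \<in> C" "v \<otimes> l = \<zero>" "v \<otimes> y = y" using annihilator[OF assms] .
  have [simp]: "v \<in> carrier R" "l \<in> carrier R" "y \<in> carrier R" using v assms CR subring_carrier[OF P] by auto
  have "(\<one> \<ominus> v) \<otimes> l = l" "(\<one> \<ominus> v) \<otimes> y = \<zero>" using v by (simp_all add: diff_mult1) (simp add: minus_eq)
  moreover have "\<one> \<ominus> v \<in> C" using v C by (simp add: sub_closed)
  ultimately show ?thesis using that by blast
qed

text \<open>Degrees need not add, since \<open>l\<close> may be a zero divisor. As long as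
  \<open>t\<close> is too long, its top coefficient \<open>\<tau>\<close> satisfies
  \<open>l \<tau> = 0\<close>; a multiplier that fixes \<open>l\<close> and kills
  \<open>\<tau>\<close> shortens \<open>t\<close>.\<close>

lemma cancel_leading:
  assumes s': "s' \<in> P\<^sub>d d" and l: "l \<in> C" and t: "t \<in> P\<^sub>d D" and st: "(s' \<oplus> l \<otimes> x [^] d) \<otimes> t \<in> P\<^sub>d (d + e)"
  shows "\<exists>u\<in>C. u \<otimes> l = l \<and> u \<otimes> t \<in> P\<^sub>d e"
  using t st
proof (induction D arbitrary: t)
  case 0
  then have "\<one> \<otimes> t \<in> P\<^sub>d e" using pdeg_mono[of 0 e] pdeg_0 by auto
  then show ?case using subringE(3)[OF C] CR[OF l] by (intro bexI[of _ \<one>]) auto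
next
  case (Suc D)
  show ?case
  proof (cases "Suc D \<le> e")
    case True
    then have "\<one> \<otimes> t \<in> P\<^sub>d e" using pdeg_mono[OF True] Suc.prems pdeg_carrier by auto
    then show ?thesis using subringE(3)[OF C] CR[OF l] by (intro bexI[of _ \<one>]) auto
  next
    case False
    then have e: "e \<le> D" by simp
    obtain t' \<tau> where t: "t' \<in> P\<^sub>d D" "\<tau> \<in> C" "t = t' \<oplus> \<tau> \<otimes> x [^] D" using Suc.prems(1) unfolding pdeg_Suc by blast
    have [simp]: "t' \<in> carrier R" "\<tau> \<in> carrier R" "l \<in> carrier R" "s' \<in> carrier R" "x \<in> carrier R"
      using t l s' CR pdeg_carrier x by auto
    define s where "s = s' \<oplus> l \<otimes> x [^] d"
    have s: "s \<in> P\<^sub>d (Suc d)" unfolding s_def pdeg_Suc using s' l by blast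
    have [simp]: "s \<in> carrier R" using pdeg_carrier[OF s] .
    define r where "r = \<tau> \<otimes> (x [^] D \<otimes> s') \<oplus> s \<otimes> t'"
    have "x [^] (d + D) = x [^] d \<otimes> x [^] D" by (simp add: nat_pow_mult)
    then have eq: "s \<otimes> t = r \<oplus> (l \<otimes> \<tau>) \<otimes> x [^] (d + D)"
      unfolding r_def t(3) by (simp add: s_def ring_norm)
    have "\<tau> \<otimes> (x [^] D \<otimes> s') \<in> P\<^sub>d (d + D)"
      using pdeg_smult[OF t(2) pdeg_shift_pow[OF s', of D]] by (simp add: add.commute)
    then have r: "r \<in> P\<^sub>d (d + D)" unfolding r_def using pdeg_add pdeg_mult[OF s t(1)] by blast
    have lt: "l \<otimes> \<tau> = \<zero>"
    proof (rule leading_zero[OF r])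
      show "l \<otimes> \<tau> \<in> C" using subringE(6)[OF C] l t by blast
      have "s \<otimes> t \<in> P\<^sub>d (d + D)" using Suc.prems(2) pdeg_mono[of "d + e" "d + D"] e unfolding s_def by auto
      then show "r \<oplus> (l \<otimes> \<tau>) \<otimes> x [^] (d + D) \<in> P\<^sub>d (d + D)" unfolding eq .
    qed
    obtain u where u: "u \<in> C" "u \<otimes> l = l" "u \<otimes> \<tau> = \<zero>" using fix_annihilator[OF _ l lt] t CP by blast
    have [simp]: "u \<in> carrier R" using u CR by blast
    have "u \<otimes> t = u \<otimes> t' \<oplus> (u \<otimes> \<tau>) \<otimes> x [^] D" unfolding t by (simp add: ring_norm)
    then have ut: "u \<otimes> t = u \<otimes> t'" using u by simp
    have "\<exists>u'\<in>C. u' \<otimes> l = l \<and> u' \<otimes> (u \<otimes> t) \<in> P\<^sub>d e"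
    proof (rule Suc.IH)
      show "u \<otimes> t \<in> P\<^sub>d D" unfolding ut using pdeg_smult[OF u(1) t(1)] .
      have "u \<otimes> (s \<otimes> t) \<in> P\<^sub>d (d + e)" using pdeg_smult[OF u(1) Suc.prems(2)] unfolding s_def .
      moreover have "u \<otimes> (s \<otimes> t) = s \<otimes> (u \<otimes> t)" using pdeg_carrier[OF Suc.prems(1)] by (simp add: m_lcomm)
      ultimately show "(s' \<oplus> l \<otimes> x [^] d) \<otimes> (u \<otimes> t) \<in> P\<^sub>d (d + e)" unfolding s_def by simp
    qed
    then obtain u' where u': "u' \<in> C" "u' \<otimes> l = l" "u' \<otimes> (u \<otimes> t) \<in> P\<^sub>d e" by blast
    have [simp]: "u' \<in> carrier R" using u' CR by blast
    have "(u' \<otimes> u) \<otimes> l = l" using u u' by (simp add: m_assoc)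
    moreover have "(u' \<otimes> u) \<otimes> t \<in> P\<^sub>d e" using u'(3) pdeg_carrier[OF Suc.prems(1)] by (simp add: m_assoc)
    ultimately show ?thesis using subringE(6)[OF C u'(1) u(1)] by blast
  qed
qed

lemma cancel_leading_pow:
  assumes s': "s' \<in> P\<^sub>d d" and l: "l \<in> C" and t: "t \<in> pimage R C x"
    and st: "(s' \<oplus> l \<otimes> x [^] d) [^] m \<otimes> t \<in> P\<^sub>d (m * d + e)"
  shows "\<exists>u\<in>C. u \<otimes> l = l \<and> u \<otimes> t \<in> P\<^sub>d e"
  using st t
proof (induction m arbitrary: t)
  case 0
  have "\<one> \<otimes> t \<in> P\<^sub>d e" using 0 subring_carrier[OF P 0(2)] by simp
  then show ?case using subringE(3)[OF C] CR[OF l] by (intro bexI[of _ \<one>]) auto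
next
  case (Suc m)
  define s where "s = s' \<oplus> l \<otimes> x [^] d"
  have "s \<in> P\<^sub>d (Suc d)" unfolding s_def pdeg_Suc using s' l by blast
  then have s: "s \<in> pimage R C x" using pdeg_pimage by blast
  have [simp]: "s \<in> carrier R" "t \<in> carrier R" using subring_carrier[OF P] s Suc by auto
  have st: "s [^] m \<otimes> t \<in> pimage R C x" using s Suc P by (simp add: subringE subring_pow)
  then obtain D where D: "s [^] m \<otimes> t \<in> P\<^sub>d D" using pimage_pdeg by blast
  have "s [^] Suc m \<otimes> t = s \<otimes> (s [^] m \<otimes> t)" by (simp add: m_ac)
  then have "s \<otimes> (s [^] m \<otimes> t) \<in> P\<^sub>d (d + (m * d + e))" using Suc.prems(1) unfolding s_def by (simp add: add_ac)
  then obtain u where u: "u \<in> C" "u \<otimes> l = l" "u \<otimes> (s [^] m \<otimes> t) \<in> P\<^sub>d (m * d + e)"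
    using cancel_leading[OF s' l D] unfolding s_def by blast
  have [simp]: "u \<in> carrier R" "l \<in> carrier R" using u l CR by auto
  have "s [^] m \<otimes> (u \<otimes> t) \<in> P\<^sub>d (m * d + e)" using u(3) by (simp add: m_lcomm)
  moreover have "u \<otimes> t \<in> pimage R C x" using u CP Suc P by (auto simp: subringE)
  ultimately obtain u' where u': "u' \<in> C" "u' \<otimes> l = l" "u' \<otimes> (u \<otimes> t) \<in> P\<^sub>d e"
    using Suc.IH unfolding s_def by blast
  have [simp]: "u' \<in> carrier R" using u' CR by blast
  have "(u' \<otimes> u) \<otimes> l = l" using u u' by (simp add: m_assoc)
  moreover have "(u' \<otimes> u) \<otimes> t \<in> P\<^sub>d e" using u'(3) by (simp add: m_assoc)
  ultimately show ?case using subringE(6)[OF C u'(1) u(1)] by blast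
qed

lemma pseudo_division:
  assumes s': "s' \<in> P\<^sub>d d" and l: "l \<in> C" and a: "a \<in> P\<^sub>d D"
  shows "\<exists>k. \<exists>q\<in>pimage R C x. \<exists>r\<in>P\<^sub>d d. l [^] (k::nat) \<otimes> a = q \<otimes> (s' \<oplus> l \<otimes> x [^] d) \<oplus> r"
  using a
proof (induction D arbitrary: a)
  case 0
  have s: "s' \<oplus> l \<otimes> x [^] d \<in> carrier R" using s' l CR pdeg_carrier x by auto
  have "a \<in> P\<^sub>d d" using 0 pdeg_mono[of 0 d] by auto
  moreover have "l [^] (0::nat) \<otimes> a = \<zero> \<otimes> (s' \<oplus> l \<otimes> x [^] d) \<oplus> a" using s pdeg_carrier[OF 0] by simp
  ultimately show ?case using subringE(2)[OF P] by blast
next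
  case (Suc D)
  define s where "s = s' \<oplus> l \<otimes> x [^] d"
  have s: "s \<in> P\<^sub>d (Suc d)" unfolding s_def pdeg_Suc using s' l by blast
  have sP: "s \<in> pimage R C x" using s pdeg_pimage by blast
  have [simp]: "s \<in> carrier R" "l \<in> carrier R" "s' \<in> carrier R" "x \<in> carrier R" "a \<in> carrier R"
    using pdeg_carrier[OF s] pdeg_carrier[OF s'] CR[OF l] x pdeg_carrier[OF Suc.prems] by auto
  show ?case
  proof (cases "Suc D \<le> d")
    case True
    then have "a \<in> P\<^sub>d d" using Suc pdeg_mono[of "Suc D" d] by auto
    moreover have "l [^] (0::nat) \<otimes> a = \<zero> \<otimes> s \<oplus> a" by simp
    ultimately show ?thesis using subringE(2)[OF P] unfolding s_def by blast
  next
    case False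
    then have dD: "d \<le> D" by simp
    obtain a' \<alpha> where a: "a' \<in> P\<^sub>d D" "\<alpha> \<in> C" "a = a' \<oplus> \<alpha> \<otimes> x [^] D" using Suc.prems unfolding pdeg_Suc by blast
    have [simp]: "a' \<in> carrier R" "\<alpha> \<in> carrier R" using a CR pdeg_carrier by auto
    define y where "y = \<alpha> \<otimes> x [^] (D - d)"
    have xP: "x [^] n \<in> pimage R C x" for n :: nat using subring_pow[OF P pimage_self[OF C x]] .
    have y: "y \<in> pimage R C x" unfolding y_def using xP a CP subringE(6)[OF P] by blast
    have [simp]: "y \<in> carrier R" using subring_carrier[OF P y] .
    have "x [^] D = x [^] (D - d) \<otimes> x [^] d" using dD by (simp add: nat_pow_mult)
    then have "l \<otimes> a \<ominus> y \<otimes> s = l \<otimes> a' \<ominus> \<alpha> \<otimes> (x [^] (D - d) \<otimes> s')"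
      unfolding a(3) s_def y_def by (simp add: ring_norm)
    moreover have "x [^] (D - d) \<otimes> s' \<in> P\<^sub>d D" using pdeg_shift_pow[OF s', of "D - d"] dD by simp
    ultimately have b: "l \<otimes> a \<ominus> y \<otimes> s \<in> P\<^sub>d D"
      using pdeg_minus pdeg_smult[OF l a(1)] pdeg_smult[OF a(2)] by simp
    obtain k q r where *: "q \<in> pimage R C x" "r \<in> P\<^sub>d d" "l [^] (k::nat) \<otimes> (l \<otimes> a \<ominus> y \<otimes> s) = q \<otimes> s \<oplus> r"
      using Suc.IH[OF b] unfolding s_def by blast
    have [simp]: "q \<in> carrier R" "r \<in> carrier R" using * subring_carrier[OF P] pdeg_carrier by auto
    have lk: "l [^] k \<in> pimage R C x" using subring_pow[OF C l] CP by blast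
    have "l [^] Suc k \<otimes> a = l [^] k \<otimes> (l \<otimes> a \<ominus> y \<otimes> s) \<oplus> (l [^] k \<otimes> y) \<otimes> s" by (simp add: ring_norm)
    also have "\<dots> = (q \<oplus> l [^] k \<otimes> y) \<otimes> s \<oplus> r" unfolding *(3) by (simp add: ring_norm)
    finally have "l [^] Suc k \<otimes> a = (q \<oplus> l [^] k \<otimes> y) \<otimes> s \<oplus> r" .
    moreover have "q \<oplus> l [^] k \<otimes> y \<in> pimage R C x"
      using *(1) y lk P by (simp add: sub_closed)
    ultimately show ?thesis using * unfolding s_def by blast
  qed
qed

end

context cring
begin

text \<open>The fraction \<open>r / s = c (a / s) - q\<close> is a polynomial in the integral
  element \<open>a / s\<close>, so all its powers have a common denominator \<open>s^n\<close>.
  Without fractions: the forms of degree \<open>n\<close> in \<open>a\<close> and \<open>s\<close>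
  play the part of \<open>s^n S[a / s]\<close>, and multiplying such a form by \<open>r\<close>
  yields \<open>s\<close> times such a form.\<close>

lemma dep_almost_integral:
  assumes S: "subring S R" and a: "a \<in> S" and s: "s \<in> S" and dep: "dep R S a s" and nontriv: "\<one> \<noteq> \<zero>"
  obtains n where "\<And>r c q m. c \<in> S \<Longrightarrow> q \<in> S \<Longrightarrow> r \<in> S \<Longrightarrow> c \<otimes> a = q \<otimes> s \<oplus> r \<Longrightarrow>
    \<exists>t\<in>S. r [^] (m::nat) \<otimes> s [^] (n::nat) = s [^] m \<otimes> t"
proof -
  note Sc = subring_carrier[OF S]
  have [simp]: "a \<in> carrier R" "s \<in> carrier R" using Sc a s by auto
  obtain cs where cs: "set cs \<subseteq> S" "hev R a s cs = \<zero>" using dep unfolding dep_def by blast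
  with nontriv obtain n where "length cs = Suc n" by (cases cs) auto
  then obtain g where g: "g \<in> forms R S a s n" "\<zero> = a [^] Suc n \<oplus> s \<otimes> g"
    using hev_eq_forms[OF S _ _ cs(1), of a s n] cs by auto
  note fc = forms_carrier[OF S \<open>a \<in> carrier R\<close> \<open>s \<in> carrier R\<close>]
  note fadd = forms_add_closed[OF S \<open>a \<in> carrier R\<close> \<open>s \<in> carrier R\<close>]
  have [simp]: "g \<in> carrier R" using fc[OF g(1)] .
  have an: "a [^] Suc n = s \<otimes> (\<ominus> g)"
    using g(2) by (simp add: r_minus eq_neg_iff del: nat_pow_Suc)
  \<comment> \<open>The pure power of \<open>a\<close> is separated from the terms divisible by
    \<open>s\<close>; the integral equation can then be applied to it.\<close>
  have split: "\<exists>k\<in>S. \<exists>w\<in>forms R S a s j. y = k \<otimes> a [^] Suc j \<oplus> s \<otimes> w" if "y \<in> forms R S a s (Suc j)" for y j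
    using that
  proof (induction j arbitrary: y)
    case 0
    then obtain h k where *: "h \<in> S" "k \<in> S" "y = a \<otimes> h \<oplus> k \<otimes> s [^] Suc 0" by auto
    then have "y = h \<otimes> a [^] Suc 0 \<oplus> s \<otimes> k" using Sc by (simp add: m_comm)
    then show ?case using * by auto
  next
    case (Suc j)
    then obtain h k where *: "h \<in> forms R S a s (Suc j)" "k \<in> S" "y = a \<otimes> h \<oplus> k \<otimes> s [^] Suc (Suc j)"
      unfolding forms.simps(2)[of _ _ _ _ "Suc j"] by blast
    obtain k' w where w: "k' \<in> S" "w \<in> forms R S a s j" "h = k' \<otimes> a [^] Suc j \<oplus> s \<otimes> w" using Suc.IH[OF *(1)] by blast
    have [simp]: "k \<in> carrier R" "k' \<in> carrier R" "w \<in> carrier R" using Sc * w fc by auto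
    have "y = k' \<otimes> a [^] Suc (Suc j) \<oplus> s \<otimes> (a \<otimes> w \<oplus> k \<otimes> s [^] Suc j)"
      unfolding * w by (simp add: ring_norm)
    moreover have "a \<otimes> w \<oplus> k \<otimes> s [^] Suc j \<in> forms R S a s (Suc j)" using w * by auto
    ultimately show ?case using w by blast
  qed
  have fS: "y \<in> S" if "y \<in> forms R S a s j" for y j
    using that
  proof (induction j arbitrary: y)
    case (Suc j)
    then show ?case using a s subringE(6,7)[OF S] subring_pow[OF S s] by (auto simp del: nat_pow_Suc)
  qed simp
  have one: "s [^] n \<in> forms R S a s n"
  proof -
    have "\<one> \<in> forms R S a s 0" using subringE(3)[OF S] by simp
    then show ?thesis using forms_mult_cpow[OF S, of a s \<one> 0 n] by simp
  qed
  have step: "\<exists>w'\<in>forms R S a s n. r \<otimes> w = s \<otimes> w'"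
    if *: "c \<in> S" "q \<in> S" "r \<in> S" "c \<otimes> a = q \<otimes> s \<oplus> r" and w: "w \<in> forms R S a s n" for r c q w
  proof -
    have [simp]: "c \<in> carrier R" "q \<in> carrier R" "r \<in> carrier R" "w \<in> carrier R" using * Sc fc[OF w] by auto
    obtain k v where v: "k \<in> S" "v \<in> forms R S a s n" "a \<otimes> w = k \<otimes> a [^] Suc n \<oplus> s \<otimes> v"
      using split[OF forms_mult_a[OF S _ _ w]] by auto
    have [simp]: "k \<in> carrier R" "v \<in> carrier R" using Sc v fc by auto
    have "r = c \<otimes> a \<ominus> q \<otimes> s" unfolding *(4) by (simp add: ring_norm)
    then have "r \<otimes> w = (c \<otimes> a \<ominus> q \<otimes> s) \<otimes> w" by (rule arg_cong)
    also have "\<dots> = c \<otimes> (a \<otimes> w) \<ominus> q \<otimes> s \<otimes> w" by (simp add: ring_norm)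
    also have "\<dots> = s \<otimes> (c \<otimes> (k \<otimes> (\<ominus> g) \<oplus> v) \<ominus> q \<otimes> w)" unfolding v(3) an by (simp add: ring_norm)
    finally have "r \<otimes> w = s \<otimes> (c \<otimes> (k \<otimes> (\<ominus> g) \<oplus> v) \<ominus> q \<otimes> w)" .
    moreover have "c \<otimes> (k \<otimes> (\<ominus> g) \<oplus> v) \<ominus> q \<otimes> w \<in> forms R S a s n"
      using * v w g forms_smult[OF S \<open>a \<in> carrier R\<close> \<open>s \<in> carrier R\<close>] add_closedD(3,4)[OF fadd] add_closed_minus[OF fadd]
      by meson
    ultimately show ?thesis by blast
  qed
  show ?thesis
  proof (rule that)
    fix r c q and m :: nat
    assume *: "c \<in> S" "q \<in> S" "r \<in> S" "c \<otimes> a = q \<otimes> s \<oplus> r"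
    have [simp]: "r \<in> carrier R" using * Sc by auto
    have "\<exists>w\<in>forms R S a s n. r [^] m \<otimes> s [^] n = s [^] m \<otimes> w"
    proof (induction m)
      case 0
      have "r [^] (0::nat) \<otimes> s [^] n = s [^] (0::nat) \<otimes> s [^] n" by simp
      then show ?case using one by blast
    next
      case (Suc m)
      then obtain w where w: "w \<in> forms R S a s n" "r [^] m \<otimes> s [^] n = s [^] m \<otimes> w" by blast
      obtain w' where w': "w' \<in> forms R S a s n" "r \<otimes> w = s \<otimes> w'" using step[OF * w(1)] by blast
      have [simp]: "w \<in> carrier R" "w' \<in> carrier R" using fc w w' by auto
      have "r [^] Suc m \<otimes> s [^] n = r \<otimes> (r [^] m \<otimes> s [^] n)" by (simp add: m_ac)
      also have "\<dots> = s [^] m \<otimes> (r \<otimes> w)" unfolding w by (simp add: m_ac)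
      also have "\<dots> = s [^] Suc m \<otimes> w'" unfolding w' by (simp add: m_ac)
      finally show ?case using w' by blast
    qed
    then show "\<exists>t\<in>S. r [^] m \<otimes> s [^] n = s [^] m \<otimes> t" using fS by blast
  qed
qed

end

context poly_ext
begin

text \<open>The denominator is \<open>s = s' + l x^d\<close>, and the induction is on its length.
  Pseudo-division gives \<open>l^k a = q s + r\<close> with \<open>r\<close> shorter than
  \<open>s\<close>; a degree count makes \<open>r\<close> vanish and \<open>pic_base\<close> removes
  the factor \<open>l^k\<close>, all this up to a multiplier \<open>U\<close> that fixes
  \<open>l\<close>. Under \<open>1 - U\<close> the leading coefficient disappears and the induction
  hypothesis applies.\<close>

lemma pic_poly_aux:
  assumes "s \<in> P\<^sub>d n" "a \<in> pimage R C x" "dep R (pimage R C x) a s" and nontriv: "\<one> \<noteq> \<zero>"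
  shows "\<exists>b\<in>pimage R C x. a = s \<otimes> b"
  using assms(1-3)
proof (induction n arbitrary: s a)
  case 0
  then show ?case using picD[OF pic_base _ zero_in_C] pdeg_0 by simp
next
  case (Suc d)
  let ?P = "pimage R C x"
  note Pc = subring_carrier[OF P]
  obtain s' l where s': "s' \<in> P\<^sub>d d" and l: "l \<in> C" and s_eq: "s = s' \<oplus> l \<otimes> x [^] d"
    using Suc.prems(1) unfolding pdeg_Suc by blast
  have s: "s \<in> ?P" and a: "a \<in> ?P" and lP: "l \<in> ?P" and dep: "dep R ?P a s"
    using Suc.prems pdeg_pimage CP l by auto
  have [simp]: "s \<in> carrier R" "a \<in> carrier R" "l \<in> carrier R" "s' \<in> carrier R" "x \<in> carrier R"
    using Pc[OF s] Pc[OF a] Pc[OF lP] pdeg_carrier[OF s'] x by auto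
  obtain n where n: "\<And>r c q m. c \<in> ?P \<Longrightarrow> q \<in> ?P \<Longrightarrow> r \<in> ?P \<Longrightarrow> c \<otimes> a = q \<otimes> s \<oplus> r \<Longrightarrow>
    \<exists>t\<in>?P. r [^] (m::nat) \<otimes> s [^] (n::nat) = s [^] m \<otimes> t"
    using dep_almost_integral[OF P a s dep nontriv] by blast
  obtain D where D: "a \<in> P\<^sub>d D" using pimage_pdeg[OF a] by blast
  obtain k q r where q: "q \<in> ?P" and r: "r \<in> P\<^sub>d d" and qr: "l [^] (k::nat) \<otimes> a = q \<otimes> s \<oplus> r"
    using pseudo_division[OF s' l D] unfolding s_eq by blast
  define c where "c = l [^] k"
  have c: "c \<in> C" unfolding c_def using subring_pow[OF C l] .
  have cP: "c \<in> ?P" and rP: "r \<in> ?P" using c CP r pdeg_pimage by auto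
  have [simp]: "q \<in> carrier R" "r \<in> carrier R" "c \<in> carrier R" using Pc q rP cP by auto
  have "\<exists>u\<in>C. u \<otimes> l = l \<and> u \<otimes> r = \<zero>"
  proof (cases d)
    case 0
    then have "\<one> \<otimes> r = \<zero>" using r pdeg_0 by simp
    then show ?thesis using subringE(3)[OF C] by (intro bexI[of _ \<one>]) auto
  next
    case (Suc d')
    \<comment> \<open>Large enough that \<open>r^m s^n\<close>, of degree at most
      \<open>m d' + n d\<close>, has degree below \<open>m d\<close>, since
      \<open>d = d' + 1\<close>. Being equal to \<open>s^m t\<close>, it forces \<open>t\<close> to
      vanish up to a multiplier.\<close>
    define m where "m = Suc (n * d)"
    obtain t where t: "t \<in> ?P" "r [^] m \<otimes> s [^] n = s [^] m \<otimes> t"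
      using n[OF cP q rP] qr unfolding c_def by blast
    have [simp]: "t \<in> carrier R" using Pc t by auto
    have "s [^] n \<in> P\<^sub>d (Suc (n * d))" using pdeg_pow Suc.prems(1) by blast
    moreover have "r [^] m \<in> P\<^sub>d (Suc (m * d'))" using pdeg_pow r Suc by simp
    ultimately have "r [^] m \<otimes> s [^] n \<in> P\<^sub>d (m * d' + Suc (n * d))" using pdeg_mult by blast
    moreover have "m * d' + Suc (n * d) = m * d + 0" unfolding Suc m_def by simp
    ultimately have "s [^] m \<otimes> t \<in> P\<^sub>d (m * d + 0)" unfolding t by simp
    then obtain u1 where u1: "u1 \<in> C" "u1 \<otimes> l = l" "u1 \<otimes> t \<in> P\<^sub>d 0"
      using cancel_leading_pow[OF s' l t(1)] unfolding s_eq by blast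
    have [simp]: "u1 \<in> carrier R" using CR u1 by blast
    \<comment> \<open>Now \<open>s^n\<close> is cancelled as well, and reducedness leads from
      \<open>r^m\<close> to \<open>r\<close>.\<close>
    have "s [^] n \<otimes> (u1 \<otimes> r [^] m) = u1 \<otimes> (r [^] m \<otimes> s [^] n)" by (simp add: m_ac)
    also have "\<dots> = s [^] m \<otimes> (u1 \<otimes> t)" unfolding t by (simp add: m_ac)
    also have "\<dots> = \<zero>" using u1(3) pdeg_0 by simp
    finally have "s [^] n \<otimes> (u1 \<otimes> r [^] m) \<in> P\<^sub>d (n * d + 0)" using pdeg_mono[of 0 "n * d"] pdeg_0 by auto
    moreover have "u1 \<otimes> r [^] m \<in> ?P" using u1 CP rP P by (auto simp: subringE subring_pow)
    ultimately obtain u2 where u2: "u2 \<in> C" "u2 \<otimes> l = l" "u2 \<otimes> (u1 \<otimes> r [^] m) \<in> P\<^sub>d 0"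
      using cancel_leading_pow[OF s' l] unfolding s_eq by blast
    have [simp]: "u2 \<in> carrier R" using CR u2 by blast
    have "r [^] m \<otimes> (u2 \<otimes> u1) = u2 \<otimes> (u1 \<otimes> r [^] m)" by (simp add: m_ac)
    then have "r [^] m \<otimes> (u2 \<otimes> u1) = \<zero>" using u2(3) pdeg_0 by simp
    moreover have u: "u2 \<otimes> u1 \<in> C" using u1 u2 subringE(6)[OF C] by blast
    ultimately have "r \<otimes> (u2 \<otimes> u1) = \<zero>" using reduced(2)[OF rP] CP by blast
    then have "(u2 \<otimes> u1) \<otimes> r = \<zero>" by (simp add: m_comm)
    moreover have "(u2 \<otimes> u1) \<otimes> l = l" using u1 u2 by (simp add: m_assoc)
    ultimately show ?thesis using u by blast
  qed
  then obtain u where u: "u \<in> C" "u \<otimes> l = l" "u \<otimes> r = \<zero>" by blast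
  have [simp]: "u \<in> carrier R" using CR u by blast
  have uP: "u \<in> ?P" using u CP by blast
  define b where "b = u \<otimes> q"
  have b: "b \<in> ?P" unfolding b_def using uP q subringE(6)[OF P] by blast
  have [simp]: "b \<in> carrier R" using Pc[OF b] .
  have "(c \<otimes> u) \<otimes> a = u \<otimes> (c \<otimes> a)" by (simp add: m_ac)
  also have "\<dots> = s \<otimes> b \<oplus> u \<otimes> r" using qr unfolding c_def[symmetric] b_def by (simp add: ring_norm)
  finally have cua: "(c \<otimes> u) \<otimes> a = s \<otimes> b" using u by simp
  obtain cs where cs: "set cs \<subseteq> ?P" "hev R a s cs = \<zero>" using dep unfolding dep_def by blast
  have csc: "set cs \<subseteq> carrier R" using cs Pc by blast
  have ne: "length cs > 0" using cs nontriv by (cases cs) auto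
  \<comment> \<open>By \<open>s b = c u a\<close> the pairs \<open>(b, c u)\<close> and
    \<open>(a, s)\<close> are proportional; once powers of \<open>s\<close> are cancelled, the
    equation of \<open>a\<close> over \<open>s\<close> becomes one of \<open>b\<close> over
    \<open>c u\<close>.\<close>
  define \<beta> where "\<beta> = hev R b (c \<otimes> u) cs"
  have cu: "c \<otimes> u \<in> ?P" using cP uP subringE(6)[OF P] by blast
  have \<beta>: "\<beta> \<in> ?P" unfolding \<beta>_def using hev_in_subring[OF P b cu cs(1)] .
  have [simp]: "\<beta> \<in> carrier R" using Pc[OF \<beta>] .
  have "s [^] length cs \<otimes> \<beta> = hev R (s \<otimes> b) (s \<otimes> (c \<otimes> u)) cs"
    unfolding \<beta>_def using csc by (intro hev_scale[symmetric]) auto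
  also have "\<dots> = hev R ((c \<otimes> u) \<otimes> a) ((c \<otimes> u) \<otimes> s) cs" unfolding cua by (simp add: m_comm)
  also have "\<dots> = (c \<otimes> u) [^] length cs \<otimes> hev R a s cs" using csc by (intro hev_scale) auto
  finally have "s [^] length cs \<otimes> \<beta> = \<zero>" using cs(2) by simp
  then have "s [^] length cs \<otimes> \<beta> \<in> P\<^sub>d (length cs * d + 0)" using pdeg_mono[of 0 "length cs * d"] pdeg_0 by auto
  then obtain u2 where u2: "u2 \<in> C" "u2 \<otimes> l = l" "u2 \<otimes> \<beta> \<in> P\<^sub>d 0"
    using cancel_leading_pow[OF s' l \<beta>] unfolding s_eq by blast
  have [simp]: "u2 \<in> carrier R" using CR u2 by blast
  have u2P: "u2 \<in> ?P" using u2 CP by blast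
  have "hev R (u2 \<otimes> b) (u2 \<otimes> (c \<otimes> u)) cs = u2 [^] length cs \<otimes> \<beta>"
    unfolding \<beta>_def using csc by (intro hev_scale) auto
  also have "\<dots> = u2 [^] (length cs - 1) \<otimes> (u2 \<otimes> \<beta>)" using ne by (cases "length cs") (auto simp: m_assoc)
  also have "\<dots> = \<zero>" using u2(3) pdeg_0 by simp
  finally have "hev R (u2 \<otimes> b) (u2 \<otimes> (c \<otimes> u)) cs = \<zero>" .
  then have "dep R ?P (u2 \<otimes> b) (u2 \<otimes> (c \<otimes> u))" using cs unfolding dep_def by blast
  moreover have "u2 \<otimes> (c \<otimes> u) = (u2 \<otimes> u) \<otimes> c" by (simp add: m_ac)
  ultimately have "dep R ?P (u2 \<otimes> b) c"
    using dep_of_multiple[OF P subringE(6)[OF P u2P b] cP subringE(6)[OF P u2P uP]] by simp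
  then obtain b' where b': "b' \<in> ?P" "u2 \<otimes> b = c \<otimes> b'"
    using picD[OF pic_base subringE(6)[OF P u2P b] c] by blast
  have [simp]: "b' \<in> carrier R" using Pc[OF b'(1)] .
  \<comment> \<open>The error of the candidate quotient \<open>b'\<close>. It is killed by
    \<open>c = l^k\<close>, hence by \<open>l\<close>, and a further multiplier removes it.\<close>
  define y where "y = u2 \<otimes> (u \<otimes> a) \<ominus> s \<otimes> b'"
  have y: "y \<in> ?P" unfolding y_def using P u2P uP a s b'(1) by (simp add: sub_closed)
  have [simp]: "y \<in> carrier R" using Pc[OF y] .
  have "c \<otimes> y = u2 \<otimes> ((c \<otimes> u) \<otimes> a) \<ominus> s \<otimes> (c \<otimes> b')" unfolding y_def by (simp add: ring_norm)
  also have "\<dots> = \<zero>" unfolding cua b'(2)[symmetric] by (simp add: m_lcomm)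
  finally have "l \<otimes> y = \<zero>" using reduced(2)[OF lP y] unfolding c_def by blast
  then obtain u3 where u3: "u3 \<in> C" "u3 \<otimes> l = l" "u3 \<otimes> y = \<zero>" using fix_annihilator[OF y l] by blast
  have [simp]: "u3 \<in> carrier R" using CR u3 by blast
  define U where "U = u3 \<otimes> (u2 \<otimes> u)"
  have UC: "U \<in> C" unfolding U_def using C u(1) u2(1) u3(1) by (simp add: sub_closed)
  have [simp]: "U \<in> carrier R" using CR UC by blast
  have "U \<otimes> l = u3 \<otimes> (u2 \<otimes> (u \<otimes> l))" unfolding U_def by (simp add: m_assoc)
  then have Ul: "U \<otimes> l = l" unfolding u(2) u2(2) u3(2) .
  have "U \<otimes> a = u3 \<otimes> y \<oplus> s \<otimes> (u3 \<otimes> b')" unfolding U_def y_def by (simp add: ring_norm)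
  then have Ua: "U \<otimes> a = s \<otimes> (u3 \<otimes> b')" using u3 by simp
  define V where "V = \<one> \<ominus> U"
  have VC: "V \<in> C" unfolding V_def using UC C by (simp add: sub_closed)
  have [simp]: "V \<in> carrier R" using CR VC by blast
  have VP: "V \<in> ?P" using VC CP by blast
  have "V \<otimes> l = l \<ominus> U \<otimes> l" unfolding V_def by (simp add: diff_mult1)
  then have Vl: "V \<otimes> l = \<zero>" unfolding Ul by simp
  have "V \<otimes> s = V \<otimes> s' \<oplus> (V \<otimes> l) \<otimes> x [^] d" unfolding s_eq by (simp add: ring_norm)
  then have Vs: "V \<otimes> s = V \<otimes> s'" unfolding Vl by simp
  have "\<exists>b\<in>?P. V \<otimes> a = (V \<otimes> s) \<otimes> b"
  proof (rule Suc.IH)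
    show "V \<otimes> s \<in> P\<^sub>d d" unfolding Vs using pdeg_smult[OF VC s'] .
    show "dep R ?P (V \<otimes> a) (V \<otimes> s)" by (rule dep_scale[OF P a s VP dep])
    show "V \<otimes> a \<in> ?P" using subringE(6)[OF P VP a] .
  qed
  then obtain b'' where b'': "b'' \<in> ?P" "V \<otimes> a = (V \<otimes> s) \<otimes> b''" by blast
  have [simp]: "b'' \<in> carrier R" using Pc[OF b''(1)] .
  have "a = U \<otimes> a \<oplus> V \<otimes> a" unfolding V_def by (simp add: ring_norm)
  also have "\<dots> = s \<otimes> (u3 \<otimes> b' \<oplus> V \<otimes> b'')" unfolding Ua b''(2) by (simp add: ring_norm)
  finally have "a = s \<otimes> (u3 \<otimes> b' \<oplus> V \<otimes> b'')" .
  moreover have "u3 \<otimes> b' \<oplus> V \<otimes> b'' \<in> ?P"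
    using u3(1) CP P b'(1) VP b''(1) by (auto simp: sub_closed)
  ultimately show ?case by blast
qed

lemma pic_poly: "pic R (pimage R C x)"
proof (cases "\<one> = \<zero>")
  case True
  then have "carrier R = {\<zero>}" using carrier_one_zero by blast
  then have "a = \<zero> \<otimes> \<zero>" if "a \<in> carrier R" for a using that by simp
  moreover have "s = \<zero>" if "s \<in> carrier R" for s using that \<open>carrier R = {\<zero>}\<close> by blast
  ultimately show ?thesis unfolding pic_on_def using subring_carrier[OF P] subringE(2)[OF P] by metis
next
  case False
  then show ?thesis unfolding pic_on_def using pic_poly_aux pimage_pdeg by blast
qed

end

section \<open>Homomorphisms and localizations\<close>

lemma hev_hom:
  assumes R: "cring R" and R': "cring R'" and h: "h \<in> ring_hom R R'"
    and [simp]: "a \<in> carrier R" "s \<in> carrier R" and "set cs \<subseteq> carrier R"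
  shows "h (hev R a s cs) = hev R' (h a) (h s) (map h cs)"
proof -
  interpret R: cring R by fact
  interpret R': cring R' by fact
  interpret h: ring_hom_cring R R' h using h by unfold_locales
  show ?thesis using assms(6) by (induction cs) (auto)
qed

lemma dep_hom:
  assumes "cring R" "cring R'" "h \<in> ring_hom R R'" "a \<in> carrier R" "s \<in> carrier R" "dep R (carrier R) a s"
  shows "dep R' (h ` carrier R) (h a) (h s)"
proof -
  interpret R: cring R by fact
  interpret R': cring R' by fact
  interpret h: ring_hom_cring R R' h using assms by unfold_locales
  obtain cs where cs: "set cs \<subseteq> carrier R" "hev R a s cs = \<zero>\<^bsub>R\<^esub>" using assms(6) unfolding dep_def by blast
  then have "hev R' (h a) (h s) (map h cs) = \<zero>\<^bsub>R'\<^esub>"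
    using hev_hom[OF assms(1-5) cs(1)] by simp
  then show ?thesis unfolding dep_def using cs by (intro exI[of _ "map h cs"]) auto
qed

lemma list_in_image: "set ds \<subseteq> f ` A \<Longrightarrow> \<exists>cs. set cs \<subseteq> A \<and> map f cs = ds"
proof (induction ds)
  case (Cons d ds)
  then obtain a cs where "a \<in> A" "d = f a" "set cs \<subseteq> A" "map f cs = ds" by auto
  then show ?case by (intro exI[of _ "a # cs"]) auto
qed simp

lemma dep_hom_inj:
  assumes "cring R" "cring R'" "h \<in> ring_hom R R'" "inj_on h (carrier R)" "a \<in> carrier R" "s \<in> carrier R"
    and "dep R' (h ` carrier R) (h a) (h s)"
  shows "dep R (carrier R) a s"
proof -
  interpret R: cring R by fact
  interpret R': cring R' by fact
  interpret h: ring_hom_cring R R' h using assms by unfold_locales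
  obtain ds where ds: "set ds \<subseteq> h ` carrier R" "hev R' (h a) (h s) ds = \<zero>\<^bsub>R'\<^esub>" using assms(7) unfolding dep_def by blast
  obtain cs where cs: "set cs \<subseteq> carrier R" "map h cs = ds" using list_in_image[OF ds(1)] by blast
  have hz: "h (hev R a s cs) = h \<zero>\<^bsub>R\<^esub>" using hev_hom[OF assms(1-3,5,6) cs(1)] ds cs by simp
  then have "hev R a s cs = \<zero>\<^bsub>R\<^esub>" using inj_onD[OF assms(4) hz] assms(5,6) cs(1) by simp
  then show ?thesis unfolding dep_def using cs by blast
qed

lemma pic_hom_inj:
  assumes "cring R" "cring R'" "h \<in> ring_hom R R'" "inj_on h (carrier R)"
  shows "pic R (carrier R) \<longleftrightarrow> pic R' (h ` carrier R)"
proof -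
  interpret R: cring R by fact
  interpret R': cring R' by fact
  interpret h: ring_hom_cring R R' h using assms by unfold_locales
  show ?thesis
  proof
    assume p: "pic R (carrier R)"
    show "pic R' (h ` carrier R)"
      unfolding pic_on_def
    proof (intro ballI impI)
      fix a' s' assume "a' \<in> h ` carrier R" "s' \<in> h ` carrier R" and dep: "dep R' (h ` carrier R) a' s'"
      then obtain a s where as: "a \<in> carrier R" "a' = h a" "s \<in> carrier R" "s' = h s" by blast
      then have "dep R (carrier R) a s" using dep_hom_inj[OF assms as(1,3)] dep by simp
      then obtain b where "b \<in> carrier R" "a = s \<otimes>\<^bsub>R\<^esub> b" using picD[OF p as(1,3)] by blast
      then have "h b \<in> h ` carrier R" "a' = s' \<otimes>\<^bsub>R'\<^esub> h b" using as by auto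
      then show "\<exists>b\<in>h ` carrier R. a' = s' \<otimes>\<^bsub>R'\<^esub> b" by blast
    qed
  next
    assume p: "pic R' (h ` carrier R)"
    show "pic R (carrier R)"
      unfolding pic_on_def
    proof (intro ballI impI)
      fix a s assume as: "a \<in> carrier R" "s \<in> carrier R" and dep: "dep R (carrier R) a s"
      obtain b where b: "b \<in> carrier R" "h a = h s \<otimes>\<^bsub>R'\<^esub> h b"
        using picD[OF p _ _ dep_hom[OF assms(1-3) as dep]] as by blast
      then have "h a = h (s \<otimes>\<^bsub>R\<^esub> b)" using as by simp
      then have "a = s \<otimes>\<^bsub>R\<^esub> b" using inj_onD[OF assms(4)] as b by auto
      then show "\<exists>b\<in>carrier R. a = s \<otimes>\<^bsub>R\<^esub> b" using b by blast
    qed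
  qed
qed

section \<open>Localization of commutative rings\<close>

locale mult_set = cring +
  fixes S
  assumes S_subset: "S \<subseteq> carrier R" and S_one: "\<one> \<in> S"
    and S_mult: "\<And>s t. s \<in> S \<Longrightarrow> t \<in> S \<Longrightarrow> s \<otimes> t \<in> S"
begin

lemma S_carrier [simp]: "s \<in> S \<Longrightarrow> s \<in> carrier R" using S_subset by blast

lemma loc_rel_iff:
  "((a, s), (b, t)) \<in> loc_rel R S \<longleftrightarrow> a \<in> carrier R \<and> b \<in> carrier R \<and> s \<in> S \<and> t \<in> S \<and>
     (\<exists>u\<in>S. u \<otimes> (t \<otimes> a) = u \<otimes> (s \<otimes> b))"
  unfolding loc_rel_def by auto

lemma loc_rel_equiv: "equiv (carrier R \<times> S) (loc_rel R S)"
proof (rule equivI)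
  show "loc_rel R S \<subseteq> (carrier R \<times> S) \<times> (carrier R \<times> S)" unfolding loc_rel_def by auto
  show "refl_on (carrier R \<times> S) (loc_rel R S)"
    unfolding refl_on_def using S_one by (auto simp: loc_rel_iff)
  show "sym (loc_rel R S)" unfolding sym_def loc_rel_def by (auto, metis)
  show "trans (loc_rel R S)"
    unfolding trans_def
  proof clarify
    fix a s b t c r assume "((a, s), (b, t)) \<in> loc_rel R S" "((b, t), (c, r)) \<in> loc_rel R S"
    then obtain u v where *: "a \<in> carrier R" "b \<in> carrier R" "c \<in> carrier R" "s \<in> S" "t \<in> S" "r \<in> S" "u \<in> S" "v \<in> S"
      "u \<otimes> (t \<otimes> a) = u \<otimes> (s \<otimes> b)" "v \<otimes> (r \<otimes> b) = v \<otimes> (t \<otimes> c)" unfolding loc_rel_iff by blast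
    have "(u \<otimes> v \<otimes> t) \<otimes> (r \<otimes> a) = (v \<otimes> r) \<otimes> (u \<otimes> (t \<otimes> a))" using *(1-8) by (simp add: m_ac)
    also have "\<dots> = (u \<otimes> s) \<otimes> (v \<otimes> (r \<otimes> b))" unfolding *(9) using *(1-8) by (simp add: m_ac)
    also have "\<dots> = (u \<otimes> v \<otimes> t) \<otimes> (s \<otimes> c)" unfolding *(10) using *(1-8) by (simp add: m_ac)
    finally show "((a, s), (c, r)) \<in> loc_rel R S"
      unfolding loc_rel_iff using * S_mult by blast
  qed
qed

abbreviation fr where "fr \<equiv> loc_frac R S"
abbreviation Loc where "Loc \<equiv> localization R S"

lemma fr_eq_iff:
  "\<lbrakk>a \<in> carrier R; b \<in> carrier R; s \<in> S; t \<in> S\<rbrakk> \<Longrightarrow> fr a s = fr b t \<longleftrightarrow> (\<exists>u\<in>S. u \<otimes> (t \<otimes> a) = u \<otimes> (s \<otimes> b))"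
  unfolding loc_frac_def using eq_equiv_class_iff[OF loc_rel_equiv, of "(a, s)" "(b, t)"] loc_rel_iff by auto

lemma fr_eqI: "\<lbrakk>a \<in> carrier R; b \<in> carrier R; s \<in> S; t \<in> S; t \<otimes> a = s \<otimes> b\<rbrakk> \<Longrightarrow> fr a s = fr b t"
  using fr_eq_iff S_one by auto

lemma fr_eqI2: "\<lbrakk>a \<in> carrier R; b \<in> carrier R; s \<in> S; t \<in> S; u \<in> S; u \<otimes> (t \<otimes> a) = u \<otimes> (s \<otimes> b)\<rbrakk> \<Longrightarrow> fr a s = fr b t"
  using fr_eq_iff by blast

lemma fr_mem: "\<lbrakk>a \<in> carrier R; s \<in> S; (b, t) \<in> fr a s\<rbrakk> \<Longrightarrow> b \<in> carrier R \<and> t \<in> S \<and> fr b t = fr a s"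
  unfolding loc_frac_def
  using equiv_class_eq[OF loc_rel_equiv, of "(a, s)" "(b, t)"] loc_rel_iff by auto

lemma fr_self: "\<lbrakk>a \<in> carrier R; s \<in> S\<rbrakk> \<Longrightarrow> (a, s) \<in> fr a s"
  unfolding loc_frac_def using equiv_class_self[OF loc_rel_equiv] by auto

lemma fr_UN2:
  assumes "a \<in> carrier R" "s \<in> S" "b \<in> carrier R" "t \<in> S"
    and "\<And>a' s' b' t'. (a', s') \<in> fr a s \<Longrightarrow> (b', t') \<in> fr b t \<Longrightarrow> F a' s' b' t' = F a s b t"
  shows "(\<Union>(a', s')\<in>fr a s. \<Union>(b', t')\<in>fr b t. F a' s' b' t') = F a s b t"
  using fr_self[OF assms(1,2)] fr_self[OF assms(3,4)] assms(5) by fast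

lemma Loc_carrier: "z \<in> carrier Loc \<longleftrightarrow> (\<exists>a\<in>carrier R. \<exists>s\<in>S. z = fr a s)"
  unfolding localization_def loc_frac_def quotient_def by auto

lemma fr_closed [simp]: "a \<in> carrier R \<Longrightarrow> s \<in> S \<Longrightarrow> fr a s \<in> carrier Loc"
  unfolding Loc_carrier by blast

lemma fr_mult:
  assumes [simp]: "a \<in> carrier R" "s \<in> S" "b \<in> carrier R" "t \<in> S"
  shows "fr a s \<otimes>\<^bsub>Loc\<^esub> fr b t = fr (a \<otimes> b) (s \<otimes> t)"
  unfolding localization_def monoid.simps
proof (rule fr_UN2[OF assms])
  fix a' s' b' t' assume "(a', s') \<in> fr a s" "(b', t') \<in> fr b t"
  then have *: "a' \<in> carrier R" "s' \<in> S" "b' \<in> carrier R" "t' \<in> S" "fr a' s' = fr a s" "fr b' t' = fr b t"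
    using fr_mem assms by blast+
  then obtain u v where uv: "u \<in> S" "v \<in> S" "u \<otimes> (s \<otimes> a') = u \<otimes> (s' \<otimes> a)" "v \<otimes> (t \<otimes> b') = v \<otimes> (t' \<otimes> b)"
    using fr_eq_iff by (meson assms)
  have "(u \<otimes> v) \<otimes> ((s \<otimes> t) \<otimes> (a' \<otimes> b')) = (u \<otimes> (s \<otimes> a')) \<otimes> (v \<otimes> (t \<otimes> b'))" using * uv(1,2) by (simp add: m_ac)
  also have "\<dots> = (u \<otimes> v) \<otimes> ((s' \<otimes> t') \<otimes> (a \<otimes> b))" unfolding uv using * uv(1,2) by (simp add: m_ac)
  finally show "fr (a' \<otimes> b') (s' \<otimes> t') = fr (a \<otimes> b) (s \<otimes> t)"
    by (rule fr_eqI2[OF _ _ _ _ S_mult[OF uv(1,2)], rotated 4]) (use *(1-4) S_mult in simp_all)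
qed

lemma fr_add:
  assumes [simp]: "a \<in> carrier R" "s \<in> S" "b \<in> carrier R" "t \<in> S"
  shows "fr a s \<oplus>\<^bsub>Loc\<^esub> fr b t = fr (t \<otimes> a \<oplus> s \<otimes> b) (s \<otimes> t)"
  unfolding localization_def ring_record_simps
proof (rule fr_UN2[OF assms])
  fix a' s' b' t' assume "(a', s') \<in> fr a s" "(b', t') \<in> fr b t"
  then have *: "a' \<in> carrier R" "s' \<in> S" "b' \<in> carrier R" "t' \<in> S" "fr a' s' = fr a s" "fr b' t' = fr b t"
    using fr_mem assms by blast+
  then obtain u v where uv: "u \<in> S" "v \<in> S" "u \<otimes> (s \<otimes> a') = u \<otimes> (s' \<otimes> a)" "v \<otimes> (t \<otimes> b') = v \<otimes> (t' \<otimes> b)"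
    using fr_eq_iff by (meson assms)
  have "(u \<otimes> v) \<otimes> ((s \<otimes> t) \<otimes> (t' \<otimes> a' \<oplus> s' \<otimes> b')) = (v \<otimes> t \<otimes> t') \<otimes> (u \<otimes> (s \<otimes> a')) \<oplus> (u \<otimes> s \<otimes> s') \<otimes> (v \<otimes> (t \<otimes> b'))"
    using * uv(1,2) by (simp add: ring_norm)
  also have "\<dots> = (u \<otimes> v) \<otimes> ((s' \<otimes> t') \<otimes> (t \<otimes> a \<oplus> s \<otimes> b))" unfolding uv using * uv(1,2) by (simp add: ring_norm)
  finally show "fr (t' \<otimes> a' \<oplus> s' \<otimes> b') (s' \<otimes> t') = fr (t \<otimes> a \<oplus> s \<otimes> b) (s \<otimes> t)"
    by (rule fr_eqI2[OF _ _ _ _ S_mult[OF uv(1,2)], rotated 4]) (use *(1-4) S_mult in simp_all)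
qed

lemma Loc_one: "\<one>\<^bsub>Loc\<^esub> = fr \<one> \<one>" and Loc_zero: "\<zero>\<^bsub>Loc\<^esub> = fr \<zero> \<one>"
  unfolding localization_def by simp_all

lemma Loc_cring: "cring Loc"
proof (rule cringI)
  note [simp] = S_one S_mult fr_mult fr_add Loc_one Loc_zero
  show "abelian_group Loc"
  proof (rule abelian_groupI)
    fix x y z assume "x \<in> carrier Loc" "y \<in> carrier Loc" "z \<in> carrier Loc"
    then obtain a s b t c r where *: "a \<in> carrier R" "s \<in> S" "x = fr a s" "b \<in> carrier R" "t \<in> S" "y = fr b t"
      "c \<in> carrier R" "r \<in> S" "z = fr c r" unfolding Loc_carrier by blast
    show "x \<oplus>\<^bsub>Loc\<^esub> y \<oplus>\<^bsub>Loc\<^esub> z = x \<oplus>\<^bsub>Loc\<^esub> (y \<oplus>\<^bsub>Loc\<^esub> z)"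
      using * by (auto intro!: fr_eqI simp: ring_norm)
  next
    fix x y assume "x \<in> carrier Loc" "y \<in> carrier Loc"
    then obtain a s b t where *: "a \<in> carrier R" "s \<in> S" "x = fr a s" "b \<in> carrier R" "t \<in> S" "y = fr b t"
      unfolding Loc_carrier by blast
    show "x \<oplus>\<^bsub>Loc\<^esub> y \<in> carrier Loc" using * by simp
    show "x \<oplus>\<^bsub>Loc\<^esub> y = y \<oplus>\<^bsub>Loc\<^esub> x" using * by (auto intro!: fr_eqI simp: ring_norm)
  next
    fix x assume "x \<in> carrier Loc"
    then obtain a s where *: "a \<in> carrier R" "s \<in> S" "x = fr a s" unfolding Loc_carrier by blast
    show "\<zero>\<^bsub>Loc\<^esub> \<oplus>\<^bsub>Loc\<^esub> x = x" using * by simp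
    have "fr (\<ominus> a) s \<oplus>\<^bsub>Loc\<^esub> x = \<zero>\<^bsub>Loc\<^esub>" using * by (simp add: r_minus l_neg) (rule fr_eqI, auto)
    then show "\<exists>y\<in>carrier Loc. y \<oplus>\<^bsub>Loc\<^esub> x = \<zero>\<^bsub>Loc\<^esub>" using * by (intro bexI[of _ "fr (\<ominus> a) s"]) auto
  qed simp
  show "comm_monoid Loc"
  proof (rule comm_monoidI)
    fix x y z assume "x \<in> carrier Loc" "y \<in> carrier Loc" "z \<in> carrier Loc"
    then obtain a s b t c r where *: "a \<in> carrier R" "s \<in> S" "x = fr a s" "b \<in> carrier R" "t \<in> S" "y = fr b t"
      "c \<in> carrier R" "r \<in> S" "z = fr c r" unfolding Loc_carrier by blast
    show "x \<otimes>\<^bsub>Loc\<^esub> y \<otimes>\<^bsub>Loc\<^esub> z = x \<otimes>\<^bsub>Loc\<^esub> (y \<otimes>\<^bsub>Loc\<^esub> z)" using * by (simp add: m_assoc)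
  next
    fix x y assume "x \<in> carrier Loc" "y \<in> carrier Loc"
    then obtain a s b t where *: "a \<in> carrier R" "s \<in> S" "x = fr a s" "b \<in> carrier R" "t \<in> S" "y = fr b t"
      unfolding Loc_carrier by blast
    show "x \<otimes>\<^bsub>Loc\<^esub> y \<in> carrier Loc" using * by simp
    show "x \<otimes>\<^bsub>Loc\<^esub> y = y \<otimes>\<^bsub>Loc\<^esub> x" using * by (simp add: m_comm)
  next
    fix x assume "x \<in> carrier Loc"
    then obtain a s where *: "a \<in> carrier R" "s \<in> S" "x = fr a s" unfolding Loc_carrier by blast
    show "\<one>\<^bsub>Loc\<^esub> \<otimes>\<^bsub>Loc\<^esub> x = x" using * by simp
  qed simp
  fix x y z assume "x \<in> carrier Loc" "y \<in> carrier Loc" "z \<in> carrier Loc"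
  then obtain a s b t c r where *: "a \<in> carrier R" "s \<in> S" "x = fr a s" "b \<in> carrier R" "t \<in> S" "y = fr b t"
    "c \<in> carrier R" "r \<in> S" "z = fr c r" unfolding Loc_carrier by blast
  show "(x \<oplus>\<^bsub>Loc\<^esub> y) \<otimes>\<^bsub>Loc\<^esub> z = x \<otimes>\<^bsub>Loc\<^esub> z \<oplus>\<^bsub>Loc\<^esub> y \<otimes>\<^bsub>Loc\<^esub> z"
    using * by simp (rule fr_eqI, auto simp: ring_norm)
qed

lemma Loc_hom: "(\<lambda>a. fr a \<one>) \<in> ring_hom R Loc"
  by (rule ring_hom_memI) (use S_one in \<open>auto simp: fr_mult fr_add Loc_one\<close>)

lemma Loc_inverse:
  assumes "a \<in> carrier R" "s \<in> S"
  shows "fr s \<one> \<otimes>\<^bsub>Loc\<^esub> fr a s = fr a \<one>" "fr s \<one> \<otimes>\<^bsub>Loc\<^esub> fr \<one> s = \<one>\<^bsub>Loc\<^esub>"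
  using assms S_one S_mult by (simp_all add: fr_mult Loc_one) (rule fr_eqI; simp)+

lemma Loc_kernel: "a \<in> carrier R \<Longrightarrow> fr a \<one> = \<zero>\<^bsub>Loc\<^esub> \<Longrightarrow> \<exists>u\<in>S. u \<otimes> a = \<zero>"
  unfolding Loc_zero using S_one by (auto simp: fr_eq_iff)

end

text \<open>Localization by its characteristic properties. Besides \<open>localization\<close>
  itself, this covers the passage from \<open>R \<otimes> M[x]\<close> to
  \<open>R \<otimes> M(x)\<close> inside a fixed ring, where \<open>h\<close> is an
  inclusion.\<close>

locale fractions = A: cring A + D: cring D for A (structure) and D (structure) and h S +
  assumes h: "h \<in> ring_hom A D" and S_sub: "S \<subseteq> carrier A"
    and S1: "\<one>\<^bsub>A\<^esub> \<in> S" and SM: "\<And>s t. s \<in> S \<Longrightarrow> t \<in> S \<Longrightarrow> s \<otimes>\<^bsub>A\<^esub> t \<in> S"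
    and units: "\<And>s. s \<in> S \<Longrightarrow> h s \<in> Units D"
    and repr: "\<And>z. z \<in> carrier D \<Longrightarrow> \<exists>a\<in>carrier A. \<exists>s\<in>S. h s \<otimes>\<^bsub>D\<^esub> z = h a"
    and ker: "\<And>a. a \<in> carrier A \<Longrightarrow> h a = \<zero>\<^bsub>D\<^esub> \<Longrightarrow> \<exists>u\<in>S. u \<otimes>\<^bsub>A\<^esub> a = \<zero>\<^bsub>A\<^esub>"
begin

sublocale h: ring_hom_cring A D h using h by unfold_locales

lemma SA: "s \<in> S \<Longrightarrow> s \<in> carrier A" using S_sub by blast

lemma unit_cancel: "s \<in> S \<Longrightarrow> y \<in> carrier D \<Longrightarrow> z \<in> carrier D \<Longrightarrow> h s \<otimes>\<^bsub>D\<^esub> y = h s \<otimes>\<^bsub>D\<^esub> z \<Longrightarrow> y = z"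
  using units D.Units_l_cancel by blast

lemma common_denominator:
  "set ds \<subseteq> carrier D \<Longrightarrow> \<exists>w\<in>S. \<forall>d\<in>set ds. \<exists>k\<in>carrier A. h w \<otimes>\<^bsub>D\<^esub> d = h k"
proof (induction ds)
  case Nil
  then show ?case using S1 by auto
next
  case (Cons d ds)
  then obtain w where w: "w \<in> S" "\<forall>d\<in>set ds. \<exists>k\<in>carrier A. h w \<otimes>\<^bsub>D\<^esub> d = h k" by auto
  obtain a s where a: "a \<in> carrier A" "s \<in> S" "h s \<otimes>\<^bsub>D\<^esub> d = h a" using repr Cons by (metis insert_subset list.simps(15))
  have "\<exists>k\<in>carrier A. h (w \<otimes>\<^bsub>A\<^esub> s) \<otimes>\<^bsub>D\<^esub> d' = h k" if d': "d' \<in> set (d # ds)" for d'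
  proof (cases "d' = d")
    case True
    then have "h (w \<otimes>\<^bsub>A\<^esub> s) \<otimes>\<^bsub>D\<^esub> d' = h (w \<otimes>\<^bsub>A\<^esub> a)"
      using Cons.prems a w SA by (simp add: D.m_assoc)
    then show ?thesis using a w SA by blast
  next
    case False
    then obtain k where k: "k \<in> carrier A" "h w \<otimes>\<^bsub>D\<^esub> d' = h k" using w d' by auto
    have [simp]: "d' \<in> carrier D" using d' Cons.prems by blast
    have "h (w \<otimes>\<^bsub>A\<^esub> s) \<otimes>\<^bsub>D\<^esub> d' = h s \<otimes>\<^bsub>D\<^esub> (h w \<otimes>\<^bsub>D\<^esub> d')" using a w SA by (simp add: D.m_ac)
    also have "\<dots> = h (s \<otimes>\<^bsub>A\<^esub> k)" unfolding k using k a SA by simp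
    finally show ?thesis using k a SA by blast
  qed
  then show ?case using SM[OF w(1) a(2)] by blast
qed

text \<open>Denominators are cleared in three stages: a common \<open>q\<close> for the two
  elements, a \<open>w\<close> for the coefficients, and a \<open>u\<close> that turns vanishing in
  \<open>D\<close> into vanishing in \<open>A\<close>. The quotient found in \<open>A\<close> is
  then divided by \<open>u w\<close>.\<close>

lemma pic_fractions:
  assumes p: "pic A (carrier A)"
  shows "pic D (carrier D)"
  unfolding pic_on_def
proof (intro ballI impI)
  fix \<alpha> \<beta> assume \<alpha>[simp]: "\<alpha> \<in> carrier D" and \<beta>[simp]: "\<beta> \<in> carrier D" and dep: "dep D (carrier D) \<alpha> \<beta>"
  obtain a0 s where as: "a0 \<in> carrier A" "s \<in> S" "h s \<otimes>\<^bsub>D\<^esub> \<alpha> = h a0" using repr[OF \<alpha>] by blast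
  obtain b0 t where bt: "b0 \<in> carrier A" "t \<in> S" "h t \<otimes>\<^bsub>D\<^esub> \<beta> = h b0" using repr[OF \<beta>] by blast
  define q where "q = s \<otimes>\<^bsub>A\<^esub> t"
  have q: "q \<in> S" unfolding q_def using SM as bt by blast
  note [simp] = SA[OF as(2)] SA[OF bt(2)] SA[OF q] as(1) bt(1)
  define a where "a = t \<otimes>\<^bsub>A\<^esub> a0"
  define b where "b = s \<otimes>\<^bsub>A\<^esub> b0"
  have [simp]: "a \<in> carrier A" "b \<in> carrier A" unfolding a_def b_def by auto
  have "h q \<otimes>\<^bsub>D\<^esub> \<alpha> = h t \<otimes>\<^bsub>D\<^esub> (h s \<otimes>\<^bsub>D\<^esub> \<alpha>)" unfolding q_def by (simp add: D.m_ac)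
  then have qa: "h q \<otimes>\<^bsub>D\<^esub> \<alpha> = h a" unfolding as a_def by simp
  have "h q \<otimes>\<^bsub>D\<^esub> \<beta> = h s \<otimes>\<^bsub>D\<^esub> (h t \<otimes>\<^bsub>D\<^esub> \<beta>)" unfolding q_def by (simp add: D.m_ac)
  then have qb: "h q \<otimes>\<^bsub>D\<^esub> \<beta> = h b" unfolding bt b_def by simp
  have "dep D (carrier D) (h a) (h b)"
    using D.dep_scale[OF D.carrier_is_subring \<alpha> \<beta> _ dep, of "h q"] unfolding qa qb by simp
  then obtain ds where ds: "set ds \<subseteq> carrier D" "hev D (h a) (h b) ds = \<zero>\<^bsub>D\<^esub>" unfolding dep_def by blast
  obtain w where w: "w \<in> S" "\<forall>d\<in>set ds. \<exists>k\<in>carrier A. h w \<otimes>\<^bsub>D\<^esub> d = h k" using common_denominator[OF ds(1)] by blast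
  have [simp]: "w \<in> carrier A" using SA w by blast
  have ex: "\<exists>ks. set ks \<subseteq> carrier A \<and> map h ks = scl D (h w) es" if "set es \<subseteq> set ds" for es
    using that
  proof (induction es)
    case Nil
    then show ?case by (intro exI[of _ "[]"]) auto
  next
    case (Cons e es)
    then obtain ks where ks: "set ks \<subseteq> carrier A" "map h ks = scl D (h w) es" by auto
    have e [simp]: "e \<in> carrier D" using Cons ds by auto
    obtain k where k: "k \<in> carrier A" "h w \<otimes>\<^bsub>D\<^esub> e = h k" using w Cons by auto
    have "e \<otimes>\<^bsub>D\<^esub> h w [^]\<^bsub>D\<^esub> Suc (length es) = (h w \<otimes>\<^bsub>D\<^esub> e) \<otimes>\<^bsub>D\<^esub> h w [^]\<^bsub>D\<^esub> length es"
      by (simp add: D.m_ac)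
    also have "\<dots> = h (k \<otimes>\<^bsub>A\<^esub> w [^]\<^bsub>A\<^esub> length es)" unfolding k using k by simp
    finally show ?case using ks k by (intro exI[of _ "(k \<otimes>\<^bsub>A\<^esub> w [^]\<^bsub>A\<^esub> length es) # ks"]) auto
  qed
  obtain ks where ks: "set ks \<subseteq> carrier A" "map h ks = scl D (h w) ds" using ex[OF subset_refl] by blast
  have "h (hev A (w \<otimes>\<^bsub>A\<^esub> a) b ks) = hev D (h w \<otimes>\<^bsub>D\<^esub> h a) (h b) (scl D (h w) ds)"
    using hev_hom[OF A.cring_axioms D.cring_axioms h _ _ ks(1), of "w \<otimes>\<^bsub>A\<^esub> a" b] ks by simp
  also have "\<dots> = hev D (h w \<otimes>\<^bsub>D\<^esub> h a) (h w \<otimes>\<^bsub>D\<^esub> h b) ds"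
    using ds by (intro D.hev_scl[symmetric]) auto
  also have "\<dots> = \<zero>\<^bsub>D\<^esub>" using ds by (subst D.hev_scale) auto
  finally obtain u where u: "u \<in> S" "u \<otimes>\<^bsub>A\<^esub> hev A (w \<otimes>\<^bsub>A\<^esub> a) b ks = \<zero>\<^bsub>A\<^esub>"
    using ker[of "hev A (w \<otimes>\<^bsub>A\<^esub> a) b ks"] ks by auto
  have [simp]: "u \<in> carrier A" using SA u by blast
  note ks(1)[simp]
  \<comment> \<open>The additional zero coefficient raises the degree, so that a factor
    \<open>u\<close> is available to annihilate the equation even if \<open>ks\<close> is
    empty.\<close>
  define ks' where "ks' = \<zero>\<^bsub>A\<^esub> # ks"
  have ks': "set ks' \<subseteq> carrier A" unfolding ks'_def using ks by auto
  have [simp]: "hev A (w \<otimes>\<^bsub>A\<^esub> a) b ks \<in> carrier A" using ks by auto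
  have "hev A (u \<otimes>\<^bsub>A\<^esub> (w \<otimes>\<^bsub>A\<^esub> a)) (u \<otimes>\<^bsub>A\<^esub> b) ks' = u [^]\<^bsub>A\<^esub> length ks' \<otimes>\<^bsub>A\<^esub> hev A (w \<otimes>\<^bsub>A\<^esub> a) b ks'"
    using ks' by (intro A.hev_scale) auto
  also have "\<dots> = u [^]\<^bsub>A\<^esub> length ks \<otimes>\<^bsub>A\<^esub> (w \<otimes>\<^bsub>A\<^esub> a) \<otimes>\<^bsub>A\<^esub> (u \<otimes>\<^bsub>A\<^esub> hev A (w \<otimes>\<^bsub>A\<^esub> a) b ks)"
    unfolding ks'_def by (simp add: A.ring_norm)
  finally have "hev A (u \<otimes>\<^bsub>A\<^esub> (w \<otimes>\<^bsub>A\<^esub> a)) (u \<otimes>\<^bsub>A\<^esub> b) ks' = \<zero>\<^bsub>A\<^esub>" using u by simp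
  then have "dep A (carrier A) (u \<otimes>\<^bsub>A\<^esub> (w \<otimes>\<^bsub>A\<^esub> a)) (u \<otimes>\<^bsub>A\<^esub> b)" unfolding dep_def using ks' by blast
  then have "dep A (carrier A) (u \<otimes>\<^bsub>A\<^esub> (w \<otimes>\<^bsub>A\<^esub> a)) b"
    by (intro A.dep_of_multiple[OF A.carrier_is_subring, of _ b u]) auto
  then obtain c where c: "c \<in> carrier A" "u \<otimes>\<^bsub>A\<^esub> (w \<otimes>\<^bsub>A\<^esub> a) = b \<otimes>\<^bsub>A\<^esub> c" using picD[OF p] by (meson A.m_closed \<open>a \<in> carrier A\<close> \<open>b \<in> carrier A\<close> \<open>u \<in> carrier A\<close> \<open>w \<in> carrier A\<close>)
  define v where "v = u \<otimes>\<^bsub>A\<^esub> w"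
  have v: "v \<in> S" unfolding v_def using SM u w by blast
  have U: "h v \<in> Units D" using units[OF v] .
  have [simp]: "v \<in> carrier A" "inv\<^bsub>D\<^esub> h v \<in> carrier D" "c \<in> carrier A" using SA[OF v] U c by auto
  have "h v \<otimes>\<^bsub>D\<^esub> h a = h b \<otimes>\<^bsub>D\<^esub> h c"
  proof -
    have "v \<otimes>\<^bsub>A\<^esub> a = b \<otimes>\<^bsub>A\<^esub> c" using c unfolding v_def by (simp add: A.m_assoc)
    then show ?thesis by (metis \<open>a \<in> carrier A\<close> \<open>b \<in> carrier A\<close> \<open>v \<in> carrier A\<close> c(1) h.hom_mult)
  qed
  then have eq: "h v \<otimes>\<^bsub>D\<^esub> (h q \<otimes>\<^bsub>D\<^esub> \<alpha>) = (h q \<otimes>\<^bsub>D\<^esub> \<beta>) \<otimes>\<^bsub>D\<^esub> h c" unfolding qa qb .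
  define \<gamma> where "\<gamma> = inv\<^bsub>D\<^esub> h v \<otimes>\<^bsub>D\<^esub> h c"
  have [simp]: "\<gamma> \<in> carrier D" unfolding \<gamma>_def by simp
  have hc: "h c = h v \<otimes>\<^bsub>D\<^esub> \<gamma>" unfolding \<gamma>_def using U by (simp add: D.m_assoc[symmetric])
  have "h v \<otimes>\<^bsub>D\<^esub> (h q \<otimes>\<^bsub>D\<^esub> \<alpha>) = h v \<otimes>\<^bsub>D\<^esub> (h q \<otimes>\<^bsub>D\<^esub> (\<beta> \<otimes>\<^bsub>D\<^esub> \<gamma>))"
    unfolding eq hc by (simp add: D.m_ac)
  then have "h q \<otimes>\<^bsub>D\<^esub> \<alpha> = h q \<otimes>\<^bsub>D\<^esub> (\<beta> \<otimes>\<^bsub>D\<^esub> \<gamma>)" using unit_cancel[OF v] by simp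
  then have "\<alpha> = \<beta> \<otimes>\<^bsub>D\<^esub> \<gamma>" using unit_cancel[OF q] by simp
  then show "\<exists>b\<in>carrier D. \<alpha> = \<beta> \<otimes>\<^bsub>D\<^esub> b" by (intro bexI[of _ \<gamma>]) auto
qed

end

lemma (in mult_set) Loc_fractions: "fractions R Loc (\<lambda>a. fr a \<one>) S"
proof -
  interpret L: cring Loc by (rule Loc_cring)
  show ?thesis
  proof
    show "(\<lambda>a. fr a \<one>) \<in> ring_hom R Loc" by (rule Loc_hom)
    show "fr s \<one> \<in> Units Loc" if "s \<in> S" for s
    proof -
      have "fr s \<one> \<otimes>\<^bsub>Loc\<^esub> fr \<one> s = \<one>\<^bsub>Loc\<^esub>" "fr s \<one> \<in> carrier Loc" "fr \<one> s \<in> carrier Loc"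
        using Loc_inverse(2)[OF one_closed that] that S_one by simp_all
      then show ?thesis unfolding Units_def using L.m_comm[of "fr s \<one>" "fr \<one> s"] by (auto intro!: bexI[of _ "fr \<one> s"])
    qed
    show "\<exists>a\<in>carrier R. \<exists>s\<in>S. fr s \<one> \<otimes>\<^bsub>Loc\<^esub> z = fr a \<one>" if "z \<in> carrier Loc" for z
      using that Loc_inverse(1) unfolding Loc_carrier by blast
    show "\<exists>u\<in>S. u \<otimes> a = \<zero>" if "a \<in> carrier R" "fr a \<one> = \<zero>\<^bsub>Loc\<^esub>" for a using Loc_kernel that by blast
  qed (use S_one S_mult in auto)
qed

section \<open>Normal rings\<close>

context domain
begin

lemma nonzero_mult_set: "mult_set R (carrier R - {\<zero>})"
  by unfold_locales (auto simp: integral_iff)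

lemma nat_pow_eq_zero: "a \<in> carrier R \<Longrightarrow> a [^] (n::nat) = \<zero> \<Longrightarrow> a = \<zero>"
  by (induction n) (use integral in auto)

text \<open>With \<open>x = a / s\<close>, \<open>hev\<close> is \<open>s^n f(x)\<close> for the
  monic polynomial \<open>f\<close> with lower coefficients \<open>cs\<close>. The reversal
  reconciles the two orders of coefficients.\<close>

lemma eval_hev:
  assumes F: "cring F" and h: "h \<in> ring_hom R F" and x: "x \<in> carrier F"
    and [simp]: "a \<in> carrier R" "s \<in> carrier R" and hx: "h s \<otimes>\<^bsub>F\<^esub> x = h a" and cs: "set cs \<subseteq> carrier R"
  shows "h (hev R a s cs) = h s [^]\<^bsub>F\<^esub> length cs \<otimes>\<^bsub>F\<^esub> ring.eval F (\<one>\<^bsub>F\<^esub> # rev (map h cs)) x"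
  using cs
proof (induction cs)
  case Nil
  interpret F: cring F by fact
  interpret h: ring_hom_cring R F h using h by unfold_locales
  show ?case using x by simp
next
  case (Cons c cs)
  interpret F: cring F by fact
  interpret h: ring_hom_cring R F h using h by unfold_locales
  define e where "e = F.eval (\<one>\<^bsub>F\<^esub> # rev (map h cs)) x"
  have [simp]: "c \<in> carrier R" "set cs \<subseteq> carrier R" using Cons by auto
  have hc: "set (\<one>\<^bsub>F\<^esub> # rev (map h cs)) \<subseteq> carrier F" using h.hom_closed subsetD[OF \<open>set cs \<subseteq> carrier R\<close>] by auto
  have [simp]: "e \<in> carrier F" unfolding e_def using F.eval_in_carrier[OF hc x] .
  have "F.eval (\<one>\<^bsub>F\<^esub> # rev (map h (c # cs))) x = F.eval ((\<one>\<^bsub>F\<^esub> # rev (map h cs)) @ [h c]) x" by simp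
  also have "\<dots> = e \<otimes>\<^bsub>F\<^esub> x \<oplus>\<^bsub>F\<^esub> h c" unfolding e_def using F.eval_append_aux[OF hc _ x, of "h c"] by simp
  finally have 1: "F.eval (\<one>\<^bsub>F\<^esub> # rev (map h (c # cs))) x = e \<otimes>\<^bsub>F\<^esub> x \<oplus>\<^bsub>F\<^esub> h c" .
  have "h (hev R a s (c # cs)) = h a \<otimes>\<^bsub>F\<^esub> (h s [^]\<^bsub>F\<^esub> length cs \<otimes>\<^bsub>F\<^esub> e) \<oplus>\<^bsub>F\<^esub> h c \<otimes>\<^bsub>F\<^esub> h s [^]\<^bsub>F\<^esub> Suc (length cs)"
    using Cons unfolding e_def by simp
  also have "\<dots> = h s [^]\<^bsub>F\<^esub> Suc (length cs) \<otimes>\<^bsub>F\<^esub> (e \<otimes>\<^bsub>F\<^esub> x \<oplus>\<^bsub>F\<^esub> h c)"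
    unfolding hx[symmetric] using x by (simp add: F.ring_norm)
  finally show ?case unfolding 1 by simp
qed

text \<open>For \<open>s \<noteq> 0\<close>, integrality of \<open>a\<close> over \<open>(s)\<close>
  is integrality of the fraction \<open>a / s\<close>. For \<open>s = 0\<close> it is nilpotency of
  \<open>a\<close>, and a domain is reduced.\<close>

theorem integrally_closed_iff_pic: "integrally_closed R \<longleftrightarrow> pic R (carrier R)"
proof -
  interpret M: mult_set R "carrier R - {\<zero>}" by (rule nonzero_mult_set)
  define F where "F = fraction_field R"
  define h where "h = to_fraction_field R"
  have F_eq: "F = M.Loc" unfolding F_def fraction_field_def by simp
  have h_eq: "h = (\<lambda>a. M.fr a \<one>)" unfolding h_def to_fraction_field_def by (rule ext) simp
  interpret fractions R F h "carrier R - {\<zero>}" unfolding F_eq h_eq by (rule M.Loc_fractions)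
  have inj: "a = b" if ab: "a \<in> carrier R" "b \<in> carrier R" "h a = h b" for a b
  proof -
    have "h (a \<ominus> b) = \<zero>\<^bsub>F\<^esub>" using ab by (simp add: minus_eq D.r_neg)
    then obtain u where "u \<in> carrier R - {\<zero>}" "u \<otimes> (a \<ominus> b) = \<zero>" using ker[of "a \<ominus> b"] ab by auto
    then have "a \<ominus> b = \<zero>" using integral[of u "a \<ominus> b"] ab by auto
    then show ?thesis using ab by simp
  qed
  have F_one: "\<one>\<^bsub>F\<^esub> \<noteq> \<zero>\<^bsub>F\<^esub>" using inj[of \<one> \<zero>] by auto
  have poly: "integral_over F (h ` carrier R) x \<longleftrightarrow>
      (\<exists>cs. set cs \<subseteq> carrier R \<and> D.eval (\<one>\<^bsub>F\<^esub> # rev (map h cs)) x = \<zero>\<^bsub>F\<^esub>)" for x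
  proof
    assume "integral_over F (h ` carrier R) x"
    then obtain f where f: "polynomial\<^bsub>F\<^esub> (h ` carrier R) f" "f \<noteq> []" "lead_coeff f = \<one>\<^bsub>F\<^esub>" "D.eval f x = \<zero>\<^bsub>F\<^esub>"
      unfolding integral_over_def by blast
    then obtain g where g: "f = \<one>\<^bsub>F\<^esub> # g" by (cases f) auto
    have "set g \<subseteq> h ` carrier R" using f(1) g unfolding polynomial_def by auto
    then obtain cs where "set cs \<subseteq> carrier R" "map h cs = rev g" using list_in_image[of "rev g" h "carrier R"] by auto
    then show "\<exists>cs. set cs \<subseteq> carrier R \<and> D.eval (\<one>\<^bsub>F\<^esub> # rev (map h cs)) x = \<zero>\<^bsub>F\<^esub>"
      using f(4) g by (intro exI[of _ cs]) simp
  next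
    assume "\<exists>cs. set cs \<subseteq> carrier R \<and> D.eval (\<one>\<^bsub>F\<^esub> # rev (map h cs)) x = \<zero>\<^bsub>F\<^esub>"
    then obtain cs where cs: "set cs \<subseteq> carrier R" "D.eval (\<one>\<^bsub>F\<^esub> # rev (map h cs)) x = \<zero>\<^bsub>F\<^esub>" by blast
    have "\<one>\<^bsub>F\<^esub> \<in> h ` carrier R" by (metis h.hom_one image_eqI one_closed)
    then have "polynomial\<^bsub>F\<^esub> (h ` carrier R) (\<one>\<^bsub>F\<^esub> # rev (map h cs))"
      unfolding polynomial_def using cs F_one by auto
    then show "integral_over F (h ` carrier R) x"
      unfolding integral_over_def using cs(2) by (intro exI[of _ "\<one>\<^bsub>F\<^esub> # rev (map h cs)"]) auto
  qed
  have ic: "integrally_closed R \<longleftrightarrow>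
    (\<forall>x\<in>carrier F. integral_over F (h ` carrier R) x \<longrightarrow> x \<in> h ` carrier R)"
    unfolding integrally_closed_def F_def h_def ..
  show ?thesis
  proof
    assume icl: "integrally_closed R"
    show "pic R (carrier R)"
      unfolding pic_on_def
    proof (intro ballI impI)
      fix a s assume as [simp]: "a \<in> carrier R" "s \<in> carrier R" and dep: "dep R (carrier R) a s"
      obtain cs where cs: "set cs \<subseteq> carrier R" "hev R a s cs = \<zero>" using dep unfolding dep_def by blast
      show "\<exists>b\<in>carrier R. a = s \<otimes> b"
      proof (cases "s = \<zero>")
        case True
        then have "a [^] length cs = \<zero>" using cs hev_zero[of a cs] by simp
        then have "a = \<zero>"
          using nat_pow_eq_zero[of a "length cs"] by simp
        then show ?thesis using True by (intro bexI[of _ \<zero>]) auto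
      next
        case False
        then have U: "h s \<in> Units F" using units by simp
        define x where "x = inv\<^bsub>F\<^esub> h s \<otimes>\<^bsub>F\<^esub> h a"
        have x [simp]: "x \<in> carrier F" unfolding x_def using U by simp
        have hx: "h s \<otimes>\<^bsub>F\<^esub> x = h a" unfolding x_def using U by (simp add: D.m_assoc[symmetric])
        let ?e = "D.eval (\<one>\<^bsub>F\<^esub> # rev (map h cs)) x"
        have e: "?e \<in> carrier F" by (rule D.eval_in_carrier) (use cs in auto)
        have "h s [^]\<^bsub>F\<^esub> length cs \<otimes>\<^bsub>F\<^esub> ?e = \<zero>\<^bsub>F\<^esub>"
          using eval_hev[OF D.cring_axioms h x as hx cs(1)] cs(2) by simp
        then have "h s [^]\<^bsub>F\<^esub> length cs \<otimes>\<^bsub>F\<^esub> ?e = h s [^]\<^bsub>F\<^esub> length cs \<otimes>\<^bsub>F\<^esub> \<zero>\<^bsub>F\<^esub>" by simp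
        then have "?e = \<zero>\<^bsub>F\<^esub>"
          using D.Units_l_cancel[OF D.Units_pow_closed[OF U] e D.zero_closed] by blast
        then have "x \<in> h ` carrier R" using icl poly[of x] cs(1) x unfolding ic by blast
        then obtain b where b: "b \<in> carrier R" "x = h b" by blast
        then have "h a = h (s \<otimes> b)" using hx by simp
        then have "a = s \<otimes> b" by (rule inj[rotated 2]) (use b in auto)
        then show ?thesis using b by blast
      qed
    qed
  next
    assume p: "pic R (carrier R)"
    show "integrally_closed R"
      unfolding ic
    proof (intro ballI impI)
      fix x assume x: "x \<in> carrier F" and "integral_over F (h ` carrier R) x"
      then obtain cs where cs: "set cs \<subseteq> carrier R" "D.eval (\<one>\<^bsub>F\<^esub> # rev (map h cs)) x = \<zero>\<^bsub>F\<^esub>" using poly by blast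
      obtain a s where as: "a \<in> carrier R" "s \<in> carrier R - {\<zero>}" and hx: "h s \<otimes>\<^bsub>F\<^esub> x = h a" using repr[OF x] by blast
      have "h (hev R a s cs) = h \<zero>"
        using eval_hev[OF D.cring_axioms h x as(1) _ hx cs(1)] as cs(2) by simp
      then have "hev R a s cs = \<zero>" by (rule inj[rotated 2]) (use as cs(1) in auto)
      then have "dep R (carrier R) a s" using cs unfolding dep_def by blast
      then obtain b where b: "b \<in> carrier R" "a = s \<otimes> b" using picD[OF p] as by blast
      then have "h s \<otimes>\<^bsub>F\<^esub> x = h s \<otimes>\<^bsub>F\<^esub> h b" using hx as by simp
      then have "x = h b" using unit_cancel[OF as(2) x] b by simp
      then show "x \<in> h ` carrier R" using b by blast
    qed
  qed
qed

end

context cring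
begin

lemma exists_prime_ideal:
  assumes I: "ideal I R" and "I \<noteq> carrier R"
  obtains P where "primeideal P R" "I \<subseteq> P"
proof -
  define \<A> where "\<A> = {J. ideal J R \<and> I \<subseteq> J \<and> \<one> \<notin> J}"
  have "\<one> \<notin> I" using ideal.one_imp_carrier[OF I] assms(2) by blast
  then have "I \<in> \<A>" unfolding \<A>_def using I by blast
  have "\<exists>M\<in>\<A>. \<forall>J\<in>\<A>. M \<subseteq> J \<longrightarrow> J = M"
  proof (rule subset_Zorn_nonempty)
    show "\<A> \<noteq> {}" using \<open>I \<in> \<A>\<close> by blast
    fix \<C> assume c: "\<C> \<noteq> {}" "subset.chain \<A> \<C>"
    then have "\<C> \<subseteq> \<A>" by (simp add: subset_chain_def)
    moreover have "subset.chain {J. ideal J R} \<C>"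
      using c unfolding subset_chain_def \<A>_def by auto
    ultimately show "\<Union>\<C> \<in> \<A>"
      using chain_Union_is_ideal[of \<C>] c(1) unfolding \<A>_def by auto
  qed
  then obtain M where M: "M \<in> \<A>" "\<forall>J\<in>\<A>. M \<subseteq> J \<longrightarrow> J = M" by blast
  have "maximalideal M R"
  proof (rule maximalidealI)
    show "ideal M R" using M unfolding \<A>_def by blast
    show "carrier R \<noteq> M" using M unfolding \<A>_def by auto
    fix J assume "ideal J R" "M \<subseteq> J" "J \<subseteq> carrier R"
    then show "J = M \<or> J = carrier R"
      using M ideal.one_imp_carrier[of J R] unfolding \<A>_def by (cases "\<one> \<in> J") blast+
  qed
  then show ?thesis using that[OF maximalideal_prime] M unfolding \<A>_def by blast
qed

lemma prime_complement:
  assumes "primeideal P R" shows "mult_set R (carrier R - P)"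
proof -
  interpret primeideal P R by fact
  show ?thesis
    by unfold_locales (use I_prime I_notcarr one_imp_carrier in auto)
qed

text \<open>If \<open>u a b = 0\<close>, there is a \<open>v\<close> such that \<open>1 - v\<close>
  kills \<open>u a\<close> and \<open>v\<close> kills \<open>b\<close>. A prime ideal misses
  \<open>v\<close> or \<open>1 - v\<close>, so one of the two fractions vanishes.\<close>

lemma pic_local_domain:
  assumes p: "pic R (carrier R)" and P: "primeideal P R"
  shows "domain (localization R (carrier R - P))"
proof -
  interpret P: primeideal P R by fact
  interpret M: mult_set R "carrier R - P" by (rule prime_complement[OF P])
  interpret L: cring M.Loc by (rule M.Loc_cring)
  show ?thesis
  proof
    show "\<one>\<^bsub>M.Loc\<^esub> \<noteq> \<zero>\<^bsub>M.Loc\<^esub>"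
    proof
      assume "\<one>\<^bsub>M.Loc\<^esub> = \<zero>\<^bsub>M.Loc\<^esub>"
      then obtain u where "u \<in> carrier R - P" "u \<otimes> \<one> = \<zero>"
        using M.Loc_kernel[of \<one>] M.Loc_one by auto
      then show False using additive_subgroup.zero_closed[OF P.is_additive_subgroup] by auto
    qed
    fix x y assume xy: "x \<otimes>\<^bsub>M.Loc\<^esub> y = \<zero>\<^bsub>M.Loc\<^esub>" "x \<in> carrier M.Loc" "y \<in> carrier M.Loc"
    then obtain a s b t where *: "a \<in> carrier R" "s \<in> carrier R - P" "x = M.fr a s"
      "b \<in> carrier R" "t \<in> carrier R - P" "y = M.fr b t" unfolding M.Loc_carrier by blast
    have "M.fr (a \<otimes> b) (s \<otimes> t) = M.fr \<zero> \<one>" using xy * by (simp add: M.fr_mult M.Loc_zero)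
    then obtain u where u: "u \<in> carrier R - P" "u \<otimes> (\<one> \<otimes> (a \<otimes> b)) = u \<otimes> ((s \<otimes> t) \<otimes> \<zero>)"
      using M.fr_eq_iff[of "a \<otimes> b" \<zero> "s \<otimes> t" \<one>] * M.S_one M.S_mult by auto
    then have "(u \<otimes> a) \<otimes> b = \<zero>" using * by (simp add: m_assoc)
    then obtain v where v: "v \<in> carrier R" "(\<one> \<ominus> v) \<otimes> (u \<otimes> a) = \<zero>" "v \<otimes> b = \<zero>"
      using pic_zero_divisors[OF carrier_is_subring p, of "u \<otimes> a" b] u * by auto
    show "x = \<zero>\<^bsub>M.Loc\<^esub> \<or> y = \<zero>\<^bsub>M.Loc\<^esub>"
    proof (cases "v \<in> P")
      case False
      have "y = M.fr \<zero> \<one>"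
        unfolding *(6) by (rule M.fr_eqI2[of _ _ _ _ v]) (use * v False M.S_one in simp_all)
      then show ?thesis by (simp add: M.Loc_zero)
    next
      case True
      have "\<one> \<ominus> v \<notin> P"
      proof
        assume "\<one> \<ominus> v \<in> P"
        then have "(\<one> \<ominus> v) \<oplus> v \<in> P" using True additive_subgroup.a_closed[OF P.is_additive_subgroup] by blast
        moreover have "(\<one> \<ominus> v) \<oplus> v = \<one>" using v(1) by (simp add: minus_eq a_assoc l_neg)
        ultimately show False using M.S_one by simp
      qed
      then have w: "(\<one> \<ominus> v) \<otimes> u \<in> carrier R - P" using M.S_mult u v by auto
      have "((\<one> \<ominus> v) \<otimes> u) \<otimes> a = (\<one> \<ominus> v) \<otimes> (u \<otimes> a)" using v(1) u(1) *(1) by (simp add: m_assoc)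
      then have "((\<one> \<ominus> v) \<otimes> u) \<otimes> (\<one> \<otimes> a) = ((\<one> \<ominus> v) \<otimes> u) \<otimes> (s \<otimes> \<zero>)"
        using v(1,2) u(1) *(1,2) by simp
      then have "x = M.fr \<zero> \<one>"
        unfolding *(3) by (rule M.fr_eqI2[OF *(1) zero_closed *(2) M.S_one w])
      then show ?thesis by (simp add: M.Loc_zero)
    qed
  qed
qed

text \<open>
  A ring is normal if and only if all its principal ideals are integrally closed; this criterion
  involves neither localizations nor zero divisors.
\<close>

theorem normal_ring_iff_pic: "normal_ring R \<longleftrightarrow> pic R (carrier R)"
proof
  assume p: "pic R (carrier R)"
  have "domain (localization R (carrier R - P)) \<and> integrally_closed (localization R (carrier R - P))"
    if P: "primeideal P R" for P
  proof -
    interpret M: mult_set R "carrier R - P" by (rule prime_complement[OF P])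
    have d: "domain M.Loc" by (rule pic_local_domain[OF p P])
    have "pic M.Loc (carrier M.Loc)" using fractions.pic_fractions[OF M.Loc_fractions p] .
    then show ?thesis using d domain.integrally_closed_iff_pic[OF d] by blast
  qed
  then show "normal_ring R" unfolding normal_ring_def using cring_axioms by blast
next
  assume n: "normal_ring R"
  show "pic R (carrier R)"
    unfolding pic_on_def
  proof (intro ballI impI)
    fix a s assume [simp]: "a \<in> carrier R" "s \<in> carrier R" and dep: "dep R (carrier R) a s"
    \<comment> \<open>The ideal \<open>(sR : a)\<close> of denominators of \<open>a / s\<close>. If
      it were proper, it would lie in a prime ideal; but a quotient found in the localization there
      has a denominator outside that prime.\<close>
    define I where "I = {u \<in> carrier R. \<exists>b\<in>carrier R. u \<otimes> a = s \<otimes> b}"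
    have I: "ideal I R"
    proof (rule idealI)
      show "ring R" by (rule ring_axioms)
      show "subgroup I (add_monoid R)"
      proof (rule add.subgroupI)
        show "I \<subseteq> carrier R" unfolding I_def by blast
        have "\<zero> \<otimes> a = s \<otimes> \<zero>" by simp
        then show "I \<noteq> {}" unfolding I_def by blast
        fix u assume "u \<in> I"
        then obtain b where u: "u \<in> carrier R" "b \<in> carrier R" "u \<otimes> a = s \<otimes> b" unfolding I_def by blast
        then have "(\<ominus> u) \<otimes> a = s \<otimes> (\<ominus> b)" by (simp add: l_minus r_minus)
        then show "\<ominus> u \<in> I" unfolding I_def using u by blast
        fix v assume "v \<in> I"
        then obtain c where v: "v \<in> carrier R" "c \<in> carrier R" "v \<otimes> a = s \<otimes> c" unfolding I_def by blast
        then have "(u \<oplus> v) \<otimes> a = s \<otimes> (b \<oplus> c)" using u by (simp add: l_distr r_distr)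
        then show "u \<oplus> v \<in> I" unfolding I_def using u v by blast
      qed
      fix u x assume "u \<in> I" and x: "x \<in> carrier R"
      then obtain b where u: "u \<in> carrier R" "b \<in> carrier R" "u \<otimes> a = s \<otimes> b" unfolding I_def by blast
      then have "(x \<otimes> u) \<otimes> a = s \<otimes> (x \<otimes> b)" using x by (simp add: m_assoc m_lcomm)
      then show "x \<otimes> u \<in> I" unfolding I_def using u x by blast
      then show "u \<otimes> x \<in> I" using u x by (simp add: m_comm)
    qed
    have "I = carrier R"
    proof (rule ccontr)
      assume "I \<noteq> carrier R"
      then obtain P where P: "primeideal P R" "I \<subseteq> P" using exists_prime_ideal[OF I] by blast
      interpret P: primeideal P R by fact
      interpret M: mult_set R "carrier R - P" by (rule prime_complement[OF P(1)])
      interpret L: cring M.Loc by (rule M.Loc_cring)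
      have "pic M.Loc (carrier M.Loc)"
        using n P(1) domain.integrally_closed_iff_pic unfolding normal_ring_def by blast
      moreover have "dep M.Loc (carrier M.Loc) (M.fr a \<one>) (M.fr s \<one>)"
      proof -
        have "dep M.Loc ((\<lambda>a. M.fr a \<one>) ` carrier R) (M.fr a \<one>) (M.fr s \<one>)"
          using dep_hom[OF cring_axioms M.Loc_cring M.Loc_hom _ _ dep] by simp
        then show ?thesis by (rule L.dep_mono) (use M.S_one in auto)
      qed
      ultimately obtain z where z: "z \<in> carrier M.Loc" "M.fr a \<one> = M.fr s \<one> \<otimes>\<^bsub>M.Loc\<^esub> z"
        using picD[of M.Loc "carrier M.Loc" "carrier M.Loc"] M.S_one by (meson M.fr_closed \<open>a \<in> carrier R\<close> \<open>s \<in> carrier R\<close>)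
      then obtain b t where bt: "b \<in> carrier R" "t \<in> carrier R - P" "z = M.fr b t" unfolding M.Loc_carrier by blast
      then have "M.fr a \<one> = M.fr (s \<otimes> b) t" using z M.S_one by (simp add: M.fr_mult)
      then have "\<exists>u\<in>carrier R - P. u \<otimes> (t \<otimes> a) = u \<otimes> (\<one> \<otimes> (s \<otimes> b))"
        by (rule M.fr_eq_iff[THEN iffD1, rotated 4]) (use bt M.S_one in simp_all)
      then obtain u where u: "u \<in> carrier R - P" "u \<otimes> (t \<otimes> a) = u \<otimes> (\<one> \<otimes> (s \<otimes> b))" by blast
      have "(u \<otimes> t) \<otimes> a = u \<otimes> (t \<otimes> a)" using bt(2) u(1) by (simp add: m_assoc)
      also have "\<dots> = s \<otimes> (u \<otimes> b)" unfolding u(2) using bt(1) u(1) by (simp add: m_lcomm)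
      finally have "u \<otimes> t \<in> I" unfolding I_def using u(1) bt(1,2) by blast
      then show False using P(2) M.S_mult[OF u(1) bt(2)] by blast
    qed
    then have "\<one> \<in> I" by simp
    then show "\<exists>b\<in>carrier R. a = s \<otimes> b" unfolding I_def by auto
  qed
qed

end

section \<open>Tensor products\<close>

lemma frag_extend_fun_diff: "frag_extend (\<lambda>x. f x - g x) c = frag_extend f c - frag_extend g c"
  using subset_UNIV by (induction c rule: frag_induction) (auto simp: frag_extend_diff)

lemma frag_add_diff: "c + d = c - (0 - d)" for c d :: "'b \<Rightarrow>\<^sub>0 int"
  by simp

section \<open>Monoid rings\<close>

context comm_monoid
begin

abbreviation MR :: "('a \<Rightarrow>\<^sub>0 int) ring" where "MR \<equiv> monoid_ring G"

lemma MR_simps: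
  "carrier MR = {c. Poly_Mapping.keys c \<subseteq> carrier G}" "\<one>\<^bsub>MR\<^esub> = frag_of \<one>" "\<zero>\<^bsub>MR\<^esub> = 0"
  "c \<oplus>\<^bsub>MR\<^esub> d = c + d" "c \<otimes>\<^bsub>MR\<^esub> d = frag_extend (\<lambda>x. frag_extend (\<lambda>y. frag_of (x \<otimes> y)) d) c"
  unfolding monoid_ring_def by simp_all

lemma MR_of: "frag_of x \<otimes>\<^bsub>MR\<^esub> frag_of y = frag_of (x \<otimes> y)"
  by (simp add: MR_simps)

lemma MR_diff1: "(c - c') \<otimes>\<^bsub>MR\<^esub> d = c \<otimes>\<^bsub>MR\<^esub> d - c' \<otimes>\<^bsub>MR\<^esub> d"
  by (simp add: MR_simps frag_extend_diff)

lemma MR_diff2: "c \<otimes>\<^bsub>MR\<^esub> (d - d') = c \<otimes>\<^bsub>MR\<^esub> d - c \<otimes>\<^bsub>MR\<^esub> d'"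
  by (simp add: MR_simps frag_extend_diff frag_extend_fun_diff)

lemma MR_zero1: "0 \<otimes>\<^bsub>MR\<^esub> d = 0" and MR_zero2: "c \<otimes>\<^bsub>MR\<^esub> 0 = 0"
  by (simp_all add: MR_simps frag_extend_eq_0)

lemma MR_induct [consumes 1, case_names zero one diff]:
  assumes "c \<in> carrier MR" "P 0" "\<And>x. x \<in> carrier G \<Longrightarrow> P (frag_of x)" "\<And>a b. P a \<Longrightarrow> P b \<Longrightarrow> P (a - b)"
  shows "P c"
  by (rule frag_induction[of c "carrier G" P]) (use assms in \<open>auto simp: MR_simps\<close>)

lemma MR_closed_diff: "c \<in> carrier MR \<Longrightarrow> d \<in> carrier MR \<Longrightarrow> c - d \<in> carrier MR"
  using keys_diff[of c d] by (auto simp: MR_simps)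

lemma MR_closed_of: "x \<in> carrier G \<Longrightarrow> frag_of x \<in> carrier MR"
  by (simp add: MR_simps keys_frag_of)

lemma MR_closed_zero: "0 \<in> carrier MR"
  by (simp add: MR_simps)

lemma MR_mult_closed: "c \<in> carrier MR \<Longrightarrow> d \<in> carrier MR \<Longrightarrow> c \<otimes>\<^bsub>MR\<^esub> d \<in> carrier MR"
proof (induction c rule: MR_induct)
  case (one x)
  show ?case using one(2,1)
    by (induction d rule: MR_induct) (auto simp: MR_zero2 MR_of MR_diff2 MR_closed_zero MR_closed_of MR_closed_diff)
qed (auto simp: MR_zero1 MR_diff1 MR_closed_zero MR_closed_diff)

lemma MR_comm: "c \<in> carrier MR \<Longrightarrow> d \<in> carrier MR \<Longrightarrow> c \<otimes>\<^bsub>MR\<^esub> d = d \<otimes>\<^bsub>MR\<^esub> c"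
proof (induction c rule: MR_induct)
  case (one x)
  show ?case using one(2,1)
    by (induction d rule: MR_induct) (auto simp: MR_zero1 MR_zero2 MR_of MR_diff1 MR_diff2 m_comm)
qed (auto simp: MR_zero1 MR_zero2 MR_diff1 MR_diff2)

lemma MR_assoc:
  "c \<in> carrier MR \<Longrightarrow> d \<in> carrier MR \<Longrightarrow> e \<in> carrier MR \<Longrightarrow> (c \<otimes>\<^bsub>MR\<^esub> d) \<otimes>\<^bsub>MR\<^esub> e = c \<otimes>\<^bsub>MR\<^esub> (d \<otimes>\<^bsub>MR\<^esub> e)"
proof (induction c rule: MR_induct)
  case (one x)
  show ?case using one(2,1,3)
  proof (induction d rule: MR_induct)
    case (one y)
    show ?case using one(3,1,2)
      by (induction e rule: MR_induct) (auto simp: MR_zero1 MR_zero2 MR_of MR_diff1 MR_diff2 m_assoc)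
  qed (auto simp: MR_zero1 MR_zero2 MR_diff1 MR_diff2)
qed (auto simp: MR_zero1 MR_zero2 MR_diff1 MR_diff2)

lemma MR_one: "c \<in> carrier MR \<Longrightarrow> \<one>\<^bsub>MR\<^esub> \<otimes>\<^bsub>MR\<^esub> c = c"
  by (induction c rule: MR_induct) (auto simp: MR_simps(2) MR_zero2 MR_of MR_diff2)

lemma MR_cring: "cring MR"
proof (rule cringI)
  show "abelian_group MR"
  proof (rule abelian_groupI)
    fix x y assume xy: "x \<in> carrier MR" "y \<in> carrier MR"
    show "x \<oplus>\<^bsub>MR\<^esub> y \<in> carrier MR"
      unfolding MR_simps(4) frag_add_diff[of x y] using xy by (intro MR_closed_diff MR_closed_zero)
  next
    fix x assume x: "x \<in> carrier MR"
    show "\<exists>y\<in>carrier MR. y \<oplus>\<^bsub>MR\<^esub> x = \<zero>\<^bsub>MR\<^esub>"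
      using MR_closed_diff[OF MR_closed_zero x] by (intro bexI[of _ "0 - x"]) (auto simp: MR_simps(3,4))
  qed (auto simp: MR_simps(3,4) MR_closed_zero add_ac)
  show "comm_monoid MR"
    by (rule comm_monoidI)
      (auto simp: MR_mult_closed MR_assoc MR_one[unfolded MR_simps(2)] MR_closed_of MR_simps(2) intro: MR_comm)
  fix x y z assume "x \<in> carrier MR" "y \<in> carrier MR" "z \<in> carrier MR"
  show "(x \<oplus>\<^bsub>MR\<^esub> y) \<otimes>\<^bsub>MR\<^esub> z = x \<otimes>\<^bsub>MR\<^esub> z \<oplus>\<^bsub>MR\<^esub> y \<otimes>\<^bsub>MR\<^esub> z"
    by (simp add: MR_simps(4,5) frag_extend_add)
qed

end

text \<open>The generated additive subgroup; closure under differences provides sums and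
  negatives.\<close>

inductive_set rel_span :: "('a \<Rightarrow>\<^sub>0 int) set \<Rightarrow> ('a \<Rightarrow>\<^sub>0 int) set" for \<R> where
  zero: "0 \<in> rel_span \<R>"
| rel: "r \<in> \<R> \<Longrightarrow> r \<in> rel_span \<R>"
| diff: "x \<in> rel_span \<R> \<Longrightarrow> y \<in> rel_span \<R> \<Longrightarrow> x - y \<in> rel_span \<R>"

section \<open>The tensor product as a quotient ring\<close>

locale tensor = A: algebra K A + B: algebra K B
  for K :: "('k, 'l) ring_scheme" and A :: "('k, 'a, 'm) module_scheme" and B :: "('k, 'b, 'n) module_scheme"
begin

sublocale M: comm_monoid "A \<times>\<times> B"
  by (rule comm_monoidI) (auto simp: A.m_assoc B.m_assoc intro: A.m_comm B.m_comm)

abbreviation "Rel \<equiv> tensor_relations K A B"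
abbreviation "I \<equiv> Idl\<^bsub>M.MR\<^esub> Rel"

sublocale MR: cring M.MR by (rule M.MR_cring)

lemma smult_mult: "k \<in> carrier K \<Longrightarrow> a \<in> carrier A \<Longrightarrow> b \<in> carrier A \<Longrightarrow> a \<otimes>\<^bsub>A\<^esub> (k \<odot>\<^bsub>A\<^esub> b) = k \<odot>\<^bsub>A\<^esub> (a \<otimes>\<^bsub>A\<^esub> b)"
  using A.smult_assoc2[of k b a] A.smult_closed by (simp add: A.m_comm)

lemma smult_mult': "k \<in> carrier K \<Longrightarrow> a \<in> carrier B \<Longrightarrow> b \<in> carrier B \<Longrightarrow> a \<otimes>\<^bsub>B\<^esub> (k \<odot>\<^bsub>B\<^esub> b) = k \<odot>\<^bsub>B\<^esub> (a \<otimes>\<^bsub>B\<^esub> b)"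
  using B.smult_assoc2[of k b a] B.smult_closed by (simp add: B.m_comm)

lemma Rel_carrier: "Rel \<subseteq> carrier M.MR"
  unfolding tensor_relations_def
  by (auto intro!: M.MR_closed_diff M.MR_closed_of simp: A.smult_closed B.smult_closed)

text \<open>Relations are carried to relations of the same kind, which is why their additive span is
  already an ideal.\<close>

lemma Rel_mult:
  assumes "r \<in> Rel" "a \<in> carrier A" "b \<in> carrier B"
  shows "frag_of (a, b) \<otimes>\<^bsub>M.MR\<^esub> r \<in> Rel"
proof -
  consider (1) c c' d where "r = frag_of (c \<oplus>\<^bsub>A\<^esub> c', d) - frag_of (c, d) - frag_of (c', d)"
      "c \<in> carrier A" "c' \<in> carrier A" "d \<in> carrier B"
    | (2) c d d' where "r = frag_of (c, d \<oplus>\<^bsub>B\<^esub> d') - frag_of (c, d) - frag_of (c, d')"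
      "c \<in> carrier A" "d \<in> carrier B" "d' \<in> carrier B"
    | (3) k c d where "r = frag_of (k \<odot>\<^bsub>A\<^esub> c, d) - frag_of (c, k \<odot>\<^bsub>B\<^esub> d)"
      "k \<in> carrier K" "c \<in> carrier A" "d \<in> carrier B"
    using assms(1) unfolding tensor_relations_def by blast
  then show ?thesis
  proof cases
    case 1
    have "frag_of (a, b) \<otimes>\<^bsub>M.MR\<^esub> r = frag_of ((a \<otimes>\<^bsub>A\<^esub> c) \<oplus>\<^bsub>A\<^esub> (a \<otimes>\<^bsub>A\<^esub> c'), b \<otimes>\<^bsub>B\<^esub> d)
      - frag_of (a \<otimes>\<^bsub>A\<^esub> c, b \<otimes>\<^bsub>B\<^esub> d) - frag_of (a \<otimes>\<^bsub>A\<^esub> c', b \<otimes>\<^bsub>B\<^esub> d)"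
      using 1 assms by (simp add: M.MR_diff2 M.MR_of A.r_distr)
    then show ?thesis unfolding tensor_relations_def using 1 assms by blast
  next
    case 2
    have "frag_of (a, b) \<otimes>\<^bsub>M.MR\<^esub> r = frag_of (a \<otimes>\<^bsub>A\<^esub> c, (b \<otimes>\<^bsub>B\<^esub> d) \<oplus>\<^bsub>B\<^esub> (b \<otimes>\<^bsub>B\<^esub> d'))
      - frag_of (a \<otimes>\<^bsub>A\<^esub> c, b \<otimes>\<^bsub>B\<^esub> d) - frag_of (a \<otimes>\<^bsub>A\<^esub> c, b \<otimes>\<^bsub>B\<^esub> d')"
      using 2 assms by (simp add: M.MR_diff2 M.MR_of B.r_distr)
    then show ?thesis unfolding tensor_relations_def using 2 assms by blast
  next
    case 3
    have "frag_of (a, b) \<otimes>\<^bsub>M.MR\<^esub> r = frag_of (k \<odot>\<^bsub>A\<^esub> (a \<otimes>\<^bsub>A\<^esub> c), b \<otimes>\<^bsub>B\<^esub> d)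
      - frag_of (a \<otimes>\<^bsub>A\<^esub> c, k \<odot>\<^bsub>B\<^esub> (b \<otimes>\<^bsub>B\<^esub> d))"
      using 3 assms by (simp add: M.MR_diff2 M.MR_of smult_mult smult_mult')
    then show ?thesis unfolding tensor_relations_def using 3 assms by blast
  qed
qed

lemma rel_span_carrier: "x \<in> rel_span Rel \<Longrightarrow> x \<in> carrier M.MR"
  by (induction rule: rel_span.induct) (use Rel_carrier M.MR_closed_diff M.MR_closed_zero in auto)

lemma MR_minus: "x \<in> carrier M.MR \<Longrightarrow> \<ominus>\<^bsub>M.MR\<^esub> x = 0 - x"
  using M.MR_closed_diff[OF M.MR_closed_zero, of x]
  by (intro MR.minus_equality) (auto simp: M.MR_simps(3,4))

lemma MR_a_minus: "x \<in> carrier M.MR \<Longrightarrow> y \<in> carrier M.MR \<Longrightarrow> x \<ominus>\<^bsub>M.MR\<^esub> y = x - y"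
  unfolding a_minus_def by (simp add: MR_minus M.MR_simps(4))

lemma rel_span_mult:
  assumes "x \<in> rel_span Rel" "c \<in> carrier M.MR"
  shows "c \<otimes>\<^bsub>M.MR\<^esub> x \<in> rel_span Rel"
  using assms(2,1)
proof (induction c rule: M.MR_induct)
  case (one z)
  obtain a b where z: "z = (a, b)" "a \<in> carrier A" "b \<in> carrier B" using one by auto
  show ?case using one(2)
    by (induction x rule: rel_span.induct) (auto simp: M.MR_zero2 M.MR_diff2 z(1) intro: rel_span.zero rel_span.diff rel_span.rel[OF Rel_mult[OF _ z(2,3)]])
qed (auto simp: M.MR_zero1 M.MR_diff1 intro: rel_span.intros)

text \<open>Because of this, maps that are merely additive and balanced factor through the quotient.\<close>

lemma I_eq: "I = rel_span Rel"
proof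
  have "ideal (rel_span Rel) M.MR"
  proof (rule idealI)
    show "ring M.MR" by (rule MR.ring_axioms)
    show "subgroup (rel_span Rel) (add_monoid M.MR)"
    proof (rule MR.add.subgroupI)
      show "rel_span Rel \<subseteq> carrier M.MR" using rel_span_carrier by blast
      show "rel_span Rel \<noteq> {}" using rel_span.zero by blast
      fix x assume x: "x \<in> rel_span Rel"
      then show "\<ominus>\<^bsub>M.MR\<^esub> x \<in> rel_span Rel"
        using rel_span.diff[OF rel_span.zero x] by (simp add: MR_minus rel_span_carrier)
      fix y assume y: "y \<in> rel_span Rel"
      show "x \<oplus>\<^bsub>M.MR\<^esub> y \<in> rel_span Rel"
        using rel_span.diff[OF x rel_span.diff[OF rel_span.zero y]] by (simp add: M.MR_simps(4))
    qed
    fix x c assume xc: "x \<in> rel_span Rel" "c \<in> carrier M.MR"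
    then show "c \<otimes>\<^bsub>M.MR\<^esub> x \<in> rel_span Rel" by (rule rel_span_mult)
    then show "x \<otimes>\<^bsub>M.MR\<^esub> c \<in> rel_span Rel"
      using M.MR_comm[OF rel_span_carrier[OF xc(1)] xc(2)] by metis
  qed
  then show "I \<subseteq> rel_span Rel" by (rule MR.genideal_minimal) (use rel_span.rel in blast)
next
  have ideal: "ideal I M.MR" by (rule MR.genideal_ideal[OF Rel_carrier])
  interpret I: ideal I M.MR by fact
  show "rel_span Rel \<subseteq> I"
  proof
    fix x assume "x \<in> rel_span Rel"
    then show "x \<in> I"
    proof induction
      case zero
      then show ?case using I.zero_closed by (simp add: M.MR_simps(3))
    next
      case (rel r)
      then show ?case using MR.genideal_self[OF Rel_carrier] by blast
    next
      case (diff x y)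
      then have "x \<ominus>\<^bsub>M.MR\<^esub> y \<in> I" unfolding a_minus_def using I.a_closed I.a_inv_closed by blast
      then show ?case using diff by (simp add: MR_a_minus rel_span_carrier)
    qed
  qed
qed

sublocale I: ideal I M.MR by (rule MR.genideal_ideal[OF Rel_carrier])

abbreviation "T \<equiv> tensor_algebra K A B"

lemma T_eq: "T = M.MR Quot I" unfolding tensor_algebra_def ..

lemma T_cring: "cring T" unfolding T_eq by (rule I.quotient_is_cring[OF MR.cring_axioms])

sublocale T: cring T by (rule T_cring)

definition \<pi> where "\<pi> x = I +>\<^bsub>M.MR\<^esub> x"
definition te where "te a b = \<pi> (frag_of (a, b))"

lemma \<pi>_hom: "\<pi> \<in> ring_hom M.MR T"
  using I.rcos_ring_hom unfolding T_eq \<pi>_def[abs_def] by simp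

sublocale \<pi>: ring_hom_cring M.MR T \<pi>
  using \<pi>_hom by unfold_locales

lemma \<pi>_surj: "z \<in> carrier T \<Longrightarrow> \<exists>x\<in>carrier M.MR. z = \<pi> x"
  unfolding T_eq \<pi>_def FactRing_def A_RCOSETS_def' by auto

lemma \<pi>_zero_iff: "x \<in> carrier M.MR \<Longrightarrow> \<pi> x = \<zero>\<^bsub>T\<^esub> \<longleftrightarrow> x \<in> I"
  unfolding \<pi>_def T_eq FactRing_def by (simp add: I.a_rcos_const) (use I.rcos_const_imp_mem I.a_rcos_const in blast)

lemma \<pi>_diff: "x \<in> carrier M.MR \<Longrightarrow> y \<in> carrier M.MR \<Longrightarrow> \<pi> (x - y) = \<pi> x \<ominus>\<^bsub>T\<^esub> \<pi> y"
  by (simp add: MR_a_minus[symmetric] a_minus_def)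

lemma \<pi>_zero: "\<pi> 0 = \<zero>\<^bsub>T\<^esub>"
  using \<pi>.hom_zero by (simp add: M.MR_simps(3))

lemma \<pi>_eq_iff: "x \<in> carrier M.MR \<Longrightarrow> y \<in> carrier M.MR \<Longrightarrow> \<pi> x = \<pi> y \<longleftrightarrow> x - y \<in> I"
  using \<pi>_zero_iff[OF M.MR_closed_diff, of x y] by (simp add: \<pi>_diff)

lemma te_closed [simp]: "a \<in> carrier A \<Longrightarrow> b \<in> carrier B \<Longrightarrow> te a b \<in> carrier T"
  unfolding te_def by (simp add: M.MR_closed_of)

lemma T_induct [consumes 1, case_names zero te diff]:
  assumes "z \<in> carrier T" "P \<zero>\<^bsub>T\<^esub>" "\<And>a b. a \<in> carrier A \<Longrightarrow> b \<in> carrier B \<Longrightarrow> P (te a b)"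
    "\<And>y z. y \<in> carrier T \<Longrightarrow> z \<in> carrier T \<Longrightarrow> P y \<Longrightarrow> P z \<Longrightarrow> P (y \<ominus>\<^bsub>T\<^esub> z)"
  shows "P z"
proof -
  obtain x where x: "x \<in> carrier M.MR" "z = \<pi> x" using \<pi>_surj assms(1) by blast
  have "x \<in> carrier M.MR \<and> P (\<pi> x)"
    using x(1)
  proof (induction x rule: M.MR_induct)
    case (one x)
    then show ?case using assms(3) M.MR_closed_of unfolding te_def by auto
  qed (auto simp: \<pi>_zero \<pi>_diff assms(2,4) M.MR_closed_zero M.MR_closed_diff)
  then show ?thesis using x by blast
qed

lemma te_rel:
  assumes "r \<in> Rel" shows "\<pi> r = \<zero>\<^bsub>T\<^esub>"
  using \<pi>_zero_iff Rel_carrier assms rel_span.rel unfolding I_eq by blast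

lemma te_add2:
  assumes [simp]: "a \<in> carrier A" "b \<in> carrier B" "b' \<in> carrier B"
  shows "te a (b \<oplus>\<^bsub>B\<^esub> b') = te a b \<oplus>\<^bsub>T\<^esub> te a b'"
proof -
  have "frag_of (a, b \<oplus>\<^bsub>B\<^esub> b') - frag_of (a, b) - frag_of (a, b') \<in> Rel"
    unfolding tensor_relations_def using assms by blast
  from te_rel[OF this] have "te a (b \<oplus>\<^bsub>B\<^esub> b') \<ominus>\<^bsub>T\<^esub> te a b \<ominus>\<^bsub>T\<^esub> te a b' = \<zero>\<^bsub>T\<^esub>"
    by (simp add: \<pi>_diff M.MR_closed_of M.MR_closed_diff te_def)
  then show ?thesis by (simp add: T.diff_eq_iff T.add.m_comm)
qed

lemma te_mult:
  assumes "a \<in> carrier A" "b \<in> carrier B" "a' \<in> carrier A" "b' \<in> carrier B"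
  shows "te a b \<otimes>\<^bsub>T\<^esub> te a' b' = te (a \<otimes>\<^bsub>A\<^esub> a') (b \<otimes>\<^bsub>B\<^esub> b')"
  unfolding te_def using assms by (subst \<pi>.hom_mult[symmetric]) (auto simp: M.MR_of intro!: M.MR_closed_of)

lemma te_one: "\<one>\<^bsub>T\<^esub> = te \<one>\<^bsub>A\<^esub> \<one>\<^bsub>B\<^esub>"
  unfolding te_def using \<pi>.hom_one by (simp add: M.MR_simps(2))

end

section \<open>Functoriality of the tensor product\<close>

locale tensor_pair = S: tensor K A B + S': tensor K A B' for K :: "('k, 'l) ring_scheme" and A :: "('k, 'a, 'm) module_scheme"
    and B :: "('k, 'b, 'n) module_scheme" and B' :: "('k, 'c, 'o) module_scheme"
begin

text \<open>This is \<open>id \<otimes> \<phi>\<close>. The map \<open>\<phi>\<close> will be a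
  projection or a functional as well as a homomorphism, so it is only \<open>K\<close>-linear, and
  the result is additive.\<close>

lemma tensor_map:
  assumes \<phi>: "\<And>b. b \<in> carrier B \<Longrightarrow> \<phi> b \<in> carrier B'"
    "\<And>b c. b \<in> carrier B \<Longrightarrow> c \<in> carrier B \<Longrightarrow> \<phi> (b \<oplus>\<^bsub>B\<^esub> c) = \<phi> b \<oplus>\<^bsub>B'\<^esub> \<phi> c"
    "\<And>k b. k \<in> carrier K \<Longrightarrow> b \<in> carrier B \<Longrightarrow> \<phi> (k \<odot>\<^bsub>B\<^esub> b) = k \<odot>\<^bsub>B'\<^esub> \<phi> b"
  obtains F where "\<And>z. z \<in> carrier S.T \<Longrightarrow> F z \<in> carrier S'.T"
    "\<And>y z. y \<in> carrier S.T \<Longrightarrow> z \<in> carrier S.T \<Longrightarrow> F (y \<oplus>\<^bsub>S.T\<^esub> z) = F y \<oplus>\<^bsub>S'.T\<^esub> F z"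
    "\<And>a b. a \<in> carrier A \<Longrightarrow> b \<in> carrier B \<Longrightarrow> F (S.te a b) = S'.te a (\<phi> b)"
proof -
  define f :: "('a \<times> 'b \<Rightarrow>\<^sub>0 int) \<Rightarrow> ('a \<times> 'c \<Rightarrow>\<^sub>0 int)"
    where "f = frag_extend (\<lambda>(a, b). frag_of (a, \<phi> b))"
  have f_of: "f (frag_of (a, b)) = frag_of (a, \<phi> b)" for a b unfolding f_def by simp
  have f_diff: "f (x - y) = f x - f y" for x y unfolding f_def by (rule frag_extend_diff)
  have f0: "f 0 = 0" unfolding f_def by simp
  have f_car: "f x \<in> carrier S'.M.MR" if "x \<in> carrier S.M.MR" for x
    using that
    by (induction x rule: S.M.MR_induct)
      (auto simp: f0 f_of f_diff S'.M.MR_closed_zero \<phi> intro!: S'.M.MR_closed_of S'.M.MR_closed_diff)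
  have f_Rel: "f r \<in> S'.Rel" if r: "r \<in> S.Rel" for r
  proof -
    consider (1) c c' d where "r = frag_of (c \<oplus>\<^bsub>A\<^esub> c', d) - frag_of (c, d) - frag_of (c', d)"
        "c \<in> carrier A" "c' \<in> carrier A" "d \<in> carrier B"
      | (2) c d d' where "r = frag_of (c, d \<oplus>\<^bsub>B\<^esub> d') - frag_of (c, d) - frag_of (c, d')"
        "c \<in> carrier A" "d \<in> carrier B" "d' \<in> carrier B"
      | (3) k c d where "r = frag_of (k \<odot>\<^bsub>A\<^esub> c, d) - frag_of (c, k \<odot>\<^bsub>B\<^esub> d)"
        "k \<in> carrier K" "c \<in> carrier A" "d \<in> carrier B"
      using r unfolding tensor_relations_def by blast
    then show ?thesis
    proof cases
      case 1
      then have "f r = frag_of (c \<oplus>\<^bsub>A\<^esub> c', \<phi> d) - frag_of (c, \<phi> d) - frag_of (c', \<phi> d)" by (simp add: f_diff f_of)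
      then show ?thesis unfolding tensor_relations_def using 1 \<phi>(1) by blast
    next
      case 2
      then have "f r = frag_of (c, \<phi> d \<oplus>\<^bsub>B'\<^esub> \<phi> d') - frag_of (c, \<phi> d) - frag_of (c, \<phi> d')" by (simp add: f_diff f_of \<phi>)
      then show ?thesis unfolding tensor_relations_def using 2 \<phi>(1) by blast
    next
      case 3
      then have "f r = frag_of (k \<odot>\<^bsub>A\<^esub> c, \<phi> d) - frag_of (c, k \<odot>\<^bsub>B'\<^esub> \<phi> d)" by (simp add: f_diff f_of \<phi>)
      then show ?thesis unfolding tensor_relations_def using 3 \<phi>(1) by blast
    qed
  qed
  have f_I: "f x \<in> S'.I" if "x \<in> S.I" for x
    using that unfolding S.I_eq S'.I_eq
    by (induction rule: rel_span.induct) (auto simp: f0 f_diff intro: rel_span.intros f_Rel)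
  \<comment> \<open>A representative is chosen; \<open>f\<close> maps the relation ideal into the
    relation ideal, so the choice does not matter.\<close>
  define F where "F z = S'.\<pi> (f (SOME x. x \<in> carrier S.M.MR \<and> z = S.\<pi> x))" for z
  have F_\<pi>: "F (S.\<pi> x) = S'.\<pi> (f x)" if x: "x \<in> carrier S.M.MR" for x
  proof -
    let ?y = "SOME y. y \<in> carrier S.M.MR \<and> S.\<pi> x = S.\<pi> y"
    have y: "?y \<in> carrier S.M.MR \<and> S.\<pi> x = S.\<pi> ?y" by (rule someI[of _ x]) (use x in simp)
    then have "?y - x \<in> S.I" using S.\<pi>_eq_iff[of ?y x] x by simp
    then have "f (?y - x) \<in> S'.I" by (rule f_I)
    then have "f ?y - f x \<in> S'.I" by (simp only: f_diff)
    then have "S'.\<pi> (f ?y) = S'.\<pi> (f x)" using S'.\<pi>_eq_iff[OF f_car f_car, of ?y x] x y by blast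
    then show ?thesis unfolding F_def by simp
  qed
  show ?thesis
  proof (rule that)
    show "F z \<in> carrier S'.T" if "z \<in> carrier S.T" for z
      using S.\<pi>_surj[OF that] F_\<pi> f_car by auto
    show "F (S.te a b) = S'.te a (\<phi> b)" if "a \<in> carrier A" "b \<in> carrier B" for a b
      unfolding S.te_def S'.te_def using that by (subst F_\<pi>) (auto simp: f_of intro!: S.M.MR_closed_of)
    fix y z assume "y \<in> carrier S.T" "z \<in> carrier S.T"
    then obtain u v where uv: "u \<in> carrier S.M.MR" "y = S.\<pi> u" "v \<in> carrier S.M.MR" "z = S.\<pi> v"
      using S.\<pi>_surj by blast
    have fa: "f (u + v) = f u + f v" unfolding f_def by (rule frag_extend_add)
    have "y \<oplus>\<^bsub>S.T\<^esub> z = S.\<pi> (u \<oplus>\<^bsub>S.M.MR\<^esub> v)" using uv by simp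
    then have "F (y \<oplus>\<^bsub>S.T\<^esub> z) = S'.\<pi> (f (u + v))" using F_\<pi>[of "u \<oplus>\<^bsub>S.M.MR\<^esub> v"] S.MR.a_closed[OF uv(1,3)] by (simp add: S.M.MR_simps(4))
    also have "\<dots> = S'.\<pi> (f u \<oplus>\<^bsub>S'.M.MR\<^esub> f v)" by (simp add: fa S'.M.MR_simps(4))
    also have "\<dots> = F y \<oplus>\<^bsub>S'.T\<^esub> F z" using uv F_\<pi> f_car by simp
    finally show "F (y \<oplus>\<^bsub>S.T\<^esub> z) = F y \<oplus>\<^bsub>S'.T\<^esub> F z" .
  qed
qed

end

section \<open>Linear projections of fields\<close>

context field
begin

definition linear_subspace :: "'a set \<Rightarrow> 'a set \<Rightarrow> bool" where
  "linear_subspace M V \<longleftrightarrow> add_closed R V \<and> (\<forall>m\<in>M. \<forall>v\<in>V. m \<otimes> v \<in> V)"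

lemma subspaceD:
  assumes "linear_subspace M V"
  shows "add_closed R V" "\<And>m v. m \<in> M \<Longrightarrow> v \<in> V \<Longrightarrow> m \<otimes> v \<in> V"
  using assms by (auto simp: linear_subspace_def)

lemma subspace_zero: "M \<subseteq> carrier R \<Longrightarrow> linear_subspace M {\<zero>}"
  by (auto simp: linear_subspace_def add_closed_def)

lemma subspace_subring: "subring M R \<Longrightarrow> linear_subspace M M"
  by (auto simp: linear_subspace_def subring_add_closed subringE)

lemma subspace_sum:
  assumes U: "linear_subspace M U" and V: "linear_subspace M V" and M: "M \<subseteq> carrier R"
  shows "linear_subspace M {u \<oplus> v | u v. u \<in> U \<and> v \<in> V}"
proof -
  note UA = add_closedD[OF subspaceD(1)[OF U]] and VA = add_closedD[OF subspaceD(1)[OF V]]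
  let ?S = "{u \<oplus> v | u v. u \<in> U \<and> v \<in> V}"
  show ?thesis
    unfolding linear_subspace_def add_closed_def
  proof (intro conjI ballI)
    show "?S \<subseteq> carrier R" using UA(5) VA(5) by auto
    have "\<zero> = \<zero> \<oplus> \<zero>" by simp
    then show "\<zero> \<in> ?S" using UA(2) VA(2) by blast
    fix x assume x: "x \<in> ?S"
    then obtain u v where u: "u \<in> U" "v \<in> V" "x = u \<oplus> v" by blast
    have [simp]: "u \<in> carrier R" "v \<in> carrier R" using u UA(5) VA(5) by auto
    have "\<ominus> x = \<ominus> u \<oplus> \<ominus> v" unfolding u by (simp add: minus_add)
    then show "\<ominus> x \<in> ?S" using u UA(4) VA(4) by blast
    show "x \<oplus> y \<in> ?S" if y: "y \<in> ?S" for y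
    proof -
      obtain u' v' where u': "u' \<in> U" "v' \<in> V" "y = u' \<oplus> v'" using y by blast
      have [simp]: "u' \<in> carrier R" "v' \<in> carrier R" using u' UA(5) VA(5) by auto
      have "x \<oplus> y = (u \<oplus> u') \<oplus> (v \<oplus> v')" unfolding u u' by (simp add: a_ac)
      then show ?thesis using u u' UA(3) VA(3) by blast
    qed
    fix m y assume m: "m \<in> M" and y: "y \<in> ?S"
    then obtain u' v' where u': "u' \<in> U" "v' \<in> V" "y = u' \<oplus> v'" by blast
    have [simp]: "u' \<in> carrier R" "v' \<in> carrier R" "m \<in> carrier R" using u' UA(5) VA(5) m M by auto
    have "m \<otimes> y = m \<otimes> u' \<oplus> m \<otimes> v'" unfolding u' by (simp add: r_distr)
    then show "m \<otimes> y \<in> ?S" using u' m subspaceD(2) U V by blast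
  qed
qed

lemma subspace_line:
  assumes M: "subring M R" and w: "w \<in> carrier R"
  shows "linear_subspace M ((\<lambda>m. m \<otimes> w) ` M)"
  unfolding linear_subspace_def add_closed_def
proof (intro conjI ballI)
  note Mc = subring_carrier[OF M]
  show "(\<lambda>m. m \<otimes> w) ` M \<subseteq> carrier R" using Mc w by auto
  show "\<zero> \<in> (\<lambda>m. m \<otimes> w) ` M" using subringE(2)[OF M] w by (intro image_eqI[of _ _ \<zero>]) auto
  fix x assume "x \<in> (\<lambda>m. m \<otimes> w) ` M"
  then obtain m where m: "m \<in> M" "x = m \<otimes> w" by blast
  show "\<ominus> x \<in> (\<lambda>m. m \<otimes> w) ` M"
    using subringE(5)[OF M m(1)] m Mc w by (intro image_eqI[of _ _ "\<ominus> m"]) (auto simp: l_minus)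
  fix y assume "y \<in> (\<lambda>m. m \<otimes> w) ` M"
  then obtain n where n: "n \<in> M" "y = n \<otimes> w" by blast
  show "x \<oplus> y \<in> (\<lambda>m. m \<otimes> w) ` M"
    using subringE(7)[OF M m(1) n(1)] m n Mc w by (intro image_eqI[of _ _ "m \<oplus> n"]) (auto simp: l_distr)
next
  note Mc = subring_carrier[OF M]
  fix m v assume m: "m \<in> M" and "v \<in> (\<lambda>m. m \<otimes> w) ` M"
  then obtain n where n: "n \<in> M" "v = n \<otimes> w" by blast
  show "m \<otimes> v \<in> (\<lambda>m. m \<otimes> w) ` M"
    using subringE(6)[OF M m n(1)] m n Mc w by (intro image_eqI[of _ _ "m \<otimes> n"]) (auto simp: m_assoc)
qed

text \<open>Zorn's lemma on the subspaces that contain \<open>U0\<close> and meet \<open>V\<close>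
  trivially; no basis is involved. A vector \<open>w\<close> outside \<open>U + V\<close> would
  allow \<open>U\<close> to be enlarged by the line \<open>M w\<close>.\<close>

lemma subspace_complement:
  assumes M: "subfield M R" and U0: "linear_subspace M U0" and V: "linear_subspace M V" and disj: "U0 \<inter> V = {\<zero>}"
  obtains U where "linear_subspace M U" "U0 \<subseteq> U" "U \<inter> V = {\<zero>}" "\<forall>w\<in>carrier R. \<exists>u\<in>U. \<exists>v\<in>V. w = u \<oplus> v"
proof -
  note Msr = subfieldE(1)[OF M]
  note Mc = subring_carrier[OF Msr] and MR = subringE(1)[OF Msr]
  note VA = add_closedD[OF subspaceD(1)[OF V]]
  define S where "S = {U. linear_subspace M U \<and> U0 \<subseteq> U \<and> U \<inter> V = {\<zero>}}"
  have "\<exists>U\<in>S. \<forall>J\<in>S. U \<subseteq> J \<longrightarrow> J = U"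
  proof (rule subset_Zorn_nonempty)
    show "S \<noteq> {}" unfolding S_def using U0 disj by blast
    fix c assume c: "c \<noteq> {}" "subset.chain S c"
    have cs: "U \<in> c \<Longrightarrow> linear_subspace M U" "U \<in> c \<Longrightarrow> U0 \<subseteq> U" "U \<in> c \<Longrightarrow> U \<inter> V = {\<zero>}" for U
      using c(2) unfolding subset_chain_def S_def by auto
    have "linear_subspace M (\<Union>c)"
      unfolding linear_subspace_def add_closed_def
    proof (intro conjI ballI)
      show "\<Union>c \<subseteq> carrier R" using add_closedD(5)[OF subspaceD(1)[OF cs(1)]] by blast
      show "\<zero> \<in> \<Union>c" using c(1) cs(3) by blast
      fix x assume "x \<in> \<Union>c"
      then obtain U where U: "U \<in> c" "x \<in> U" by blast
      then show "\<ominus> x \<in> \<Union>c" using add_closedD(4)[OF subspaceD(1)[OF cs(1)]] by blast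
      fix y assume "y \<in> \<Union>c"
      then obtain U' where U': "U' \<in> c" "y \<in> U'" by blast
      have "U \<subseteq> U' \<or> U' \<subseteq> U" using c(2) U U' unfolding subset_chain_def by blast
      then obtain U2 where "U2 \<in> c" "x \<in> U2" "y \<in> U2" using U U' by blast
      then show "x \<oplus> y \<in> \<Union>c" using add_closedD(3)[OF subspaceD(1)[OF cs(1)]] by blast
    next
      fix m v assume "m \<in> M" "v \<in> \<Union>c"
      then show "m \<otimes> v \<in> \<Union>c" using subspaceD(2)[OF cs(1)] by blast
    qed
    moreover have "U0 \<subseteq> \<Union>c" using cs(2) c(1) by blast
    moreover have "\<Union>c \<inter> V = {\<zero>}" using cs(3) c(1) by blast
    ultimately show "\<Union>c \<in> S" unfolding S_def by blast
  qed
  then obtain U where "U \<in> S" and max: "\<forall>J\<in>S. U \<subseteq> J \<longrightarrow> J = U" by blast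
  then have U: "linear_subspace M U" "U0 \<subseteq> U" "U \<inter> V = {\<zero>}" unfolding S_def by auto
  note UA = add_closedD[OF subspaceD(1)[OF U(1)]]
  have "\<exists>u\<in>U. \<exists>v\<in>V. w = u \<oplus> v" if w: "w \<in> carrier R" for w
  proof (rule ccontr)
    assume no: "\<not> (\<exists>u\<in>U. \<exists>v\<in>V. w = u \<oplus> v)"
    define L where "L = (\<lambda>m. m \<otimes> w) ` M"
    define U' where "U' = {u \<oplus> l | u l. u \<in> U \<and> l \<in> L}"
    have L: "linear_subspace M L" unfolding L_def by (rule subspace_line[OF Msr w])
    have "linear_subspace M U'" unfolding U'_def by (rule subspace_sum[OF U(1) L MR])
    moreover have UU': "U \<subseteq> U'"
    proof
      fix u assume u: "u \<in> U"
      have "u = u \<oplus> \<zero>" using UA(5)[OF u] by simp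
      then show "u \<in> U'" unfolding U'_def using u add_closedD(2)[OF subspaceD(1)[OF L]] by blast
    qed
    moreover have "y = \<zero>" if y: "y \<in> U'" "y \<in> V" for y
    proof -
      obtain u m where um: "u \<in> U" "m \<in> M" "y = u \<oplus> m \<otimes> w" using y(1) unfolding U'_def L_def by blast
      have [simp]: "u \<in> carrier R" "m \<in> carrier R" "y \<in> carrier R" "w \<in> carrier R"
        using UA(5)[OF um(1)] Mc[OF um(2)] VA(5)[OF y(2)] w by auto
      have "m = \<zero>"
      proof (rule ccontr)
        assume m: "m \<noteq> \<zero>"
        then have im: "inv m \<in> M" using subfield_m_inv(1)[OF M] um(2) by auto
        have imm: "inv m \<otimes> m = \<one>" using subfield_m_inv(3)[OF M] um(2) m by auto
        have [simp]: "inv m \<in> carrier R" using Mc[OF im] .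
        have "m \<otimes> w = y \<ominus> u" unfolding um(3) by (simp add: minus_eq a_ac r_neg2 r_neg)
        then have "inv m \<otimes> (m \<otimes> w) = inv m \<otimes> (y \<ominus> u)" by simp
        then have "w = inv m \<otimes> (\<ominus> u) \<oplus> inv m \<otimes> y"
          using imm by (simp add: m_assoc[symmetric]) (simp add: minus_eq r_distr a_comm)
        moreover have "inv m \<otimes> (\<ominus> u) \<in> U" "inv m \<otimes> y \<in> V"
          using subspaceD(2)[OF U(1) im] UA(4)[OF um(1)] subspaceD(2)[OF V im y(2)] by auto
        ultimately show False using no by blast
      qed
      then have "y = u" using um(3) by simp
      then show ?thesis using um(1) y(2) U(3) by blast
    qed
    moreover have "\<zero> \<in> U'" "\<zero> \<in> V" using UU' UA(2) VA(2) by auto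
    ultimately have "U' \<in> S" unfolding S_def using U(2) by blast
    then have "U' = U" using max UU' by blast
    moreover have "w \<in> U'"
    proof -
      have "w = \<zero> \<oplus> \<one> \<otimes> w" using w by simp
      then show ?thesis unfolding U'_def L_def using UA(2) subringE(3)[OF Msr] by blast
    qed
    ultimately have "w \<in> U" by simp
    moreover have "w = w \<oplus> \<zero>" using w by simp
    ultimately show False using no VA(2) by blast
  qed
  then show ?thesis using that[OF U] by blast
qed

lemma linear_projection:
  assumes M: "subfield M R" and U0: "linear_subspace M U0" and V: "linear_subspace M V" and disj: "U0 \<inter> V = {\<zero>}"
  obtains pr where "\<And>w. w \<in> carrier R \<Longrightarrow> pr w \<in> V" "\<And>v. v \<in> V \<Longrightarrow> pr v = v" "\<And>u. u \<in> U0 \<Longrightarrow> pr u = \<zero>"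
    "\<And>v w. v \<in> carrier R \<Longrightarrow> w \<in> carrier R \<Longrightarrow> pr (v \<oplus> w) = pr v \<oplus> pr w"
    "\<And>m w. m \<in> M \<Longrightarrow> w \<in> carrier R \<Longrightarrow> pr (m \<otimes> w) = m \<otimes> pr w"
proof -
  obtain U where U: "linear_subspace M U" "U0 \<subseteq> U" "U \<inter> V = {\<zero>}"
    and dec: "\<forall>w\<in>carrier R. \<exists>u\<in>U. \<exists>v\<in>V. w = u \<oplus> v"
    using subspace_complement[OF assms] by blast
  note UA = add_closedD[OF subspaceD(1)[OF U(1)]] and VA = add_closedD[OF subspaceD(1)[OF V]]
  note Mc = subring_carrier[OF subfieldE(1)[OF M]]
  have uniq: "v = v'" if uv: "u \<in> U" "u' \<in> U" "v \<in> V" "v' \<in> V" "u \<oplus> v = u' \<oplus> v'" for u u' v v'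
  proof -
    have [simp]: "u \<in> carrier R" "u' \<in> carrier R" "v \<in> carrier R" "v' \<in> carrier R" using uv UA(5) VA(5) by auto
    have "u \<ominus> u' = (u \<oplus> v) \<ominus> (u' \<oplus> v)" by (simp add: ring_norm)
    also have "\<dots> = v' \<ominus> v" unfolding uv(5) by (simp add: ring_norm)
    finally have "v' \<ominus> v \<in> U" using add_closed_minus[OF subspaceD(1)[OF U(1)] uv(1,2)] by simp
    moreover have "v' \<ominus> v \<in> V" using add_closed_minus[OF subspaceD(1)[OF V] uv(4,3)] .
    ultimately have "v' \<ominus> v = \<zero>" using U(3) by blast
    then show ?thesis by simp
  qed
  define pr where "pr w = (THE v. v \<in> V \<and> (\<exists>u\<in>U. w = u \<oplus> v))" for w
  have pr_eq: "pr (u \<oplus> v) = v" if "u \<in> U" "v \<in> V" for u v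
    unfolding pr_def
  proof (rule the_equality)
    show "v \<in> V \<and> (\<exists>w\<in>U. u \<oplus> v = w \<oplus> v)" using that by blast
    show "v' = v" if "v' \<in> V \<and> (\<exists>w\<in>U. u \<oplus> v = w \<oplus> v')" for v'
      using that uniq[OF \<open>u \<in> U\<close> _ \<open>v \<in> V\<close>] by metis
  qed
  show ?thesis
  proof (rule that)
    show "pr w \<in> V" if w: "w \<in> carrier R" for w
    proof -
      obtain u v where "u \<in> U" "v \<in> V" "w = u \<oplus> v" using dec w by blast
      then show ?thesis using pr_eq by simp
    qed
    show "pr v = v" if "v \<in> V" for v using pr_eq[OF UA(2) that] VA(5)[OF that] by simp
    show "pr u = \<zero>" if "u \<in> U0" for u using pr_eq[OF _ VA(2), of u] UA(5)[of u] U(2) that by auto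
    fix w assume "w \<in> carrier R"
    then obtain u v where w: "u \<in> U" "v \<in> V" "w = u \<oplus> v" using dec by blast
    have [simp]: "u \<in> carrier R" "v \<in> carrier R" using w UA(5) VA(5) by auto
    show "pr (m \<otimes> w) = m \<otimes> pr w" if m: "m \<in> M" for m
    proof -
      have "m \<otimes> w = m \<otimes> u \<oplus> m \<otimes> v" unfolding w using Mc[OF m] by (simp add: r_distr)
      then show ?thesis using pr_eq subspaceD(2)[OF U(1) m w(1)] subspaceD(2)[OF V m w(2)] w by simp
    qed
    fix w' assume "w' \<in> carrier R"
    then obtain u' v' where w': "u' \<in> U" "v' \<in> V" "w' = u' \<oplus> v'" using dec by blast
    have [simp]: "u' \<in> carrier R" "v' \<in> carrier R" using w' UA(5) VA(5) by auto
    have "w' \<oplus> w = (u' \<oplus> u) \<oplus> (v' \<oplus> v)" unfolding w w' by (simp add: a_ac)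
    then show "pr (w' \<oplus> w) = pr w' \<oplus> pr w" using pr_eq UA(3)[OF w'(1) w(1)] VA(3)[OF w'(2) w(2)] w w' by simp
  qed
qed

text \<open>Projection onto the line \<open>M e\<close> along a complement containing
  \<open>U0\<close>, followed by division by \<open>e\<close>.\<close>

lemma linear_functional:
  assumes M: "subfield M R" and U0: "linear_subspace M U0" and e: "e \<in> carrier R" "e \<notin> U0"
  obtains lam where "\<And>w. w \<in> carrier R \<Longrightarrow> lam w \<in> M" "\<And>u. u \<in> U0 \<Longrightarrow> lam u = \<zero>" "lam e = \<one>"
    "\<And>v w. v \<in> carrier R \<Longrightarrow> w \<in> carrier R \<Longrightarrow> lam (v \<oplus> w) = lam v \<oplus> lam w"
    "\<And>m w. m \<in> M \<Longrightarrow> w \<in> carrier R \<Longrightarrow> lam (m \<otimes> w) = m \<otimes> lam w"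
proof -
  note Msr = subfieldE(1)[OF M]
  note Mc = subring_carrier[OF Msr]
  note UA = add_closedD[OF subspaceD(1)[OF U0]]
  define V where "V = (\<lambda>m. m \<otimes> e) ` M"
  have V: "linear_subspace M V" unfolding V_def by (rule subspace_line[OF Msr e(1)])
  have e0: "e \<noteq> \<zero>" using e UA(2) by blast
  then have U: "e \<in> Units R" using e(1) field_Units by simp
  have "x = \<zero>" if x: "x \<in> U0" "x \<in> V" for x
  proof -
    obtain m where m: "m \<in> M" "x = m \<otimes> e" using x unfolding V_def by blast
    show ?thesis
    proof (rule ccontr)
      assume "x \<noteq> \<zero>"
      then have "m \<noteq> \<zero>" using m e by auto
      then have im: "inv m \<in> M" "inv m \<otimes> m = \<one>" using subfield_m_inv(1,3)[OF M] m by auto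
      have "inv m \<otimes> x = e" unfolding m using im Mc[OF m(1)] Mc[OF im(1)] e(1) by (simp add: m_assoc[symmetric])
      then show False using subspaceD(2)[OF U0 im(1) x(1)] e(2) by simp
    qed
  qed
  then have disj: "U0 \<inter> V = {\<zero>}" using UA(2) add_closedD(2)[OF subspaceD(1)[OF V]] by blast
  obtain pr where pr: "\<And>w. w \<in> carrier R \<Longrightarrow> pr w \<in> V" "\<And>v. v \<in> V \<Longrightarrow> pr v = v" "\<And>u. u \<in> U0 \<Longrightarrow> pr u = \<zero>"
    "\<And>v w. v \<in> carrier R \<Longrightarrow> w \<in> carrier R \<Longrightarrow> pr (v \<oplus> w) = pr v \<oplus> pr w"
    "\<And>m w. m \<in> M \<Longrightarrow> w \<in> carrier R \<Longrightarrow> pr (m \<otimes> w) = m \<otimes> pr w"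
    using linear_projection[OF M U0 V disj] by blast
  have prc: "w \<in> carrier R \<Longrightarrow> pr w \<in> carrier R" for w
    using pr(1) add_closedD(5)[OF subspaceD(1)[OF V]] by blast
  have ic: "inv e \<in> carrier R" using U by simp
  show ?thesis
  proof (rule that[of "\<lambda>w. pr w \<otimes> inv e"])
    fix w assume w: "w \<in> carrier R"
    obtain m where m: "m \<in> M" "pr w = m \<otimes> e" using pr(1)[OF w] unfolding V_def by blast
    then show "pr w \<otimes> inv e \<in> M" using Mc[OF m(1)] e(1) U ic by (simp add: m_assoc)
    show "pr (m \<otimes> w) \<otimes> inv e = m \<otimes> (pr w \<otimes> inv e)" if "m \<in> M" for m
      using pr(5)[OF that w] Mc[OF that] prc[OF w] ic by (simp add: m_assoc)
    show "pr (v \<oplus> w) \<otimes> inv e = pr v \<otimes> inv e \<oplus> pr w \<otimes> inv e" if "v \<in> carrier R" for v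
      using pr(4)[OF that w] prc[OF that] prc[OF w] ic by (simp add: l_distr)
  next
    show "pr u \<otimes> inv e = \<zero>" if "u \<in> U0" for u using pr(3)[OF that] ic by simp
    have "\<one> \<otimes> e \<in> V" unfolding V_def using subringE(3)[OF Msr] by blast
    then show "pr e \<otimes> inv e = \<one>" using pr(2)[of e] e(1) U by simp
  qed
qed

end

section \<open>Extension of scalars\<close>

lemma hev_consistent: "hev (R\<lparr>carrier := S\<rparr>) a s cs = hev R a s cs"
  by (induction cs) (simp_all add: nat_pow_def)

lemma dep_consistent: "dep (R\<lparr>carrier := S\<rparr>) = dep R"
  by (intro ext) (simp add: dep_def hev_consistent)

text \<open>None of these notions reads the carrier of the record, so a subring may be treated as a
  ring of its own.\<close>

lemma pic_consistent: "pic_on (R\<lparr>carrier := S\<rparr>) = pic_on R"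
  by (intro ext) (simp add: pic_on_def dep_consistent)

lemma (in cring) pic_trivial:
  assumes "\<one> = \<zero>" "subring S R" shows "pic R S"
proof -
  have "carrier R = {\<zero>}" using assms(1) carrier_one_zero by blast
  then have "a = s \<otimes> \<zero>" if "a \<in> S" "s \<in> S" for a s
    using that subring_carrier[OF assms(2)] by (metis r_null singletonD)
  then show ?thesis unfolding pic_on_def using subringE(2)[OF assms(2)] by blast
qed

lemma (in cring) pv_append:
  assumes "set zs \<subseteq> carrier R" "set us \<subseteq> carrier R" "t \<in> carrier R"
  shows "pv R (zs @ us) t = pv R zs t \<oplus> t [^] length zs \<otimes> pv R us t"
  using assms(1)
proof (induction zs)
  case Nil
  then show ?case using pv_closed[OF assms(2,3)] by simp
next
  case (Cons z zs)
  then have [simp]: "z \<in> carrier R" "pv R zs t \<in> carrier R" "pv R us t \<in> carrier R" "t \<in> carrier R"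
    using assms pv_closed by auto
  have "pv R ((z # zs) @ us) t = z \<oplus> t \<otimes> (pv R zs t \<oplus> t [^] length zs \<otimes> pv R us t)" using Cons by simp
  also have "\<dots> = pv R (z # zs) t \<oplus> t [^] length (z # zs) \<otimes> pv R us t" by (simp add: ring_norm)
  finally show ?case .
qed

lemma (in cring) pv_scale:
  assumes "set zs \<subseteq> carrier R" "l \<in> carrier R" "t \<in> carrier R"
  shows "pv R (map ((\<otimes>) l) zs) t = l \<otimes> pv R zs t"
  using assms(1)
proof (induction zs)
  case (Cons z zs)
  then have [simp]: "z \<in> carrier R" "pv R zs t \<in> carrier R" using assms pv_closed by auto
  show ?case using Cons assms(2,3) by (simp add: r_distr m_lcomm)
qed (use assms in simp)

text \<open>Division with remainder by the monic polynomial with lower coefficients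
  \<open>fs\<close>. The remainder is fixed before the root \<open>t\<close>, so it serves for
  \<open>x\<close> and for all conjugates at once.\<close>

lemma (in cring) pv_reduce:
  assumes M: "subring M R" and fs: "set fs \<subseteq> M" and zs: "set zs \<subseteq> M"
  shows "\<exists>ms. set ms \<subseteq> M \<and> length ms = length fs \<and>
    (\<forall>t\<in>carrier R. t [^] length fs \<oplus> pv R fs t = \<zero> \<longrightarrow> pv R zs t = pv R ms t)"
  using zs
proof (induction zs)
  case Nil
  have "pv R (replicate n \<zero>) t = \<zero>" if "t \<in> carrier R" for n t using that by (induction n) auto
  then show ?case using subringE(2)[OF M] by (intro exI[of _ "replicate (length fs) \<zero>"]) auto
next
  case (Cons z zs)
  note Mc = subringE(1)[OF M]
  obtain ms where ms: "set ms \<subseteq> M" "length ms = length fs"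
    "\<forall>t\<in>carrier R. t [^] length fs \<oplus> pv R fs t = \<zero> \<longrightarrow> pv R zs t = pv R ms t" using Cons by auto
  \<comment> \<open>The list for \<open>z + T ms\<close> has one coefficient too many; its top term
    \<open>l T^d\<close> is replaced by \<open>- l fs\<close>.\<close>
  define ls where "ls = z # ms"
  have ls: "set ls \<subseteq> M" "length ls = Suc (length fs)" unfolding ls_def using ms Cons by auto
  then obtain us l where ul: "ls = us @ [l]" by (metis length_Suc_conv_rev)
  have us: "set us \<subseteq> M" "l \<in> M" "length us = length fs" using ls ul by auto
  have nl: "\<ominus> l \<in> M" using subringE(5)[OF M us(2)] .
  define gs where "gs = map ((\<otimes>) (\<ominus> l)) fs"
  have gs: "set gs \<subseteq> M" "length gs = length fs" unfolding gs_def using fs subringE(6)[OF M nl] by auto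
  obtain vs where vs: "set vs \<subseteq> M" "length vs = length fs" "\<forall>t\<in>carrier R. pv R vs t = pv R us t \<oplus> pv R gs t"
    using pv_add_ex[OF M us(1) gs(1)] us gs by auto
  have "pv R (z # zs) t = pv R vs t" if t: "t \<in> carrier R" "t [^] length fs \<oplus> pv R fs t = \<zero>" for t
  proof -
    have [simp]: "l \<in> carrier R" "pv R us t \<in> carrier R" "pv R fs t \<in> carrier R" "set us \<subseteq> carrier R"
      using us Mc t fs by (auto intro!: pv_closed)
    have xd: "t [^] length fs = \<ominus> pv R fs t" using t by (simp add: eq_neg_iff)
    have "pv R (z # zs) t = pv R (us @ [l]) t" unfolding ul[symmetric] ls_def using ms t by simp
    also have "\<dots> = pv R us t \<oplus> t [^] length fs \<otimes> l" using pv_append[of us "[l]" t] us t by simp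
    also have "\<dots> = pv R us t \<oplus> (\<ominus> l) \<otimes> pv R fs t" unfolding xd by (simp add: l_minus r_minus m_comm)
    also have "(\<ominus> l) \<otimes> pv R fs t = pv R gs t" unfolding gs_def using fs Mc t by (subst pv_scale) auto
    finally show ?thesis using vs t by simp
  qed
  then show ?case using vs by blast
qed

section \<open>The subrings A \<otimes> M of A \<otimes> W\<close>

locale base_change = tensor K A W + W: field W + K: field K
  for K :: "('k, 'l) ring_scheme" and A :: "('k, 'a, 'm) module_scheme" and W :: "('k, 'b, 'n) module_scheme"
begin

definition j where "j w = te \<one>\<^bsub>A\<^esub> w"

text \<open>The image of \<open>A \<otimes> M\<close> in \<open>A \<otimes> W\<close>.\<close>

inductive_set bm :: "'b set \<Rightarrow> ('a \<times> 'b \<Rightarrow>\<^sub>0 int) set set" for M where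
  zero: "\<zero>\<^bsub>T\<^esub> \<in> bm M"
| te: "a \<in> carrier A \<Longrightarrow> m \<in> M \<Longrightarrow> te a m \<in> bm M"
| diff: "x \<in> bm M \<Longrightarrow> y \<in> bm M \<Longrightarrow> x \<ominus>\<^bsub>T\<^esub> y \<in> bm M"

lemma j_closed [simp]: "w \<in> carrier W \<Longrightarrow> j w \<in> carrier T"
  unfolding j_def by simp

lemma j_hom: "j \<in> ring_hom W T"
  by (rule ring_hom_memI) (auto simp: j_def te_add2 te_mult te_one)

sublocale j: ring_hom_cring W T j
  using j_hom by unfold_locales

lemma te_eq: "a \<in> carrier A \<Longrightarrow> w \<in> carrier W \<Longrightarrow> te a w = te a \<one>\<^bsub>W\<^esub> \<otimes>\<^bsub>T\<^esub> j w"
  unfolding j_def by (simp add: te_mult)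

lemma te_j: "a \<in> carrier A \<Longrightarrow> v \<in> carrier W \<Longrightarrow> w \<in> carrier W \<Longrightarrow> te a (v \<otimes>\<^bsub>W\<^esub> w) = te a v \<otimes>\<^bsub>T\<^esub> j w"
  unfolding j_def by (simp add: te_mult)

lemma bm_carrier:
  assumes "M \<subseteq> carrier W" "x \<in> bm M" shows "x \<in> carrier T"
  using assms(2) by induction (use assms(1) in auto)

lemma bm_mono: "M \<subseteq> M' \<Longrightarrow> bm M \<subseteq> bm M'"
proof
  fix x assume "M \<subseteq> M'" and "x \<in> bm M"
  from this(2) show "x \<in> bm M'"
    by induction (use \<open>M \<subseteq> M'\<close> bm.intros in blast)+
qed

lemma bm_full: "bm (carrier W) = carrier T"
proof
  show "bm (carrier W) \<subseteq> carrier T" using bm_carrier by blast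
  show "carrier T \<subseteq> bm (carrier W)"
  proof
    fix z assume "z \<in> carrier T" then show "z \<in> bm (carrier W)"
      by (induction z rule: T_induct) (auto intro: bm.intros)
  qed
qed

lemma bm_add: "M \<subseteq> carrier W \<Longrightarrow> x \<in> bm M \<Longrightarrow> y \<in> bm M \<Longrightarrow> x \<oplus>\<^bsub>T\<^esub> y \<in> bm M"
proof -
  assume M: "M \<subseteq> carrier W" and x: "x \<in> bm M" and y: "y \<in> bm M"
  have "x \<ominus>\<^bsub>T\<^esub> (\<zero>\<^bsub>T\<^esub> \<ominus>\<^bsub>T\<^esub> y) \<in> bm M" using x y by (intro bm.diff bm.zero)
  moreover have "x \<ominus>\<^bsub>T\<^esub> (\<zero>\<^bsub>T\<^esub> \<ominus>\<^bsub>T\<^esub> y) = x \<oplus>\<^bsub>T\<^esub> y"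
    using bm_carrier[OF M x] bm_carrier[OF M y] by (simp add: T.ring_norm)
  ultimately show ?thesis by simp
qed

lemma bm_minus: "M \<subseteq> carrier W \<Longrightarrow> x \<in> bm M \<Longrightarrow> \<ominus>\<^bsub>T\<^esub> x \<in> bm M"
  using bm.diff[OF bm.zero] bm_carrier by (metis T.a_inv_closed T.l_zero a_minus_def)

lemma bm_mult:
  assumes M: "subring M W" and x: "x \<in> bm M" and y: "y \<in> bm M"
  shows "x \<otimes>\<^bsub>T\<^esub> y \<in> bm M"
proof -
  note Mc = subringE(1)[OF M]
  have 1: "te a m \<otimes>\<^bsub>T\<^esub> y \<in> bm M" if am: "a \<in> carrier A" "m \<in> M" for a m
    using y
  proof induction
    case zero
    have "te a m \<in> carrier T" using am Mc by auto
    then show ?case by (simp add: bm.zero)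
  next
    case (te b n)
    have "m \<in> carrier W" "n \<in> carrier W" using am te Mc by auto
    then show ?case using am te subringE(6)[OF M] by (simp add: te_mult bm.te)
  next
    case (diff u v)
    have "te a m \<in> carrier T" using am Mc by auto
    then show ?case using diff bm_carrier[OF Mc] by (simp add: T.diff_mult2 bm.diff)
  qed
  have yc: "y \<in> carrier T" using bm_carrier[OF Mc y] .
  show ?thesis using x
  proof induction
    case (diff u v)
    then show ?case using bm_carrier[OF Mc] yc by (simp add: T.diff_mult1 bm.diff)
  qed (use yc 1 in \<open>auto simp: bm.zero\<close>)
qed

lemma bm_subring:
  assumes M: "subring M W" shows "subring (bm M) T"
proof (rule T.subringI)
  note Mc = subringE(1)[OF M]
  show "bm M \<subseteq> carrier T" using bm_carrier[OF Mc] by blast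
  show "\<one>\<^bsub>T\<^esub> \<in> bm M" unfolding te_one using subringE(3)[OF M] by (intro bm.te) auto
qed (use bm_minus bm_add bm_mult subringE(1)[OF M] M in auto)

lemma j_bm: "m \<in> M \<Longrightarrow> j m \<in> bm M"
  unfolding j_def by (rule bm.te) auto

lemma bm_chain_Union:
  assumes c: "c \<noteq> {}" "\<And>M N. M \<in> c \<Longrightarrow> N \<in> c \<Longrightarrow> M \<subseteq> N \<or> N \<subseteq> M" and x: "x \<in> bm (\<Union>c)"
  shows "\<exists>M\<in>c. x \<in> bm M"
  using x
proof induction
  case zero
  then show ?case using c(1) bm.zero by blast
next
  case (te a m)
  then show ?case using bm.te by blast
next
  case (diff x y)
  then obtain M N where "M \<in> c" "x \<in> bm M" "N \<in> c" "y \<in> bm N" by blast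
  then show ?case using c(2)[of M N] bm_mono[of M N] bm_mono[of N M] bm.diff by blast
qed

text \<open>The two elements and the coefficients of an equation are finitely many and lie over one
  member of the chain.\<close>

lemma pic_chain_Union:
  assumes c: "c \<noteq> {}" "\<And>M N. M \<in> c \<Longrightarrow> N \<in> c \<Longrightarrow> M \<subseteq> N \<or> N \<subseteq> M"
    and p: "\<And>M. M \<in> c \<Longrightarrow> pic T (bm M)"
  shows "pic T (bm (\<Union>c))"
  unfolding pic_on_def
proof (intro ballI impI)
  fix a s assume "a \<in> bm (\<Union>c)" "s \<in> bm (\<Union>c)" and dep: "dep T (bm (\<Union>c)) a s"
  then obtain M N where M: "M \<in> c" "a \<in> bm M" and N: "N \<in> c" "s \<in> bm N" using bm_chain_Union[OF c] by meson
  obtain cs where cs: "set cs \<subseteq> bm (\<Union>c)" "hev T a s cs = \<zero>\<^bsub>T\<^esub>" using dep unfolding dep_def by blast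
  from cs(1) have "\<exists>L\<in>c. set cs \<subseteq> bm L"
  proof (induction cs)
    case (Cons d cs)
    then obtain L where L: "L \<in> c" "set cs \<subseteq> bm L" by auto
    obtain L' where L': "L' \<in> c" "d \<in> bm L'" using bm_chain_Union[OF c, of d] Cons by auto
    from c(2)[OF L(1) L'(1)] show ?case
    proof
      assume "L \<subseteq> L'"
      then show ?case using bm_mono[of L L'] L L' by (intro bexI[of _ L']) auto
    next
      assume "L' \<subseteq> L"
      then show ?case using bm_mono[of L' L] L L' by (intro bexI[of _ L]) auto
    qed
  qed (use c in auto)
  then obtain L where L: "L \<in> c" "set cs \<subseteq> bm L" by blast
  have "\<exists>Q\<in>c. M \<subseteq> Q \<and> N \<subseteq> Q \<and> L \<subseteq> Q"
    using c(2)[OF M(1) N(1)] c(2)[OF M(1) L(1)] c(2)[OF N(1) L(1)] M N L by blast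
  then obtain Q where Q: "Q \<in> c" "M \<subseteq> Q" "N \<subseteq> Q" "L \<subseteq> Q" by blast
  have "a \<in> bm Q" "s \<in> bm Q" "dep T (bm Q) a s"
    using M N L Q bm_mono cs(2) unfolding dep_def by blast+
  then obtain b where "b \<in> bm Q" "a = s \<otimes>\<^bsub>T\<^esub> b" using picD[OF p[OF Q(1)]] by blast
  then show "\<exists>b\<in>bm (\<Union>c). a = s \<otimes>\<^bsub>T\<^esub> b" using bm_mono[of Q "\<Union>c"] Q(1) by blast
qed

definition base :: "'b set" where "base = (\<lambda>k. k \<odot>\<^bsub>W\<^esub> \<one>\<^bsub>W\<^esub>) ` carrier K"

lemma smult_base: "k \<in> carrier K \<Longrightarrow> w \<in> carrier W \<Longrightarrow> k \<odot>\<^bsub>W\<^esub> w = (k \<odot>\<^bsub>W\<^esub> \<one>\<^bsub>W\<^esub>) \<otimes>\<^bsub>W\<^esub> w"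
  using B.smult_assoc2[of k "\<one>\<^bsub>W\<^esub>" w] by simp

text \<open>An \<open>M\<close>-linear \<open>\<phi>\<close> is \<open>K\<close>-linear because
  \<open>M\<close> contains the image \<open>base\<close> of \<open>K\<close>, so it can be tensored
  with \<open>A\<close>. The last clause keeps track of where the images lie.\<close>

lemma linear_map:
  assumes M: "M \<subseteq> carrier W" "base \<subseteq> M"
    and \<phi>: "\<And>w. w \<in> carrier W \<Longrightarrow> \<phi> w \<in> carrier W"
      "\<And>v w. v \<in> carrier W \<Longrightarrow> w \<in> carrier W \<Longrightarrow> \<phi> (v \<oplus>\<^bsub>W\<^esub> w) = \<phi> v \<oplus>\<^bsub>W\<^esub> \<phi> w"
      "\<And>m w. m \<in> M \<Longrightarrow> w \<in> carrier W \<Longrightarrow> \<phi> (m \<otimes>\<^bsub>W\<^esub> w) = m \<otimes>\<^bsub>W\<^esub> \<phi> w"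
  obtains F where "\<And>z. z \<in> carrier T \<Longrightarrow> F z \<in> carrier T"
    "\<And>y z. y \<in> carrier T \<Longrightarrow> z \<in> carrier T \<Longrightarrow> F (y \<oplus>\<^bsub>T\<^esub> z) = F y \<oplus>\<^bsub>T\<^esub> F z"
    "\<And>y z. y \<in> bm M \<Longrightarrow> z \<in> carrier T \<Longrightarrow> F (y \<otimes>\<^bsub>T\<^esub> z) = y \<otimes>\<^bsub>T\<^esub> F z"
    "\<And>a w. a \<in> carrier A \<Longrightarrow> w \<in> carrier W \<Longrightarrow> F (te a w) = te a (\<phi> w)"
    "\<And>V V' z. V \<subseteq> carrier W \<Longrightarrow> \<phi> ` V \<subseteq> V' \<Longrightarrow> V' \<subseteq> carrier W \<Longrightarrow> z \<in> bm V \<Longrightarrow> F z \<in> bm V'"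
proof -
  interpret tensor_pair K A W W by unfold_locales
  have \<phi>K: "\<phi> (k \<odot>\<^bsub>W\<^esub> w) = k \<odot>\<^bsub>W\<^esub> \<phi> w" if k: "k \<in> carrier K" and w: "w \<in> carrier W" for k w
  proof -
    have "k \<odot>\<^bsub>W\<^esub> \<one>\<^bsub>W\<^esub> \<in> M" using k M unfolding base_def by blast
    then show ?thesis using smult_base[OF k w] smult_base[OF k \<phi>(1)[OF w]] \<phi>(3) w by simp
  qed
  obtain F where F: "\<And>z. z \<in> carrier T \<Longrightarrow> F z \<in> carrier T"
    "\<And>y z. y \<in> carrier T \<Longrightarrow> z \<in> carrier T \<Longrightarrow> F (y \<oplus>\<^bsub>T\<^esub> z) = F y \<oplus>\<^bsub>T\<^esub> F z"
    "\<And>a b. a \<in> carrier A \<Longrightarrow> b \<in> carrier W \<Longrightarrow> F (te a b) = te a (\<phi> b)"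
  proof -
    show ?thesis by (rule tensor_map[of \<phi>, OF \<phi>(1,2) \<phi>K]; (assumption | rule that)+)
  qed
  have F0: "F \<zero>\<^bsub>T\<^esub> = \<zero>\<^bsub>T\<^esub>"
    using F(2)[of "\<zero>\<^bsub>T\<^esub>" "\<zero>\<^bsub>T\<^esub>"] F(1)[of "\<zero>\<^bsub>T\<^esub>"] T.add.r_cancel_one'[of "F \<zero>\<^bsub>T\<^esub>" "F \<zero>\<^bsub>T\<^esub>"] by simp
  have Fd: "F (y \<ominus>\<^bsub>T\<^esub> z) = F y \<ominus>\<^bsub>T\<^esub> F z" if yz: "y \<in> carrier T" "z \<in> carrier T" for y z
  proof -
    have "F ((y \<ominus>\<^bsub>T\<^esub> z) \<oplus>\<^bsub>T\<^esub> z) = F (y \<ominus>\<^bsub>T\<^esub> z) \<oplus>\<^bsub>T\<^esub> F z" using F(2) yz by simp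
    moreover have "(y \<ominus>\<^bsub>T\<^esub> z) \<oplus>\<^bsub>T\<^esub> z = y" using yz by (simp add: T.ring_norm)
    ultimately show ?thesis using F(1) yz by (simp add: T.eq_diff_iff)
  qed
  show ?thesis
  proof (rule that[OF F(1,2) _ F(3)])
    fix y z assume y: "y \<in> bm M" and z: "z \<in> carrier T"
    show "F (y \<otimes>\<^bsub>T\<^esub> z) = y \<otimes>\<^bsub>T\<^esub> F z" using y
    proof induction
      case zero
      then show ?case using F(1) z F0 by simp
    next
      case (te a m)
      have m: "m \<in> carrier W" using te M by blast
      show ?case using z
      proof (induction z rule: T_induct)
        case zero
        then show ?case using F0 te m by simp
      next
        case (te b w)
        then show ?case using \<open>a \<in> carrier A\<close> m \<open>m \<in> M\<close> F(3) \<phi> by (simp add: te_mult)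
      next
        case (diff u v)
        then show ?case using \<open>a \<in> carrier A\<close> m F(1) Fd by (simp add: T.diff_mult2)
      qed
    next
      case (diff u v)
      then show ?case using bm_carrier[OF M(1)] z F(1) Fd by (simp add: T.diff_mult1)
    qed
  next
    fix V V' z assume V: "V \<subseteq> carrier W" "\<phi> ` V \<subseteq> V'" "V' \<subseteq> carrier W" and "z \<in> bm V"
    from this(4) show "F z \<in> bm V'"
    proof induction
      case (diff u v)
      then show ?case using Fd bm_carrier[OF V(1)] by (simp add: bm.diff)
    next
      case (te a m)
      have "m \<in> carrier W" "\<phi> m \<in> V'" using te V by auto
      then show ?case using F(3) te by (simp add: bm.te)
    qed (simp add: F0 bm.zero)
  qed
qed

text \<open>Obtained from an \<open>M\<close>-linear projection of the field \<open>W\<close> onto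
  \<open>M\<close>. It is linear over \<open>bm M\<close> but in general not multiplicative;
  linearity suffices to bring equations back.\<close>

lemma retraction:
  assumes M: "subfield M W" "base \<subseteq> M"
  obtains \<rho> where "\<And>a. a \<in> carrier T \<Longrightarrow> \<rho> a \<in> bm M" "\<rho> \<one>\<^bsub>T\<^esub> = \<one>\<^bsub>T\<^esub>"
      "\<And>a b. a \<in> carrier T \<Longrightarrow> b \<in> carrier T \<Longrightarrow> \<rho> (a \<oplus>\<^bsub>T\<^esub> b) = \<rho> a \<oplus>\<^bsub>T\<^esub> \<rho> b"
      "\<And>c a. c \<in> bm M \<Longrightarrow> a \<in> carrier T \<Longrightarrow> \<rho> (c \<otimes>\<^bsub>T\<^esub> a) = c \<otimes>\<^bsub>T\<^esub> \<rho> a"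
proof -
  note Msr = subfieldE(1)[OF M(1)] and Mc = subfieldE(3)[OF M(1)]
  have disj: "{\<zero>\<^bsub>W\<^esub>} \<inter> M = {\<zero>\<^bsub>W\<^esub>}" using subringE(2)[OF Msr] by blast
  obtain pr where pr: "\<And>w. w \<in> carrier W \<Longrightarrow> pr w \<in> M" "\<And>v. v \<in> M \<Longrightarrow> pr v = v" "\<And>u. u \<in> {\<zero>\<^bsub>W\<^esub>} \<Longrightarrow> pr u = \<zero>\<^bsub>W\<^esub>"
    "\<And>v w. v \<in> carrier W \<Longrightarrow> w \<in> carrier W \<Longrightarrow> pr (v \<oplus>\<^bsub>W\<^esub> w) = pr v \<oplus>\<^bsub>W\<^esub> pr w"
    "\<And>m w. m \<in> M \<Longrightarrow> w \<in> carrier W \<Longrightarrow> pr (m \<otimes>\<^bsub>W\<^esub> w) = m \<otimes>\<^bsub>W\<^esub> pr w"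
  proof -
    show ?thesis by (rule W.linear_projection[OF M(1) W.subspace_zero[OF Mc] W.subspace_subring[OF Msr] disj]; (assumption | rule that)+)
  qed
  have prW: "w \<in> carrier W \<Longrightarrow> pr w \<in> carrier W" for w using pr(1) Mc by blast
  obtain F where F: "\<And>z. z \<in> carrier T \<Longrightarrow> F z \<in> carrier T"
    "\<And>y z. y \<in> carrier T \<Longrightarrow> z \<in> carrier T \<Longrightarrow> F (y \<oplus>\<^bsub>T\<^esub> z) = F y \<oplus>\<^bsub>T\<^esub> F z"
    "\<And>y z. y \<in> bm M \<Longrightarrow> z \<in> carrier T \<Longrightarrow> F (y \<otimes>\<^bsub>T\<^esub> z) = y \<otimes>\<^bsub>T\<^esub> F z"
    "\<And>a w. a \<in> carrier A \<Longrightarrow> w \<in> carrier W \<Longrightarrow> F (te a w) = te a (pr w)"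
    "\<And>V V' z. V \<subseteq> carrier W \<Longrightarrow> pr ` V \<subseteq> V' \<Longrightarrow> V' \<subseteq> carrier W \<Longrightarrow> z \<in> bm V \<Longrightarrow> F z \<in> bm V'"
  proof -
    show ?thesis by (rule linear_map[OF Mc M(2) prW pr(4,5)]; (assumption | rule that)+)
  qed
  have "F a \<in> bm M" if "a \<in> carrier T" for a
    using F(5)[of "carrier W" M a] pr(1) Mc that bm_full by blast
  moreover have "F \<one>\<^bsub>T\<^esub> = \<one>\<^bsub>T\<^esub>"
    unfolding te_one using F(4)[of "\<one>\<^bsub>A\<^esub>" "\<one>\<^bsub>W\<^esub>"] pr(2)[OF subringE(3)[OF Msr]] by simp
  ultimately show ?thesis by (intro that[of F] F(2,3))
qed

text \<open>Evaluation at \<open>y\<close> is an \<open>M\<close>-linear map on \<open>M[x]\<close>.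
  It is extended to \<open>W\<close> by a projection onto \<open>M[x]\<close>, so that it induces a
  map on the whole of \<open>T\<close>; this map is linear over \<open>bm M\<close>, sends the
  powers of \<open>j x\<close> to those of \<open>j y\<close>, and therefore carries relations to
  relations.\<close>

lemma specialization_lift:
  assumes M: "subfield M W" "base \<subseteq> M" and x: "x \<in> carrier W" and xy: "specialization W M x y"
  shows "specialization T (bm M) (j x) (j y)"
proof -
  note Msr = subfieldE(1)[OF M(1)] and Mc = subfieldE(3)[OF M(1)]
  have y: "y \<in> carrier W" using xy unfolding specialization_def by blast
  define V where "V = pimage W M x"
  have Vs: "subring V W" unfolding V_def by (rule B.pimage_subring[OF Msr x])
  have MV: "M \<subseteq> V" unfolding V_def by (rule B.pimage_base[OF Msr x])
  have V: "W.linear_subspace M V"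
    unfolding W.linear_subspace_def using B.subring_add_closed[OF Vs] subringE(6)[OF Vs] MV by blast
  have disj: "{\<zero>\<^bsub>W\<^esub>} \<inter> V = {\<zero>\<^bsub>W\<^esub>}" using subringE(2)[OF Vs] by blast
  obtain pr where pr: "\<And>w. w \<in> carrier W \<Longrightarrow> pr w \<in> V" "\<And>v. v \<in> V \<Longrightarrow> pr v = v" "\<And>u. u \<in> {\<zero>\<^bsub>W\<^esub>} \<Longrightarrow> pr u = \<zero>\<^bsub>W\<^esub>"
    "\<And>v w. v \<in> carrier W \<Longrightarrow> w \<in> carrier W \<Longrightarrow> pr (v \<oplus>\<^bsub>W\<^esub> w) = pr v \<oplus>\<^bsub>W\<^esub> pr w"
    "\<And>m w. m \<in> M \<Longrightarrow> w \<in> carrier W \<Longrightarrow> pr (m \<otimes>\<^bsub>W\<^esub> w) = m \<otimes>\<^bsub>W\<^esub> pr w"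
  proof -
    show ?thesis by (rule W.linear_projection[OF M(1) W.subspace_zero[OF Mc] V disj]; (assumption | rule that)+)
  qed
  \<comment> \<open>Evaluation at \<open>y\<close>, through a chosen representation as a polynomial
    in \<open>x\<close>; the specialization property makes the value independent of the
    choice.\<close>
  define \<sigma> where "\<sigma> v = pv W (SOME ms. set ms \<subseteq> M \<and> v = pv W ms x) y" for v
  have \<sigma>: "\<sigma> (pv W ms x) = pv W ms y" if ms: "set ms \<subseteq> M" for ms
  proof -
    let ?ns = "SOME ns. set ns \<subseteq> M \<and> pv W ms x = pv W ns x"
    have ns: "set ?ns \<subseteq> M \<and> pv W ms x = pv W ?ns x" by (rule someI[of _ ms]) (use ms in simp)
    define ns where "ns = ?ns"
    have ns: "set ns \<subseteq> M" "pv W ms x = pv W ns x" using ns unfolding ns_def by auto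
    have "\<ominus>\<^bsub>W\<^esub> \<one>\<^bsub>W\<^esub> \<in> M" using subringE(3,5)[OF Msr] by blast
    then obtain us where us: "set us \<subseteq> M" "\<forall>t\<in>carrier W. pv W us t = pv W ms t \<oplus>\<^bsub>W\<^esub> (\<ominus>\<^bsub>W\<^esub> \<one>\<^bsub>W\<^esub>) \<otimes>\<^bsub>W\<^esub> pv W ns t"
      using B.polyfunD[OF B.polyfun_add[OF Msr B.polyfun_pv[OF ms] B.polyfun_smult[OF Msr B.polyfun_pv[OF ns(1)]]]] by blast
    have c: "pv W ms t \<in> carrier W" "pv W ns t \<in> carrier W" if "t \<in> carrier W" for t
      using that ms ns Mc by (auto intro!: B.pv_closed)
    have "pv W us x = \<zero>\<^bsub>W\<^esub>" using us(2) x ns(2) c[OF x] by (simp add: B.l_minus B.r_neg)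
    then have "pv W us y = \<zero>\<^bsub>W\<^esub>" using xy us(1) unfolding specialization_def by blast
    then have "pv W ms y \<oplus>\<^bsub>W\<^esub> \<ominus>\<^bsub>W\<^esub> (pv W ns y) = \<zero>\<^bsub>W\<^esub>" using us(2) y c[OF y] by (simp add: B.l_minus)
    then have "pv W ms y = pv W ns y" using c[OF y] by (metis B.minus_equality B.minus_minus B.a_inv_closed)
    then show ?thesis unfolding \<sigma>_def ns_def by simp
  qed
  have Vd: "\<exists>ms. set ms \<subseteq> M \<and> v = pv W ms x" if "v \<in> V" for v using that unfolding V_def pimage_def by blast
  define \<phi> where "\<phi> w = \<sigma> (pr w)" for w
  have \<phi>1: "\<phi> w \<in> carrier W" if w: "w \<in> carrier W" for w
  proof -
    obtain ms where ms: "set ms \<subseteq> M" "pr w = pv W ms x" using Vd[OF pr(1)[OF w]] by blast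
    have "set ms \<subseteq> carrier W" using ms Mc by blast
    then show ?thesis unfolding \<phi>_def ms(2) \<sigma>[OF ms(1)] using y by simp
  qed
  have \<phi>2: "\<phi> (v \<oplus>\<^bsub>W\<^esub> w) = \<phi> v \<oplus>\<^bsub>W\<^esub> \<phi> w" if vw: "v \<in> carrier W" "w \<in> carrier W" for v w
  proof -
    obtain ms where ms: "set ms \<subseteq> M" "pr v = pv W ms x" using Vd[OF pr(1)[OF vw(1)]] by blast
    obtain ns where ns: "set ns \<subseteq> M" "pr w = pv W ns x" using Vd[OF pr(1)[OF vw(2)]] by blast
    obtain us where us: "set us \<subseteq> M" "\<forall>t\<in>carrier W. pv W us t = pv W ms t \<oplus>\<^bsub>W\<^esub> pv W ns t"
      using B.pv_add_ex[OF Msr ms(1) ns(1)] by blast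
    have "pr (v \<oplus>\<^bsub>W\<^esub> w) = pv W us x" using pr(4)[OF vw] ms ns us x by simp
    then show ?thesis unfolding \<phi>_def ms(2) ns(2) using \<sigma>[OF ms(1)] \<sigma>[OF ns(1)] \<sigma>[OF us(1)] us(2) y by simp
  qed
  have \<phi>3: "\<phi> (m \<otimes>\<^bsub>W\<^esub> w) = m \<otimes>\<^bsub>W\<^esub> \<phi> w" if mw: "m \<in> M" "w \<in> carrier W" for m w
  proof -
    obtain ms where ms: "set ms \<subseteq> M" "pr w = pv W ms x" using Vd[OF pr(1)[OF mw(2)]] by blast
    obtain us where us: "set us \<subseteq> M" "\<forall>t\<in>carrier W. pv W us t = m \<otimes>\<^bsub>W\<^esub> pv W ms t"
      using B.polyfunD[OF B.polyfun_smult[OF Msr B.polyfun_pv[OF ms(1)] mw(1)]] by blast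
    have "pr (m \<otimes>\<^bsub>W\<^esub> w) = pv W us x" using pr(5)[OF mw] ms us x by simp
    then show ?thesis unfolding \<phi>_def ms(2) using \<sigma>[OF ms(1)] \<sigma>[OF us(1)] us(2) y by simp
  qed
  have \<phi>x: "\<phi> (x [^]\<^bsub>W\<^esub> k) = y [^]\<^bsub>W\<^esub> k" for k :: nat
  proof -
    have "set (replicate k \<zero>\<^bsub>W\<^esub> @ [\<one>\<^bsub>W\<^esub>]) \<subseteq> M" using subringE(2,3)[OF Msr] by auto
    moreover have "pv W (replicate k \<zero>\<^bsub>W\<^esub> @ [\<one>\<^bsub>W\<^esub>]) t = t [^]\<^bsub>W\<^esub> k" if "t \<in> carrier W" for t
      using that by (induction k) (auto simp: B.m_comm)
    ultimately have "x [^]\<^bsub>W\<^esub> k \<in> V" "\<sigma> (x [^]\<^bsub>W\<^esub> k) = y [^]\<^bsub>W\<^esub> k"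
      using \<sigma>[of "replicate k \<zero>\<^bsub>W\<^esub> @ [\<one>\<^bsub>W\<^esub>]"] x y
      unfolding V_def pimage_def by (metis (mono_tags, lifting) mem_Collect_eq)+
    then show ?thesis unfolding \<phi>_def using pr(2) by simp
  qed
  obtain F where F: "\<And>z. z \<in> carrier T \<Longrightarrow> F z \<in> carrier T"
    "\<And>y z. y \<in> carrier T \<Longrightarrow> z \<in> carrier T \<Longrightarrow> F (y \<oplus>\<^bsub>T\<^esub> z) = F y \<oplus>\<^bsub>T\<^esub> F z"
    "\<And>y z. y \<in> bm M \<Longrightarrow> z \<in> carrier T \<Longrightarrow> F (y \<otimes>\<^bsub>T\<^esub> z) = y \<otimes>\<^bsub>T\<^esub> F z"
    "\<And>a w. a \<in> carrier A \<Longrightarrow> w \<in> carrier W \<Longrightarrow> F (te a w) = te a (\<phi> w)"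
    "\<And>V V' z. V \<subseteq> carrier W \<Longrightarrow> \<phi> ` V \<subseteq> V' \<Longrightarrow> V' \<subseteq> carrier W \<Longrightarrow> z \<in> bm V \<Longrightarrow> F z \<in> bm V'"
  proof -
    show ?thesis by (rule linear_map[OF Mc M(2) \<phi>1 \<phi>2 \<phi>3]; (assumption | rule that)+)
  qed
  have F0: "F \<zero>\<^bsub>T\<^esub> = \<zero>\<^bsub>T\<^esub>" using F(3)[OF bm.zero, of "\<zero>\<^bsub>T\<^esub>"] F(1)[of "\<zero>\<^bsub>T\<^esub>"] by simp
  have Fj: "F (j x [^]\<^bsub>T\<^esub> k) = j y [^]\<^bsub>T\<^esub> k" for k :: nat
  proof -
    have "F (j (x [^]\<^bsub>W\<^esub> k)) = j (y [^]\<^bsub>W\<^esub> k)" unfolding j_def using F(4) x \<phi>x by simp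
    then show ?thesis using x y by simp
  qed
  have bmc: "z \<in> bm M \<Longrightarrow> z \<in> carrier T" for z using bm_carrier[OF Mc] .
  \<comment> \<open>The power of \<open>j x\<close> is carried along because \<open>F\<close> need
    not be multiplicative: Horner's scheme is unfolded into monomials.\<close>
  have Fpv: "F (pv T zs (j x) \<otimes>\<^bsub>T\<^esub> j x [^]\<^bsub>T\<^esub> k) = pv T zs (j y) \<otimes>\<^bsub>T\<^esub> j y [^]\<^bsub>T\<^esub> k"
    if "set zs \<subseteq> bm M" for zs and k :: nat
    using that
  proof (induction zs arbitrary: k)
    case Nil
    then show ?case using x y F0 by simp
  next
    case (Cons z zs)
    then have z: "z \<in> bm M" and zs: "set zs \<subseteq> bm M" by auto
    have [simp]: "z \<in> carrier T" "pv T zs (j x) \<in> carrier T" "pv T zs (j y) \<in> carrier T" "x \<in> carrier W" "y \<in> carrier W"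
      using bmc z zs x y by (auto intro!: T.pv_closed)
    have "pv T (z # zs) (j x) \<otimes>\<^bsub>T\<^esub> j x [^]\<^bsub>T\<^esub> k
        = z \<otimes>\<^bsub>T\<^esub> j x [^]\<^bsub>T\<^esub> k \<oplus>\<^bsub>T\<^esub> pv T zs (j x) \<otimes>\<^bsub>T\<^esub> j x [^]\<^bsub>T\<^esub> Suc k"
      by (simp add: T.ring_norm del: j.hom_mult)
    then have "F (pv T (z # zs) (j x) \<otimes>\<^bsub>T\<^esub> j x [^]\<^bsub>T\<^esub> k)
        = F (z \<otimes>\<^bsub>T\<^esub> j x [^]\<^bsub>T\<^esub> k) \<oplus>\<^bsub>T\<^esub> F (pv T zs (j x) \<otimes>\<^bsub>T\<^esub> j x [^]\<^bsub>T\<^esub> Suc k)"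
      using F(2) by simp
    also have "\<dots> = z \<otimes>\<^bsub>T\<^esub> j y [^]\<^bsub>T\<^esub> k \<oplus>\<^bsub>T\<^esub> pv T zs (j y) \<otimes>\<^bsub>T\<^esub> j y [^]\<^bsub>T\<^esub> Suc k"
      using F(3)[OF z] Fj Cons.IH[OF zs, of "Suc k"] by simp
    also have "\<dots> = pv T (z # zs) (j y) \<otimes>\<^bsub>T\<^esub> j y [^]\<^bsub>T\<^esub> k"
      by (simp add: T.ring_norm del: j.hom_mult)
    finally show ?case .
  qed
  show ?thesis
    unfolding specialization_def
  proof (intro conjI allI impI)
    show "j y \<in> carrier T" using y by simp
    fix zs assume zs: "set zs \<subseteq> bm M" and z0: "pv T zs (j x) = \<zero>\<^bsub>T\<^esub>"
    have "pv T zs (j y) \<in> carrier T" using bmc zs y by (auto intro!: T.pv_closed)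
    then show "pv T zs (j y) = \<zero>\<^bsub>T\<^esub>" using Fpv[OF zs, of 0] z0 F0 by simp
  qed
qed

lemma pimage_bm:
  assumes M: "subring M W" and x: "x \<in> carrier W"
  shows "pimage T (bm M) (j x) = bm (pimage W M x)"
proof
  note V = B.pimage_subring[OF M x] and P = T.pimage_subring[OF bm_subring[OF M] j_closed[OF x]]
  show "pimage T (bm M) (j x) \<subseteq> bm (pimage W M x)"
  proof
    fix z assume "z \<in> pimage T (bm M) (j x)"
    then obtain zs where zs: "set zs \<subseteq> bm M" "z = pv T zs (j x)" unfolding pimage_def by blast
    have "pv T zs (j x) \<in> bm (pimage W M x)"
      using zs(1)
    proof (induction zs)
      case Nil
      then show ?case by (simp add: bm.zero)
    next
      case (Cons z zs)
      then show ?case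
        using subringE(6,7)[OF bm_subring[OF V]] j_bm[OF B.pimage_self[OF M x]] bm_mono[OF B.pimage_base[OF M x]]
        by auto
    qed
    then show "z \<in> bm (pimage W M x)" using zs by simp
  qed
  show "bm (pimage W M x) \<subseteq> pimage T (bm M) (j x)"
  proof
    fix z assume "z \<in> bm (pimage W M x)"
    then show "z \<in> pimage T (bm M) (j x)"
    proof induction
      case zero
      then show ?case using subringE(2)[OF P] .
    next
      case (te a m)
      then obtain ms where ms: "set ms \<subseteq> M" "m = pv W ms x" unfolding pimage_def by blast
      have "te a (pv W ms x) \<in> pimage T (bm M) (j x)"
        using ms(1)
      proof (induction ms)
        case Nil
        have "te a \<zero>\<^bsub>W\<^esub> \<in> bm M" using bm.te te(1) subringE(2)[OF M] by blast
        then show ?case using T.pimage_base[OF bm_subring[OF M] j_closed[OF x]] by auto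
      next
        case (Cons m ms)
        have [simp]: "m \<in> carrier W" "pv W ms x \<in> carrier W"
          using Cons.prems subringE(1)[OF M] x by (auto intro!: B.pv_closed)
        have "te a m \<in> bm M" using bm.te te(1) Cons by simp
        then have "te a m \<in> pimage T (bm M) (j x)" using T.pimage_base[OF bm_subring[OF M] j_closed[OF x]] by blast
        moreover have "te a (pv W ms x) \<otimes>\<^bsub>T\<^esub> j x \<in> pimage T (bm M) (j x)"
          using subringE(6)[OF P] Cons T.pimage_self[OF bm_subring[OF M] j_closed[OF x]] by simp
        moreover have "te a (pv W (m # ms) x) = te a m \<oplus>\<^bsub>T\<^esub> te a (pv W ms x) \<otimes>\<^bsub>T\<^esub> j x"
          using te(1) x te_j[of a "pv W ms x" x] by (simp add: te_add2 B.m_comm)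
        ultimately show ?case using subringE(7)[OF P] by simp
      qed
      then show ?case using ms by simp
    next
      case (diff u v)
      then show ?case using T.subring_minus[OF P] by blast
    qed
  qed
qed

lemma j_units: "w \<in> carrier W \<Longrightarrow> w \<noteq> \<zero>\<^bsub>W\<^esub> \<Longrightarrow> j w \<in> Units T"
proof -
  assume w: "w \<in> carrier W" "w \<noteq> \<zero>\<^bsub>W\<^esub>"
  then have U: "w \<in> Units W" using W.field_Units by simp
  have "j (inv\<^bsub>W\<^esub> w) \<otimes>\<^bsub>T\<^esub> j w = \<one>\<^bsub>T\<^esub>" "j w \<otimes>\<^bsub>T\<^esub> j (inv\<^bsub>W\<^esub> w) = \<one>\<^bsub>T\<^esub>"
    using U w j.hom_mult[of "inv\<^bsub>W\<^esub> w" w] j.hom_mult[of w "inv\<^bsub>W\<^esub> w"] by auto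
  then show ?thesis unfolding Units_def using U w by auto
qed

text \<open>A nonzero \<open>T\<close> contains the field \<open>W\<close> as scalars, so distinct
  elements of \<open>W\<close> differ by units.\<close>

lemma separated_image:
  assumes "finite Y" "Y \<subseteq> carrier W" and "\<one>\<^bsub>T\<^esub> \<noteq> \<zero>\<^bsub>T\<^esub>"
  shows "separated T (j ` Y)" "card (j ` Y) = card Y"
proof -
  have inj: "v = w" if vw: "v \<in> carrier W" "w \<in> carrier W" "j v = j w" for v w
  proof (rule ccontr)
    assume "v \<noteq> w"
    then have U: "j (v \<ominus>\<^bsub>W\<^esub> w) \<in> Units T" using vw by (intro j_units) auto
    have "j (v \<ominus>\<^bsub>W\<^esub> w) = \<zero>\<^bsub>T\<^esub>" using vw by (simp add: a_minus_def T.r_neg)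
    then show False using U assms(3) T.Units_r_inv T.Units_inv_closed by (metis T.l_null)
  qed
  show "separated T (j ` Y)"
    unfolding separated_def
  proof (intro conjI ballI impI)
    fix u v assume "u \<in> j ` Y" "v \<in> j ` Y" "u \<noteq> v"
    then obtain a b where ab: "a \<in> carrier W" "b \<in> carrier W" "u = j a" "v = j b" "a \<noteq> b" using assms(2) by blast
    then have "j (a \<ominus>\<^bsub>W\<^esub> b) \<in> Units T" by (intro j_units) auto
    then show "u \<ominus>\<^bsub>T\<^esub> v \<in> Units T" using ab by (simp add: a_minus_def)
  qed (use assms in simp)
  show "card (j ` Y) = card Y" by (rule card_image) (use inj assms(2) in \<open>auto intro!: inj_onI\<close>)
qed

text \<open>As no nonzero polynomial over \<open>M\<close> vanishes at \<open>x\<close>, there is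
  nothing to check for a specialization: \<open>x\<close> specializes to every element of the
  infinite field \<open>W\<close>.\<close>

lemma pic_adjoin_transcendental:
  assumes M: "subfield M W" "base \<subseteq> M" and x: "x \<in> carrier W"
    and tr: "\<And>ms. set ms \<subseteq> M \<Longrightarrow> pv W ms x = \<zero>\<^bsub>W\<^esub> \<Longrightarrow> set ms \<subseteq> {\<zero>\<^bsub>W\<^esub>}"
    and inf: "infinite (carrier W)" and p: "pic T (bm M)"
  shows "pic T (bm (pimage W M x))"
proof (cases "\<one>\<^bsub>T\<^esub> = \<zero>\<^bsub>T\<^esub>")
  case True
  then show ?thesis
    using T.pic_trivial bm_subring[OF B.pimage_subring[OF subfieldE(1)[OF M(1)] x]] by blast
next
  case False
  note Msr = subfieldE(1)[OF M(1)]
  obtain \<rho> where \<rho>: "\<And>a. a \<in> carrier T \<Longrightarrow> \<rho> a \<in> bm M" "\<rho> \<one>\<^bsub>T\<^esub> = \<one>\<^bsub>T\<^esub>"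
      "\<And>a b. a \<in> carrier T \<Longrightarrow> b \<in> carrier T \<Longrightarrow> \<rho> (a \<oplus>\<^bsub>T\<^esub> b) = \<rho> a \<oplus>\<^bsub>T\<^esub> \<rho> b"
      "\<And>c a. c \<in> bm M \<Longrightarrow> a \<in> carrier T \<Longrightarrow> \<rho> (c \<otimes>\<^bsub>T\<^esub> a) = c \<otimes>\<^bsub>T\<^esub> \<rho> a"
  proof -
    show ?thesis by (rule retraction[OF M]; (assumption | rule that)+)
  qed
  have spec: "specialization W M x y" if "y \<in> carrier W" for y
    unfolding specialization_def
  proof (intro conjI allI impI)
    fix ms assume "set ms \<subseteq> M" "pv W ms x = \<zero>\<^bsub>W\<^esub>"
    then have "set ms \<subseteq> {\<zero>\<^bsub>W\<^esub>}" by (rule tr)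
    then show "pv W ms y = \<zero>\<^bsub>W\<^esub>" using that by (induction ms) auto
  qed (rule that)
  have many: "\<exists>Y. separated T Y \<and> card Y = n \<and> (\<forall>y\<in>Y. specialization T (bm M) (j x) y)" for n
  proof -
    obtain Y where Y: "Y \<subseteq> carrier W" "finite Y" "card Y = n" using infinite_arbitrarily_large[OF inf] by blast
    then show ?thesis
      using separated_image[OF Y(2,1) False] specialization_lift[OF M x spec] by (intro exI[of _ "j ` Y"]) auto
  qed
  have points: "\<exists>zs Y. set zs \<subseteq> bm M \<and> z = pv T zs (j x) \<and> separated T Y \<and> card Y = length zs \<and>
      (\<forall>y\<in>Y. specialization T (bm M) (j x) y)" if "z \<in> pimage T (bm M) (j x)" for z
    using that many unfolding pimage_def by blast
  interpret E: poly_ext T "bm M" "j x" \<rho>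
    by (intro poly_ext.intro spec_ext.intro poly_ext_axioms.intro spec_ext_axioms.intro;
        fact T.cring_axioms bm_subring[OF Msr] j_closed[OF x] p \<rho> points many)
  show ?thesis using E.pic_poly unfolding pimage_bm[OF Msr x] .
qed

text \<open>Modulo the equation of \<open>x\<close>, every element is represented by
  \<open>length fs\<close> coefficients, which is exactly the number of conjugates in
  \<open>Y\<close>.\<close>

lemma pic_adjoin_algebraic:
  assumes M: "subfield M W" "base \<subseteq> M" and x: "x \<in> carrier W" and fs: "set fs \<subseteq> M"
    and root: "x [^]\<^bsub>W\<^esub> length fs \<oplus>\<^bsub>W\<^esub> pv W fs x = \<zero>\<^bsub>W\<^esub>"
    and Y: "finite Y" "card Y = length fs" "\<And>y. y \<in> Y \<Longrightarrow> specialization W M x y"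
    and p: "pic T (bm M)"
  shows "pic T (bm (pimage W M x))"
proof (cases "\<one>\<^bsub>T\<^esub> = \<zero>\<^bsub>T\<^esub>")
  case True
  then show ?thesis
    using T.pic_trivial bm_subring[OF B.pimage_subring[OF subfieldE(1)[OF M(1)] x]] by blast
next
  case False
  note Msr = subfieldE(1)[OF M(1)]
  obtain \<rho> where \<rho>: "\<And>a. a \<in> carrier T \<Longrightarrow> \<rho> a \<in> bm M" "\<rho> \<one>\<^bsub>T\<^esub> = \<one>\<^bsub>T\<^esub>"
      "\<And>a b. a \<in> carrier T \<Longrightarrow> b \<in> carrier T \<Longrightarrow> \<rho> (a \<oplus>\<^bsub>T\<^esub> b) = \<rho> a \<oplus>\<^bsub>T\<^esub> \<rho> b"
      "\<And>c a. c \<in> bm M \<Longrightarrow> a \<in> carrier T \<Longrightarrow> \<rho> (c \<otimes>\<^bsub>T\<^esub> a) = c \<otimes>\<^bsub>T\<^esub> \<rho> a"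
  proof -
    show ?thesis by (rule retraction[OF M]; (assumption | rule that)+)
  qed
  define d where "d = length fs"
  have YW: "Y \<subseteq> carrier W" using Y(3) unfolding specialization_def by blast
  note sep = separated_image[OF Y(1) YW False]
  note C = bm_subring[OF Msr]
  have rep: "\<exists>zs. set zs \<subseteq> bm M \<and> length zs = d \<and> z = pv T zs (j x)" if "z \<in> pimage T (bm M) (j x)" for z
    using that unfolding pimage_bm[OF Msr x]
  proof induction
    case zero
    have "pv T (replicate d \<zero>\<^bsub>T\<^esub>) (j x) = \<zero>\<^bsub>T\<^esub>" using x by (induction d) auto
    then show ?case using bm.zero by (intro exI[of _ "replicate d \<zero>\<^bsub>T\<^esub>"]) auto
  next
    case (te a v)
    obtain ms where ms: "set ms \<subseteq> M" "length ms = d" "v = pv W ms x"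
    proof -
      obtain zs where "set zs \<subseteq> M" "v = pv W zs x" using te(2) unfolding pimage_def by blast
      then show ?thesis using B.pv_reduce[OF Msr fs] root x that unfolding d_def by metis
    qed
    have "te a (pv W ms x) = pv T (map (te a) ms) (j x)"
      using ms(1)
    proof (induction ms)
      case Nil
      have "te a \<zero>\<^bsub>W\<^esub> = te a (\<zero>\<^bsub>W\<^esub> \<otimes>\<^bsub>W\<^esub> \<zero>\<^bsub>W\<^esub>)" by simp
      also have "\<dots> = \<zero>\<^bsub>T\<^esub>" using te(1) te_j[of a "\<zero>\<^bsub>W\<^esub>" "\<zero>\<^bsub>W\<^esub>"] by simp
      finally show ?case by simp
    next
      case (Cons m ms)
      have [simp]: "m \<in> carrier W" "pv W ms x \<in> carrier W"
        using Cons.prems subringE(1)[OF Msr] x by (auto intro!: B.pv_closed)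
      have "te a (pv W (m # ms) x) = te a m \<oplus>\<^bsub>T\<^esub> te a (pv W ms x) \<otimes>\<^bsub>T\<^esub> j x"
        using te(1) x te_j[of a "pv W ms x" x] by (simp add: te_add2 B.m_comm)
      then show ?case using Cons te(1) x by (simp add: T.m_comm)
    qed
    then show ?case using ms te(1) bm.te by (intro exI[of _ "map (te a) ms"]) auto
  next
    case (diff u v)
    then obtain ws us where *: "set ws \<subseteq> bm M" "length ws = d" "u = pv T ws (j x)"
      "set us \<subseteq> bm M" "length us = d" "v = pv T us (j x)" by blast
    have nu: "pv T (map (\<lambda>z. \<ominus>\<^bsub>T\<^esub> z) hs) (j x) = \<ominus>\<^bsub>T\<^esub> pv T hs (j x)" if "set hs \<subseteq> bm M" for hs
      using that
    proof (induction hs)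
      case (Cons h hs)
      then have [simp]: "h \<in> carrier T" "pv T hs (j x) \<in> carrier T"
        using subringE(1)[OF C] x by (auto intro!: T.pv_closed)
      show ?case using Cons x by (simp add: T.minus_add T.r_minus)
    qed simp
    have us': "set (map (\<lambda>z. \<ominus>\<^bsub>T\<^esub> z) us) \<subseteq> bm M" using *(4) subringE(5)[OF C] by auto
    obtain vs where "set vs \<subseteq> bm M" "length vs = d"
      "\<forall>t\<in>carrier T. pv T vs t = pv T ws t \<oplus>\<^bsub>T\<^esub> pv T (map (\<lambda>z. \<ominus>\<^bsub>T\<^esub> z) us) t"
      using T.pv_add_ex[OF C *(1) us'] * by auto
    then show ?case using * nu x by (intro exI[of _ vs]) (auto simp: a_minus_def)
  qed
  have points: "\<exists>zs Y. set zs \<subseteq> bm M \<and> z = pv T zs (j x) \<and> separated T Y \<and> card Y = length zs \<and>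
      (\<forall>y\<in>Y. specialization T (bm M) (j x) y)" if z: "z \<in> pimage T (bm M) (j x)" for z
  proof -
    obtain zs where "set zs \<subseteq> bm M" "length zs = d" "z = pv T zs (j x)" using rep[OF z] by blast
    then show ?thesis
      using sep Y specialization_lift[OF M x] unfolding d_def
      by (intro exI[of _ zs] exI[of _ "j ` Y"]) auto
  qed
  interpret E: spec_ext T "bm M" "j x" \<rho>
    by (intro spec_ext.intro spec_ext_axioms.intro; fact T.cring_axioms C j_closed[OF x] p \<rho> points)
  have "set (map j fs) \<subseteq> bm M" using fs j_bm by auto
  moreover have "j x [^]\<^bsub>T\<^esub> length (map j fs) \<oplus>\<^bsub>T\<^esub> pv T (map j fs) (j x) = \<zero>\<^bsub>T\<^esub>"
  proof -
    have fsc: "set fs \<subseteq> carrier W" using fs subringE(1)[OF Msr] by blast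
    then have "pv T (map j fs) (j x) = j (pv W fs x)" using x by (induction fs) simp_all
    then have "j x [^]\<^bsub>T\<^esub> length (map j fs) \<oplus>\<^bsub>T\<^esub> pv T (map j fs) (j x) = j (x [^]\<^bsub>W\<^esub> length fs \<oplus>\<^bsub>W\<^esub> pv W fs x)"
      using x fsc by simp
    then show ?thesis using root by simp
  qed
  ultimately have "pic T (pimage T (bm M) (j x))" by (rule E.pic_of_root)
  then show ?thesis unfolding pimage_bm[OF Msr x] .
qed

text \<open>\<open>bm V'\<close> is the localization of \<open>bm V\<close> at the nonzero elements
  of \<open>V\<close>; both are subrings of \<open>T\<close>, with the inclusion as structure
  map.\<close>

lemma pic_localize:
  assumes V: "subring V W" and V': "subring V' W" "V \<subseteq> V'"
    and frac: "\<And>w. w \<in> V' \<Longrightarrow> \<exists>q\<in>V - {\<zero>\<^bsub>W\<^esub>}. q \<otimes>\<^bsub>W\<^esub> w \<in> V"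
    and inverses: "\<And>q. q \<in> V - {\<zero>\<^bsub>W\<^esub>} \<Longrightarrow> inv\<^bsub>W\<^esub> q \<in> V'"
    and p: "pic T (bm V)"
  shows "pic T (bm V')"
proof -
  let ?A = "T\<lparr>carrier := bm V\<rparr>" and ?D = "T\<lparr>carrier := bm V'\<rparr>"
  have cA: "cring ?A" and cD: "cring ?D"
    using T.subcring_iff[THEN iffD1, OF subringE(1) T.subcringI'] bm_subring[OF V] bm_subring[OF V'(1)] by auto
  note Vc = B.subring_carrier[OF V]
  interpret D: cring ?D by fact
  interpret Fr: fractions ?A ?D "\<lambda>z. z" "j ` (V - {\<zero>\<^bsub>W\<^esub>})"
  proof (intro fractions.intro cA cD, unfold_locales)
    show "(\<lambda>z. z) \<in> ring_hom ?A ?D"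
      by (rule ring_hom_memI) (use bm_mono[OF V'(2)] in auto)
    show "j ` (V - {\<zero>\<^bsub>W\<^esub>}) \<subseteq> carrier ?A" using j_bm by auto
    show "\<one>\<^bsub>?A\<^esub> \<in> j ` (V - {\<zero>\<^bsub>W\<^esub>})" using j.hom_one subringE(3)[OF V] by (auto intro!: image_eqI[of _ _ "\<one>\<^bsub>W\<^esub>"])
    show "s \<otimes>\<^bsub>?A\<^esub> t \<in> j ` (V - {\<zero>\<^bsub>W\<^esub>})" if st: "s \<in> j ` (V - {\<zero>\<^bsub>W\<^esub>})" "t \<in> j ` (V - {\<zero>\<^bsub>W\<^esub>})" for s t
    proof -
      obtain v w where vw: "v \<in> V - {\<zero>\<^bsub>W\<^esub>}" "w \<in> V - {\<zero>\<^bsub>W\<^esub>}" "s = j v" "t = j w" using st by blast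
      then have "v \<otimes>\<^bsub>W\<^esub> w \<in> V - {\<zero>\<^bsub>W\<^esub>}" using subringE(6)[OF V] Vc W.integral_iff by auto
      then show ?thesis using vw Vc by (intro image_eqI[of _ _ "v \<otimes>\<^bsub>W\<^esub> w"]) auto
    qed
    show "s \<in> Units ?D" if s: "s \<in> j ` (V - {\<zero>\<^bsub>W\<^esub>})" for s
    proof -
      obtain v where v: "v \<in> V - {\<zero>\<^bsub>W\<^esub>}" "s = j v" using s by blast
      have vc: "v \<in> carrier W" "v \<noteq> \<zero>\<^bsub>W\<^esub>" "v \<in> Units W" using v Vc W.field_Units by auto
      have "j (inv\<^bsub>W\<^esub> v) \<otimes>\<^bsub>T\<^esub> j v = \<one>\<^bsub>T\<^esub>" "j v \<otimes>\<^bsub>T\<^esub> j (inv\<^bsub>W\<^esub> v) = \<one>\<^bsub>T\<^esub>"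
        using vc j.hom_mult[of "inv\<^bsub>W\<^esub> v" v] j.hom_mult[of v "inv\<^bsub>W\<^esub> v"] by auto
      then show ?thesis unfolding Units_def using v j_bm[OF inverses[OF v(1)]] j_bm[of v V'] V'(2) by auto
    qed
    have ex: "\<exists>q\<in>V - {\<zero>\<^bsub>W\<^esub>}. j q \<otimes>\<^bsub>T\<^esub> z \<in> bm V" if "z \<in> bm V'" for z
      using that
    proof induction
      case zero
      then show ?case using subringE(3)[OF V] bm.zero by (intro bexI[of _ "\<one>\<^bsub>W\<^esub>"]) auto
    next
      case (te a w)
      obtain q where q: "q \<in> V - {\<zero>\<^bsub>W\<^esub>}" "q \<otimes>\<^bsub>W\<^esub> w \<in> V" using frac[OF te(2)] by blast
      have c: "q \<in> carrier W" "w \<in> carrier W" using q Vc te B.subring_carrier[OF V'(1)] by auto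
      have "j q \<otimes>\<^bsub>T\<^esub> te a w = te a (q \<otimes>\<^bsub>W\<^esub> w)" unfolding j_def using c te by (simp add: te_mult)
      then show ?case using q bm.te[OF te(1) q(2)] by (intro bexI[of _ q]) simp_all
    next
      case (diff u v)
      then obtain q r where qr: "q \<in> V - {\<zero>\<^bsub>W\<^esub>}" "j q \<otimes>\<^bsub>T\<^esub> u \<in> bm V" "r \<in> V - {\<zero>\<^bsub>W\<^esub>}" "j r \<otimes>\<^bsub>T\<^esub> v \<in> bm V" by blast
      have c: "q \<in> carrier W" "r \<in> carrier W" "u \<in> carrier T" "v \<in> carrier T"
        using qr Vc diff bm_carrier[OF subringE(1)[OF V'(1)]] by auto
      have "q \<otimes>\<^bsub>W\<^esub> r \<in> V - {\<zero>\<^bsub>W\<^esub>}" using qr subringE(6)[OF V] c W.integral_iff by auto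
      moreover have "j (q \<otimes>\<^bsub>W\<^esub> r) \<otimes>\<^bsub>T\<^esub> (u \<ominus>\<^bsub>T\<^esub> v) = j r \<otimes>\<^bsub>T\<^esub> (j q \<otimes>\<^bsub>T\<^esub> u) \<ominus>\<^bsub>T\<^esub> j q \<otimes>\<^bsub>T\<^esub> (j r \<otimes>\<^bsub>T\<^esub> v)"
        using c by (simp add: T.ring_norm)
      moreover have "j r \<in> bm V" "j q \<in> bm V" using qr j_bm by auto
      ultimately show ?case
        using qr bm.diff[OF bm_mult[OF V, of "j r" "j q \<otimes>\<^bsub>T\<^esub> u"] bm_mult[OF V, of "j q" "j r \<otimes>\<^bsub>T\<^esub> v"]]
        by (intro bexI[of _ "q \<otimes>\<^bsub>W\<^esub> r"]) (simp_all del: j.hom_mult)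
    qed
    show "\<exists>a\<in>carrier ?A. \<exists>s\<in>j ` (V - {\<zero>\<^bsub>W\<^esub>}). s \<otimes>\<^bsub>?D\<^esub> z = a" if "z \<in> carrier ?D" for z
      using ex[of z] that by auto
    show "\<exists>u\<in>j ` (V - {\<zero>\<^bsub>W\<^esub>}). u \<otimes>\<^bsub>?A\<^esub> a = \<zero>\<^bsub>?A\<^esub>" if "a \<in> carrier ?A" "a = \<zero>\<^bsub>?D\<^esub>" for a
      using that subringE(3)[OF V] by (intro bexI[of _ "j \<one>\<^bsub>W\<^esub>"] imageI) auto
  qed
  show ?thesis using Fr.pic_fractions p by (simp add: pic_consistent)
qed

end

section \<open>Frobenius and separability\<close>

context cring
begin

lemma binomial:
  assumes [simp]: "x \<in> carrier R" "y \<in> carrier R"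
  shows "(x \<oplus> y) [^] n = (\<Oplus>k\<in>{..n}. add_pow R (n choose k) (x [^] k \<otimes> y [^] (n - k)))"
proof (induction n)
  case (Suc n)
  define f where "f k = add_pow R (n choose k) (x [^] k \<otimes> y [^] (Suc n - k))" for k
  define g where "g k = (if k = 0 then \<zero> else add_pow R (n choose (k - 1)) (x [^] k \<otimes> y [^] (Suc n - k)))" for k
  have [simp]: "f k \<in> carrier R" "g k \<in> carrier R" for k unfolding f_def g_def by auto
  have "(\<Oplus>k\<in>{..n}. add_pow R (n choose k) (x [^] k \<otimes> y [^] (n - k))) \<otimes> y = (\<Oplus>k\<in>{..n}. f k)"
    unfolding f_def by (subst finsum_ldistr) (auto intro!: finsum_cong' simp: add_pow_ldistr m_assoc Suc_diff_le)
  also have "\<dots> = (\<Oplus>k\<in>{..Suc n}. f k)" by (simp add: finsum_Suc f_def binomial_eq_0)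
  finally have 1: "(x \<oplus> y) [^] n \<otimes> y = (\<Oplus>k\<in>{..Suc n}. f k)" using Suc by simp
  have "(\<Oplus>k\<in>{..n}. add_pow R (n choose k) (x [^] k \<otimes> y [^] (n - k))) \<otimes> x = (\<Oplus>k\<in>{..n}. g (Suc k))"
    unfolding g_def by (subst finsum_ldistr) (auto intro!: finsum_cong' simp: add_pow_ldistr add_pow_rdistr m_ac)
  also have "\<dots> = (\<Oplus>k\<in>{..Suc n}. g k)" by (subst finsum_Suc2) (auto simp: g_def)
  finally have 2: "(x \<oplus> y) [^] n \<otimes> x = (\<Oplus>k\<in>{..Suc n}. g k)" using Suc by simp
  have "(x \<oplus> y) [^] Suc n = (x \<oplus> y) [^] n \<otimes> y \<oplus> (x \<oplus> y) [^] n \<otimes> x" by (simp add: r_distr a_comm)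
  also have "\<dots> = (\<Oplus>k\<in>{..Suc n}. f k \<oplus> g k)" unfolding 1 2 by (rule finsum_addf[symmetric]) auto
  also have "\<dots> = (\<Oplus>k\<in>{..Suc n}. add_pow R (Suc n choose k) (x [^] k \<otimes> y [^] (Suc n - k)))"
  proof (rule finsum_cong')
    show "f k \<oplus> g k = add_pow R (Suc n choose k) (x [^] k \<otimes> y [^] (Suc n - k))" for k
      unfolding f_def g_def by (cases k) (auto simp: add.nat_pow_mult add.m_comm)
  qed auto
  finally show ?case .
qed simp

lemma char_scale:
  assumes "add_pow R (p :: nat) \<one> = \<zero>" "x \<in> carrier R"
  shows "add_pow R p x = \<zero>"
  using add_pow_ldistr[of \<one> x p] assms by simp

lemma frobenius_add:
  assumes p: "Factorial_Ring.prime (p :: nat)" and ch: "add_pow R p \<one> = \<zero>" and [simp]: "x \<in> carrier R" "y \<in> carrier R"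
  shows "(x \<oplus> y) [^] p = x [^] p \<oplus> y [^] p"
proof -
  let ?f = "\<lambda>k. add_pow R (p choose k) (x [^] k \<otimes> y [^] (p - k))"
  have p0: "p \<noteq> 0" using p by auto
  have "?f k = \<zero>" if k: "k \<in> {..p} - {0, p}" for k
  proof -
    have "p dvd (p choose k)" using k p by (intro dvd_choose_prime) auto
    then obtain m where "p choose k = p * m" by blast
    then have "?f k = add_pow R m (add_pow R p (x [^] k \<otimes> y [^] (p - k)))" by (simp add: add.nat_pow_pow)
    then show ?thesis using char_scale[OF ch] by simp
  qed
  then have "(\<Oplus>k\<in>{..p}. ?f k) = (\<Oplus>k\<in>{0, p}. ?f k)"
    by (intro add.finprod_mono_neutral_cong_right) auto
  also have "\<dots> = x [^] p \<oplus> y [^] p" using p0 by (simp add: a_comm)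
  finally show ?thesis by (simp add: binomial)
qed

lemma frobenius_minus:
  assumes p: "Factorial_Ring.prime (p :: nat)" and ch: "add_pow R p \<one> = \<zero>" and [simp]: "x \<in> carrier R" "y \<in> carrier R"
  shows "(x \<ominus> y) [^] p = x [^] p \<ominus> y [^] p"
proof -
  have "(x \<ominus> y) \<oplus> y = x" by (simp add: ring_norm)
  then have "(x \<ominus> y) [^] p \<oplus> y [^] p = x [^] p"
    using frobenius_add[OF p ch, of "x \<ominus> y" y] by simp
  then show ?thesis by (simp add: eq_diff_iff)
qed

text \<open>By Bezout, \<open>k\<close> is invertible modulo \<open>p\<close>.\<close>

lemma char_cancel:
  assumes ch: "add_pow R p \<one> = \<zero>" and z: "z \<in> carrier R" "add_pow R k z = \<zero>" and p: "Factorial_Ring.prime (p :: nat)" "\<not> p dvd k"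
  shows "z = \<zero>"
proof -
  have "coprime k p" using prime_imp_coprime[OF p] by (simp add: coprime_commute)
  moreover have "k \<noteq> 0" using p(2) by (metis dvd_0_right)
  ultimately obtain u v where uv: "k * u = p * v + 1" using bezout_nat[of k p] by auto
  have "add_pow R (k * u) z = add_pow R u (add_pow R k z)" by (rule add.nat_pow_pow[OF z(1), symmetric])
  moreover have "add_pow R (p * v + 1) z = add_pow R v (add_pow R p z) \<oplus> z"
    using z by (simp add: add.nat_pow_mult[symmetric] add.nat_pow_pow)
  ultimately show ?thesis using uv z char_scale[OF ch z(1)] by simp
qed

end

text \<open>
  \<open>dv\<close> evaluates the derivative by the product rule; its coefficient list is obtained from \<open>weighted R 1\<close>.
\<close>

primrec dv :: "('a, 'm) ring_scheme \<Rightarrow> 'a list \<Rightarrow> 'a \<Rightarrow> 'a" where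
  "dv R [] y = \<zero>\<^bsub>R\<^esub>"
| "dv R (z # zs) y = pv R zs y \<oplus>\<^bsub>R\<^esub> y \<otimes>\<^bsub>R\<^esub> dv R zs y"

primrec weighted :: "('a, 'm) ring_scheme \<Rightarrow> nat \<Rightarrow> 'a list \<Rightarrow> 'a list" where
  "weighted R k [] = []"
| "weighted R k (z # zs) = add_pow R k z # weighted R (Suc k) zs"

lemma length_weighted [simp]: "length (weighted R k zs) = length zs"
  by (induction zs arbitrary: k) auto

lemma nth_weighted: "i < length zs \<Longrightarrow> weighted R k zs ! i = add_pow R (k + i) (zs ! i)"
proof (induction zs arbitrary: k i)
  case (Cons z zs)
  then show ?case by (cases i) auto
qed simp

section \<open>Formal derivatives\<close>

context cring
begin

lemma dv_closed: "set zs \<subseteq> carrier R \<Longrightarrow> y \<in> carrier R \<Longrightarrow> dv R zs y \<in> carrier R"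
  by (induction zs) auto

lemma set_sdiv: "set zs \<subseteq> carrier R \<Longrightarrow> y \<in> carrier R \<Longrightarrow> set (sdiv R y zs) \<subseteq> carrier R"
  by (induction zs) auto

text \<open>The product rule for \<open>F = F(y) + (T - y) q\<close>.\<close>

lemma dv_sdiv:
  assumes [simp]: "t \<in> carrier R" "y \<in> carrier R" and "z \<in> carrier R" "set zs \<subseteq> carrier R"
  shows "dv R (z # zs) t = pv R (sdiv R y zs) t \<oplus> (t \<ominus> y) \<otimes> dv R (sdiv R y zs) t"
  using assms(3,4)
proof (induction zs arbitrary: z)
  case (Cons w ws)
  then have [simp]: "w \<in> carrier R" "set ws \<subseteq> carrier R" by auto
  have [simp]: "set (sdiv R y ws) \<subseteq> carrier R" by (rule set_sdiv) auto
  have [simp]: "dv R (sdiv R y ws) t \<in> carrier R" "pv R (w # ws) y \<in> carrier R" by (simp_all add: dv_closed)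
  define q P D where "q = pv R (w # ws) y" and "P = pv R (sdiv R y ws) t" and "D = dv R (sdiv R y ws) t"
  have [simp]: "q \<in> carrier R" "P \<in> carrier R" "D \<in> carrier R" unfolding q_def P_def D_def by auto
  have "dv R (z # w # ws) t = pv R (w # ws) t \<oplus> t \<otimes> dv R (w # ws) t" by simp
  also have "\<dots> = (q \<oplus> (t \<ominus> y) \<otimes> P) \<oplus> t \<otimes> (P \<oplus> (t \<ominus> y) \<otimes> D)"
    unfolding q_def P_def D_def by (subst pv_sdiv[of t y]) (use Cons.IH[of w] in auto)
  also have "\<dots> = (q \<oplus> t \<otimes> P) \<oplus> (t \<ominus> y) \<otimes> (P \<oplus> t \<otimes> D)" by (simp add: ring_norm)
  finally show ?case unfolding q_def P_def D_def by simp
qed simp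

lemma sdiv_snoc:
  assumes "set gs \<subseteq> carrier R" "l \<in> carrier R" "y \<in> carrier R"
  shows "\<exists>hs. set hs \<subseteq> carrier R \<and> length hs = length gs \<and> sdiv R y (gs @ [l]) = hs @ [l]"
  using assms(1)
proof (induction gs)
  case Nil
  then show ?case using assms by simp
next
  case (Cons g gs)
  then obtain hs where "set hs \<subseteq> carrier R" "length hs = length gs" "sdiv R y (gs @ [l]) = hs @ [l]" by auto
  moreover have "pv R (g # (gs @ [l])) y \<in> carrier R" using Cons assms by (intro pv_closed) auto
  ultimately show ?case by (intro exI[of _ "pv R (g # (gs @ [l])) y # hs"]) auto
qed

lemma set_weighted:
  assumes M: "subring M R" and "set zs \<subseteq> M" shows "set (weighted R k zs) \<subseteq> M"
proof -
  have "add_pow R n z \<in> M" if z: "z \<in> M" for n :: nat and z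
    using subringE(2,7)[OF M] z by (induction n) auto
  with assms(2) show ?thesis by (induction zs arbitrary: k) auto
qed

lemma pv_weighted_Suc:
  assumes "set zs \<subseteq> carrier R" and [simp]: "y \<in> carrier R"
  shows "pv R (weighted R (Suc k) zs) y = pv R zs y \<oplus> pv R (weighted R k zs) y"
  using assms(1)
proof (induction zs arbitrary: k)
  case (Cons z zs)
  then have [simp]: "z \<in> carrier R" "set zs \<subseteq> carrier R" by auto
  have [simp]: "pv R (weighted R k zs) y \<in> carrier R" for k
    using set_weighted[OF carrier_is_subring] Cons by (intro pv_closed) auto
  show ?case using Cons.IH[of "Suc k"] by (simp add: ring_norm)
qed simp

lemma pv_weighted:
  assumes "set zs \<subseteq> carrier R" and [simp]: "y \<in> carrier R"
  shows "pv R (weighted R 0 zs) y = y \<otimes> dv R zs y"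
  using assms(1)
proof (induction zs)
  case (Cons z zs)
  then show ?case using pv_weighted_Suc[of zs y 0] dv_closed[of zs y] by simp
qed simp

lemma dv_eq_pv:
  assumes "z \<in> carrier R" "set zs \<subseteq> carrier R" and [simp]: "y \<in> carrier R"
  shows "dv R (z # zs) y = pv R (weighted R 1 zs) y"
  using pv_weighted[of zs y] pv_weighted_Suc[of zs y 0] assms by simp

lemma pv_zeros: "set zs \<subseteq> {\<zero>} \<Longrightarrow> y \<in> carrier R \<Longrightarrow> pv R zs y = \<zero>"
  by (induction zs) auto

text \<open>A polynomial whose exponents are all divisible by \<open>p\<close> is a polynomial in
  \<open>T^p\<close>; coefficients are consumed in blocks of \<open>p\<close>. The length bound says
  that \<open>gs\<close> has at most \<open>length zs / p\<close> coefficients, rounded up.\<close>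

lemma pv_frobenius:
  assumes p: "p > 0" and zs: "set zs \<subseteq> carrier R" "\<And>i. i < length zs \<Longrightarrow> \<not> p dvd i \<Longrightarrow> zs ! i = \<zero>"
  shows "\<exists>gs. set gs \<subseteq> set zs \<and> p * length gs < length zs + p \<and> (set gs \<subseteq> {\<zero>} \<longrightarrow> set zs \<subseteq> {\<zero>}) \<and>
    (\<forall>t\<in>carrier R. pv R zs t = pv R gs (t [^] p))"
  using zs
proof (induction "length zs" arbitrary: zs rule: less_induct)
  case less
  show ?case
  proof (cases zs)
    case Nil
    then show ?thesis using p by (intro exI[of _ "[]"]) auto
  next
    case (Cons z rs)
    define ws us where "ws = drop p zs" and "us = take (p - 1) rs"
    have zs: "zs = z # us @ ws"
      unfolding ws_def us_def Cons using p by (cases p) auto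
    have us0: "set us \<subseteq> {\<zero>}"
    proof
      fix u assume "u \<in> set us"
      then obtain i where i: "i < length us" "u = us ! i" by (metis in_set_conv_nth)
      then have "Suc i < p" "Suc i < length zs" unfolding us_def Cons by auto
      moreover from this have "\<not> p dvd Suc i" using nat_dvd_not_less by blast
      moreover have "zs ! Suc i = us ! i" using i unfolding zs by (simp add: nth_append)
      ultimately show "u \<in> {\<zero>}" using less.prems(2)[of "Suc i"] i by simp
    qed
    have c: "z \<in> carrier R" "set us \<subseteq> carrier R" "set ws \<subseteq> carrier R" using less.prems(1) unfolding zs by auto
    have "\<exists>gs. set gs \<subseteq> set ws \<and> p * length gs < length ws + p \<and> (set gs \<subseteq> {\<zero>} \<longrightarrow> set ws \<subseteq> {\<zero>}) \<and>
      (\<forall>t\<in>carrier R. pv R ws t = pv R gs (t [^] p))"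
    proof (rule less.hyps[OF _ c(3)])
      show "length ws < length zs" unfolding zs by simp
      fix i assume i: "i < length ws" "\<not> p dvd i"
      then have "zs ! (p + i) = \<zero>" using less.prems(2)[of "p + i"] unfolding ws_def by simp
      then show "ws ! i = \<zero>" using i unfolding ws_def by simp
    qed
    then obtain gs where gs: "set gs \<subseteq> set ws" "p * length gs < length ws + p" "set gs \<subseteq> {\<zero>} \<Longrightarrow> set ws \<subseteq> {\<zero>}"
      "\<And>t. t \<in> carrier R \<Longrightarrow> pv R ws t = pv R gs (t [^] p)" by blast
    have "pv R zs t = pv R (z # gs) (t [^] p)" if t: "t \<in> carrier R" for t
    proof -
      have [simp]: "pv R ws t \<in> carrier R" using c t by simp
      have "t \<otimes> pv R (us @ ws) t = t [^] p \<otimes> pv R ws t"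
      proof (cases "ws = []")
        case True
        then show ?thesis using pv_zeros[OF us0 t] t by simp
      next
        case False
        then have "Suc (length us) = p" using p unfolding ws_def us_def Cons by (cases p) auto
        then have "t [^] p = t \<otimes> t [^] length us" using t by (metis nat_pow_Suc2)
        then show ?thesis using pv_append[OF c(2,3) t] pv_zeros[OF us0 t] t by (simp add: m_assoc)
      qed
      then show ?thesis unfolding zs using gs(4)[OF t] by simp
    qed
    moreover have "p * length (z # gs) < length zs + p"
    proof (cases "ws = []")
      case True
      then have "length gs = 0" using gs(1) by auto
      then show ?thesis unfolding zs by simp
    next
      case False
      then have "length zs = p + length ws" unfolding ws_def by simp
      then show ?thesis using gs(2) by simp
    qed
    ultimately show ?thesis using gs(1,3) us0 unfolding zs by (intro exI[of _ "z # gs"]) auto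
  qed
qed

end

section \<open>Roots, minimal polynomials and conjugates\<close>

context field
begin

lemma pv_eval:
  assumes "set zs \<subseteq> carrier R" and [simp]: "x \<in> carrier R"
  shows "pv R zs x = eval (rev zs) x"
  using assms(1)
proof (induction zs)
  case (Cons z zs)
  have [simp]: "z \<in> carrier R" "pv R zs x \<in> carrier R" using Cons.prems by simp_all
  have IH: "eval (rev zs) x = pv R zs x" using Cons by simp
  have "eval (rev zs @ [z]) x = eval (rev zs) x \<otimes> x \<oplus> z" using Cons by (intro eval_append_aux) auto
  then show ?case by (simp add: IH a_comm m_comm)
qed simp

text \<open>Algebraic closedness: \<open>fs\<close> lists the lower coefficients of a monic
  polynomial, and \<open>fs \<noteq> []\<close> says that its degree is positive.\<close>

definition has_roots :: bool where
  "has_roots \<longleftrightarrow> (\<forall>fs. set fs \<subseteq> carrier R \<longrightarrow> fs \<noteq> [] \<longrightarrow> (\<exists>y\<in>carrier R. y [^] length fs \<oplus> pv R fs y = \<zero>))"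

text \<open>Roots are split off one by one. At a root \<open>y\<close> the derivative of
  \<open>(T - y) q\<close> is \<open>q(y)\<close>, so \<open>y\<close> is not a root of
  \<open>q\<close> and is counted only once.\<close>

lemma distinct_roots:
  assumes hr: has_roots and "set fs \<subseteq> carrier R"
    and "\<And>y. y \<in> carrier R \<Longrightarrow> pv R (fs @ [\<one>]) y = \<zero> \<Longrightarrow> dv R (fs @ [\<one>]) y \<noteq> \<zero>"
  shows "\<exists>Y\<subseteq>carrier R. finite Y \<and> card Y = length fs \<and> (\<forall>y\<in>Y. pv R (fs @ [\<one>]) y = \<zero>)"
  using assms(2,3)
proof (induction "length fs" arbitrary: fs)
  case 0
  then show ?case by (intro exI[of _ "{}"]) auto
next
  case (Suc n)
  then obtain z gs where fs: "fs = z # gs" by (cases fs) auto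
  have c: "z \<in> carrier R" "set gs \<subseteq> carrier R" "set (gs @ [\<one>]) \<subseteq> carrier R" using Suc.prems fs by auto
  obtain y where y: "y \<in> carrier R" "y [^] length fs \<oplus> pv R fs y = \<zero>"
    using hr Suc.prems fs unfolding has_roots_def by blast
  have root: "pv R (z # (gs @ [\<one>])) y = \<zero>"
    using pv_append[of fs "[\<one>]" y] Suc.prems(1) y unfolding fs by (simp add: a_comm)
  obtain hs where hs: "set hs \<subseteq> carrier R" "length hs = length gs" "sdiv R y (gs @ [\<one>]) = hs @ [\<one>]"
    using sdiv_snoc[OF c(2) one_closed y(1)] by blast
  have F: "pv R (fs @ [\<one>]) t = (t \<ominus> y) \<otimes> pv R (hs @ [\<one>]) t" if t: "t \<in> carrier R" for t
    using pv_sdiv[OF t y(1) c(1,3)] root t y(1) hs unfolding fs by simp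
  have D: "dv R (fs @ [\<one>]) t = pv R (hs @ [\<one>]) t \<oplus> (t \<ominus> y) \<otimes> dv R (hs @ [\<one>]) t" if t: "t \<in> carrier R" for t
    using dv_sdiv[OF t y(1) c(1,3)] hs unfolding fs by simp
  have Dc: "dv R (hs @ [\<one>]) t \<in> carrier R" if "t \<in> carrier R" for t using dv_closed that hs by simp
  have qc: "pv R (hs @ [\<one>]) t \<in> carrier R" if "t \<in> carrier R" for t using that hs by simp
  have "\<exists>Y\<subseteq>carrier R. finite Y \<and> card Y = length hs \<and> (\<forall>y\<in>Y. pv R (hs @ [\<one>]) y = \<zero>)"
  proof (rule Suc.hyps(1)[OF _ hs(1)])
    show "n = length hs" using Suc fs hs by simp
    fix t assume t: "t \<in> carrier R" "pv R (hs @ [\<one>]) t = \<zero>"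
    then have "pv R (fs @ [\<one>]) t = \<zero>" using F y by simp
    then have "dv R (fs @ [\<one>]) t \<noteq> \<zero>" using Suc.prems(2) t by blast
    then show "dv R (hs @ [\<one>]) t \<noteq> \<zero>" using D[OF t(1)] t y by auto
  qed
  then obtain Y where Y: "Y \<subseteq> carrier R" "finite Y" "card Y = length hs" "\<And>t. t \<in> Y \<Longrightarrow> pv R (hs @ [\<one>]) t = \<zero>" by blast
  have "dv R (fs @ [\<one>]) y \<noteq> \<zero>" using Suc.prems(2)[OF y(1)] root unfolding fs by simp
  then have "pv R (hs @ [\<one>]) y \<noteq> \<zero>" using D[OF y(1)] y(1) Dc[OF y(1)] by (auto simp: a_minus_def r_neg)
  then have "y \<notin> Y" using Y(4) by blast
  then have "card (insert y Y) = length fs" using Y hs fs by simp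
  moreover have "pv R (fs @ [\<one>]) t = \<zero>" if "t \<in> insert y Y" for t
    using that root F[of t] Y y unfolding fs by auto
  ultimately show ?case using Y y by (intro exI[of _ "insert y Y"]) auto
qed

lemma pow_eq_zero: "y [^] n = \<zero> \<Longrightarrow> y \<in> carrier R \<Longrightarrow> y = \<zero>" for n :: nat
  by (induction n) (auto simp: integral_iff)

text \<open>Zero top coefficients are dropped, then the relation is divided by its leading
  coefficient; the strict bound on the length accounts for the leading \<open>1\<close> that
  \<open>fs\<close> omits.\<close>

lemma monic_relation:
  assumes M: "subfield M R" and x: "x \<in> carrier R" and "set ms \<subseteq> M" "\<not> set ms \<subseteq> {\<zero>}" "pv R ms x = \<zero>"
  shows "\<exists>fs. set fs \<subseteq> M \<and> length fs < length ms \<and> x [^] length fs \<oplus> pv R fs x = \<zero>"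
  using assms(3-)
proof (induction ms rule: rev_induct)
  case (snoc l ms)
  note Mc = subfieldE(3)[OF M]
  have c [simp]: "l \<in> carrier R" "set ms \<subseteq> carrier R" "x \<in> carrier R" "pv R ms x \<in> carrier R"
    using snoc.prems Mc x by auto
  have eq: "pv R ms x \<oplus> x [^] length ms \<otimes> l = \<zero>" using pv_append[of ms "[l]" x] snoc.prems by simp
  show ?case
  proof (cases "l = \<zero>")
    case True
    then have "pv R ms x = \<zero>" using eq by simp
    then obtain fs where "set fs \<subseteq> M" "length fs < length ms" "x [^] length fs \<oplus> pv R fs x = \<zero>"
      using snoc True by auto
    then show ?thesis by (intro exI[of _ fs]) auto
  next
    case False
    have il: "inv l \<in> M" "inv l \<otimes> l = \<one>" using subfield_m_inv(1,3)[OF M] snoc.prems False by auto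
    have [simp]: "inv l \<in> carrier R" using il Mc by blast
    have "x [^] length ms \<oplus> inv l \<otimes> pv R ms x = inv l \<otimes> l \<otimes> x [^] length ms \<oplus> inv l \<otimes> pv R ms x"
      using il by simp
    also have "\<dots> = inv l \<otimes> (pv R ms x \<oplus> x [^] length ms \<otimes> l)" by (simp add: ring_norm)
    finally have "x [^] length ms \<oplus> inv l \<otimes> pv R ms x = \<zero>" using eq by simp
    moreover have "set (map ((\<otimes>) (inv l)) ms) \<subseteq> M"
      using snoc.prems subringE(6)[OF subfieldE(1)[OF M] il(1)] by auto
    ultimately show ?thesis by (intro exI[of _ "map ((\<otimes>) (inv l)) ms"]) (auto simp: pv_scale)
  qed
qed simp

lemma pimage_simple_extension: "subring M R \<Longrightarrow> x \<in> carrier R \<Longrightarrow> pimage R M x = simple_extension M x"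
proof
  assume M: "subring M R" and x: "x \<in> carrier R"
  note Mc = subringE(1)[OF M]
  show "pimage R M x \<subseteq> simple_extension M x"
  proof
    fix v assume "v \<in> pimage R M x"
    then obtain zs where zs: "set zs \<subseteq> M" "v = pv R zs x" unfolding pimage_def by blast
    have "pv R zs x \<in> simple_extension M x"
      using zs(1)
    proof (induction zs)
      case (Cons z zs)
      then have "pv R zs x \<otimes> x \<oplus> z \<in> simple_extension M x" by (intro simple_extension.lin) auto
      moreover have "pv R zs x \<in> carrier R" "z \<in> carrier R" using Cons Mc x by auto
      ultimately show ?case using x by (simp add: m_comm a_comm)
    qed (simp add: simple_extension.zero)
    then show "v \<in> simple_extension M x" using zs by simp
  qed
  show "simple_extension M x \<subseteq> pimage R M x"
  proof
    fix v assume "v \<in> simple_extension M x"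
    then show "v \<in> pimage R M x"
    proof induction
      case zero
      then show ?case using subringE(2)[OF pimage_subring[OF M x]] .
    next
      case (lin k1 k2)
      then show ?case
        using subringE(6,7)[OF pimage_subring[OF M x]] pimage_self[OF M x] pimage_base[OF M x] by blast
    qed
  qed
qed

lemma pimage_subfield:
  assumes M: "subfield M R" and x: "x \<in> carrier R" and ms: "set ms \<subseteq> M" "\<not> set ms \<subseteq> {\<zero>}" "pv R ms x = \<zero>"
  shows "subfield (pimage R M x) R"
proof -
  note Mc = subfieldE(3)[OF M]
  obtain fs where fs: "set fs \<subseteq> M" "x [^] length fs \<oplus> pv R fs x = \<zero>" using monic_relation[OF M x ms] by blast
  have "eval (\<one> # rev fs) x = \<zero>"
    using fs pv_eval[of fs x] Mc x by auto
  moreover have "\<one> # rev fs \<in> carrier (M [X])"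
    using fs subringE(3)[OF subfieldE(1)[OF M]] unfolding univ_poly_carrier[symmetric] polynomial_def by auto
  ultimately have "(algebraic over M) x" by (intro algebraicI) auto
  then show ?thesis
    using simple_extension_is_subfield[OF M x] pimage_simple_extension[OF subfieldE(1)[OF M] x] by simp
qed

text \<open>
  If the derivative of the minimal polynomial \<open>F\<close> vanished, then \<open>F\<close> would be a polynomial in \<open>T\<^sup>p\<close>, hence a
  \<open>p\<close>-th power because \<open>M\<close> is perfect. So the derivative is invertible at \<open>x\<close>, hence at all conjugates.
\<close>

lemma conjugates:
  assumes hr: has_roots and p: "Factorial_Ring.prime (p :: nat)" and ch: "add_pow R p \<one> = \<zero>"
    and M: "subfield M R" and perfect: "\<And>m. m \<in> M \<Longrightarrow> \<exists>n\<in>M. n [^] p = m"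
    and x: "x \<in> carrier R" and ms: "set ms \<subseteq> M" "\<not> set ms \<subseteq> {\<zero>}" "pv R ms x = \<zero>"
  shows "\<exists>fs Y. set fs \<subseteq> M \<and> x [^] length fs \<oplus> pv R fs x = \<zero> \<and> finite Y \<and> card Y = length fs \<and>
    (\<forall>y\<in>Y. specialization R M x y)"
proof -
  note Msr = subfieldE(1)[OF M] and Mc = subfieldE(3)[OF M]
  let ?P = "\<lambda>d. \<exists>fs. set fs \<subseteq> M \<and> length fs = d \<and> x [^] d \<oplus> pv R fs x = \<zero>"
  define d where "d = (LEAST d. ?P d)"
  have "\<exists>d. ?P d" using monic_relation[OF M x ms] by blast
  then have "?P d" unfolding d_def by (rule LeastI_ex)
  then obtain fs where fs: "set fs \<subseteq> M" "length fs = d" "x [^] d \<oplus> pv R fs x = \<zero>" by blast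
  \<comment> \<open>Minimality of \<open>d\<close>: at most \<open>d\<close> coefficients mean
    degree less than \<open>d\<close>.\<close>
  have least: "set ns \<subseteq> {\<zero>}" if ns: "set ns \<subseteq> M" "length ns \<le> d" "pv R ns x = \<zero>" for ns
  proof (rule ccontr)
    assume "\<not> set ns \<subseteq> {\<zero>}"
    then obtain gs where "set gs \<subseteq> M" "length gs < length ns" "x [^] length gs \<oplus> pv R gs x = \<zero>"
      using monic_relation[OF M x ns(1) _ ns(3)] by blast
    then show False using Least_le[of ?P "length gs"] ns(2) unfolding d_def[symmetric] by auto
  qed
  define F where "F = fs @ [\<one>]"
  have FM: "set F \<subseteq> M" unfolding F_def using fs subringE(3)[OF Msr] by auto
  have fc: "set fs \<subseteq> carrier R" "set F \<subseteq> carrier R" using fs FM Mc by auto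
  have F: "pv R F t = t [^] d \<oplus> pv R fs t" if "t \<in> carrier R" for t
    unfolding F_def using pv_append[of fs "[\<one>]" t] fc that fs by (simp add: a_comm)
  \<comment> \<open>A relation of \<open>x\<close> reduces modulo \<open>F\<close> to one with
    \<open>d\<close> coefficients, which is trivial by minimality; so the relation also holds at
    every root of \<open>F\<close>.\<close>
  have spec: "specialization R M x y" if y: "y \<in> carrier R" "pv R F y = \<zero>" for y
    unfolding specialization_def
  proof (intro conjI allI impI)
    fix zs assume zs: "set zs \<subseteq> M" "pv R zs x = \<zero>"
    obtain ns where ns: "set ns \<subseteq> M" "length ns = d"
      "\<And>t. t \<in> carrier R \<Longrightarrow> t [^] d \<oplus> pv R fs t = \<zero> \<Longrightarrow> pv R zs t = pv R ns t"
      using pv_reduce[OF Msr fs(1) zs(1)] fs(2) by blast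
    have "pv R ns x = \<zero>" using ns(3)[OF x fs(3)] zs by simp
    then have "set ns \<subseteq> {\<zero>}" using least ns by simp
    then show "pv R zs y = \<zero>" using ns(3)[OF y(1)] y F pv_zeros by simp
  qed (rule y)
  have d0: "d > 0"
  proof (rule ccontr)
    assume "\<not> d > 0"
    then show False using fs by simp
  qed
  then obtain z gs where fz: "fs = z # gs" using fs(2) by (cases fs) auto
  define D where "D = weighted R 1 (gs @ [\<one>])"
  have Fz: "F = z # (gs @ [\<one>])" unfolding F_def fz by simp
  have DM: "set D \<subseteq> M" unfolding D_def using set_weighted[OF Msr] FM unfolding Fz by auto
  have Dd: "dv R F t = pv R D t" if "t \<in> carrier R" for t
    using dv_eq_pv[of z "gs @ [\<one>]" t] that fc(1) unfolding D_def Fz fz by simp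
  have D0: "pv R D x \<noteq> \<zero>"
  proof
    assume "pv R D x = \<zero>"
    moreover have "length D \<le> d" unfolding D_def using fs(2) unfolding fz by simp
    ultimately have Dz: "set D \<subseteq> {\<zero>}" using least[OF DM] by blast
    \<comment> \<open>The derivative has the coefficients \<open>(k + 1) F_(k+1)\<close>, and an
      integer not divisible by \<open>p\<close> can be cancelled.\<close>
    have "F ! i = \<zero>" if i: "i < length F" "\<not> p dvd i" for i
    proof -
      obtain k where k: "i = Suc k" using i by (cases i) auto
      have kl: "k < length (gs @ [\<one>])" using i unfolding k Fz by simp
      have "D ! k = add_pow R (Suc k) (F ! i)" unfolding D_def k Fz nth_weighted[OF kl] by simp
      moreover have "D ! k \<in> set D" using kl unfolding D_def by (intro nth_mem) simp
      moreover have "F ! i \<in> carrier R" using fc nth_mem[OF i(1)] by blast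
      ultimately show ?thesis using Dz char_cancel[OF ch _ _ p, of "F ! i" i] i unfolding k by auto
    qed
    then obtain hs where hs: "set hs \<subseteq> set F" "p * length hs < length F + p" "set hs \<subseteq> {\<zero>} \<Longrightarrow> set F \<subseteq> {\<zero>}"
        "\<And>t. t \<in> carrier R \<Longrightarrow> pv R F t = pv R hs (t [^] p)"
      using pv_frobenius[OF prime_gt_0_nat[OF p] fc(2)] by blast
    \<comment> \<open>With \<open>p\<close>-th roots of the coefficients, \<open>F(x)\<close>
      becomes the \<open>p\<close>-th power of a polynomial in \<open>x\<close> that is too short
      for a nontrivial relation.\<close>
    obtain r where r: "\<And>m. m \<in> M \<Longrightarrow> r m \<in> M" "\<And>m. m \<in> M \<Longrightarrow> r m [^] p = m" using perfect by metis
    have hM: "set hs \<subseteq> M" using hs FM by blast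
    have rc: "m \<in> M \<Longrightarrow> r m \<in> carrier R" for m using r(1) Mc by blast
    have "pv R (map r hs) x [^] p = pv R hs (x [^] p)"
      using hM
    proof (induction hs)
      case Nil
      then show ?case using prime_gt_0_nat[OF p] by (simp add: nat_pow_zero)
    next
      case (Cons h hs)
      then have [simp]: "r h \<in> carrier R" "pv R (map r hs) x \<in> carrier R" "h \<in> M" using x by (auto intro!: pv_closed rc)
      show ?case using Cons r x by (simp add: frobenius_add[OF p ch] nat_pow_distrib)
    qed
    also have "\<dots> = \<zero>" using hs(4)[OF x] F[OF x] fs by simp
    finally have "pv R (map r hs) x [^] p = \<zero>" .
    moreover have "pv R (map r hs) x \<in> carrier R" using hM rc x by (intro pv_closed) auto
    ultimately have "pv R (map r hs) x = \<zero>" by (rule pow_eq_zero)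
    \<comment> \<open>From \<open>p length hs < d + 1 + p\<close>: for \<open>length hs > d\<close>
      this would give \<open>p d < d + 1\<close>, impossible with \<open>p \<ge> 2\<close> and
      \<open>d > 0\<close>.\<close>
    moreover have "length hs \<le> d"
    proof (rule ccontr)
      assume "\<not> length hs \<le> d"
      then have "p * Suc d \<le> p * length hs" by (intro mult_le_mono2) simp
      also have "\<dots> < Suc d + p" using hs(2) fs(2) unfolding F_def by simp
      finally have "p * Suc d < Suc d + p" .
      moreover have "p * Suc d = p + p * d" by (rule mult_Suc_right)
      moreover have "2 * d \<le> p * d" using prime_ge_2_nat[OF p] by (intro mult_le_mono1)
      ultimately show False using d0 by linarith
    qed
    moreover have "set (map r hs) \<subseteq> M" using hM r by auto
    ultimately have "set (map r hs) \<subseteq> {\<zero>}" using least[of "map r hs"] by simp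
    then have "r h = \<zero>" if "h \<in> set hs" for h using that by auto
    moreover have "\<zero> [^] p = \<zero>" using prime_gt_0_nat[OF p] by (intro nat_pow_zero) simp
    ultimately have "h = \<zero>" if "h \<in> set hs" for h using r(2)[of h] that hM by auto
    then have "set F \<subseteq> {\<zero>}" using hs(3) by blast
    then show False unfolding F_def by simp
  qed
  note V = pimage_subfield[OF M x ms]
  have "pv R D x \<in> pimage R M x" unfolding pimage_def using DM by blast
  then have "inv (pv R D x) \<in> pimage R M x" and i: "inv (pv R D x) \<otimes> pv R D x = \<one>"
    using subfield_m_inv(1,3)[OF V] D0 by auto
  then obtain ps where ps: "set ps \<subseteq> M" "inv (pv R D x) = pv R ps x" unfolding pimage_def by blast
  \<comment> \<open>The inverse of \<open>D(x)\<close> in the field \<open>M[x]\<close> is a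
    polynomial \<open>ps\<close> in \<open>x\<close>; the relation \<open>ps D - 1\<close> vanishes
    at \<open>x\<close> and so at all roots of \<open>F\<close>.\<close>
  obtain us where us: "set us \<subseteq> M" "\<And>t. t \<in> carrier R \<Longrightarrow> pv R us t = pv R ps t \<otimes> pv R D t"
    using polyfunD[OF polyfun_mult[OF Msr polyfun_pv[OF ps(1)] polyfun_pv[OF DM]]] by blast
  have nu: "set (\<ominus> \<one> # []) \<subseteq> M" using subringE(3,5)[OF Msr] by simp
  obtain vs where vs: "set vs \<subseteq> M" "\<And>t. t \<in> carrier R \<Longrightarrow> pv R vs t = pv R us t \<oplus> \<ominus> \<one>"
    using pv_add_ex[OF Msr us(1) nu] by auto
  have "pv R vs x = \<zero>" using vs us x i ps by (simp add: r_neg)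
  have "dv R F y \<noteq> \<zero>" if y: "y \<in> carrier R" "pv R F y = \<zero>" for y
  proof
    assume "dv R F y = \<zero>"
    then have "pv R us y = \<zero>" using us(2)[OF y(1)] Dd[OF y(1)] ps Mc y pv_closed[of "ps" y] by auto
    moreover have "pv R vs y = \<zero>"
      using spec[OF y] vs(1) \<open>pv R vs x = \<zero>\<close> unfolding specialization_def by blast
    ultimately show False using vs(2)[OF y(1)] by simp
  qed
  then obtain Y where "Y \<subseteq> carrier R" "finite Y" "card Y = length fs" "\<forall>y\<in>Y. pv R F y = \<zero>"
    using distinct_roots[OF hr fc(1)] unfolding F_def by blast
  then show ?thesis using fs spec by (intro exI[of _ fs] exI[of _ Y]) auto
qed

text \<open>The fraction field of \<open>V\<close>, realized inside the field
  \<open>R\<close>.\<close>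

definition fraction_set :: "'a set \<Rightarrow> 'a set" where
  "fraction_set V = {w \<in> carrier R. \<exists>q\<in>V - {\<zero>}. q \<otimes> w \<in> V}"

lemma fraction_set_subfield:
  assumes V: "subring V R"
  shows "V \<subseteq> fraction_set V" "subfield (fraction_set V) R" "\<And>q. q \<in> V - {\<zero>} \<Longrightarrow> inv q \<in> fraction_set V"
proof -
  note Vc = subring_carrier[OF V]
  have one: "\<one> \<in> V - {\<zero>}" using subringE(3)[OF V] by simp
  show VF: "V \<subseteq> fraction_set V"
    unfolding fraction_set_def using one Vc by (auto intro!: bexI[of _ \<one>])
  have FI: "w \<in> fraction_set V" if "w \<in> carrier R" "q \<in> V - {\<zero>}" "q \<otimes> w \<in> V" for w q
    using that unfolding fraction_set_def by blast
  have prod: "q \<otimes> r \<in> V - {\<zero>}" if "q \<in> V - {\<zero>}" "r \<in> V - {\<zero>}" for q r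
    using that subringE(6)[OF V] Vc integral_iff by auto
  have "subring (fraction_set V) R"
  proof (rule subringI)
    show "fraction_set V \<subseteq> carrier R" unfolding fraction_set_def by blast
    show "\<one> \<in> fraction_set V" using VF one by blast
    fix w assume "w \<in> fraction_set V"
    then obtain q where w: "w \<in> carrier R" and q: "q \<in> V - {\<zero>}" "q \<otimes> w \<in> V" unfolding fraction_set_def by blast
    have qc: "q \<in> carrier R" using q Vc by blast
    show "\<ominus> w \<in> fraction_set V" using FI[OF _ q(1), of "\<ominus> w"] subringE(5)[OF V q(2)] qc w by (simp add: r_minus)
    fix z assume "z \<in> fraction_set V"
    then obtain r where z: "z \<in> carrier R" and r: "r \<in> V - {\<zero>}" "r \<otimes> z \<in> V" unfolding fraction_set_def by blast
    have rc: "r \<in> carrier R" using r Vc by blast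
    have "(q \<otimes> r) \<otimes> (w \<otimes> z) = (q \<otimes> w) \<otimes> (r \<otimes> z)" using qc rc w z by (simp add: m_ac)
    then show "w \<otimes> z \<in> fraction_set V" using FI[OF _ prod[OF q(1) r(1)]] subringE(6)[OF V q(2) r(2)] w z by simp
    have "(q \<otimes> r) \<otimes> (w \<oplus> z) = r \<otimes> (q \<otimes> w) \<oplus> q \<otimes> (r \<otimes> z)" using qc rc w z by (simp add: ring_norm)
    then show "w \<oplus> z \<in> fraction_set V"
      using FI[OF _ prod[OF q(1) r(1)]] subringE(6,7)[OF V] q r w z by auto
  qed
  moreover have inv_mem: "inv w \<in> fraction_set V" if wF: "w \<in> fraction_set V - {\<zero>}" for w
  proof -
    obtain q where w: "w \<in> carrier R" "w \<noteq> \<zero>" and q: "q \<in> V - {\<zero>}" "q \<otimes> w \<in> V" using wF unfolding fraction_set_def by blast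
    have wU: "w \<in> Units R" using w field_Units by simp
    have qc: "q \<in> carrier R" using q Vc by blast
    have "q \<otimes> w \<in> V - {\<zero>}" using q w qc integral_iff by auto
    moreover have "(q \<otimes> w) \<otimes> inv w = q" using wU w qc by (simp add: m_assoc)
    ultimately show ?thesis using FI[of "inv w" "q \<otimes> w"] wU q by auto
  qed
  ultimately show "subfield (fraction_set V) R" by (intro subfieldI') auto
  show "inv q \<in> fraction_set V" if "q \<in> V - {\<zero>}" for q using inv_mem[of q] VF that by blast
qed

text \<open>If two powers of \<open>x\<close> coincided, \<open>T^i - T^k\<close> would be a
  nontrivial relation.\<close>

lemma transcendental_infinite:
  assumes M: "subring M R" and x: "x \<in> carrier R"
    and tr: "\<And>ms. set ms \<subseteq> M \<Longrightarrow> pv R ms x = \<zero> \<Longrightarrow> set ms \<subseteq> {\<zero>}"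
  shows "infinite (carrier R)"
proof
  assume "finite (carrier R)"
  moreover have "range (\<lambda>k :: nat. x [^] k) \<subseteq> carrier R" using x by auto
  ultimately have "\<not> inj (\<lambda>k :: nat. x [^] k)" using finite_subset finite_imageD infinite_UNIV_nat by metis
  then obtain i k :: nat where ik: "i < k" "x [^] i = x [^] k"
    unfolding inj_def by (metis linorder_neqE_nat)
  have r0: "set (replicate n \<zero>) \<subseteq> {\<zero>}" "set (replicate n \<zero>) \<subseteq> carrier R" for n
    by (simp_all add: set_replicate_conv_if)
  have z: "pv R (replicate n \<zero> @ [u]) x = x [^] n \<otimes> u" if "u \<in> carrier R" for n u
    using pv_append[OF r0(2), of "[u]" x n] pv_zeros[OF r0(1)] that x by simp
  have z': "pv R (replicate n \<zero> @ (\<one> # us)) x = x [^] n \<otimes> (\<one> \<oplus> x \<otimes> pv R us x)" if "set us \<subseteq> carrier R" for n us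
    using pv_append[OF r0(2), of "\<one> # us" x n] pv_zeros[OF r0(1)] that x by simp
  define us where "us = replicate (k - Suc i) \<zero> @ [\<ominus> \<one>]"
  have usM: "set us \<subseteq> M" unfolding us_def using subringE(2,3,5)[OF M] by auto
  then have "set us \<subseteq> carrier R" using subringE(1)[OF M] by blast
  then have "pv R (replicate i \<zero> @ (\<one> # us)) x = x [^] i \<otimes> (\<one> \<oplus> x \<otimes> (x [^] (k - Suc i) \<otimes> \<ominus> \<one>))"
    using z' z[of "\<ominus> \<one>"] unfolding us_def by simp
  also have "\<dots> = x [^] i \<ominus> x [^] i \<otimes> (x \<otimes> x [^] (k - Suc i))" using x by (simp add: ring_norm)
  also have "x [^] i \<otimes> (x \<otimes> x [^] (k - Suc i)) = x [^] k"
  proof -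
    have "x \<otimes> x [^] (k - Suc i) = x [^] (k - i)"
      using x ik(1) by (metis Suc_diff_Suc nat_pow_Suc2)
    then show ?thesis using x ik(1) by (simp add: nat_pow_mult)
  qed
  also have "x [^] i \<ominus> x [^] k = \<zero>" using ik x by simp
  finally have "set (replicate i \<zero> @ (\<one> # us)) \<subseteq> {\<zero>}" using tr[of "replicate i \<zero> @ (\<one> # us)"] usM subringE(2,3)[OF M] by (cases "i = 0") (simp_all add: set_replicate_conv_if)
  then show False by simp
qed

end

lemma (in algebraically_closed) has_roots: "has_roots"
  unfolding has_roots_def
proof (intro allI impI)
  fix fs assume fs: "set fs \<subseteq> carrier L" "fs \<noteq> []"
  let ?p = "\<one> # rev fs"
  have pc: "?p \<in> carrier (poly_ring L)"
    using fs unfolding univ_poly_carrier[symmetric] polynomial_def by auto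
  have "size (roots ?p) = length fs" using roots_over_carrier[OF pc] unfolding splitted_def by simp
  then have "roots ?p \<noteq> {#}" using fs by auto
  then obtain a where "a \<in># roots ?p" by (meson multiset_nonemptyE)
  then have "a \<in> carrier L" "eval ?p a = \<zero>"
    using roots_mem_iff_is_root[OF pc] unfolding is_root_def by auto
  then show "\<exists>y\<in>carrier L. y [^] length fs \<oplus> pv L fs y = \<zero>"
    using pv_eval[of fs a] fs by (intro bexI[of _ a]) auto
qed

section \<open>Extraction of \<open>p\<close>-th roots\<close>

lemma (in cring) char_hom:
  assumes h: "h \<in> ring_hom R S" and S: "cring S" and ch: "add_pow R (p :: nat) \<one> = \<zero>"
  shows "add_pow S p \<one>\<^bsub>S\<^esub> = \<zero>\<^bsub>S\<^esub>"
proof -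
  interpret S: cring S by fact
  interpret h: ring_hom_cring R S h using h by unfold_locales
  have "h (add_pow R n \<one>) = add_pow S n \<one>\<^bsub>S\<^esub>" for n :: nat by (induction n) auto
  from this[of p] show ?thesis using ch by simp
qed

lemma (in cring) hev_frobenius:
  assumes p: "Factorial_Ring.prime (p :: nat)" "add_pow R p \<one> = \<zero>"
    and [simp]: "a \<in> carrier R" "s \<in> carrier R" and "set cs \<subseteq> carrier R"
  shows "hev R a s cs [^] p = hev R (a [^] p) (s [^] p) (map (\<lambda>c. c [^] p) cs)"
  using assms(5)
proof (induction cs)
  case (Cons c cs)
  then have [simp]: "c \<in> carrier R" "set cs \<subseteq> carrier R" by auto
  have "(s [^] Suc (length cs)) [^] p = (s [^] p) [^] Suc (length cs)"
    by (simp only: nat_pow_pow assms(4) mult.commute)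
  then show ?case using Cons by (simp add: frobenius_add[OF p] nat_pow_distrib del: nat_pow_Suc)
qed simp

text \<open>Multiplication by \<open>y\<close> kills all terms with a factor \<open>s\<close>, and
  \<open>a\<close> acts on \<open>y\<close> as \<open>y\<close> does; only the power coming from the
  leading term survives. This will make an error term nilpotent.\<close>

lemma (in cring) hev_orthogonal:
  assumes [simp]: "a \<in> carrier R" "s \<in> carrier R" "y \<in> carrier R" and "set cs \<subseteq> carrier R"
    and sy: "s \<otimes> y = \<zero>" and ay: "a \<otimes> y = y \<otimes> y"
  shows "hev R a s cs \<otimes> y = y [^] Suc (length cs)"
  using assms(4)
proof (induction cs)
  case (Cons c cs)
  then have [simp]: "c \<in> carrier R" "hev R a s cs \<in> carrier R" by auto
  have "c \<otimes> s [^] Suc (length cs) \<otimes> y = c \<otimes> s [^] length cs \<otimes> (s \<otimes> y)" by (simp add: m_assoc)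
  then have z: "c \<otimes> s [^] Suc (length cs) \<otimes> y = \<zero>" using sy by simp
  have "a \<otimes> hev R a s cs \<otimes> y = a \<otimes> (hev R a s cs \<otimes> y)" by (simp add: m_assoc)
  also have "\<dots> = (a \<otimes> y) \<otimes> y [^] length cs" using Cons by (simp add: m_ac)
  also have "\<dots> = y [^] Suc (Suc (length cs))" unfolding ay by (simp add: m_ac)
  finally show ?case using z by (simp add: l_distr del: nat_pow_Suc)
qed simp

text \<open>Since monic polynomials have roots, Frobenius is bijective on \<open>W\<close>;
  \<open>rt\<close> will be its inverse.\<close>

locale frobenius_change = base_change K A W for K :: "('k, 'l) ring_scheme"
    and A :: "('k, 'a, 'm) module_scheme" and W :: "('k, 'b, 'n) module_scheme" +
  fixes p :: nat
  assumes p: "Factorial_Ring.prime p" and charW: "add_pow W p \<one>\<^bsub>W\<^esub> = \<zero>\<^bsub>W\<^esub>" and roots: "W.has_roots"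
begin

lemma charT: "add_pow T p \<one>\<^bsub>T\<^esub> = \<zero>\<^bsub>T\<^esub>"
  by (rule B.char_hom[OF j_hom T.cring_axioms charW])

lemmas frob_add = B.frobenius_add[OF p charW] and frob_minus = B.frobenius_minus[OF p charW]
  and frobT_add = T.frobenius_add[OF p charT] and frobT_minus = T.frobenius_minus[OF p charT]

lemma p_pos: "p > 0"
  using p by (rule prime_gt_0_nat)

lemma frob_inj:
  assumes "x \<in> carrier W" "y \<in> carrier W" "x [^]\<^bsub>W\<^esub> p = y [^]\<^bsub>W\<^esub> p"
  shows "x = y"
proof -
  have "(x \<ominus>\<^bsub>W\<^esub> y) [^]\<^bsub>W\<^esub> p = \<zero>\<^bsub>W\<^esub>" using assms by (simp add: frob_minus)
  then have "x \<ominus>\<^bsub>W\<^esub> y = \<zero>\<^bsub>W\<^esub>" by (rule W.pow_eq_zero) (use assms in simp)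
  then show ?thesis using assms by simp
qed

lemma root_ex:
  assumes "w \<in> carrier W" shows "\<exists>y\<in>carrier W. y [^]\<^bsub>W\<^esub> p = w"
proof -
  obtain q where q: "p = Suc q" using p_pos by (cases p) auto
  let ?fs = "\<ominus>\<^bsub>W\<^esub> w # replicate q \<zero>\<^bsub>W\<^esub>"
  have "set ?fs \<subseteq> carrier W" using assms by (simp add: set_replicate_conv_if)
  then obtain y where y: "y \<in> carrier W" "y [^]\<^bsub>W\<^esub> length ?fs \<oplus>\<^bsub>W\<^esub> pv W ?fs y = \<zero>\<^bsub>W\<^esub>"
    using roots unfolding W.has_roots_def by blast
  have "pv W (replicate q \<zero>\<^bsub>W\<^esub>) y = \<zero>\<^bsub>W\<^esub>" using y by (intro B.pv_zeros) (simp_all add: set_replicate_conv_if)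
  then have "pv W ?fs y = \<ominus>\<^bsub>W\<^esub> w" using y assms by simp
  moreover have "length ?fs = p" unfolding q by simp
  ultimately have "y [^]\<^bsub>W\<^esub> p \<oplus>\<^bsub>W\<^esub> \<ominus>\<^bsub>W\<^esub> w = \<zero>\<^bsub>W\<^esub>" using y by metis
  then have "y [^]\<^bsub>W\<^esub> p = w" using assms y by (metis B.minus_equality B.minus_minus B.nat_pow_closed B.a_inv_closed)
  then show ?thesis using y by blast
qed

definition rt :: "'b \<Rightarrow> 'b" where "rt w = (THE y. y \<in> carrier W \<and> y [^]\<^bsub>W\<^esub> p = w)"

lemma rt: assumes "w \<in> carrier W" shows "rt w \<in> carrier W" "rt w [^]\<^bsub>W\<^esub> p = w"
proof -
  have "\<exists>!y. y \<in> carrier W \<and> y [^]\<^bsub>W\<^esub> p = w" using root_ex[OF assms] frob_inj by blast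
  from theI'[OF this] show "rt w \<in> carrier W" "rt w [^]\<^bsub>W\<^esub> p = w" unfolding rt_def by auto
qed

lemma rt_eq: "y \<in> carrier W \<Longrightarrow> y [^]\<^bsub>W\<^esub> p = w \<Longrightarrow> rt w = y"
  using frob_inj[of "rt w" y] rt[of w] by auto

lemma rt_pow: "y \<in> carrier W \<Longrightarrow> rt (y [^]\<^bsub>W\<^esub> p) = y"
  by (rule rt_eq) auto

lemma rt_add: "v \<in> carrier W \<Longrightarrow> w \<in> carrier W \<Longrightarrow> rt (v \<oplus>\<^bsub>W\<^esub> w) = rt v \<oplus>\<^bsub>W\<^esub> rt w"
  by (rule rt_eq) (auto simp: rt frob_add)

lemma rt_mult: "v \<in> carrier W \<Longrightarrow> w \<in> carrier W \<Longrightarrow> rt (v \<otimes>\<^bsub>W\<^esub> w) = rt v \<otimes>\<^bsub>W\<^esub> rt w"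
  by (rule rt_eq) (auto simp: rt B.nat_pow_distrib)

text \<open>Frobenius is additive on \<open>T\<close> and maps \<open>a \<otimes> m\<close> to
  \<open>a^p \<otimes> m^p\<close>.\<close>

lemma bm_frobenius:
  assumes V: "V \<subseteq> carrier W" and V': "\<And>v. v \<in> V \<Longrightarrow> v [^]\<^bsub>W\<^esub> p \<in> V'" and z: "z \<in> bm V"
  shows "z [^]\<^bsub>T\<^esub> p \<in> bm V'"
  using z
proof induction
  case zero
  have "\<zero>\<^bsub>T\<^esub> [^]\<^bsub>T\<^esub> p = \<zero>\<^bsub>T\<^esub>" using p_pos by (intro T.nat_pow_zero) simp
  then show ?case by (simp add: bm.zero)
next
  case (te a m)
  have m: "m \<in> carrier W" using te V by blast
  have "te a m [^]\<^bsub>T\<^esub> n = te (a [^]\<^bsub>A\<^esub> n) (m [^]\<^bsub>W\<^esub> n)" for n :: nat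
    using te m by (induction n) (auto simp: te_one te_mult)
  then show ?case using te V' by (simp add: bm.te)
next
  case (diff u v)
  then show ?case using bm_carrier[OF V] by (simp add: frobT_minus bm.diff)
qed

definition p_roots :: "'b set \<Rightarrow> 'b set" where "p_roots M = {y \<in> carrier W. y [^]\<^bsub>W\<^esub> p \<in> M}"

definition p_powers :: "'b set \<Rightarrow> 'b set" where "p_powers M = (\<lambda>m. m [^]\<^bsub>W\<^esub> p) ` M"

section \<open>Fields of p-th roots and of p-th powers\<close>

lemma p_roots_subfield:
  assumes M: "subfield M W" shows "subfield (p_roots M) W"
proof (rule W.subfieldI')
  note Ms = subfieldE(1)[OF M]
  show "subring (p_roots M) W"
    by (rule B.subringI)
      (use subringE(3,5,6,7)[OF Ms] B.subring_pow[OF Ms] frob_minus[of "\<zero>\<^bsub>W\<^esub>"] p_pos in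
        \<open>auto simp: p_roots_def frob_add B.nat_pow_distrib B.nat_pow_zero a_minus_def\<close>)
  fix k assume k: "k \<in> p_roots M - {\<zero>\<^bsub>W\<^esub>}"
  then have kU: "k \<in> Units W" "k \<in> carrier W" "k [^]\<^bsub>W\<^esub> p \<in> M" "k \<noteq> \<zero>\<^bsub>W\<^esub>"
    unfolding p_roots_def using W.field_Units by auto
  have k0: "k [^]\<^bsub>W\<^esub> p \<noteq> \<zero>\<^bsub>W\<^esub>" using W.pow_eq_zero kU by blast
  have "(inv\<^bsub>W\<^esub> k) [^]\<^bsub>W\<^esub> p = inv\<^bsub>W\<^esub> (k [^]\<^bsub>W\<^esub> p)"
    using kU k0 by (intro B.comm_inv_char[symmetric]) (auto simp: B.nat_pow_distrib[symmetric])
  then show "inv\<^bsub>W\<^esub> k \<in> p_roots M"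
    unfolding p_roots_def using kU B.subfield_m_inv(1)[OF M, of "k [^]\<^bsub>W\<^esub> p"] k0 by simp
qed

lemma p_powers_subfield:
  assumes M: "subfield M W" shows "subfield (p_powers M) W"
proof (rule W.subfieldI')
  note Ms = subfieldE(1)[OF M] and Mc = subfieldE(3)[OF M]
  show "subring (p_powers M) W"
  proof (rule B.subringI)
    show "p_powers M \<subseteq> carrier W" unfolding p_powers_def using Mc by auto
    show "\<one>\<^bsub>W\<^esub> \<in> p_powers M" unfolding p_powers_def using subringE(3)[OF Ms] by (intro image_eqI[of _ _ "\<one>\<^bsub>W\<^esub>"]) auto
    fix u assume "u \<in> p_powers M"
    then obtain m where m: "m \<in> M" "u = m [^]\<^bsub>W\<^esub> p" unfolding p_powers_def by blast
    have mc: "m \<in> carrier W" using m Mc by blast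
    have "(\<zero>\<^bsub>W\<^esub> \<ominus>\<^bsub>W\<^esub> m) [^]\<^bsub>W\<^esub> p = \<ominus>\<^bsub>W\<^esub> u"
      using m mc p_pos by (subst frob_minus) (auto simp: B.nat_pow_zero a_minus_def)
    then show "\<ominus>\<^bsub>W\<^esub> u \<in> p_powers M"
      unfolding p_powers_def using m B.subring_minus[OF Ms subringE(2)[OF Ms]] by (intro image_eqI[of _ _ "\<zero>\<^bsub>W\<^esub> \<ominus>\<^bsub>W\<^esub> m"]) auto
    fix v assume "v \<in> p_powers M"
    then obtain n where n: "n \<in> M" "v = n [^]\<^bsub>W\<^esub> p" unfolding p_powers_def by blast
    have nc: "n \<in> carrier W" using n Mc by blast
    show "u \<otimes>\<^bsub>W\<^esub> v \<in> p_powers M" unfolding p_powers_def using m n mc nc subringE(6)[OF Ms]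
      by (intro image_eqI[of _ _ "m \<otimes>\<^bsub>W\<^esub> n"]) (auto simp: B.nat_pow_distrib)
    show "u \<oplus>\<^bsub>W\<^esub> v \<in> p_powers M" unfolding p_powers_def using m n mc nc subringE(7)[OF Ms]
      by (intro image_eqI[of _ _ "m \<oplus>\<^bsub>W\<^esub> n"]) (auto simp: frob_add)
  qed
  fix k assume "k \<in> p_powers M - {\<zero>\<^bsub>W\<^esub>}"
  then obtain m where m: "m \<in> M" "k = m [^]\<^bsub>W\<^esub> p" "k \<noteq> \<zero>\<^bsub>W\<^esub>" unfolding p_powers_def by blast
  have m0: "m \<noteq> \<zero>\<^bsub>W\<^esub>" using m p_pos B.nat_pow_zero by auto
  have mc: "m \<in> carrier W" "m \<in> Units W" using m m0 Mc W.field_Units by auto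
  have "(inv\<^bsub>W\<^esub> m) [^]\<^bsub>W\<^esub> p = inv\<^bsub>W\<^esub> k"
    unfolding m(2) using mc by (intro B.comm_inv_char[symmetric]) (auto simp: B.nat_pow_distrib[symmetric])
  then show "inv\<^bsub>W\<^esub> k \<in> p_powers M"
    unfolding p_powers_def using B.subfield_m_inv(1)[OF M, of m] m m0 by (intro image_eqI[of _ _ "inv\<^bsub>W\<^esub> m"]) auto
qed

lemma p_powers_sub: "subring M W \<Longrightarrow> p_powers M \<subseteq> M"
  unfolding p_powers_def using B.subring_pow by auto

lemma sub_p_roots: "subring M W \<Longrightarrow> M \<subseteq> p_roots M"
  unfolding p_roots_def using B.subring_pow B.subring_carrier by auto

text \<open>This makes every map that is linear over the \<open>p\<close>-th powers of
  \<open>M\<close> also linear over \<open>K\<close>.\<close>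

lemma base_p_powers:
  assumes rb: "p_roots base \<subseteq> M" shows "base \<subseteq> p_powers M"
proof
  fix b assume b: "b \<in> base"
  then have bc: "b \<in> carrier W" unfolding base_def by auto
  then have "rt b \<in> M" using rb rt[OF bc] b unfolding p_roots_def by auto
  then show "b \<in> p_powers M" unfolding p_powers_def using rt(2)[OF bc] by (intro image_eqI[of _ _ "rt b"]) auto
qed

text \<open>Sums of tensors are kept as lists because the number of terms is an induction parameter
  and the vectors must be inspected for linear dependence.\<close>

primrec pair_sum :: "(('a \<times> 'b \<Rightarrow>\<^sub>0 int) set \<times> 'b) list \<Rightarrow> ('a \<times> 'b \<Rightarrow>\<^sub>0 int) set" where
  "pair_sum [] = \<zero>\<^bsub>T\<^esub>"
| "pair_sum (q # L) = fst q \<otimes>\<^bsub>T\<^esub> j (snd q) \<oplus>\<^bsub>T\<^esub> pair_sum L"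

text \<open>Written as a line plus a span, the shape to which \<open>subspace_line\<close> and
  \<open>subspace_sum\<close> apply.\<close>

primrec list_span :: "'b set \<Rightarrow> 'b list \<Rightarrow> 'b set" where
  "list_span M [] = {\<zero>\<^bsub>W\<^esub>}"
| "list_span M (e # es) = {u \<oplus>\<^bsub>W\<^esub> v | u v. u \<in> (\<lambda>m. m \<otimes>\<^bsub>W\<^esub> e) ` M \<and> v \<in> list_span M es}"

lemma pair_sum_closed: "set L \<subseteq> carrier T \<times> carrier W \<Longrightarrow> pair_sum L \<in> carrier T"
  by (induction L) (auto simp: mem_Times_iff)

lemma pair_sum_append:
  "set L \<subseteq> carrier T \<times> carrier W \<Longrightarrow> set L' \<subseteq> carrier T \<times> carrier W \<Longrightarrow> pair_sum (L @ L') = pair_sum L \<oplus>\<^bsub>T\<^esub> pair_sum L'"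
  by (induction L) (auto simp: pair_sum_closed mem_Times_iff T.a_assoc)

lemma pair_sum_neg:
  "set L \<subseteq> carrier T \<times> carrier W \<Longrightarrow> pair_sum (map (\<lambda>(a, e). (\<ominus>\<^bsub>T\<^esub> a, e)) L) = \<ominus>\<^bsub>T\<^esub> pair_sum L"
  by (induction L) (auto simp: pair_sum_closed T.l_minus T.minus_add)

lemma pair_sum_ex:
  assumes M: "subring M W" and N: "N \<subseteq> carrier W" and z: "z \<in> bm N"
  shows "\<exists>L. set L \<subseteq> bm M \<times> N \<and> z = pair_sum L"
  using z
proof induction
  case zero
  then show ?case by (intro exI[of _ "[]"]) auto
next
  case (te a m)
  have m: "m \<in> carrier W" using te N by blast
  then show ?case
    using te te_eq[OF te(1) m] bm.te[OF te(1) subringE(3)[OF M]] by (intro exI[of _ "[(te a \<one>\<^bsub>W\<^esub>, m)]"]) auto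
next
  case (diff u v)
  note bc = bm_carrier[OF subringE(1)[OF M]]
  obtain L L' where L: "set L \<subseteq> bm M \<times> N" "u = pair_sum L" and L': "set L' \<subseteq> bm M \<times> N" "v = pair_sum L'" using diff by blast
  let ?L = "map (\<lambda>(a, e). (\<ominus>\<^bsub>T\<^esub> a, e)) L'"
  have "set ?L \<subseteq> bm M \<times> N" using L'(1) bm_minus[OF subringE(1)[OF M]] by auto
  moreover have c: "set K \<subseteq> carrier T \<times> carrier W" if "set K \<subseteq> bm M \<times> N" for K
    using that bc N by auto
  ultimately have "pair_sum (L @ ?L) = u \<ominus>\<^bsub>T\<^esub> v"
    using pair_sum_append[OF c[OF L(1)] c] pair_sum_neg[OF c[OF L'(1)]] L L' by (simp add: a_minus_def)
  then show ?case using L \<open>set ?L \<subseteq> bm M \<times> N\<close> by (intro exI[of _ "L @ ?L"]) auto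
qed

lemma list_span_subspace:
  assumes M: "subring M W" and "set es \<subseteq> carrier W"
  shows "W.linear_subspace M (list_span M es)"
  using assms(2)
proof (induction es)
  case Nil
  then show ?case using W.subspace_zero[OF subringE(1)[OF M]] by simp
next
  case (Cons e es)
  then show ?case using W.subspace_sum[OF W.subspace_line[OF M] _ subringE(1)[OF M]] by simp
qed

lemma list_span_mem:
  assumes M: "subring M W" and es: "set es \<subseteq> carrier W" "e \<in> set es"
  shows "e \<in> list_span M es"
  using es
proof (induction es)
  case (Cons d es)
  then have d: "d \<in> carrier W" and S: "W.linear_subspace M (list_span M es)" using list_span_subspace[OF M] by auto
  note SA = B.add_closedD[OF W.subspaceD(1)[OF S]]
  show ?case
  proof (cases "e = d")
    case True
    have "d = \<one>\<^bsub>W\<^esub> \<otimes>\<^bsub>W\<^esub> d \<oplus>\<^bsub>W\<^esub> \<zero>\<^bsub>W\<^esub>" using d by simp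
    then show ?thesis using True subringE(3)[OF M] SA(2) by auto
  next
    case False
    then have e: "e \<in> list_span M es" "e \<in> carrier W" using Cons by auto
    have "e = \<zero>\<^bsub>W\<^esub> \<otimes>\<^bsub>W\<^esub> d \<oplus>\<^bsub>W\<^esub> e" using d e by simp
    then show ?thesis using subringE(2)[OF M] e by auto
  qed
qed simp

text \<open>A term \<open>c \<otimes> u\<close> whose vector \<open>u\<close> depends on those of
  \<open>L\<close> is distributed over their coefficients, without adding a term.\<close>

lemma pair_sum_absorb:
  assumes M: "subring M W" and c: "c \<in> bm M" and "set L \<subseteq> bm M \<times> carrier W" "u \<in> list_span M (map snd L)"
  shows "\<exists>L'. set L' \<subseteq> bm M \<times> snd ` set L \<and> length L' = length L \<and> pair_sum L' = pair_sum L \<oplus>\<^bsub>T\<^esub> c \<otimes>\<^bsub>T\<^esub> j u"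
  using assms(3,4)
proof (induction L arbitrary: u)
  case Nil
  then show ?case using bm_carrier[OF subringE(1)[OF M] c] by simp
next
  case (Cons q L)
  note bc = bm_carrier[OF subringE(1)[OF M]] and Mc = B.subring_carrier[OF M]
  obtain a e where q: "q = (a, e)" "a \<in> bm M" "e \<in> carrier W" and L: "set L \<subseteq> bm M \<times> carrier W"
    using Cons.prems(1) by (cases q) auto
  obtain m v where m: "m \<in> M" and v: "v \<in> list_span M (map snd L)" and u: "u = m \<otimes>\<^bsub>W\<^esub> e \<oplus>\<^bsub>W\<^esub> v"
    using Cons.prems(2) q by auto
  obtain L' where L': "set L' \<subseteq> bm M \<times> snd ` set L" "length L' = length L" "pair_sum L' = pair_sum L \<oplus>\<^bsub>T\<^esub> c \<otimes>\<^bsub>T\<^esub> j v"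
    using Cons.IH[OF L v] by blast
  have "set (map snd L) \<subseteq> carrier W" using L by auto
  then have vc: "v \<in> carrier W" using v B.add_closedD(5)[OF W.subspaceD(1)[OF list_span_subspace[OF M]]] by blast
  have wc: "pair_sum L \<in> carrier T" using L bc by (intro pair_sum_closed) auto
  have "a \<oplus>\<^bsub>T\<^esub> c \<otimes>\<^bsub>T\<^esub> j m \<in> bm M"
    using q c m bm_mult[OF M c j_bm[OF m]] bm_add[OF subringE(1)[OF M]] by blast
  moreover have "pair_sum ((a \<oplus>\<^bsub>T\<^esub> c \<otimes>\<^bsub>T\<^esub> j m, e) # L') = pair_sum (q # L) \<oplus>\<^bsub>T\<^esub> c \<otimes>\<^bsub>T\<^esub> j u"
  proof -
    have [simp]: "a \<in> carrier T" "c \<in> carrier T" "j m \<in> carrier T" "j e \<in> carrier T" "j v \<in> carrier T" "pair_sum L \<in> carrier T"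
      using q c m vc wc bc Mc by auto
    have "pair_sum ((a \<oplus>\<^bsub>T\<^esub> c \<otimes>\<^bsub>T\<^esub> j m, e) # L') = (a \<oplus>\<^bsub>T\<^esub> c \<otimes>\<^bsub>T\<^esub> j m) \<otimes>\<^bsub>T\<^esub> j e \<oplus>\<^bsub>T\<^esub> (pair_sum L \<oplus>\<^bsub>T\<^esub> c \<otimes>\<^bsub>T\<^esub> j v)"
      by (simp add: L'(3))
    also have "\<dots> = (a \<otimes>\<^bsub>T\<^esub> j e \<oplus>\<^bsub>T\<^esub> pair_sum L) \<oplus>\<^bsub>T\<^esub> c \<otimes>\<^bsub>T\<^esub> (j m \<otimes>\<^bsub>T\<^esub> j e \<oplus>\<^bsub>T\<^esub> j v)" by (simp add: T.ring_norm)
    also have "j m \<otimes>\<^bsub>T\<^esub> j e \<oplus>\<^bsub>T\<^esub> j v = j u" unfolding u using q vc Mc[OF m] by simp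
    finally show ?thesis by (simp add: q)
  qed
  ultimately show ?case using L' q by (intro exI[of _ "(a \<oplus>\<^bsub>T\<^esub> c \<otimes>\<^bsub>T\<^esub> j m, e) # L'"]) auto
qed

text \<open>
  If \<open>\<lambda>\<close> is \<open>M\<close>-linear, then \<open>y\<^sup>p \<mapsto> \<lambda>(y)\<^sup>p\<close> is \<open>M\<^sup>p\<close>-linear, hence induces a map on the tensor product.
\<close>

lemma frobenius_functional:
  assumes M: "subfield M W" and rb: "p_roots base \<subseteq> M" and es: "set es \<subseteq> carrier W" and e: "e \<in> carrier W" "e \<notin> list_span M es"
  obtains F where "\<And>y z. y \<in> carrier T \<Longrightarrow> z \<in> carrier T \<Longrightarrow> F (y \<oplus>\<^bsub>T\<^esub> z) = F y \<oplus>\<^bsub>T\<^esub> F z"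
    "\<And>y z. y \<in> bm (p_powers M) \<Longrightarrow> z \<in> carrier T \<Longrightarrow> F (y \<otimes>\<^bsub>T\<^esub> z) = y \<otimes>\<^bsub>T\<^esub> F z"
    "\<And>z. z \<in> carrier T \<Longrightarrow> F z \<in> bm M"
    "\<And>d. d \<in> set es \<Longrightarrow> F (j (d [^]\<^bsub>W\<^esub> p)) = \<zero>\<^bsub>T\<^esub>" "F (j (e [^]\<^bsub>W\<^esub> p)) = \<one>\<^bsub>T\<^esub>" "F \<zero>\<^bsub>T\<^esub> = \<zero>\<^bsub>T\<^esub>"
proof -
  note Ms = subfieldE(1)[OF M] and Mc = subfieldE(3)[OF M]
  note Ps = subfieldE(1)[OF p_powers_subfield[OF M]] and Pc = subfieldE(3)[OF p_powers_subfield[OF M]]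
  obtain lam where lam: "\<And>w. w \<in> carrier W \<Longrightarrow> lam w \<in> M" "\<And>u. u \<in> list_span M es \<Longrightarrow> lam u = \<zero>\<^bsub>W\<^esub>" "lam e = \<one>\<^bsub>W\<^esub>"
    "\<And>v w. v \<in> carrier W \<Longrightarrow> w \<in> carrier W \<Longrightarrow> lam (v \<oplus>\<^bsub>W\<^esub> w) = lam v \<oplus>\<^bsub>W\<^esub> lam w"
    "\<And>m w. m \<in> M \<Longrightarrow> w \<in> carrier W \<Longrightarrow> lam (m \<otimes>\<^bsub>W\<^esub> w) = m \<otimes>\<^bsub>W\<^esub> lam w"
  proof -
    show ?thesis by (rule W.linear_functional[OF M list_span_subspace[OF Ms es] e]; (assumption | rule that)+)
  qed
  have lc: "w \<in> carrier W \<Longrightarrow> lam w \<in> carrier W" for w using lam(1) Mc by blast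
  define \<mu> where "\<mu> w = lam (rt w) [^]\<^bsub>W\<^esub> p" for w
  have \<mu>c: "\<mu> w \<in> carrier W" if "w \<in> carrier W" for w unfolding \<mu>_def using that lc rt by simp
  have \<mu>a: "\<mu> (v \<oplus>\<^bsub>W\<^esub> w) = \<mu> v \<oplus>\<^bsub>W\<^esub> \<mu> w" if "v \<in> carrier W" "w \<in> carrier W" for v w
    unfolding \<mu>_def using that lc rt by (simp add: rt_add lam frob_add)
  have \<mu>m: "\<mu> (m \<otimes>\<^bsub>W\<^esub> w) = m \<otimes>\<^bsub>W\<^esub> \<mu> w" if m: "m \<in> p_powers M" and w: "w \<in> carrier W" for m w
  proof -
    obtain n where n: "n \<in> M" "m = n [^]\<^bsub>W\<^esub> p" using m unfolding p_powers_def by blast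
    have "n \<in> carrier W" using n Mc by blast
    then show ?thesis unfolding \<mu>_def n(2) using w n(1) lc rt by (simp add: rt_mult rt_pow lam B.nat_pow_distrib)
  qed
  obtain F where F: "\<And>z. z \<in> carrier T \<Longrightarrow> F z \<in> carrier T"
    "\<And>y z. y \<in> carrier T \<Longrightarrow> z \<in> carrier T \<Longrightarrow> F (y \<oplus>\<^bsub>T\<^esub> z) = F y \<oplus>\<^bsub>T\<^esub> F z"
    "\<And>y z. y \<in> bm (p_powers M) \<Longrightarrow> z \<in> carrier T \<Longrightarrow> F (y \<otimes>\<^bsub>T\<^esub> z) = y \<otimes>\<^bsub>T\<^esub> F z"
    "\<And>a w. a \<in> carrier A \<Longrightarrow> w \<in> carrier W \<Longrightarrow> F (te a w) = te a (\<mu> w)"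
    "\<And>V V' z. V \<subseteq> carrier W \<Longrightarrow> \<mu> ` V \<subseteq> V' \<Longrightarrow> V' \<subseteq> carrier W \<Longrightarrow> z \<in> bm V \<Longrightarrow> F z \<in> bm V'"
  proof -
    show ?thesis by (rule linear_map[OF Pc base_p_powers[OF rb] \<mu>c \<mu>a \<mu>m]; (assumption | rule that)+)
  qed
  have Fj: "F (j w) = j (\<mu> w)" if "w \<in> carrier W" for w unfolding j_def using F(4) that by simp
  show ?thesis
  proof (rule that[OF F(2,3)])
    have "\<mu> w \<in> M" if "w \<in> carrier W" for w
      unfolding \<mu>_def by (rule B.subring_pow[OF Ms lam(1)[OF rt(1)[OF that]]])
    then show "F z \<in> bm M" if "z \<in> carrier T" for z
      using F(5)[OF subset_refl _ Mc, of z] that bm_full by auto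
    show "F (j (d [^]\<^bsub>W\<^esub> p)) = \<zero>\<^bsub>T\<^esub>" if d: "d \<in> set es" for d
    proof -
      have "d \<in> carrier W" "lam d = \<zero>\<^bsub>W\<^esub>" using d es lam(2) list_span_mem[OF Ms es d] by auto
      then show ?thesis using Fj[of "d [^]\<^bsub>W\<^esub> p"] p_pos unfolding \<mu>_def by (simp add: rt_pow B.nat_pow_zero del: j.hom_pow)
    qed
    show "F (j (e [^]\<^bsub>W\<^esub> p)) = \<one>\<^bsub>T\<^esub>"
      using Fj[of "e [^]\<^bsub>W\<^esub> p"] e lam(3) unfolding \<mu>_def by (simp add: rt_pow del: j.hom_pow)
    show "F \<zero>\<^bsub>T\<^esub> = \<zero>\<^bsub>T\<^esub>" using F(3)[OF bm.zero, of "\<zero>\<^bsub>T\<^esub>"] F(1)[of "\<zero>\<^bsub>T\<^esub>"] by simp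
  qed auto
qed

text \<open>
  Induction on the length of a representation \<open>\<Sum> a\<^sub>k e\<^sub>k\<close>. If \<open>e\<close> is not in the span of the other \<open>e\<^sub>k\<close>, a functional
  that is \<open>\<one>\<close> at \<open>e\<close> and \<open>\<zero>\<close> at the others turns the equation into \<open>a\<^sup>p = c\<^sup>p F(b)\<close>, so \<open>c\<close> divides the coefficient \<open>a\<close>.
\<close>

lemma divide_in_root:
  assumes M: "subfield M W" and rb: "p_roots base \<subseteq> M" and pic: "pic T (bm M)" and c: "c \<in> bm M"
    and "set L \<subseteq> bm M \<times> p_roots M" "b \<in> bm M" "pair_sum L [^]\<^bsub>T\<^esub> p = c [^]\<^bsub>T\<^esub> p \<otimes>\<^bsub>T\<^esub> b"
  shows "\<exists>s\<in>bm (p_roots M). pair_sum L = c \<otimes>\<^bsub>T\<^esub> s"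
  using assms(5-7)
proof (induction "length L" arbitrary: L b)
  case 0
  have "c \<in> carrier T" using c bm_carrier[OF subfieldE(3)[OF M]] by blast
  then show ?case using 0 bm.zero by (intro bexI[of _ "\<zero>\<^bsub>T\<^esub>"]) auto
next
  case (Suc n)
  note Ms = subfieldE(1)[OF M] and Mc = subfieldE(3)[OF M]
  note bc = bm_carrier[OF Mc]
  have RW: "p_roots M \<subseteq> carrier W" unfolding p_roots_def by blast
  obtain a e L' where L: "L = (a, e) # L'" using Suc(2) by (cases L) auto
  have ae: "a \<in> bm M" "e \<in> p_roots M" and L': "set L' \<subseteq> bm M \<times> p_roots M" "length L' = n" using Suc L by auto
  have L'c: "set L' \<subseteq> bm M \<times> carrier W" "set L' \<subseteq> carrier T \<times> carrier W" "set (map snd L') \<subseteq> carrier W"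
    using L' RW bc by auto
  have [simp]: "a \<in> carrier T" "e \<in> carrier W" "pair_sum L' \<in> carrier T" "c \<in> carrier T" "b \<in> carrier T"
    using ae RW bc c Suc.prems pair_sum_closed[OF L'c(2)] by auto
  show ?case
  proof (cases "e \<in> list_span M (map snd L')")
    case True
    obtain L'' where L'': "set L'' \<subseteq> bm M \<times> snd ` set L'" "length L'' = length L'" "pair_sum L'' = pair_sum L' \<oplus>\<^bsub>T\<^esub> a \<otimes>\<^bsub>T\<^esub> j e"
      using pair_sum_absorb[OF Ms ae(1) L'c(1) True] by blast
    have wL: "pair_sum L'' = pair_sum L" unfolding L''(3) L by (simp add: T.a_comm)
    have "snd ` set L' \<subseteq> p_roots M" using L'(1) by force
    then have "set L'' \<subseteq> bm M \<times> p_roots M" using L''(1) by blast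
    then show ?thesis using Suc.hyps(1)[of L'' b] L'' L' Suc.prems wL by simp
  next
    case False
    obtain F where F: "\<And>y z. y \<in> carrier T \<Longrightarrow> z \<in> carrier T \<Longrightarrow> F (y \<oplus>\<^bsub>T\<^esub> z) = F y \<oplus>\<^bsub>T\<^esub> F z"
      "\<And>y z. y \<in> bm (p_powers M) \<Longrightarrow> z \<in> carrier T \<Longrightarrow> F (y \<otimes>\<^bsub>T\<^esub> z) = y \<otimes>\<^bsub>T\<^esub> F z"
      "\<And>z. z \<in> carrier T \<Longrightarrow> F z \<in> bm M"
      "\<And>d. d \<in> set (map snd L') \<Longrightarrow> F (j (d [^]\<^bsub>W\<^esub> p)) = \<zero>\<^bsub>T\<^esub>" "F (j (e [^]\<^bsub>W\<^esub> p)) = \<one>\<^bsub>T\<^esub>" "F \<zero>\<^bsub>T\<^esub> = \<zero>\<^bsub>T\<^esub>"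
    proof -
      show ?thesis by (rule frobenius_functional[OF M rb L'c(3) \<open>e \<in> carrier W\<close> False]; (assumption | rule that)+)
    qed
    have pow: "z [^]\<^bsub>T\<^esub> p \<in> bm (p_powers M)" if "z \<in> bm M" for z
      using bm_frobenius[OF Mc _ that, of "p_powers M"] unfolding p_powers_def by blast
    have tm: "F ((z \<otimes>\<^bsub>T\<^esub> j d) [^]\<^bsub>T\<^esub> p) = z [^]\<^bsub>T\<^esub> p \<otimes>\<^bsub>T\<^esub> F (j (d [^]\<^bsub>W\<^esub> p))" if "z \<in> bm M" "d \<in> carrier W" for z d
      using that bc F(2)[OF pow[OF that(1)], of "j (d [^]\<^bsub>W\<^esub> p)"] by (simp add: T.nat_pow_distrib)
    have F0: "F (pair_sum H [^]\<^bsub>T\<^esub> p) = \<zero>\<^bsub>T\<^esub>" if "set H \<subseteq> set L'" for H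
      using that
    proof (induction H)
      case Nil
      have "\<zero>\<^bsub>T\<^esub> [^]\<^bsub>T\<^esub> p = \<zero>\<^bsub>T\<^esub>" using p_pos by (intro T.nat_pow_zero) simp
      then show ?case using F(6) by simp
    next
      case (Cons q H)
      obtain z d where q: "q = (z, d)" by (cases q) auto
      have zL: "(z, d) \<in> set L'" using Cons.prems q by simp
      then have zd: "z \<in> bm M" "d \<in> carrier W" using L'c(1) by blast+
      have dL: "d \<in> set (map snd L')" using imageI[OF zL, of snd] by simp
      have Hc: "pair_sum H \<in> carrier T" using Cons L'c by (intro pair_sum_closed) auto
      have "pair_sum (q # H) [^]\<^bsub>T\<^esub> p = (z \<otimes>\<^bsub>T\<^esub> j d) [^]\<^bsub>T\<^esub> p \<oplus>\<^bsub>T\<^esub> pair_sum H [^]\<^bsub>T\<^esub> p"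
        unfolding q using zd bc Hc by (simp add: frobT_add)
      then show ?case
        using tm[OF zd(1,2)] F(1)[of "(z \<otimes>\<^bsub>T\<^esub> j d) [^]\<^bsub>T\<^esub> p" "pair_sum H [^]\<^bsub>T\<^esub> p"] F(4)[OF dL] Cons zd bc Hc by simp
    qed
    have wsL: "pair_sum L [^]\<^bsub>T\<^esub> p = (a \<otimes>\<^bsub>T\<^esub> j e) [^]\<^bsub>T\<^esub> p \<oplus>\<^bsub>T\<^esub> pair_sum L' [^]\<^bsub>T\<^esub> p"
      unfolding L by (simp add: frobT_add)
    have "F (pair_sum L [^]\<^bsub>T\<^esub> p) = a [^]\<^bsub>T\<^esub> p"
      unfolding wsL using F(1)[of "(a \<otimes>\<^bsub>T\<^esub> j e) [^]\<^bsub>T\<^esub> p" "pair_sum L' [^]\<^bsub>T\<^esub> p"] tm[OF ae(1), of e] F(5) F0 by simp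
    then have "a [^]\<^bsub>T\<^esub> p = c [^]\<^bsub>T\<^esub> p \<otimes>\<^bsub>T\<^esub> F b"
      unfolding Suc.prems(3) using F(2)[OF pow[OF c], of b] by simp
    then have "dep T (bm M) a c"
      using T.dep_of_pow_eq[OF bm_subring[OF Ms] ae(1) c F(3)[of b] p_pos] by simp
    then obtain b0 where b0: "b0 \<in> bm M" "a = c \<otimes>\<^bsub>T\<^esub> b0" using picD[OF pic ae(1) c] by blast
    have b0c [simp]: "b0 \<in> carrier T" using b0 bc by blast
    have e1: "j (e [^]\<^bsub>W\<^esub> p) \<in> bm M" using ae(2) unfolding p_roots_def by (intro j_bm) auto
    \<comment> \<open>Subtracting the term of \<open>e\<close> shortens the sum; the equation keeps
      its form because \<open>e^p\<close> lies in \<open>M\<close>, so that \<open>b'\<close> stays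
      in \<open>bm M\<close>.\<close>
    define b' where "b' = b \<ominus>\<^bsub>T\<^esub> b0 [^]\<^bsub>T\<^esub> p \<otimes>\<^bsub>T\<^esub> j (e [^]\<^bsub>W\<^esub> p)"
    have b': "b' \<in> bm M"
      unfolding b'_def
      using bm.diff[OF Suc.prems(2) bm_mult[OF Ms T.subring_pow[OF bm_subring[OF Ms] b0(1)] e1]] .
    have cancel: "y = (x \<oplus>\<^bsub>T\<^esub> y) \<ominus>\<^bsub>T\<^esub> x" if "x \<in> carrier T" "y \<in> carrier T" for x y
      using that by (simp add: T.ring_norm)
    have "pair_sum L' [^]\<^bsub>T\<^esub> p = pair_sum L [^]\<^bsub>T\<^esub> p \<ominus>\<^bsub>T\<^esub> (a \<otimes>\<^bsub>T\<^esub> j e) [^]\<^bsub>T\<^esub> p"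
      unfolding wsL by (rule cancel) simp_all
    also have "(a \<otimes>\<^bsub>T\<^esub> j e) [^]\<^bsub>T\<^esub> p = c [^]\<^bsub>T\<^esub> p \<otimes>\<^bsub>T\<^esub> (b0 [^]\<^bsub>T\<^esub> p \<otimes>\<^bsub>T\<^esub> j (e [^]\<^bsub>W\<^esub> p))"
      unfolding b0(2) by (simp add: T.nat_pow_distrib T.m_assoc)
    also have "pair_sum L [^]\<^bsub>T\<^esub> p \<ominus>\<^bsub>T\<^esub> \<dots> = c [^]\<^bsub>T\<^esub> p \<otimes>\<^bsub>T\<^esub> b'"
      unfolding b'_def Suc.prems(3) by (simp add: T.diff_mult2)
    finally obtain s where s: "s \<in> bm (p_roots M)" "pair_sum L' = c \<otimes>\<^bsub>T\<^esub> s"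
      using Suc.hyps(1)[of L' b'] L' b' by auto
    have "s \<in> carrier T" using s bm_carrier[OF RW] by blast
    then have "pair_sum L = c \<otimes>\<^bsub>T\<^esub> (b0 \<otimes>\<^bsub>T\<^esub> j e \<oplus>\<^bsub>T\<^esub> s)" unfolding L by (simp add: s b0 T.ring_norm)
    moreover have "b0 \<otimes>\<^bsub>T\<^esub> j e \<oplus>\<^bsub>T\<^esub> s \<in> bm (p_roots M)"
      using s b0(1) bm_mono[OF sub_p_roots[OF Ms]] j_bm[OF ae(2)]
        bm_mult[OF subfieldE(1)[OF p_roots_subfield[OF M]]] bm_add[OF RW] by blast
    ultimately show ?thesis by blast
  qed
qed

text \<open>
  After multiplication by \<open>s [^] (p - 1)\<close>, the denominator is \<open>s\<^sup>p\<close>, which comes from \<open>M\<close>.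
\<close>

lemma pic_p_roots:
  assumes M: "subfield M W" and rb: "p_roots base \<subseteq> M" and pic: "pic T (bm M)"
  shows "pic T (bm (p_roots M))"
proof -
  note Ms = subfieldE(1)[OF M] and Mc = subfieldE(3)[OF M]
  note Rs = subfieldE(1)[OF p_roots_subfield[OF M]] and Rc = subfieldE(3)[OF p_roots_subfield[OF M]]
  note bs = bm_subring[OF Ms] and brs = bm_subring[OF Rs]
  note bc = bm_carrier[OF Rc]
  have pow: "z [^]\<^bsub>T\<^esub> p \<in> bm M" if "z \<in> bm (p_roots M)" for z
    using bm_frobenius[OF Rc _ that, of M] unfolding p_roots_def by blast
  have div: "\<exists>s\<in>bm (p_roots M). a = c \<otimes>\<^bsub>T\<^esub> s"
    if "a \<in> bm (p_roots M)" "c \<in> bm M" "b \<in> bm M" "a [^]\<^bsub>T\<^esub> p = c [^]\<^bsub>T\<^esub> p \<otimes>\<^bsub>T\<^esub> b" for a b c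
    using pair_sum_ex[OF Ms Rc that(1)] divide_in_root[OF M rb pic that(2) _ that(3)] that(4) by blast
  \<comment> \<open>Reducedness is the case of denominator zero: \<open>y^p\<close> is nilpotent in
    \<open>bm M\<close>, hence zero, and \<open>div\<close> with \<open>c = 0\<close> gives
    \<open>y = 0\<close>.\<close>
  have red: "y = \<zero>\<^bsub>T\<^esub>" if y: "y \<in> bm (p_roots M)" "y [^]\<^bsub>T\<^esub> n = \<zero>\<^bsub>T\<^esub>" and n: "n > 0" for y and n :: nat
  proof -
    have "(y [^]\<^bsub>T\<^esub> p) [^]\<^bsub>T\<^esub> n = (y [^]\<^bsub>T\<^esub> n) [^]\<^bsub>T\<^esub> p" using bc[OF y(1)] by (simp add: T.nat_pow_pow mult.commute)
    also have "\<dots> = \<zero>\<^bsub>T\<^esub>" unfolding y(2) using p_pos by (intro T.nat_pow_zero) simp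
    finally have "y [^]\<^bsub>T\<^esub> p = \<zero>\<^bsub>T\<^esub>" using T.pic_reduced[OF bs pic bm.zero pow[OF y(1)]] by blast
    moreover have "\<zero>\<^bsub>T\<^esub> [^]\<^bsub>T\<^esub> p = \<zero>\<^bsub>T\<^esub>" using p_pos by (intro T.nat_pow_zero) simp
    ultimately obtain s where "s \<in> bm (p_roots M)" "y = \<zero>\<^bsub>T\<^esub> \<otimes>\<^bsub>T\<^esub> s"
      using div[OF y(1) bm.zero bm.zero] by auto
    then show ?thesis using bc by simp
  qed
  show ?thesis
    unfolding pic_on_def
  proof (intro ballI impI)
    fix a s assume a: "a \<in> bm (p_roots M)" and s: "s \<in> bm (p_roots M)" and d: "dep T (bm (p_roots M)) a s"
    have [simp]: "a \<in> carrier T" "s \<in> carrier T" using a s bc by auto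
    obtain cs where cs: "set cs \<subseteq> bm (p_roots M)" "hev T a s cs = \<zero>\<^bsub>T\<^esub>" using d unfolding dep_def by blast
    have csc: "set cs \<subseteq> carrier T" using cs bc by blast
    obtain q where q: "p = Suc q" using p_pos by (cases p) auto
    define c where "c = s [^]\<^bsub>T\<^esub> p"
    define a1 where "a1 = a \<otimes>\<^bsub>T\<^esub> s [^]\<^bsub>T\<^esub> q"
    have c: "c \<in> bm M" unfolding c_def by (rule pow[OF s])
    have a1: "a1 \<in> bm (p_roots M)" unfolding a1_def using a T.subring_pow[OF brs s] bm_mult[OF Rs] by blast
    have "hev T a s cs [^]\<^bsub>T\<^esub> p = \<zero>\<^bsub>T\<^esub>" unfolding cs(2) using p_pos by (intro T.nat_pow_zero) simp
    then have "hev T (a [^]\<^bsub>T\<^esub> p) (s [^]\<^bsub>T\<^esub> p) (map (\<lambda>c. c [^]\<^bsub>T\<^esub> p) cs) = \<zero>\<^bsub>T\<^esub>"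
      using T.hev_frobenius[OF p charT _ _ csc] by simp
    moreover have "set (map (\<lambda>c. c [^]\<^bsub>T\<^esub> p) cs) \<subseteq> bm M" using cs pow by auto
    \<comment> \<open>Frobenius moves the equation into \<open>bm M\<close>, so \<open>a^p\<close>
      is integral over \<open>s^p\<close> there.\<close>
    ultimately have "dep T (bm M) (a [^]\<^bsub>T\<^esub> p) (s [^]\<^bsub>T\<^esub> p)" unfolding dep_def by blast
    then obtain b where b: "b \<in> bm M" "a [^]\<^bsub>T\<^esub> p = s [^]\<^bsub>T\<^esub> p \<otimes>\<^bsub>T\<^esub> b"
      using picD[OF pic pow[OF a] pow[OF s]] by blast
    have [simp]: "b \<in> carrier T" "c \<in> carrier T" using b c bm_carrier[OF Mc] by auto
    have "a1 [^]\<^bsub>T\<^esub> p = (s [^]\<^bsub>T\<^esub> p \<otimes>\<^bsub>T\<^esub> b) \<otimes>\<^bsub>T\<^esub> (s [^]\<^bsub>T\<^esub> q) [^]\<^bsub>T\<^esub> p"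
      unfolding a1_def by (simp add: T.nat_pow_distrib b)
    also have "\<dots> = (s [^]\<^bsub>T\<^esub> p \<otimes>\<^bsub>T\<^esub> (s [^]\<^bsub>T\<^esub> q) [^]\<^bsub>T\<^esub> p) \<otimes>\<^bsub>T\<^esub> b" by (simp add: T.m_ac)
    also have "s [^]\<^bsub>T\<^esub> p \<otimes>\<^bsub>T\<^esub> (s [^]\<^bsub>T\<^esub> q) [^]\<^bsub>T\<^esub> p = c [^]\<^bsub>T\<^esub> p"
    proof -
      have "p + q * p = p * p" unfolding q by simp
      then show ?thesis unfolding c_def by (simp add: T.nat_pow_pow T.nat_pow_mult)
    qed
    finally obtain t where t: "t \<in> bm (p_roots M)" "a1 = c \<otimes>\<^bsub>T\<^esub> t" using div[OF a1 c b(1)] by blast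
    have [simp]: "t \<in> carrier T" using t bc by blast
    \<comment> \<open>The error of the candidate quotient \<open>t\<close>. It is killed by
      \<open>s^(p-1)\<close>, hence by \<open>s\<close>, and then the equation of \<open>a\<close>
      shows that it is nilpotent.\<close>
    define y where "y = a \<ominus>\<^bsub>T\<^esub> s \<otimes>\<^bsub>T\<^esub> t"
    have y: "y \<in> bm (p_roots M)" unfolding y_def using a bm.diff bm_mult[OF Rs s t(1)] by blast
    have [simp]: "y \<in> carrier T" using y bc by blast
    have "s [^]\<^bsub>T\<^esub> q \<otimes>\<^bsub>T\<^esub> y = a1 \<ominus>\<^bsub>T\<^esub> c \<otimes>\<^bsub>T\<^esub> t"
      unfolding y_def a1_def c_def q by (simp add: T.diff_mult2 T.m_ac)
    then have "s [^]\<^bsub>T\<^esub> q \<otimes>\<^bsub>T\<^esub> y = \<zero>\<^bsub>T\<^esub>" using t by simp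
    moreover have "(s \<otimes>\<^bsub>T\<^esub> y) [^]\<^bsub>T\<^esub> p = (s [^]\<^bsub>T\<^esub> q \<otimes>\<^bsub>T\<^esub> y) \<otimes>\<^bsub>T\<^esub> (s \<otimes>\<^bsub>T\<^esub> y [^]\<^bsub>T\<^esub> q)"
      unfolding q by (simp add: T.nat_pow_distrib T.m_ac)
    ultimately have "(s \<otimes>\<^bsub>T\<^esub> y) [^]\<^bsub>T\<^esub> p = \<zero>\<^bsub>T\<^esub>" by simp
    then have sy: "s \<otimes>\<^bsub>T\<^esub> y = \<zero>\<^bsub>T\<^esub>" using red[OF bm_mult[OF Rs s y] _ p_pos] by blast
    have "y \<otimes>\<^bsub>T\<^esub> y = a \<otimes>\<^bsub>T\<^esub> y \<ominus>\<^bsub>T\<^esub> t \<otimes>\<^bsub>T\<^esub> (s \<otimes>\<^bsub>T\<^esub> y)"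
    proof -
      have "(a \<ominus>\<^bsub>T\<^esub> s \<otimes>\<^bsub>T\<^esub> t) \<otimes>\<^bsub>T\<^esub> y = a \<otimes>\<^bsub>T\<^esub> y \<ominus>\<^bsub>T\<^esub> t \<otimes>\<^bsub>T\<^esub> (s \<otimes>\<^bsub>T\<^esub> y)" by (simp add: T.ring_norm)
      then show ?thesis using y_def by simp
    qed
    then have "a \<otimes>\<^bsub>T\<^esub> y = y \<otimes>\<^bsub>T\<^esub> y" using sy by (simp add: a_minus_def)
    then have "y [^]\<^bsub>T\<^esub> Suc (length cs) = hev T a s cs \<otimes>\<^bsub>T\<^esub> y"
      using T.hev_orthogonal[OF _ _ _ csc sy] by simp
    then have "y [^]\<^bsub>T\<^esub> Suc (length cs) = \<zero>\<^bsub>T\<^esub>" using cs(2) by simp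
    then have "y = \<zero>\<^bsub>T\<^esub>" using red[OF y] by blast
    then have "a = s \<otimes>\<^bsub>T\<^esub> t" unfolding y_def by simp
    then show "\<exists>b\<in>bm (p_roots M). a = s \<otimes>\<^bsub>T\<^esub> b" using t by blast
  qed
qed

section \<open>The maximal subfield is everything\<close>

lemma chain_subfield:
  assumes c: "c \<noteq> {}" "\<And>M N. M \<in> c \<Longrightarrow> N \<in> c \<Longrightarrow> M \<subseteq> N \<or> N \<subseteq> M" and sf: "\<And>M. M \<in> c \<Longrightarrow> subfield M W"
  shows "subfield (\<Union>c) W"
proof (rule W.subfieldI')
  note Ms = subfieldE(1)[OF sf]
  show "subring (\<Union>c) W"
  proof (rule B.subringI)
    show "\<Union>c \<subseteq> carrier W" using subringE(1)[OF Ms] by blast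
    show "\<one>\<^bsub>W\<^esub> \<in> \<Union>c" using subringE(3)[OF Ms] c(1) by blast
    fix x assume "x \<in> \<Union>c"
    then obtain M where M: "M \<in> c" "x \<in> M" by blast
    show "\<ominus>\<^bsub>W\<^esub> x \<in> \<Union>c" using subringE(5)[OF Ms] M by blast
    fix y assume "y \<in> \<Union>c"
    then obtain N where N: "N \<in> c" "y \<in> N" by blast
    obtain L where L: "L \<in> c" "x \<in> L" "y \<in> L" using c(2)[OF M(1) N(1)] M N by blast
    show "x \<otimes>\<^bsub>W\<^esub> y \<in> \<Union>c" using subringE(6)[OF Ms] L by blast
    show "x \<oplus>\<^bsub>W\<^esub> y \<in> \<Union>c" using subringE(7)[OF Ms] L by blast
  qed
  show "inv\<^bsub>W\<^esub> k \<in> \<Union>c" if "k \<in> \<Union>c - {\<zero>\<^bsub>W\<^esub>}" for k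
    using that B.subfield_m_inv(1)[OF sf] by blast
qed

lemma pic_all:
  assumes M0: "subfield M0 W" "p_roots base \<subseteq> M0" "pic T (bm M0)"
  shows "pic T (carrier T)"
proof -
  define S where "S = {M. subfield M W \<and> p_roots base \<subseteq> M \<and> pic T (bm M)}"
  have "\<exists>M\<in>S. \<forall>N\<in>S. M \<subseteq> N \<longrightarrow> N = M"
  proof (rule subset_Zorn_nonempty)
    show "S \<noteq> {}" using M0 unfolding S_def by blast
    fix c assume c: "c \<noteq> {}" "subset.chain S c"
    have cS: "M \<in> c \<Longrightarrow> M \<in> S" for M using c(2) unfolding subset_chain_def by blast
    have ch: "M \<subseteq> N \<or> N \<subseteq> M" if "M \<in> c" "N \<in> c" for M N
      using c(2) that unfolding subset_chain_def by blast
    have "subfield (\<Union>c) W" by (rule chain_subfield[OF c(1) ch]) (use cS in \<open>auto simp: S_def\<close>)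
    moreover have "p_roots base \<subseteq> \<Union>c" using c(1) cS unfolding S_def by blast
    moreover have "pic T (bm (\<Union>c))" by (rule pic_chain_Union[OF c(1) ch]) (use cS in \<open>auto simp: S_def\<close>)
    ultimately show "\<Union>c \<in> S" unfolding S_def by blast
  qed
  then obtain M where "M \<in> S" and max: "\<And>N. N \<in> S \<Longrightarrow> M \<subseteq> N \<Longrightarrow> N = M" by blast
  then have M: "subfield M W" and rb: "p_roots base \<subseteq> M" and pic: "pic T (bm M)" unfolding S_def by auto
  note Ms = subfieldE(1)[OF M] and Mc = subfieldE(3)[OF M]
  have bM: "base \<subseteq> M" using base_p_powers[OF rb] p_powers_sub[OF Ms] by blast
  have grow: "N = M" if "subfield N W" "M \<subseteq> N" "pic T (bm N)" for N
    using max[of N] that rb unfolding S_def by blast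
  have MR: "p_roots M = M" using grow[OF p_roots_subfield[OF M] sub_p_roots[OF Ms] pic_p_roots[OF M rb pic]] .
  have perfect: "\<exists>n\<in>M. n [^]\<^bsub>W\<^esub> p = m" if m: "m \<in> M" for m
  proof -
    have mc: "m \<in> carrier W" using m Mc by blast
    have "rt m \<in> p_roots M" unfolding p_roots_def using rt[OF mc] m by simp
    then show ?thesis using MR rt(2)[OF mc] by auto
  qed
  have "x \<in> M" if x: "x \<in> carrier W" for x
  proof (cases "\<exists>ms. set ms \<subseteq> M \<and> pv W ms x = \<zero>\<^bsub>W\<^esub> \<and> \<not> set ms \<subseteq> {\<zero>\<^bsub>W\<^esub>}")
    case True
    then obtain ms where ms: "set ms \<subseteq> M" "\<not> set ms \<subseteq> {\<zero>\<^bsub>W\<^esub>}" "pv W ms x = \<zero>\<^bsub>W\<^esub>" by blast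
    obtain fs Y where fs: "set fs \<subseteq> M" "x [^]\<^bsub>W\<^esub> length fs \<oplus>\<^bsub>W\<^esub> pv W fs x = \<zero>\<^bsub>W\<^esub>"
      and Y: "finite Y" "card Y = length fs" "\<And>y. y \<in> Y \<Longrightarrow> specialization W M x y"
      using W.conjugates[OF roots p charW M perfect x ms] by blast
    have "pic T (bm (pimage W M x))" by (rule pic_adjoin_algebraic[OF M bM x fs Y pic])
    then have "pimage W M x = M" using grow[OF W.pimage_subfield[OF M x ms] B.pimage_base[OF Ms x]] by blast
    then show ?thesis using B.pimage_self[OF Ms x] by simp
  next
    case False
    then have tr: "\<And>ms. set ms \<subseteq> M \<Longrightarrow> pv W ms x = \<zero>\<^bsub>W\<^esub> \<Longrightarrow> set ms \<subseteq> {\<zero>\<^bsub>W\<^esub>}" by blast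
    let ?V = "pimage W M x" and ?F = "W.fraction_set (pimage W M x)"
    note Vs = B.pimage_subring[OF Ms x]
    note Fs = W.fraction_set_subfield[OF Vs]
    have "pic T (bm ?V)"
      by (rule pic_adjoin_transcendental[OF M bM x tr W.transcendental_infinite[OF Ms x tr] pic])
    \<comment> \<open>Maximality concerns subfields, so the property must first pass from
      \<open>M[x]\<close> to its fraction field.\<close>
    then have "pic T (bm ?F)"
      by (intro pic_localize[OF Vs subfieldE(1)[OF Fs(2)] Fs(1) _ Fs(3)]) (auto simp: W.fraction_set_def)
    then have "?F = M" using grow[OF Fs(2)] Fs(1) B.pimage_base[OF Ms x] by blast
    then show ?thesis using B.pimage_self[OF Ms x] Fs(1) by blast
  qed
  then have "M = carrier W" using Mc by blast
  then show ?thesis using pic bm_full by simp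
qed

end

section \<open>Geometric normality\<close>

text \<open>The record is rebuilt so that it has the type of a plain module, whatever the record
  type of \<open>D\<close>; scalars act through \<open>h\<close>.\<close>

definition hom_algebra :: "('b, 'm) ring_scheme \<Rightarrow> ('k \<Rightarrow> 'b) \<Rightarrow> ('k, 'b) module" where
  "hom_algebra D h = \<lparr>carrier = carrier D, monoid.mult = monoid.mult D, one = \<one>\<^bsub>D\<^esub>, ring.zero = \<zero>\<^bsub>D\<^esub>,
     add = ring.add D, smult = (\<lambda>k x. h k \<otimes>\<^bsub>D\<^esub> x)\<rparr>"

lemma hom_algebra_simps [simp]:
  "carrier (hom_algebra D h) = carrier D" "x \<otimes>\<^bsub>hom_algebra D h\<^esub> y = x \<otimes>\<^bsub>D\<^esub> y" "\<one>\<^bsub>hom_algebra D h\<^esub> = \<one>\<^bsub>D\<^esub>"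
  "\<zero>\<^bsub>hom_algebra D h\<^esub> = \<zero>\<^bsub>D\<^esub>" "x \<oplus>\<^bsub>hom_algebra D h\<^esub> y = x \<oplus>\<^bsub>D\<^esub> y" "k \<odot>\<^bsub>hom_algebra D h\<^esub> x = h k \<otimes>\<^bsub>D\<^esub> x"
  by (simp_all add: hom_algebra_def)

lemma hom_algebra_pow [simp]: "x [^]\<^bsub>hom_algebra D h\<^esub> (n :: nat) = x [^]\<^bsub>D\<^esub> n"
  by (simp add: nat_pow_def)

lemma hom_algebra_iso: "(\<lambda>x. x) \<in> ring_iso D (hom_algebra D h)"
  unfolding ring_iso_def ring_hom_def by (auto simp: bij_betw_def)

lemma (in field) hom_algebra_field: "field (hom_algebra R h)"
proof -
  have "(hom_algebra R h)\<lparr>ring.zero := \<zero>\<rparr> = hom_algebra R h" by (simp add: hom_algebra_def)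
  then show ?thesis using ring_iso_imp_img_field[OF hom_algebra_iso[of R h]] by metis
qed

lemma (in field) hom_algebra:
  assumes K: "cring K" and h: "h \<in> ring_hom K R"
  shows "algebra K (hom_algebra R h)"
proof (rule algebraI[OF K])
  interpret H: field "hom_algebra R h" by (rule hom_algebra_field)
  show "cring (hom_algebra R h)" by (rule H.cring_axioms)
qed (use ring_hom_memE[OF h] in \<open>auto simp: l_distr r_distr m_assoc\<close>)

lemma (in field) hom_algebra_has_roots: "has_roots \<Longrightarrow> field.has_roots (hom_algebra R h)"
proof -
  interpret H: field "hom_algebra R h" by (rule hom_algebra_field)
  have "pv (hom_algebra R h) fs y = pv R fs y" for fs y by (induction fs) auto
  then show "has_roots \<Longrightarrow> H.has_roots" unfolding has_roots_def H.has_roots_def by simp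
qed

lemma (in algebra) structure_hom: "(\<lambda>k. k \<odot>\<^bsub>M\<^esub> \<one>\<^bsub>M\<^esub>) \<in> ring_hom R M"
  by (rule ring_hom_memI) (auto simp: smult_l_distr smult_assoc1 smult_assoc2)

lemma subfield_algebra:
  assumes W: "field W" "algebra K W" and M: "subfield M W" "(\<lambda>k. k \<odot>\<^bsub>W\<^esub> \<one>\<^bsub>W\<^esub>) ` carrier K \<subseteq> M"
  shows "field (W\<lparr>carrier := M\<rparr>)" "algebra K (W\<lparr>carrier := M\<rparr>)"
proof -
  interpret W: field W by fact
  interpret A: algebra K W by fact
  note Mc = subfieldE(3)[OF M(1)]
  show f: "field (W\<lparr>carrier := M\<rparr>)" by (rule W.subfield_iff(2)[OF M(1)])
  interpret F: field "W\<lparr>carrier := M\<rparr>" by fact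
  have "k \<odot>\<^bsub>W\<^esub> w \<in> M" if "k \<in> carrier K" "w \<in> M" for k w
  proof -
    have "k \<odot>\<^bsub>W\<^esub> w = (k \<odot>\<^bsub>W\<^esub> \<one>\<^bsub>W\<^esub>) \<otimes>\<^bsub>W\<^esub> w" using that Mc A.smult_assoc2[of k "\<one>\<^bsub>W\<^esub>" w] by auto
    then show ?thesis using that M(2) subringE(6)[OF subfieldE(1)[OF M(1)]] by auto
  qed
  then show "algebra K (W\<lparr>carrier := M\<rparr>)"
    using Mc by (intro algebraI[OF A.R.cring_axioms F.cring_axioms])
      (auto simp: A.smult_l_distr A.smult_r_distr A.smult_assoc1 A.smult_assoc2 subset_iff)
qed

context base_change
begin

text \<open>A quotient \<open>b\<close> found in \<open>T\<close> is replaced by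
  \<open>\<rho> b\<close>: apply the retraction to \<open>a = s b\<close>.\<close>

lemma pic_descent:
  assumes M: "subfield M W" "base \<subseteq> M" and pic: "pic T (carrier T)"
  shows "pic T (bm M)"
  unfolding pic_on_def
proof (intro ballI impI)
  obtain \<rho> where \<rho>: "\<And>a. a \<in> carrier T \<Longrightarrow> \<rho> a \<in> bm M" "\<rho> \<one>\<^bsub>T\<^esub> = \<one>\<^bsub>T\<^esub>"
      "\<And>a b. a \<in> carrier T \<Longrightarrow> b \<in> carrier T \<Longrightarrow> \<rho> (a \<oplus>\<^bsub>T\<^esub> b) = \<rho> a \<oplus>\<^bsub>T\<^esub> \<rho> b"
      "\<And>c a. c \<in> bm M \<Longrightarrow> a \<in> carrier T \<Longrightarrow> \<rho> (c \<otimes>\<^bsub>T\<^esub> a) = c \<otimes>\<^bsub>T\<^esub> \<rho> a"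
  proof -
    show ?thesis by (rule retraction[OF M]; (assumption | rule that)+)
  qed
  note bc = bm_carrier[OF subfieldE(3)[OF M(1)]]
  fix a s assume a: "a \<in> bm M" and s: "s \<in> bm M" and d: "dep T (bm M) a s"
  have "dep T (carrier T) a s" using T.dep_mono[OF d] bc by blast
  then obtain b where b: "b \<in> carrier T" "a = s \<otimes>\<^bsub>T\<^esub> b" using picD[OF pic] bc a s by blast
  have "a = a \<otimes>\<^bsub>T\<^esub> \<rho> \<one>\<^bsub>T\<^esub>" using \<rho>(2) bc[OF a] by simp
  also have "\<dots> = \<rho> (a \<otimes>\<^bsub>T\<^esub> \<one>\<^bsub>T\<^esub>)" using \<rho>(4)[OF a] by simp
  also have "\<dots> = s \<otimes>\<^bsub>T\<^esub> \<rho> b" using b bc[OF a] \<rho>(4)[OF s b(1)] by simp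
  finally show "\<exists>b\<in>bm M. a = s \<otimes>\<^bsub>T\<^esub> b" using \<rho>(1)[OF b(1)] by blast
qed

lemma base_image:
  assumes L: "algebra K L" and \<psi>: "\<psi> \<in> ring_hom L W"
    "\<And>k l. k \<in> carrier K \<Longrightarrow> l \<in> carrier L \<Longrightarrow> \<psi> (k \<odot>\<^bsub>L\<^esub> l) = k \<odot>\<^bsub>W\<^esub> \<psi> l"
  shows "base \<subseteq> \<psi> ` carrier L"
proof
  interpret L: algebra K L by fact
  fix b assume "b \<in> base"
  then obtain k where "k \<in> carrier K" "b = k \<odot>\<^bsub>W\<^esub> \<one>\<^bsub>W\<^esub>" unfolding base_def by blast
  then have "b = \<psi> (k \<odot>\<^bsub>L\<^esub> \<one>\<^bsub>L\<^esub>)" "k \<odot>\<^bsub>L\<^esub> \<one>\<^bsub>L\<^esub> \<in> carrier L" using \<psi>(2) ring_hom_memE(4)[OF \<psi>(1)] by auto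
  then show "b \<in> \<psi> ` carrier L" by blast
qed

text \<open>A \<open>K\<close>-linear left inverse of \<open>\<psi>\<close> induces a left inverse
  on tensor products. Hence \<open>A \<otimes> L\<close> embeds in \<open>T\<close>, and its image
  is the subring that belongs to the image of \<open>L\<close>.\<close>

lemma tensor_transfer:
  assumes L: "field L" "algebra K L" and \<psi>: "\<psi> \<in> ring_hom L W"
    "\<And>k l. k \<in> carrier K \<Longrightarrow> l \<in> carrier L \<Longrightarrow> \<psi> (k \<odot>\<^bsub>L\<^esub> l) = k \<odot>\<^bsub>W\<^esub> \<psi> l"
  shows "subfield (\<psi> ` carrier L) W"
    "pic (tensor_algebra K A L) (carrier (tensor_algebra K A L)) \<longleftrightarrow> pic T (bm (\<psi> ` carrier L))"
proof -
  interpret L: field L by fact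
  interpret LA: algebra K L by fact
  interpret Lt: tensor K A L by unfold_locales
  interpret P: tensor_pair K A L W by unfold_locales
  interpret P': tensor_pair K A W L by unfold_locales
  interpret \<psi>: ring_hom_ring L W \<psi> using \<psi>(1) by unfold_locales
  show sf: "subfield (\<psi> ` carrier L) W"
    using \<psi>.img_is_subfield(2)[OF L.carrier_is_subfield] W.one_not_zero by simp
  define M where "M = \<psi> ` carrier L"
  have M: "subfield M W" unfolding M_def by (rule sf)
  note Ms = subfieldE(1)[OF M] and Mc = subfieldE(3)[OF M]
  have bM: "base \<subseteq> M" unfolding M_def by (rule base_image[OF L(2) \<psi>])
  have inj: "inj_on \<psi> (carrier L)" by (rule non_trivial_field_hom_is_inj[OF \<psi>(1) L(1) W.field_axioms])
  have disj: "{\<zero>\<^bsub>W\<^esub>} \<inter> M = {\<zero>\<^bsub>W\<^esub>}" using subringE(2)[OF Ms] by blast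
  obtain pr where pr: "\<And>w. w \<in> carrier W \<Longrightarrow> pr w \<in> M" "\<And>v. v \<in> M \<Longrightarrow> pr v = v" "\<And>u. u \<in> {\<zero>\<^bsub>W\<^esub>} \<Longrightarrow> pr u = \<zero>\<^bsub>W\<^esub>"
    "\<And>v w. v \<in> carrier W \<Longrightarrow> w \<in> carrier W \<Longrightarrow> pr (v \<oplus>\<^bsub>W\<^esub> w) = pr v \<oplus>\<^bsub>W\<^esub> pr w"
    "\<And>m w. m \<in> M \<Longrightarrow> w \<in> carrier W \<Longrightarrow> pr (m \<otimes>\<^bsub>W\<^esub> w) = m \<otimes>\<^bsub>W\<^esub> pr w"
  proof -
    show ?thesis by (rule W.linear_projection[OF M W.subspace_zero[OF Mc] W.subspace_subring[OF Ms] disj]; (assumption | rule that)+)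
  qed
  define \<phi> where "\<phi> w = inv_into (carrier L) \<psi> (pr w)" for w
  have \<phi>: "\<phi> w \<in> carrier L" "\<psi> (\<phi> w) = pr w" if "w \<in> carrier W" for w
    using pr(1)[OF that] unfolding \<phi>_def M_def by (auto intro: inv_into_into f_inv_into_f)
  have \<phi>\<psi>: "\<phi> (\<psi> l) = l" if "l \<in> carrier L" for l
    using that inj pr(2)[of "\<psi> l"] unfolding \<phi>_def M_def by (simp add: inv_into_f_f)
  have \<phi>_add: "\<phi> (v \<oplus>\<^bsub>W\<^esub> w) = \<phi> v \<oplus>\<^bsub>L\<^esub> \<phi> w" if "v \<in> carrier W" "w \<in> carrier W" for v w
    by (rule inj_onD[OF inj]) (use that \<phi> pr(4) in auto)
  have \<phi>_smult: "\<phi> (k \<odot>\<^bsub>W\<^esub> w) = k \<odot>\<^bsub>L\<^esub> \<phi> w" if kw: "k \<in> carrier K" "w \<in> carrier W" for k w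
  proof (rule inj_onD[OF inj])
    have "k \<odot>\<^bsub>W\<^esub> \<one>\<^bsub>W\<^esub> \<in> M" using bM kw unfolding base_def by blast
    then have "pr (k \<odot>\<^bsub>W\<^esub> w) = (k \<odot>\<^bsub>W\<^esub> \<one>\<^bsub>W\<^esub>) \<otimes>\<^bsub>W\<^esub> pr w" using pr(5) kw smult_base[OF kw] by simp
    also have "\<dots> = k \<odot>\<^bsub>W\<^esub> pr w" using smult_base[OF kw(1), of "pr w"] pr(1)[OF kw(2)] Mc by auto
    finally show "\<psi> (\<phi> (k \<odot>\<^bsub>W\<^esub> w)) = \<psi> (k \<odot>\<^bsub>L\<^esub> \<phi> w)" using kw \<phi> \<psi>(2) by simp
  qed (use kw \<phi> in auto)
  have \<psi>c: "\<And>l. l \<in> carrier L \<Longrightarrow> \<psi> l \<in> carrier W" and \<psi>_add: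
    "\<And>l m. l \<in> carrier L \<Longrightarrow> m \<in> carrier L \<Longrightarrow> \<psi> (l \<oplus>\<^bsub>L\<^esub> m) = \<psi> l \<oplus>\<^bsub>W\<^esub> \<psi> m" by auto
  obtain H where H: "\<And>z. z \<in> carrier Lt.T \<Longrightarrow> H z \<in> carrier T"
    "\<And>y z. y \<in> carrier Lt.T \<Longrightarrow> z \<in> carrier Lt.T \<Longrightarrow> H (y \<oplus>\<^bsub>Lt.T\<^esub> z) = H y \<oplus>\<^bsub>T\<^esub> H z"
    "\<And>a b. a \<in> carrier A \<Longrightarrow> b \<in> carrier L \<Longrightarrow> H (Lt.te a b) = te a (\<psi> b)"
  proof -
    show ?thesis by (rule P.tensor_map[of \<psi>, OF \<psi>c \<psi>_add \<psi>(2)]; (assumption | rule that)+)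
  qed
  obtain G where G: "\<And>z. z \<in> carrier T \<Longrightarrow> G z \<in> carrier Lt.T"
    "\<And>y z. y \<in> carrier T \<Longrightarrow> z \<in> carrier T \<Longrightarrow> G (y \<oplus>\<^bsub>T\<^esub> z) = G y \<oplus>\<^bsub>Lt.T\<^esub> G z"
    "\<And>a b. a \<in> carrier A \<Longrightarrow> b \<in> carrier W \<Longrightarrow> G (te a b) = Lt.te a (\<phi> b)"
  proof -
    show ?thesis by (rule P'.tensor_map[of \<phi>, OF \<phi>(1) \<phi>_add \<phi>_smult]; (assumption | rule that)+)
  qed
  have H0: "H \<zero>\<^bsub>Lt.T\<^esub> = \<zero>\<^bsub>T\<^esub>"
    using H(2)[of "\<zero>\<^bsub>Lt.T\<^esub>" "\<zero>\<^bsub>Lt.T\<^esub>"] H(1)[of "\<zero>\<^bsub>Lt.T\<^esub>"] T.add.r_cancel_one'[of "H \<zero>\<^bsub>Lt.T\<^esub>" "H \<zero>\<^bsub>Lt.T\<^esub>"] by simp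
  have G0: "G \<zero>\<^bsub>T\<^esub> = \<zero>\<^bsub>Lt.T\<^esub>"
    using G(2)[of "\<zero>\<^bsub>T\<^esub>" "\<zero>\<^bsub>T\<^esub>"] G(1)[of "\<zero>\<^bsub>T\<^esub>"] Lt.T.add.r_cancel_one'[of "G \<zero>\<^bsub>T\<^esub>" "G \<zero>\<^bsub>T\<^esub>"] by simp
  have Hd: "H (y \<ominus>\<^bsub>Lt.T\<^esub> z) = H y \<ominus>\<^bsub>T\<^esub> H z" if yz: "y \<in> carrier Lt.T" "z \<in> carrier Lt.T" for y z
  proof -
    have "H ((y \<ominus>\<^bsub>Lt.T\<^esub> z) \<oplus>\<^bsub>Lt.T\<^esub> z) = H (y \<ominus>\<^bsub>Lt.T\<^esub> z) \<oplus>\<^bsub>T\<^esub> H z" using H(2) yz by simp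
    moreover have "(y \<ominus>\<^bsub>Lt.T\<^esub> z) \<oplus>\<^bsub>Lt.T\<^esub> z = y" using yz by (simp add: Lt.T.ring_norm)
    ultimately show ?thesis using H(1) yz by (simp add: T.eq_diff_iff)
  qed
  have Gd: "G (y \<ominus>\<^bsub>T\<^esub> z) = G y \<ominus>\<^bsub>Lt.T\<^esub> G z" if yz: "y \<in> carrier T" "z \<in> carrier T" for y z
  proof -
    have "G ((y \<ominus>\<^bsub>T\<^esub> z) \<oplus>\<^bsub>T\<^esub> z) = G (y \<ominus>\<^bsub>T\<^esub> z) \<oplus>\<^bsub>Lt.T\<^esub> G z" using G(2) yz by simp
    moreover have "(y \<ominus>\<^bsub>T\<^esub> z) \<oplus>\<^bsub>T\<^esub> z = y" using yz by (simp add: T.ring_norm)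
    ultimately show ?thesis using G(1) yz by (simp add: Lt.T.eq_diff_iff)
  qed
  have GH: "G (H z) = z" if "z \<in> carrier Lt.T" for z
    using that
  proof (induction z rule: Lt.T_induct)
    case (te a b)
    then show ?case using H(3) G(3) \<psi>c \<phi>\<psi> by simp
  next
    case (diff u v)
    then show ?case using Hd Gd H(1) by simp
  qed (simp add: H0 G0)
  have Hm: "H (y \<otimes>\<^bsub>Lt.T\<^esub> z) = H y \<otimes>\<^bsub>T\<^esub> H z" if yz: "y \<in> carrier Lt.T" "z \<in> carrier Lt.T" for y z
    using yz(1)
  proof (induction y rule: Lt.T_induct)
    case zero
    then show ?case using yz H(1) H0 by simp
  next
    case (te a b)
    show ?case using yz(2)
    proof (induction z rule: Lt.T_induct)
      case zero
      then show ?case using H0 H(1)[of "Lt.te a b"] te by simp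
    next
      case (te c d)
      then show ?case using \<open>a \<in> carrier A\<close> \<open>b \<in> carrier L\<close> H(3) \<psi>c by (simp add: Lt.te_mult te_mult)
    next
      case (diff u v)
      then show ?case using te \<psi>c H(1) Hd by (simp add: Lt.T.diff_mult2 T.diff_mult2)
    qed
  next
    case (diff u v)
    then show ?case using yz H(1) Hd by (simp add: Lt.T.diff_mult1 T.diff_mult1)
  qed
  have "H \<in> ring_hom Lt.T T"
    by (rule ring_hom_memI) (use H Hm in \<open>auto simp: te_one Lt.te_one\<close>)
  moreover have "inj_on H (carrier Lt.T)" using GH by (metis inj_onI)
  moreover have "H ` carrier Lt.T = bm M"
  proof
    show "H ` carrier Lt.T \<subseteq> bm M"
    proof
      fix y assume "y \<in> H ` carrier Lt.T"
      then obtain z where z: "z \<in> carrier Lt.T" "y = H z" by blast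
      have "H z \<in> bm M" using z(1)
        by (induction z rule: Lt.T_induct) (auto simp: H0 H(3) Hd M_def intro: bm.intros)
      then show "y \<in> bm M" using z by simp
    qed
    show "bm M \<subseteq> H ` carrier Lt.T"
    proof
      fix y assume "y \<in> bm M" then show "y \<in> H ` carrier Lt.T"
      proof induction
        case zero
        then show ?case using H0 by (intro image_eqI[of _ _ "\<zero>\<^bsub>Lt.T\<^esub>"]) auto
      next
        case (te a m)
        then obtain l where "l \<in> carrier L" "m = \<psi> l" unfolding M_def by blast
        then show ?case using te H(3) by (intro image_eqI[of _ _ "Lt.te a l"]) auto
      next
        case (diff u v)
        then obtain y z where "y \<in> carrier Lt.T" "u = H y" "z \<in> carrier Lt.T" "v = H z" by blast
        then show ?case using Hd by (intro image_eqI[of _ _ "y \<ominus>\<^bsub>Lt.T\<^esub> z"]) auto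
      qed
    qed
  qed
  ultimately show "pic (tensor_algebra K A L) (carrier (tensor_algebra K A L)) \<longleftrightarrow> pic T (bm (\<psi> ` carrier L))"
    using pic_hom_inj[OF Lt.T.cring_axioms T.cring_axioms] unfolding M_def by metis
qed

end

text \<open>
  Both fields are purely inseparable of exponent one over \<open>K\<close>, and \<open>p\<close>-th roots are unique: map the \<open>p\<close>-th root of
  \<open>k\<close> in \<open>E\<close> to the \<open>p\<close>-th root of \<open>k\<close> in \<open>W\<close>.
\<close>

lemma root_embedding:
  assumes K: "field K" and E: "field E" "algebra K E" and W: "field W" "algebra K W"
    and p: "Factorial_Ring.prime (p :: nat)" and ch: "add_pow K p \<one>\<^bsub>K\<^esub> = \<zero>\<^bsub>K\<^esub>"
    and Er: "\<And>x. x \<in> carrier E \<Longrightarrow> \<exists>k\<in>carrier K. x [^]\<^bsub>E\<^esub> p = k \<odot>\<^bsub>E\<^esub> \<one>\<^bsub>E\<^esub>"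
    and Ek: "\<And>k. k \<in> carrier K \<Longrightarrow> \<exists>x\<in>carrier E. x [^]\<^bsub>E\<^esub> p = k \<odot>\<^bsub>E\<^esub> \<one>\<^bsub>E\<^esub>"
    and Wk: "\<And>k. k \<in> carrier K \<Longrightarrow> \<exists>w\<in>carrier W. w [^]\<^bsub>W\<^esub> p = k \<odot>\<^bsub>W\<^esub> \<one>\<^bsub>W\<^esub>"
  shows "\<exists>\<psi>\<in>ring_hom E W. (\<forall>k\<in>carrier K. \<forall>x\<in>carrier E. \<psi> (k \<odot>\<^bsub>E\<^esub> x) = k \<odot>\<^bsub>W\<^esub> \<psi> x) \<and>
    \<psi> ` carrier E = {w \<in> carrier W. \<exists>k\<in>carrier K. w [^]\<^bsub>W\<^esub> p = k \<odot>\<^bsub>W\<^esub> \<one>\<^bsub>W\<^esub>}"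
proof -
  interpret K: field K by fact
  interpret E: field E by fact
  interpret W: field W by fact
  interpret EA: algebra K E by fact
  interpret WA: algebra K W by fact
  define e where "e k = k \<odot>\<^bsub>E\<^esub> \<one>\<^bsub>E\<^esub>" for k
  define h where "h k = k \<odot>\<^bsub>W\<^esub> \<one>\<^bsub>W\<^esub>" for k
  have eh: "e \<in> ring_hom K E" "h \<in> ring_hom K W"
    using EA.structure_hom WA.structure_hom unfolding e_def[abs_def] h_def[abs_def] by auto
  interpret e: ring_hom_cring K E e using eh(1) by unfold_locales
  interpret h: ring_hom_cring K W h using eh(2) by unfold_locales
  have chE: "add_pow E p \<one>\<^bsub>E\<^esub> = \<zero>\<^bsub>E\<^esub>" and chW: "add_pow W p \<one>\<^bsub>W\<^esub> = \<zero>\<^bsub>W\<^esub>"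
    using K.char_hom[OF eh(1) E.cring_axioms ch] K.char_hom[OF eh(2) W.cring_axioms ch] by auto
  have e_inj: "inj_on e (carrier K)" by (rule non_trivial_field_hom_is_inj[OF eh(1) K E(1)])
  have froW: "v = w" if vw: "v \<in> carrier W" "w \<in> carrier W" "v [^]\<^bsub>W\<^esub> p = w [^]\<^bsub>W\<^esub> p" for v w
  proof -
    have "(v \<ominus>\<^bsub>W\<^esub> w) [^]\<^bsub>W\<^esub> p = \<zero>\<^bsub>W\<^esub>" using vw by (simp add: W.frobenius_minus[OF p chW])
    then have "v \<ominus>\<^bsub>W\<^esub> w = \<zero>\<^bsub>W\<^esub>" by (rule W.pow_eq_zero) (use vw in simp)
    then show ?thesis using vw by simp
  qed
  \<comment> \<open>The graph of the embedding. It is single-valued because \<open>k\<close> is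
    determined by \<open>x\<close>, and \<open>w\<close> by its \<open>p\<close>-th power; it is
    total because \<open>W\<close> contains the roots.\<close>
  define rel where "rel x w \<longleftrightarrow> x \<in> carrier E \<and> w \<in> carrier W \<and>
    (\<exists>k\<in>carrier K. x [^]\<^bsub>E\<^esub> p = e k \<and> w [^]\<^bsub>W\<^esub> p = h k)" for x w
  have fn: "v = w" if vw: "rel x v" "rel x w" for x v w
  proof -
    obtain k l where k: "k \<in> carrier K" "x [^]\<^bsub>E\<^esub> p = e k" "v [^]\<^bsub>W\<^esub> p = h k"
      and l: "l \<in> carrier K" "x [^]\<^bsub>E\<^esub> p = e l" "w [^]\<^bsub>W\<^esub> p = h l"
      using vw unfolding rel_def by blast
    have "k = l" by (rule inj_onD[OF e_inj trans[OF k(2)[symmetric] l(2)] k(1) l(1)])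
    then have "v [^]\<^bsub>W\<^esub> p = w [^]\<^bsub>W\<^esub> p" by (simp only: k(3) l(3))
    then show ?thesis using froW vw unfolding rel_def by blast
  qed
  have ex: "\<exists>w. rel x w" if "x \<in> carrier E" for x
    using Er[OF that] Wk that unfolding rel_def e_def h_def by metis
  define \<psi> where "\<psi> x = (SOME w. rel x w)" for x
  have rel\<psi>: "rel x (\<psi> x)" if "x \<in> carrier E" for x unfolding \<psi>_def using ex[OF that] by (rule someI_ex)
  have \<psi>I: "\<psi> x = w" if "rel x w" for x w
    by (rule fn[OF rel\<psi> that]) (use that in \<open>simp add: rel_def\<close>)
  have rel_add: "rel (x \<oplus>\<^bsub>E\<^esub> y) (v \<oplus>\<^bsub>W\<^esub> w)" if xy: "rel x v" "rel y w" for x y v w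
  proof -
    obtain k l where kl: "k \<in> carrier K" "x [^]\<^bsub>E\<^esub> p = e k" "v [^]\<^bsub>W\<^esub> p = h k" "l \<in> carrier K" "y [^]\<^bsub>E\<^esub> p = e l" "w [^]\<^bsub>W\<^esub> p = h l"
      and c: "x \<in> carrier E" "v \<in> carrier W" "y \<in> carrier E" "w \<in> carrier W" using xy unfolding rel_def by blast
    show ?thesis unfolding rel_def using kl c
      by (intro conjI bexI[of _ "k \<oplus>\<^bsub>K\<^esub> l"]) (auto simp: E.frobenius_add[OF p chE] W.frobenius_add[OF p chW])
  qed
  have rel_mult: "rel (x \<otimes>\<^bsub>E\<^esub> y) (v \<otimes>\<^bsub>W\<^esub> w)" if xy: "rel x v" "rel y w" for x y v w
  proof -
    obtain k l where kl: "k \<in> carrier K" "x [^]\<^bsub>E\<^esub> p = e k" "v [^]\<^bsub>W\<^esub> p = h k" "l \<in> carrier K" "y [^]\<^bsub>E\<^esub> p = e l" "w [^]\<^bsub>W\<^esub> p = h l"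
      and c: "x \<in> carrier E" "v \<in> carrier W" "y \<in> carrier E" "w \<in> carrier W" using xy unfolding rel_def by blast
    show ?thesis unfolding rel_def using kl c
      by (intro conjI bexI[of _ "k \<otimes>\<^bsub>K\<^esub> l"]) (auto simp: E.nat_pow_distrib W.nat_pow_distrib)
  qed
  have rel_base: "rel (e k) (h k)" if "k \<in> carrier K" for k
    unfolding rel_def using that by (intro conjI bexI[of _ "k [^]\<^bsub>K\<^esub> p"]) auto
  have rel_one: "rel \<one>\<^bsub>E\<^esub> \<one>\<^bsub>W\<^esub>" using rel_base[of "\<one>\<^bsub>K\<^esub>"] by simp
  have hom: "\<psi> \<in> ring_hom E W"
  proof (rule ring_hom_memI)
    show "\<psi> x \<in> carrier W" if "x \<in> carrier E" for x using rel\<psi>[OF that] unfolding rel_def by blast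
    show "\<psi> (x \<otimes>\<^bsub>E\<^esub> y) = \<psi> x \<otimes>\<^bsub>W\<^esub> \<psi> y" if "x \<in> carrier E" "y \<in> carrier E" for x y
      using \<psi>I[OF rel_mult[OF rel\<psi> rel\<psi>]] that by blast
    show "\<psi> (x \<oplus>\<^bsub>E\<^esub> y) = \<psi> x \<oplus>\<^bsub>W\<^esub> \<psi> y" if "x \<in> carrier E" "y \<in> carrier E" for x y
      using \<psi>I[OF rel_add[OF rel\<psi> rel\<psi>]] that by blast
    show "\<psi> \<one>\<^bsub>E\<^esub> = \<one>\<^bsub>W\<^esub>" by (rule \<psi>I[OF rel_one])
  qed
  have smult: "\<psi> (k \<odot>\<^bsub>E\<^esub> x) = k \<odot>\<^bsub>W\<^esub> \<psi> x" if kx: "k \<in> carrier K" "x \<in> carrier E" for k x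
  proof -
    have w: "\<psi> x \<in> carrier W" using rel\<psi>[OF kx(2)] unfolding rel_def by blast
    have "k \<odot>\<^bsub>E\<^esub> x = e k \<otimes>\<^bsub>E\<^esub> x" "k \<odot>\<^bsub>W\<^esub> \<psi> x = h k \<otimes>\<^bsub>W\<^esub> \<psi> x"
      using kx w EA.smult_assoc2[of k "\<one>\<^bsub>E\<^esub>" x] WA.smult_assoc2[of k "\<one>\<^bsub>W\<^esub>" "\<psi> x"] unfolding e_def h_def by auto
    then show ?thesis using \<psi>I[OF rel_mult[OF rel_base[OF kx(1)] rel\<psi>[OF kx(2)]]] by simp
  qed
  have "w \<in> \<psi> ` carrier E" if w: "w \<in> carrier W" "k \<in> carrier K" "w [^]\<^bsub>W\<^esub> p = h k" for w k
  proof -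
    obtain x where x: "x \<in> carrier E" "x [^]\<^bsub>E\<^esub> p = e k" using Ek[OF w(2)] unfolding e_def by blast
    then have "rel x w" unfolding rel_def using w by blast
    then show ?thesis using \<psi>I x by blast
  qed
  then have "\<psi> ` carrier E = {w \<in> carrier W. \<exists>k\<in>carrier K. w [^]\<^bsub>W\<^esub> p = k \<odot>\<^bsub>W\<^esub> \<one>\<^bsub>W\<^esub>}"
    using rel\<psi> unfolding rel_def h_def by blast
  then show ?thesis using hom smult by blast
qed

lemma (in field) ring_char_prime:
  assumes "ring_char R = p" "p > 0"
  shows "Factorial_Ring.prime p" "add_pow R p \<one> = \<zero>"
proof -
  have dvd: "add_pow R n \<one> = \<zero> \<longleftrightarrow> p dvd n" for n :: nat
    using add.pow_eq_id[of \<one> n] assms(1) unfolding ring_char_def by simp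
  then show "add_pow R p \<one> = \<zero>" by simp
  have m: "add_pow R (a * b) \<one> = add_pow R a \<one> \<otimes> add_pow R b \<one>" for a b :: nat
    using add_pow_ldistr[of \<one> "add_pow R b \<one>" a] add.nat_pow_pow[of \<one> a b] by (simp add: mult.commute)
  show "Factorial_Ring.prime p"
  proof (rule Factorial_Ring.primeI)
    show "prime_elem p"
    proof (rule Factorial_Ring.prime_elemI)
      show "p \<noteq> 0" using assms by simp
      show "\<not> is_unit p" using dvd[of 1] by auto
      fix a b assume "p dvd a * b"
      then have "add_pow R (a * b) \<one> = \<zero>" using dvd by blast
      then have "add_pow R a \<one> = \<zero> \<or> add_pow R b \<one> = \<zero>" unfolding m by (simp add: integral_iff)
      then show "p dvd a \<or> p dvd b" using dvd by blast
    qed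
  qed simp
qed

lemma (in field) alg_closure_embedding:
  "field alg_closure" "field.has_roots alg_closure" "indexed_const \<in> ring_hom R alg_closure"
proof -
  interpret C: algebraic_closure alg_closure "indexed_const ` carrier R" by (rule alg_closureE(1))
  show "field alg_closure" by (rule C.field_axioms)
  show "C.has_roots" by (rule C.has_roots)
  show "indexed_const \<in> ring_hom R alg_closure" by (rule alg_closureE(2))
qed

section \<open>The two implications\<close>

context
  fixes K :: "('a, 'm) ring_scheme" and A :: "('a, 'b, 'n) module_scheme" and p :: nat
  assumes K: "field K" and A: "algebra K A" and p: "Factorial_Ring.prime p" and ch: "add_pow K p \<one>\<^bsub>K\<^esub> = \<zero>\<^bsub>K\<^esub>"
begin

interpretation K: field K by (rule K)

lemma frobenius_changeI:
  assumes "field W" "algebra K W" "field.has_roots W"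
  shows "frobenius_change K A W p"
proof -
  interpret W: field W by fact
  interpret algebra K W by fact
  interpret A: algebra K A by (rule A)
  have "add_pow W p \<one>\<^bsub>W\<^esub> = \<zero>\<^bsub>W\<^esub>" using K.char_hom[OF structure_hom W.cring_axioms ch] .
  then show ?thesis using assms p by unfold_locales
qed

text \<open>\<open>root_extension\<close> is the subfield \<open>p_roots base\<close> of the
  algebraic closure, viewed as a \<open>K\<close>-algebra, and inherits its structure from
  there.\<close>

lemma root_extension_props:
  "field (root_extension K p)" "algebra K (root_extension K p)"
  "\<And>x. x \<in> carrier (root_extension K p) \<Longrightarrow>
    \<exists>k\<in>carrier K. x [^]\<^bsub>root_extension K p\<^esub> p = k \<odot>\<^bsub>root_extension K p\<^esub> \<one>\<^bsub>root_extension K p\<^esub>"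
  "\<And>k. k \<in> carrier K \<Longrightarrow>
    \<exists>x\<in>carrier (root_extension K p). x [^]\<^bsub>root_extension K p\<^esub> p = k \<odot>\<^bsub>root_extension K p\<^esub> \<one>\<^bsub>root_extension K p\<^esub>"
proof -
  note C = K.alg_closure_embedding
  let ?C = "K.alg_closure" and ?i = "K.indexed_const"
  interpret C: field ?C by (rule C(1))
  let ?W = "hom_algebra ?C ?i"
  have W: "field ?W" "algebra K ?W" "field.has_roots ?W"
    using C.hom_algebra_field C.hom_algebra[OF K.cring_axioms C(3)] C.hom_algebra_has_roots[OF C(2)] .
  interpret F: frobenius_change K A ?W p by (rule frobenius_changeI[OF W])
  have base: "F.base = ?i ` carrier K"
    unfolding F.base_def using ring_hom_memE(1)[OF C(3)] by (intro image_cong) auto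
  have base_img: "F.base = (\<lambda>k. k \<odot>\<^bsub>?W\<^esub> \<one>\<^bsub>?W\<^esub>) ` carrier K" unfolding F.base_def ..
  have RE: "root_extension K p = ?W\<lparr>carrier := F.p_roots F.base\<rparr>"
    unfolding root_extension_def Let_def F.p_roots_def base by (simp add: hom_algebra_def nat_pow_def)
  interpret W: field ?W by (rule W(1))
  have "ring_hom_ring K ?W (\<lambda>k. k \<odot>\<^bsub>?W\<^esub> \<one>\<^bsub>?W\<^esub>)"
    using F.B.structure_hom by unfold_locales
  then have "subfield F.base ?W"
    unfolding base_img using ring_hom_ring.img_is_subfield(2)[OF _ K.carrier_is_subfield]
      domain.one_not_zero[OF field.axioms(1)[OF W(1)]] by blast
  note sf = F.p_roots_subfield[OF this] and sub = F.sub_p_roots[OF subfieldE(1)[OF this]]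
  show "field (root_extension K p)" "algebra K (root_extension K p)"
    unfolding RE using subfield_algebra[OF W(1,2) sf] sub unfolding base_img by auto
  have pw: "x [^]\<^bsub>root_extension K p\<^esub> n = x [^]\<^bsub>?W\<^esub> n" for x and n :: nat
    unfolding RE by (simp add: nat_pow_def)
  show "\<exists>k\<in>carrier K. x [^]\<^bsub>root_extension K p\<^esub> p = k \<odot>\<^bsub>root_extension K p\<^esub> \<one>\<^bsub>root_extension K p\<^esub>"
    if "x \<in> carrier (root_extension K p)" for x
    using that unfolding pw unfolding RE F.p_roots_def F.base_def by auto
  show "\<exists>x\<in>carrier (root_extension K p). x [^]\<^bsub>root_extension K p\<^esub> p = k \<odot>\<^bsub>root_extension K p\<^esub> \<one>\<^bsub>root_extension K p\<^esub>"
    if k: "k \<in> carrier K" for k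
  proof -
    have b: "k \<odot>\<^bsub>?W\<^esub> \<one>\<^bsub>?W\<^esub> \<in> F.base" "k \<odot>\<^bsub>?W\<^esub> \<one>\<^bsub>?W\<^esub> \<in> carrier ?W"
      using k F.B.smult_closed[OF k F.B.one_closed] unfolding F.base_def by auto
    show ?thesis
      using F.rt[OF b(2)] b(1) unfolding pw unfolding RE F.p_roots_def by (intro bexI[of _ "F.rt (k \<odot>\<^bsub>?W\<^esub> \<one>\<^bsub>?W\<^esub>)"]) auto
  qed
qed

text \<open>Any model \<open>L\<close> of \<open>K\<^sup>1\<^sup>/\<^sup>p\<close> maps
  isomorphically onto \<open>root_extension\<close>; this brings the property from a model on
  another type to the one in the theorem.\<close>

lemma pic_iff_root_extension:
  assumes L: "field L" "algebra K L"
    and Lr: "\<And>x. x \<in> carrier L \<Longrightarrow> \<exists>k\<in>carrier K. x [^]\<^bsub>L\<^esub> p = k \<odot>\<^bsub>L\<^esub> \<one>\<^bsub>L\<^esub>"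
    and Lk: "\<And>k. k \<in> carrier K \<Longrightarrow> \<exists>x\<in>carrier L. x [^]\<^bsub>L\<^esub> p = k \<odot>\<^bsub>L\<^esub> \<one>\<^bsub>L\<^esub>"
    and pic: "pic (tensor_algebra K A L) (carrier (tensor_algebra K A L))"
  shows "pic (tensor_algebra K A (root_extension K p)) (carrier (tensor_algebra K A (root_extension K p)))"
proof -
  note RE = root_extension_props
  let ?W = "root_extension K p"
  interpret W: field ?W by (rule RE(1))
  interpret WA: algebra K ?W by (rule RE(2))
  interpret A: algebra K A by (rule A)
  interpret base_change K A ?W by unfold_locales
  obtain \<psi> where \<psi>: "\<psi> \<in> ring_hom L ?W" "\<forall>k\<in>carrier K. \<forall>x\<in>carrier L. \<psi> (k \<odot>\<^bsub>L\<^esub> x) = k \<odot>\<^bsub>?W\<^esub> \<psi> x"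
      and img: "\<psi> ` carrier L = {w \<in> carrier ?W. \<exists>k\<in>carrier K. w [^]\<^bsub>?W\<^esub> p = k \<odot>\<^bsub>?W\<^esub> \<one>\<^bsub>?W\<^esub>}"
    using root_embedding[OF K L RE(1,2) p ch Lr Lk RE(4)] by blast
  have "\<psi> ` carrier L = carrier ?W" unfolding img using RE(3) by blast
  then show ?thesis using tensor_transfer(2)[OF L \<psi>(1)] \<psi>(2) pic bm_full by simp
qed

text \<open>\<open>W\<close> is an algebraic closure of \<open>L\<close>, seen as a
  \<open>K\<close>-algebra, so it contains both \<open>L\<close> and a copy of the root extension.
  The property ascends from the latter to all of \<open>W\<close> and descends to the
  former.\<close>

lemma pic_of_root_extension:
  assumes L: "field L" "algebra K L"
    and pic: "pic (tensor_algebra K A (root_extension K p)) (carrier (tensor_algebra K A (root_extension K p)))"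
  shows "pic (tensor_algebra K A L) (carrier (tensor_algebra K A L))"
proof -
  note RE = root_extension_props
  interpret L: field L by fact
  interpret LA: algebra K L by fact
  note C = L.alg_closure_embedding
  interpret C: field L.alg_closure by (rule C(1))
  let ?W = "hom_algebra L.alg_closure (\<lambda>k. L.indexed_const (k \<odot>\<^bsub>L\<^esub> \<one>\<^bsub>L\<^esub>))"
  have comp: "(\<lambda>k. L.indexed_const (k \<odot>\<^bsub>L\<^esub> \<one>\<^bsub>L\<^esub>)) \<in> ring_hom K L.alg_closure"
    using ring_hom_trans[OF LA.structure_hom C(3)] by (simp add: comp_def)
  have W: "field ?W" "algebra K ?W" "field.has_roots ?W"
    using C.hom_algebra_field C.hom_algebra[OF K.cring_axioms comp] C.hom_algebra_has_roots[OF C(2)] .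
  interpret F: frobenius_change K A ?W p by (rule frobenius_changeI[OF W])
  have Wk: "\<exists>w\<in>carrier ?W. w [^]\<^bsub>?W\<^esub> p = k \<odot>\<^bsub>?W\<^esub> \<one>\<^bsub>?W\<^esub>" if k: "k \<in> carrier K" for k
    by (rule F.root_ex[OF F.B.smult_closed[OF k F.B.one_closed]])
  obtain \<psi> where \<psi>: "\<psi> \<in> ring_hom (root_extension K p) ?W"
      "\<forall>k\<in>carrier K. \<forall>x\<in>carrier (root_extension K p). \<psi> (k \<odot>\<^bsub>root_extension K p\<^esub> x) = k \<odot>\<^bsub>?W\<^esub> \<psi> x"
      and img: "\<psi> ` carrier (root_extension K p) = {w \<in> carrier ?W. \<exists>k\<in>carrier K. w [^]\<^bsub>?W\<^esub> p = k \<odot>\<^bsub>?W\<^esub> \<one>\<^bsub>?W\<^esub>}"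
    using root_embedding[OF K RE(1,2) W(1,2) p ch RE(3,4) Wk] by blast
  have M0: "\<psi> ` carrier (root_extension K p) = F.p_roots F.base"
    unfolding img F.p_roots_def F.base_def by auto
  note tr = F.tensor_transfer[OF RE(1,2) \<psi>(1)]
  have "pic F.T (carrier F.T)"
    by (rule F.pic_all[of "F.p_roots F.base"]) (use tr \<psi>(2) pic M0 in auto)
  moreover have \<iota>: "L.indexed_const \<in> ring_hom L ?W"
    using C(3) unfolding ring_hom_def by simp
  moreover have sm: "L.indexed_const (k \<odot>\<^bsub>L\<^esub> l) = k \<odot>\<^bsub>?W\<^esub> L.indexed_const l" if "k \<in> carrier K" "l \<in> carrier L" for k l
    using that ring_hom_memE(2)[OF C(3), of "k \<odot>\<^bsub>L\<^esub> \<one>\<^bsub>L\<^esub>" l] LA.smult_assoc2[of k "\<one>\<^bsub>L\<^esub>" l] by simp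
  ultimately show ?thesis
    using F.tensor_transfer[OF L \<iota> sm] F.pic_descent F.base_image[OF L(2) \<iota> sm] by blast
qed

text \<open>
  Frobenius identifies \<open>K\<^sup>1\<^sup>/\<^sup>p\<close> with \<open>K\<close>, on which \<open>k\<close> then acts as multiplication by \<open>k\<^sup>p\<close>.
\<close>

lemma twisted_extension:
  assumes f: "inj_on (f :: 'a \<Rightarrow> 'c) (carrier K)"
  shows "\<exists>L :: ('a, 'c) module. field L \<and> algebra K L \<and>
    (\<forall>x\<in>carrier L. \<exists>k\<in>carrier K. x [^]\<^bsub>L\<^esub> p = k \<odot>\<^bsub>L\<^esub> \<one>\<^bsub>L\<^esub>) \<and>
    (\<forall>k\<in>carrier K. \<exists>x\<in>carrier L. x [^]\<^bsub>L\<^esub> p = k \<odot>\<^bsub>L\<^esub> \<one>\<^bsub>L\<^esub>)"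
proof -
  let ?D = "image_ring f K" and ?h = "\<lambda>k. f (k [^]\<^bsub>K\<^esub> p)"
  interpret D: field ?D by (rule K.inj_imp_image_ring_is_field[OF f])
  have fh: "f \<in> ring_hom K ?D" using inj_imp_image_ring_iso[OF f] unfolding ring_iso_def by simp
  interpret f: ring_hom_cring K ?D f using fh by unfold_locales
  have "(\<lambda>k. k [^]\<^bsub>K\<^esub> p) \<in> ring_hom K K"
    by (rule ring_hom_memI) (auto simp: K.frobenius_add[OF p ch] K.nat_pow_distrib)
  then have h: "?h \<in> ring_hom K ?D" using ring_hom_trans[OF _ fh] by (force simp: comp_def)
  let ?L = "hom_algebra ?D ?h"
  have L: "field ?L" "algebra K ?L" using D.hom_algebra_field D.hom_algebra[OF K.cring_axioms h] .
  \<comment> \<open>\<open>f k\<close> is the \<open>p\<close>-th root of \<open>k\<close>: its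
    \<open>p\<close>-th power is \<open>f (k^p)\<close>, which is how \<open>k\<close> acts on
    \<open>1\<close>.\<close>
  have root: "f k [^]\<^bsub>?L\<^esub> p = k \<odot>\<^bsub>?L\<^esub> \<one>\<^bsub>?L\<^esub>" if "k \<in> carrier K" for k using that by simp
  show ?thesis
  proof (intro exI[of _ ?L] conjI ballI L)
    fix x assume "x \<in> carrier ?L"
    then obtain k where "k \<in> carrier K" "x = f k" by (auto simp: image_ring_carrier)
    then show "\<exists>k\<in>carrier K. x [^]\<^bsub>?L\<^esub> p = k \<odot>\<^bsub>?L\<^esub> \<one>\<^bsub>?L\<^esub>" using root[of k] by (intro bexI[of _ k]) (simp_all only:)
  next
    fix k assume "k \<in> carrier K"
    then show "\<exists>x\<in>carrier ?L. x [^]\<^bsub>?L\<^esub> p = k \<odot>\<^bsub>?L\<^esub> \<one>\<^bsub>?L\<^esub>"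
      using root[of k] by (intro bexI[of _ "f k"]) (simp_all only: hom_algebra_simps image_ring_carrier imageI)
  qed
qed

end

theorem corollary3p3:
  fixes K :: "('a, 'm) ring_scheme"
    and R :: "('a, 'b, 'n) module_scheme"
    and p :: nat
  assumes "field K"
    and "ring_char K = p"
    and "p > 0"
    and "algebra K R"
    and large: "\<exists>f :: 'a \<Rightarrow> 'c. inj_on f (carrier K)"
  shows "geometrically_normal TYPE('c) K R \<longleftrightarrow>
         normal_ring (tensor_algebra K R (root_extension K p))"
proof -
  interpret K: field K by fact
  note p = K.ring_char_prime[OF assms(2,3)]
  note RE = root_extension_props[OF assms(1,4) p]
  have normal: "normal_ring (tensor_algebra K R L) \<longleftrightarrow> pic (tensor_algebra K R L) (carrier (tensor_algebra K R L))"
    if "algebra K L" for L :: "('a, 'd, 'e) module_scheme"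
  proof -
    interpret tensor K R L using assms(4) that by (rule tensor.intro)
    show ?thesis by (rule T.normal_ring_iff_pic)
  qed
  show ?thesis
  proof
    assume gn: "geometrically_normal TYPE('c) K R"
    \<comment> \<open>The hypothesis concerns fields on \<open>'c\<close> only; the injection
      carries a copy of \<open>K\<close> to that type.\<close>
    obtain f :: "'a \<Rightarrow> 'c" where f: "inj_on f (carrier K)" using large by blast
    from twisted_extension[OF assms(1,4) p f] obtain L :: "('a, 'c) module" where L: "field L" "algebra K L"
      and roots: "\<And>x. x \<in> carrier L \<Longrightarrow> \<exists>k\<in>carrier K. x [^]\<^bsub>L\<^esub> p = k \<odot>\<^bsub>L\<^esub> \<one>\<^bsub>L\<^esub>"
        "\<And>k. k \<in> carrier K \<Longrightarrow> \<exists>x\<in>carrier L. x [^]\<^bsub>L\<^esub> p = k \<odot>\<^bsub>L\<^esub> \<one>\<^bsub>L\<^esub>"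
      by (elim exE conjE) simp
    have "normal_ring (tensor_algebra K R L)" using gn L unfolding geometrically_normal_def by blast
    then show "normal_ring (tensor_algebra K R (root_extension K p))"
      using normal[OF L(2)] normal[OF RE(2)] pic_iff_root_extension[OF assms(1,4) p L roots] by blast
  next
    assume "normal_ring (tensor_algebra K R (root_extension K p))"
    then have "pic (tensor_algebra K R (root_extension K p)) (carrier (tensor_algebra K R (root_extension K p)))"
      using normal[OF RE(2)] by blast
    then show "geometrically_normal TYPE('c) K R"
      unfolding geometrically_normal_def using pic_of_root_extension[OF assms(1,4) p] normal by blast
  qed
qed

end
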